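(* There exists a universal constant $C$ such that for every $C^3$-regular solution $(\Omega_t,u,p)_{t\in[0,T)}$ of the free-surface Stokes problem with viscosity $\vartheta>0$ and every $t\in[0,T)$, $$\vartheta^2\int_{\Omega_t}|\nabla^2u|^2\,dx\le r_t\int_{\partial\Omega_t}|\partial_{\tau_t}\kappa_t|^2\,d\mathcal{H}^1+\vartheta^2\frac{C}{r_t^2}\int_{\Omega_t}|\nabla u|^2\,dx .$$
   Context: A domain is a nonempty bounded open connected subset of $\mathbb{R}^2$. It is $C^k$-regular if, after rotating coordinates, it is locally the subgraph of a $C^k$ function. For such $\Omega$: $\nu$ is the outer unit normal on $\partial\Omega$, $\tau=(-\nu_2,\nu_1)$ the unit tangent; $\partial_\tau f=[\nabla\tilde f]\tau$ for any local $C^1$ extension $\tilde f$ of $f$; $\mathrm{div}_\tau X=\langle\partial_\tau X,\tau\rangle$; $\kappa=\mathrm{div}_\tau\nu$ is the curvature (nonnegative for convex $\Omega$). $\nabla_{\mathrm{sym}}X=\frac12(\nabla X+(\nabla X)^{T})$. Uniform ball condition (UBC) with radius $r>0$: for every $x\in\partial\Omega$ there are open balls $B_r(x_-)\subset\Omega$ and $B_r(x_+)\subset\mathbb{R}^2\setminus\Omega$ with $\partial B_r(x_-)\cap\partial B_r(x_+)=\{x\}$. The maximal UBC radius $r_\Omega$ is the supremum of all such $r$. Normal velocity: for a family $(\Omega_t)_{t\in I}$ of $C^1$-regular domains, $t\in I$, $x\in\partial\Omega_t$, suppose that for all small $|h|$ there is a unique number $s_{t,x}(h)$ closest to zero with $x+s_{t,x}(h)\nu_t(x)\in\partial\Omega_{t+h}$.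 The normal velocity at $(t,x)$ is $v(t,x)=s_{t,x}'(0)$ if this derivative exists. $C^k$-regular solution ($k\ge2$): a family $(\Omega_t,u(t,\cdot),p(t,\cdot))_{t\in[0,T)}$ such that (i) each $\Omega_t$ is a $C^k$-regular domain, $u(t,\cdot)\in C^k(\overline{\Omega_t};\mathbb{R}^2)$, $p(t,\cdot)\in C^{k-1}(\overline{\Omega_t})$, and, with a time-independent constant $\vartheta>0$, classically $\vartheta\Delta u-\nabla p=0$ and $\mathrm{div}\,u=0$ in $\Omega_t$, and $\kappa_t\nu_t=[pI-2\vartheta\nabla_{\mathrm{sym}}u]\nu_t$ on $\partial\Omega_t$; (ii) $\int_{\Omega_t}u\,dx=0$ and $\int_{\Omega_t}\nabla u\,dx$ is a symmetric matrix for each $t$; (iii) $(\Omega_t)$ moves with normal velocity $v(t,\cdot)=\langle u(t,\cdot),\nu_t\rangle$ on $\partial\Omega_t$ for every $t\in[0,T)$; (iv) $u$ and its spatial derivatives $\nabla^l u$, $l\le k$, are continuous on $\{(t,x):t\in[0,T),x\in\overline{\Omega_t}\}$. Notation: $u=u(t,\cdot)$, $r_t=r_{\Omega_t}$, and $\nu_t,\tau_t,\kappa_t$ are the normal, tangent and curvature of $\partial\Omega_t$. *)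

theory Defs
  imports "HOL-Analysis.Analysis"
begin

section \<open>Functions of class \<open>C\<^sup>k\<close>\<close>

definition dir_deriv :: "'a \<Rightarrow> ('a::euclidean_space \<Rightarrow> 'b::real_normed_vector) \<Rightarrow> 'a \<Rightarrow> 'b" where
  "dir_deriv b f x = frechet_derivative f (at x) b"

text \<open>Iterated directional derivatives; for lists over \<^term>\<open>Basis\<close> these are the iterated
  partial derivatives.\<close>

definition iter_deriv :: "'a list \<Rightarrow> ('a::euclidean_space \<Rightarrow> 'b::real_normed_vector) \<Rightarrow> 'a \<Rightarrow> 'b" where
  "iter_deriv bs f = foldr dir_deriv bs f"

definition Ck_on :: "nat \<Rightarrow> 'a set \<Rightarrow> ('a::euclidean_space \<Rightarrow> 'b::real_normed_vector) \<Rightarrow> bool" where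
  "Ck_on k S f \<longleftrightarrow> open S \<and>
     (\<forall>bs. set bs \<subseteq> Basis \<longrightarrow>
        (length bs < k \<longrightarrow> (\<forall>x\<in>S. iter_deriv bs f differentiable (at x))) \<and>
        (length bs \<le> k \<longrightarrow> continuous_on S (iter_deriv bs f)))"

text \<open>\<open>f \<in> C\<^sup>k\<close> on the closure of the open set \<open>S\<close>: all derivatives of order at most \<open>k\<close> extend
  continuously from \<open>S\<close> to the closure. The values of \<open>f\<close> itself on the boundary are meaningful,
  so \<open>f\<close> is required to be its own extension.\<close>

definition Ck_closure :: "nat \<Rightarrow> 'a set \<Rightarrow> ('a::euclidean_space \<Rightarrow> 'b::real_normed_vector) \<Rightarrow> bool" where
  "Ck_closure k S f \<longleftrightarrow> Ck_on k S f \<and> continuous_on (closure S) f \<and>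
     (\<forall>bs. set bs \<subseteq> Basis \<and> length bs \<le> k \<longrightarrow>
        (\<exists>g. continuous_on (closure S) g \<and> (\<forall>x\<in>S. g x = iter_deriv bs f x)))"

text \<open>The value at \<open>x \<in> closure S\<close> of the continuous extension of \<open>f\<close> from the open set \<open>S\<close>;
  it equals \<open>f x\<close> if \<open>x \<in> S\<close> and \<open>f\<close> is continuous on \<open>S\<close>.\<close>

definition ext_val :: "'a set \<Rightarrow> ('a::euclidean_space \<Rightarrow> 'b::real_normed_vector) \<Rightarrow> 'a \<Rightarrow> 'b" where
  "ext_val S f x = Lim (at x within S) f"


section \<open>Regular planar domains\<close>

definition planar_domain :: "(real^2) set \<Rightarrow> bool" where
  "planar_domain \<Omega> \<longleftrightarrow> \<Omega> \<noteq> {} \<and> bounded \<Omega> \<and> open \<Omega> \<and> connected \<Omega>"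

text \<open>In the open set \<open>U\<close>, and in the coordinates rotated by \<open>Q\<close>, \<open>\<Omega>\<close> is the subgraph of \<open>g\<close>.\<close>

definition subgraph_chart ::
  "nat \<Rightarrow> (real^2) set \<Rightarrow> (real^2) set \<Rightarrow> real^2^2 \<Rightarrow> (real \<Rightarrow> real) \<Rightarrow> bool" where
  "subgraph_chart k \<Omega> U Q g \<longleftrightarrow> open U \<and> rotation_matrix Q \<and> Ck_on k UNIV g \<and>
     \<Omega> \<inter> U = {y \<in> U. (Q *v y) $ 2 < g ((Q *v y) $ 1)}"

definition regular_domain :: "nat \<Rightarrow> (real^2) set \<Rightarrow> bool" where
  "regular_domain k \<Omega> \<longleftrightarrow> planar_domain \<Omega> \<and>
     (\<forall>x\<in>frontier \<Omega>. \<exists>U Q g. x \<in> U \<and> subgraph_chart k \<Omega> U Q g)"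

text \<open>The outer unit normal of the subgraph of \<open>g\<close> at \<open>(s, g s)\<close> is
  \<open>(-g' s, 1) / sqrt (1 + (g' s)\<^sup>2)\<close>, rotated back by the transpose of \<open>Q\<close>. At boundary points of
  a \<open>C\<^sup>1\<close>-regular domain it does not depend on the chart. On other points of the plane the value
  is unspecified.\<close>

definition outer_normal :: "(real^2) set \<Rightarrow> real^2 \<Rightarrow> real^2" where
  "outer_normal \<Omega> x = (THE n. \<exists>U Q g. x \<in> U \<and> subgraph_chart 1 \<Omega> U Q g \<and>
     n = (1 / sqrt (1 + (deriv g ((Q *v x) $ 1))\<^sup>2)) *\<^sub>R
           (transpose Q *v vector [- deriv g ((Q *v x) $ 1), 1]))"

definition unit_tangent :: "(real^2) set \<Rightarrow> real^2 \<Rightarrow> real^2" where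
  "unit_tangent \<Omega> x = vector [- outer_normal \<Omega> x $ 2, outer_normal \<Omega> x $ 1]"

text \<open>Here \<open>f\<close> matters only on the boundary of \<open>\<Omega>\<close>, and \<open>F\<close> is a local \<open>C\<^sup>1\<close> extension.\<close>

definition tangential_deriv ::
  "(real^2) set \<Rightarrow> (real^2 \<Rightarrow> 'b::real_normed_vector) \<Rightarrow> real^2 \<Rightarrow> 'b" where
  "tangential_deriv \<Omega> f x = (THE d. \<exists>U F. x \<in> U \<and> Ck_on 1 U F \<and>
     (\<forall>y\<in>frontier \<Omega> \<inter> U. F y = f y) \<and>
     d = frechet_derivative F (at x) (unit_tangent \<Omega> x))"

definition tangential_div :: "(real^2) set \<Rightarrow> (real^2 \<Rightarrow> real^2) \<Rightarrow> real^2 \<Rightarrow> real" where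
  "tangential_div \<Omega> X x = tangential_deriv \<Omega> X x \<bullet> unit_tangent \<Omega> x"

definition curvature :: "(real^2) set \<Rightarrow> real^2 \<Rightarrow> real" where
  "curvature \<Omega> = tangential_div \<Omega> (outer_normal \<Omega>)"

definition uniform_ball_condition :: "(real^2) set \<Rightarrow> real \<Rightarrow> bool" where
  "uniform_ball_condition \<Omega> r \<longleftrightarrow> 0 < r \<and>
     (\<forall>x\<in>frontier \<Omega>. \<exists>xm xp. ball xm r \<subseteq> \<Omega> \<and> ball xp r \<subseteq> - \<Omega> \<and> sphere xm r \<inter> sphere xp r = {x})"

definition ubc_radius :: "(real^2) set \<Rightarrow> real" where
  "ubc_radius \<Omega> = Sup {r. uniform_ball_condition \<Omega> r}"


section \<open>One-dimensional Hausdorff measure\<close>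

definition hausdorff1_pre :: "real \<Rightarrow> 'a::metric_space set \<Rightarrow> ennreal" where
  "hausdorff1_pre \<delta> A =
     (INF C \<in> {C :: nat \<Rightarrow> 'a set. A \<subseteq> (\<Union>i. C i) \<and> (\<forall>i. bounded (C i) \<and> diameter (C i) \<le> \<delta>)}.
        \<Sum>i. ennreal (diameter (C i)))"

definition hausdorff1_outer :: "'a::metric_space set \<Rightarrow> ennreal" where
  "hausdorff1_outer A = (SUP \<delta> \<in> {0<..}. hausdorff1_pre \<delta> A)"

text \<open>This is a metric outer measure, hence countably additive on the Borel sets, so that
  \<^term>\<open>measure_of\<close> does not collapse it to the zero measure.\<close>

definition hausdorff1 :: "'a::metric_space measure" where
  "hausdorff1 = measure_of UNIV (sets borel) hausdorff1_outer"


section \<open>Normal velocity\<close>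

text \<open>\<open>s h\<close> is the unique number closest to zero with \<open>x + s h *\<^sub>R \<nu>\<^sub>t x\<close> on the boundary of
  \<open>\<Omega> (t + h)\<close>. Only times \<open>t + h \<in> I\<close> are considered, so that the derivative is one-sided at an
  endpoint of \<open>I\<close>.\<close>

definition has_normal_velocity ::
  "real set \<Rightarrow> (real \<Rightarrow> (real^2) set) \<Rightarrow> real \<Rightarrow> real^2 \<Rightarrow> real \<Rightarrow> bool" where
  "has_normal_velocity I \<Omega> t x v \<longleftrightarrow>
     (\<exists>s \<delta>. 0 < \<delta> \<and>
        (\<forall>h. \<bar>h\<bar> < \<delta> \<and> t + h \<in> I \<longrightarrow>
           x + s h *\<^sub>R outer_normal (\<Omega> t) x \<in> frontier (\<Omega> (t + h)) \<and>
           (\<forall>\<sigma>. x + \<sigma> *\<^sub>R outer_normal (\<Omega> t) x \<in> frontier (\<Omega> (t + h)) \<and> \<sigma> \<noteq> s h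
                  \<longrightarrow> \<bar>s h\<bar> < \<bar>\<sigma>\<bar>)) \<and>
        (s has_real_derivative v) (at 0 within {h. t + h \<in> I}))"


section \<open>The free-surface Stokes problem\<close>

definition grad :: "('a::euclidean_space \<Rightarrow> real) \<Rightarrow> 'a \<Rightarrow> 'a" where
  "grad f x = (\<Sum>b\<in>Basis. dir_deriv b f x *\<^sub>R b)"

definition laplacian :: "('a::euclidean_space \<Rightarrow> 'b::real_normed_vector) \<Rightarrow> 'a \<Rightarrow> 'b" where
  "laplacian f x = (\<Sum>b\<in>Basis. iter_deriv [b, b] f x)"

definition hess_norm_sq :: "('a::euclidean_space \<Rightarrow> 'b::real_normed_vector) \<Rightarrow> 'a \<Rightarrow> real" where
  "hess_norm_sq f x = (\<Sum>b\<in>Basis. \<Sum>c\<in>Basis. (norm (iter_deriv [b, c] f x))\<^sup>2)"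

definition nabla :: "(real^2 \<Rightarrow> real^2) \<Rightarrow> real^2 \<Rightarrow> real^2^2" where
  "nabla u x = jacobian u (at x)"

definition sym_part :: "real^2^2 \<Rightarrow> real^2^2" where
  "sym_part A = (1/2) *\<^sub>R (A + transpose A)"

text \<open>The time interval \<open>[0, T)\<close>; \<open>T\<close> may be infinite.\<close>

definition time_interval :: "ereal \<Rightarrow> real set" where
  "time_interval T = {t. 0 \<le> t \<and> ereal t < T}"

definition stokes_solution ::
  "nat \<Rightarrow> real \<Rightarrow> ereal \<Rightarrow> (real \<Rightarrow> (real^2) set) \<Rightarrow> (real \<Rightarrow> real^2 \<Rightarrow> real^2)
     \<Rightarrow> (real \<Rightarrow> real^2 \<Rightarrow> real) \<Rightarrow> bool" where
  "stokes_solution k \<theta> T \<Omega> u p \<longleftrightarrow> 2 \<le> k \<and> 0 < \<theta> \<and>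
     (\<forall>t\<in>time_interval T.
        regular_domain k (\<Omega> t) \<and> Ck_closure k (\<Omega> t) (u t) \<and> Ck_closure (k - 1) (\<Omega> t) (p t) \<and>
        (\<forall>x\<in>\<Omega> t. \<theta> *\<^sub>R laplacian (u t) x - grad (p t) x = 0 \<and> trace (nabla (u t) x) = 0) \<and>
        (\<forall>x\<in>frontier (\<Omega> t).
           curvature (\<Omega> t) x *\<^sub>R outer_normal (\<Omega> t) x =
             (p t x *\<^sub>R mat 1 - (2 * \<theta>) *\<^sub>R sym_part (ext_val (\<Omega> t) (nabla (u t)) x))
               *v outer_normal (\<Omega> t) x) \<and>
        (LINT x:\<Omega> t|lborel. u t x) = 0 \<and>
        transpose (LINT x:\<Omega> t|lborel. nabla (u t) x) = (LINT x:\<Omega> t|lborel. nabla (u t) x) \<and>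
        (\<forall>x\<in>frontier (\<Omega> t).
           has_normal_velocity (time_interval T) \<Omega> t x (u t x \<bullet> outer_normal (\<Omega> t) x))) \<and>
     continuous_on {(t, x). t \<in> time_interval T \<and> x \<in> closure (\<Omega> t)} (\<lambda>(t, x). u t x) \<and>
     (\<forall>bs. set bs \<subseteq> Basis \<and> length bs \<le> k \<longrightarrow>
        continuous_on {(t, x). t \<in> time_interval T \<and> x \<in> closure (\<Omega> t)}
          (\<lambda>(t, x). ext_val (\<Omega> t) (iter_deriv bs (u t)) x))"

end

theory Submission
  imports Defs "HOL-Analysis.Analysis"
begin

text \<open>Only a fixed time matters. Let \<open>e = \<partial>\<^sub>1u\<^sub>1\<close>, \<open>s = (\<partial>\<^sub>1u\<^sub>2 + \<partial>\<^sub>2u\<^sub>1)/2\<close> and let \<open>w\<close> be the vorticity;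
  put \<open>G = e - \<i> s\<close> and \<open>W = w\<^sub>x - \<i> w\<^sub>y\<close>. The Stokes system says that \<open>p/\<theta>\<close> and \<open>w\<close> are conjugate harmonic,
  so that \<open>W\<close> is holomorphic, and that \<open>(\<partial>\<^sub>x + \<i>\<partial>\<^sub>y) G = -(\<i>/2) W\<close>. Writing the normal \<open>n\<close> as a complex number, the
  boundary condition reads \<open>p/\<theta> = \<kappa>/\<theta> + 2 Re (G n\<^sup>2)\<close> and \<open>Im (G n\<^sup>2) = 0\<close>.

  The integral of \<open>|\<nabla>w|\<^sup>2\<close> is the boundary integral of \<open>(p/\<theta>) Im (n W)\<close>, and \<open>Im (n W) = - \<partial>\<^sub>\<tau>w\<close>. The curvature part
  of \<open>p/\<theta>\<close> is integrated by parts along the boundary and leaves \<open>w \<partial>\<^sub>\<tau>\<kappa>\<close>, which Young's inequality and a trace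
  inequality control. The remaining part is the boundary integral of \<open>n G W n\<^sup>2\<close>. If \<open>M\<close> extends \<open>n\<^sup>2\<close>
  to the domain, then \<open>(\<partial>\<^sub>x + \<i>\<partial>\<^sub>y)(G W M)\<close> is \<open>-(\<i>/2) W\<^sup>2 M\<close> up to a term that is only linear in
  \<open>W\<close>. The dangerous \<open>W\<^sup>2 M\<close> is of the same size as \<open>|\<nabla>w|\<^sup>2\<close>, but \<open>W\<^sup>2\<close> is holomorphic and \<open>M\<close> is close to
  \<open>-(\<partial>\<^sub>x + \<i>\<partial>\<^sub>y) R\<close> for a field \<open>R\<close> that vanishes on the boundary, so one half of it can be removed. The other
  second derivatives are recovered from \<open>W\<close> and the null Lagrangian \<open>e\<^sub>x s\<^sub>y - e\<^sub>y s\<^sub>x\<close>.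

  Boundary integrals are replaced throughout by averages over the layer between the distances \<open>\<epsilon>\<close> and \<open>2\<epsilon>\<close>
  from the boundary, so that the only divergence theorem needed is the one for compactly supported fields. At the end
  the averages are compared with the Hausdorff measure by covering the layer with small rectangles.\<close>

section \<open>Partial derivatives in the plane\<close>

text \<open>The factor of the curvature term must be exactly 1, although layer averages are compared
  with the Hausdorff integral only up to a factor 192. That term comes out of Young's inequality
  with a free weight, so the weight 1/768 repays the loss and only the universal constant grows. A
  one-sided comparison by coverings suffices, since the curvature term is the only boundary integral
  that survives; the others are absorbed by trace inequalities.

  The other obstacle leaves no such freedom: the term with W^2 M carries the same coefficient as the
  integral of |grad w|^2 on the left, so no choice of weights absorbs it. Only the cancellation by R
  lowers its coefficient to 1/2.

  The ball condition makes the normal Lipschitz with constant 1/r and bounds the curvature by 1/r.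
  At depth below r/2 this makes the nearest boundary point a Lipschitz function and gives 1 - d
  \<kappa> \<ge> 1/2, which is why the layer has half the radius of the balls. A C^3 boundary has a
  curvature that is C^1 along it with a merely continuous derivative, so the curvature is integrated
  by parts only once.\<close>

definition has_partials :: "(real^2 \<Rightarrow> 'b::real_normed_vector) \<Rightarrow> 'b \<Rightarrow> 'b \<Rightarrow> real^2 \<Rightarrow> bool" where
  "has_partials f a b x \<longleftrightarrow> (f has_derivative (\<lambda>h. (h$1) *\<^sub>R a + (h$2) *\<^sub>R b)) (at x)"

lemma has_partials_const: "has_partials (\<lambda>x. c) 0 0 x"
  by (simp add: has_partials_def)

lemma has_partials_add:
  "has_partials f a b x \<Longrightarrow> has_partials g a' b' x \<Longrightarrow> has_partials (\<lambda>x. f x + g x) (a + a') (b + b') x"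
  unfolding has_partials_def by (drule (1) has_derivative_add) (simp add: algebra_simps)

lemma has_partials_diff:
  "has_partials f a b x \<Longrightarrow> has_partials g a' b' x \<Longrightarrow> has_partials (\<lambda>x. f x - g x) (a - a') (b - b') x"
  unfolding has_partials_def by (drule (1) has_derivative_diff) (simp add: algebra_simps)

lemma has_partials_bounded_linear:
  assumes "bounded_linear L" "has_partials f a b x"
  shows "has_partials (\<lambda>x. L (f x)) (L a) (L b) x"
proof -
  interpret bounded_linear L by fact
  show ?thesis using has_derivative[OF assms(2)[unfolded has_partials_def]]
    by (simp add: has_partials_def add scale)
qed

lemmas has_partials_minus = has_partials_bounded_linear[OF bounded_linear_minus[OF bounded_linear_ident]]
  and has_partials_Re = has_partials_bounded_linear[OF bounded_linear_Re]
  and has_partials_Im = has_partials_bounded_linear[OF bounded_linear_Im]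
  and has_partials_cnj = has_partials_bounded_linear[OF bounded_linear_cnj]
  and has_partials_of_real = has_partials_bounded_linear[OF bounded_linear_of_real]
  and has_partials_vec_nth = has_partials_bounded_linear[OF bounded_linear_vec_nth]

lemma has_partials_scaleR:
  "has_partials f a b x \<Longrightarrow> has_partials g a' b' x \<Longrightarrow>
   has_partials (\<lambda>x. f x *\<^sub>R g x) (a *\<^sub>R g x + f x *\<^sub>R a') (b *\<^sub>R g x + f x *\<^sub>R b') x"
  unfolding has_partials_def by (drule (1) has_derivative_scaleR) (simp add: algebra_simps)

lemma has_partials_mult:
  fixes f g :: "real^2 \<Rightarrow> 'b::real_normed_algebra"
  shows "has_partials f a b x \<Longrightarrow> has_partials g a' b' x \<Longrightarrow>
   has_partials (\<lambda>x. f x * g x) (a * g x + f x * a') (b * g x + f x * b') x"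
  unfolding has_partials_def by (drule (1) has_derivative_mult) (simp add: algebra_simps)

lemma has_partials_compose_real:
  assumes "(g has_real_derivative g') (at (f x))" "has_partials f a b x"
  shows "has_partials (\<lambda>x. g (f x)) (g' * a) (g' * b) x"
  using has_derivative_compose[OF assms(2)[unfolded has_partials_def] assms(1)[unfolded has_field_derivative_def]]
  by (simp add: has_partials_def algebra_simps)

lemma has_partials_imp_continuous: "has_partials f a b x \<Longrightarrow> continuous (at x) f"
  unfolding has_partials_def by (rule has_derivative_continuous)

lemma has_partials_continuous_on: "(\<And>x. x \<in> S \<Longrightarrow> has_partials f (a x) (b x) x) \<Longrightarrow> continuous_on S f"
  by (meson has_partials_imp_continuous continuous_at_imp_continuous_on)

lemma has_partials_unique:
  assumes "has_partials f a b x" "has_partials f a' b' x" shows "a = a' \<and> b = b'"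
proof -
  have "(\<lambda>h::real^2. (h$1) *\<^sub>R a + (h$2) *\<^sub>R b) = (\<lambda>h. (h$1) *\<^sub>R a' + (h$2) *\<^sub>R b')"
    using assms unfolding has_partials_def by (rule has_derivative_unique)
  from fun_cong[OF this, of "axis 1 1"] fun_cong[OF this, of "axis 2 1"] show ?thesis
    by (simp add: axis_def)
qed

lemma has_partials_cong_open:
  assumes "has_partials f a b x" "open U" "x \<in> U" "\<And>y. y \<in> U \<Longrightarrow> f y = g y"
  shows "has_partials g a b x"
  using has_derivative_transform_within_open[OF assms(1)[unfolded has_partials_def] assms(2,3)] assms(4)
  by (auto simp: has_partials_def)

section \<open>Integrals of derivatives of compactly supported functions\<close>

lemma integrable_compact_support:
  fixes f :: "'a::euclidean_space \<Rightarrow> 'b::{banach, second_countable_topology}"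
  assumes "continuous_on UNIV f" "compact S" "\<And>x. x \<notin> S \<Longrightarrow> f x = 0"
  shows "integrable lborel f"
proof -
  have "integrable lborel (\<lambda>x. indicator S x *\<^sub>R f x)"
    using borel_integrable_compact[OF assms(2) continuous_on_subset[OF assms(1)]] by auto
  moreover have "(\<lambda>x. indicator S x *\<^sub>R f x) = f"
    using assms(3) by (auto simp: indicator_def)
  ultimately show ?thesis by simp
qed

text \<open>The field f is controlled only on U, for instance near the boundary, where the normal
  makes sense. As S is closed and contained in U, the open sets U and - S cover the plane, and on -
  S the product is 0.\<close>

lemma continuous_cutoff:
  fixes g :: "'a::euclidean_space \<Rightarrow> real" and f :: "'a \<Rightarrow> 'b::real_normed_vector"
  assumes "continuous_on UNIV g" "open U" "continuous_on U f" "closed S" "S \<subseteq> U" "\<And>x. x \<notin> S \<Longrightarrow> g x = 0"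
  shows "continuous_on UNIV (\<lambda>x. g x *\<^sub>R f x)"
proof -
  have "continuous_on (U \<union> - S) (\<lambda>x. g x *\<^sub>R f x)"
  proof (rule continuous_on_open_Un)
    show "continuous_on U (\<lambda>x. g x *\<^sub>R f x)"
      by (intro continuous_intros continuous_on_subset[OF assms(1)] assms(3)) auto
    show "continuous_on (- S) (\<lambda>x. g x *\<^sub>R f x)"
      by (rule continuous_on_eq[OF continuous_on_const[of _ 0]]) (use assms(6) in auto)
  qed (use assms in auto)
  moreover have "U \<union> - S = UNIV" using assms(5) by auto
  ultimately show ?thesis by simp
qed

lemma integrable_cutoff:
  fixes g :: "'a::euclidean_space \<Rightarrow> real" and f :: "'a \<Rightarrow> 'b::{banach, second_countable_topology}"
  assumes "continuous_on UNIV g" "open U" "continuous_on U f" "compact S" "S \<subseteq> U" "\<And>x. x \<notin> S \<Longrightarrow> g x = 0"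
  shows "integrable lborel (\<lambda>x. g x *\<^sub>R f x)"
  by (rule integrable_compact_support[OF continuous_cutoff[OF assms(1-3) compact_imp_closed]])
    (use assms in auto)

text \<open>By translation invariance every difference quotient has integral zero.\<close>

lemma integral_directional_derivative_zero:
  fixes F :: "'a::euclidean_space \<Rightarrow> 'b::euclidean_space"
  assumes der: "\<And>x. (F has_derivative F' x) (at x)"
    and bd: "\<And>x. norm (F' x v) \<le> M"
    and supp: "compact S" "\<And>x. x \<notin> S \<Longrightarrow> F x = 0"
  shows "(LINT x|lborel. F' x v) = 0"
proof -
  define h where "h i = inverse (real (Suc i))" for i
  define q where "q i x = (1 / h i) *\<^sub>R (F (x + h i *\<^sub>R v) - F x)" for i x
  have h: "h i > 0" "h i \<le> 1" for i by (simp_all add: h_def field_simps)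
  have cont: "continuous_on UNIV F"
    using der by (meson continuous_at_imp_continuous_on has_derivative_continuous)
  have int: "integrable lborel F" by (rule integrable_compact_support[OF cont supp])
  have shift: "integrable lborel (\<lambda>x. F (x + t)) \<and> (LINT x|lborel. F (x + t)) = (LINT x|lborel. F x)" for t
  proof -
    have 1: "lborel = distr lborel borel (\<lambda>x. t + x)" using lborel_distr_plus[of t] by simp
    have m: "(\<lambda>x. t + x) \<in> measurable lborel borel" by simp
    have Fm: "F \<in> borel_measurable borel" using cont by (rule borel_measurable_continuous_onI)
    have "integrable (distr lborel borel (\<lambda>x. t + x)) F" using int 1 by simp
    then have "integrable lborel (\<lambda>x. F (t + x))" using integrable_distr_eq[OF m Fm] by simp
    moreover have "(LINT x|lborel. F x) = (LINT x|lborel. F (t + x))"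
      using integral_distr[OF m Fm] 1 by simp
    ultimately show ?thesis by (simp add: add.commute)
  qed
  have q0: "(LINT x|lborel. q i x) = 0" for i
    unfolding q_def using shift[of "h i *\<^sub>R v"] int by simp
  have M: "M \<ge> 0" using bd[of 0] norm_ge_zero order_trans by blast
  have qb: "norm (q i x) \<le> M" for i x
  proof -
    define \<phi> where "\<phi> t = F (x + t *\<^sub>R v)" for t :: real
    have d: "(\<phi> has_derivative (\<lambda>s. s *\<^sub>R F' (x + t *\<^sub>R v) v)) (at t within {0..h i})" for t
    proof -
      have lin: "linear (F' (x + t *\<^sub>R v))" using der has_derivative_linear by blast
      have "((\<lambda>t. x + t *\<^sub>R v) has_derivative (\<lambda>s. s *\<^sub>R v)) (at t)" by (auto intro!: derivative_eq_intros)
      from has_derivative_compose[OF this der] show ?thesis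
        unfolding \<phi>_def using lin by (simp add: linear_scale has_derivative_at_withinI)
    qed
    have "norm (\<phi> (h i) - \<phi> 0) \<le> M * norm (h i - 0)"
    proof (rule differentiable_bound[OF _ d])
      show "onorm (\<lambda>s. s *\<^sub>R F' (x + t *\<^sub>R v) v) \<le> M" for t
        by (rule onorm_bound) (use bd M in \<open>auto intro!: mult_left_mono simp: mult.commute[of M]\<close>)
    qed (use h[of i] in auto)
    then show ?thesis using h[of i] by (simp add: q_def \<phi>_def pos_divide_le_eq)
  qed
  obtain R where R: "\<And>x. x \<in> S \<Longrightarrow> norm x \<le> R"
    using compact_imp_bounded[OF supp(1)] bounded_iff by blast
  \<comment> \<open>Since \<open>h i\<close> is at most 1, all difference quotients vanish outside
    this one ball, so a multiple of its indicator dominates them.\<close>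
  define B where "B = cball (0::'a) (R + norm v)"
  have qB: "q i x = 0" if "x \<notin> B" for i x
  proof -
    have "norm x > R + norm v" using that by (simp add: B_def)
    moreover have "norm (h i *\<^sub>R v) \<le> norm v" using h[of i] by (simp add: mult_left_le_one_le)
    moreover have "norm x \<le> norm (x + h i *\<^sub>R v) + norm (h i *\<^sub>R v)"
      by (metis add_diff_cancel norm_triangle_ineq4)
    ultimately have "norm (x + h i *\<^sub>R v) > R \<and> norm x > R" using norm_ge_zero[of v] by linarith
    then show ?thesis using R supp(2) unfolding q_def by (metis diff_zero linorder_not_le scaleR_zero_right)
  qed
  have lim: "(\<lambda>i. q i x) \<longlonglongrightarrow> F' x v" for x
  proof -
    have lin: "linear (F' x)" using der has_derivative_linear by blast
    have "((\<lambda>t. x + t *\<^sub>R v) has_derivative (\<lambda>s. s *\<^sub>R v)) (at 0)" by (auto intro!: derivative_eq_intros)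
    from has_derivative_compose[OF this, of F "F' x"]
    have "((\<lambda>t. F (x + t *\<^sub>R v)) has_derivative (\<lambda>s. s *\<^sub>R F' x v)) (at 0)"
      using lin der[of x] by (simp add: linear_scale)
    then have "((\<lambda>t. norm (F (x + t *\<^sub>R v) - F x - t *\<^sub>R F' x v) / norm t) \<longlongrightarrow> 0) (at 0)"
      by (simp add: has_derivative_at)
    moreover have "\<forall>\<^sub>F t in at (0::real). norm (F (x + t *\<^sub>R v) - F x - t *\<^sub>R F' x v) / norm t
        = norm ((1/t) *\<^sub>R (F (x + t *\<^sub>R v) - F x) - F' x v)"
    proof (rule eventually_at_filter[THEN iffD2, OF always_eventually], intro allI impI)
      fix t :: real assume t: "t \<noteq> 0"
      have "(1/t) *\<^sub>R (F (x + t *\<^sub>R v) - F x) - F' x v = (1/t) *\<^sub>R (F (x + t *\<^sub>R v) - F x - t *\<^sub>R F' x v)"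
        using t by (simp add: scaleR_diff_right)
      also have "norm \<dots> = norm (F (x + t *\<^sub>R v) - F x - t *\<^sub>R F' x v) / norm t"
        by (simp only: norm_scaleR real_norm_def abs_divide) simp
      finally show "norm (F (x + t *\<^sub>R v) - F x - t *\<^sub>R F' x v) / norm t
        = norm ((1/t) *\<^sub>R (F (x + t *\<^sub>R v) - F x) - F' x v)" by simp
    qed
    ultimately have "((\<lambda>t. norm ((1/t) *\<^sub>R (F (x + t *\<^sub>R v) - F x) - F' x v)) \<longlongrightarrow> 0) (at 0)"
      using tendsto_cong by force
    then have "((\<lambda>t. (1/t) *\<^sub>R (F (x + t *\<^sub>R v) - F x)) \<longlongrightarrow> F' x v) (at 0)"
      using LIM_zero_iff tendsto_norm_zero_iff by blast
    moreover have "filterlim h (at 0) sequentially"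
      unfolding filterlim_at using h LIMSEQ_inverse_real_of_nat by (auto simp: h_def[abs_def])
    ultimately show ?thesis unfolding q_def by (rule filterlim_compose)
  qed
  have Fm: "F \<in> borel_measurable borel" using cont by (rule borel_measurable_continuous_onI)
  have qm: "q i \<in> borel_measurable lborel" for i
  proof -
    have "(\<lambda>x. F (x + h i *\<^sub>R v)) \<in> borel_measurable borel"
      by (rule measurable_compose[OF _ Fm]) simp
    then show ?thesis unfolding q_def[abs_def] using Fm by simp
  qed
  have "(\<lambda>i. LINT x|lborel. q i x) \<longlonglongrightarrow> (LINT x|lborel. F' x v)"
  proof (rule integral_dominated_convergence[where w="\<lambda>x. indicator B x *\<^sub>R M"])
    show "(\<lambda>x. q i x) \<in> borel_measurable lborel" for i using qm by simp
    show "(\<lambda>x. F' x v) \<in> borel_measurable lborel" by (rule borel_measurable_LIMSEQ_metric[OF qm lim])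
    show "integrable lborel (\<lambda>x. indicator B x *\<^sub>R M)"
      using borel_integrable_compact[of B "\<lambda>_. M"] by (auto simp: B_def)
    show "AE x in lborel. norm (q i x) \<le> indicator B x *\<^sub>R M" for i
      using qB qb M by (auto simp: indicator_def intro!: AE_I2)
  qed (use lim in auto)
  then show ?thesis by (simp add: q0 LIMSEQ_const_iff)
qed

text \<open>This is the form in which the divergence theorem is used; boundary terms arise later
  from differentiating a cutoff factor. The complement of S is open and F vanishes there, which
  supplies the derivative outside S.\<close>

lemma integral_partials_zero:
  fixes F :: "real^2 \<Rightarrow> 'b::euclidean_space"
  assumes S: "compact S" and der: "\<And>x. x \<in> S \<Longrightarrow> has_partials F (F1 x) (F2 x) x"
    and out: "\<And>x. x \<notin> S \<Longrightarrow> F x = 0 \<and> F1 x = 0 \<and> F2 x = 0"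
    and bd: "bounded (F1 ` S)" "bounded (F2 ` S)"
  shows "(LINT x|lborel. F1 x) = 0" "(LINT x|lborel. F2 x) = 0"
proof -
  have D: "has_partials F (F1 x) (F2 x) x" for x
  proof (cases "x \<in> S")
    case False
    have "has_partials (\<lambda>x. 0) 0 0 x" by (rule has_partials_const)
    then have "has_partials F 0 0 x"
      by (rule has_partials_cong_open[where U="- S"]) (use S False out compact_imp_closed in auto)
    then show ?thesis using out[OF False] by simp
  qed (rule der)
  obtain M where M: "M > 0" "\<And>x. x \<in> S \<Longrightarrow> norm (F1 x) \<le> M" using bd(1) bounded_pos by (metis image_eqI)
  obtain N where N: "N > 0" "\<And>x. x \<in> S \<Longrightarrow> norm (F2 x) \<le> N" using bd(2) bounded_pos by (metis image_eqI)
  have M': "norm (F1 x) \<le> M" "norm (F2 x) \<le> N" for x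
    using M N out by (metis less_imp_le norm_zero)+
  note Z = integral_directional_derivative_zero[OF D[unfolded has_partials_def], of _ _ S]
  have "(LINT x|lborel. ((axis 1 1 :: real^2)$1) *\<^sub>R F1 x + ((axis 1 1 :: real^2)$2) *\<^sub>R F2 x) = 0"
    by (rule Z[where M=M]) (use M' S out in \<open>auto simp: axis_def\<close>)
  moreover have "(LINT x|lborel. ((axis 2 1 :: real^2)$1) *\<^sub>R F1 x + ((axis 2 1 :: real^2)$2) *\<^sub>R F2 x) = 0"
    by (rule Z[where M=N]) (use M' S out in \<open>auto simp: axis_def\<close>)
  ultimately show "(LINT x|lborel. F1 x) = 0" "(LINT x|lborel. F2 x) = 0" by (simp_all add: axis_def)
qed

lemma mixed_partials_equal:
  fixes f :: "real^2 \<Rightarrow> real"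
  assumes U: "open U" "x \<in> U"
    and f: "\<And>y. y \<in> U \<Longrightarrow> has_partials f (f1 y) (f2 y) y"
    and f1: "\<And>y. y \<in> U \<Longrightarrow> has_partials f1 (f11 y) (f12 y) y"
    and f2: "\<And>y. y \<in> U \<Longrightarrow> has_partials f2 (f21 y) (f22 y) y"
    and c: "continuous_on U f12" "continuous_on U f21"
  shows "f12 x = f21 x"
proof (rule ccontr)
  assume ne: "f12 x \<noteq> f21 x"
  define \<delta> where "\<delta> = \<bar>f12 x - f21 x\<bar> / 2"
  have \<delta>: "\<delta> > 0" using ne by (simp add: \<delta>_def)
  have "isCont f12 x" "isCont f21 x" using c U by (auto simp: continuous_on_eq_continuous_at)
  then obtain \<rho>1 \<rho>2 where r1: "\<rho>1 > 0" "\<And>y. dist y x < \<rho>1 \<Longrightarrow> dist (f12 y) (f12 x) < \<delta>"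
    and r2: "\<rho>2 > 0" "\<And>y. dist y x < \<rho>2 \<Longrightarrow> dist (f21 y) (f21 x) < \<delta>"
    unfolding continuous_at_eps_delta using \<delta> by metis
  obtain \<rho>3 where r3: "\<rho>3 > 0" "ball x \<rho>3 \<subseteq> U" using U open_contains_ball by blast
  define \<rho> where "\<rho> = min \<rho>1 (min \<rho>2 \<rho>3)"
  define h where "h = \<rho> / 3"
  have h: "h > 0" using r1 r2 r3 by (simp add: h_def \<rho>_def)
  define p where "p s t = x + s *\<^sub>R axis 1 1 + t *\<^sub>R axis 2 1" for s t :: real
  have near: "dist (p s t) x < \<rho>" if "0 \<le> s" "s \<le> h" "0 \<le> t" "t \<le> h" for s t
  proof -
    have "dist (p s t) x = norm (s *\<^sub>R axis 1 1 + t *\<^sub>R axis 2 1 :: real^2)" by (simp add: p_def dist_norm)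
    also have "\<dots> \<le> norm (s *\<^sub>R axis 1 1 :: real^2) + norm (t *\<^sub>R axis 2 1 :: real^2)" by (rule norm_triangle_ineq)
    also have "\<dots> \<le> h + h" using that by simp
    also have "\<dots> < \<rho>" using h by (simp add: h_def)
    finally show ?thesis .
  qed
  have inU: "p s t \<in> U" if "0 \<le> s" "s \<le> h" "0 \<le> t" "t \<le> h" for s t
    using near[OF that] r3(2) by (auto simp: \<rho>_def dist_commute)
  have ds: "((\<lambda>s. g (p s t)) has_real_derivative a) (at s)"
    if "has_partials g a b (p s t)" for g :: "real^2 \<Rightarrow> real" and a b s t
  proof -
    have "((\<lambda>s. p s t) has_derivative (\<lambda>k. k *\<^sub>R axis 1 1)) (at s)"
      unfolding p_def by (auto intro!: derivative_eq_intros)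
    from has_derivative_compose[OF this that[unfolded has_partials_def]] show ?thesis
      by (simp add: has_field_derivative_def axis_def mult_commute_abs)
  qed
  have dt: "((\<lambda>t. g (p s t)) has_real_derivative b) (at t)"
    if "has_partials g a b (p s t)" for g :: "real^2 \<Rightarrow> real" and a b s t
  proof -
    have "((\<lambda>t. p s t) has_derivative (\<lambda>k. k *\<^sub>R axis 2 1)) (at t)"
      unfolding p_def by (auto intro!: derivative_eq_intros)
    from has_derivative_compose[OF this that[unfolded has_partials_def]] show ?thesis
      by (simp add: has_field_derivative_def axis_def mult_commute_abs)
  qed
  \<comment> \<open>The second difference of f over a square of side h. The mean value theorem,
    applied in either order of the variables, evaluates it as h^2 times one or the other mixed
    derivative at some point of the square.\<close>
  define A where "A = f (p h h) - f (p h 0) - f (p 0 h) + f (p 0 0)"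
  have "\<exists>s. 0 < s \<and> s < h \<and> (f (p h h) - f (p h 0)) - (f (p 0 h) - f (p 0 0)) = (h - 0) * (f1 (p s h) - f1 (p s 0))"
    by (rule MVT2[OF h]) (auto intro!: DERIV_diff ds f inU)
  then obtain s where s: "0 < s" "s < h" "A = h * (f1 (p s h) - f1 (p s 0))" by (auto simp: A_def)
  have "\<exists>t. 0 < t \<and> t < h \<and> f1 (p s h) - f1 (p s 0) = (h - 0) * f12 (p s t)"
    by (rule MVT2[OF h]) (use s in \<open>auto intro!: dt f1 inU\<close>)
  then obtain t where t: "0 < t" "t < h" "A = h * (h * f12 (p s t))" using s by auto
  have "\<exists>t. 0 < t \<and> t < h \<and> (f (p h h) - f (p 0 h)) - (f (p h 0) - f (p 0 0)) = (h - 0) * (f2 (p h t) - f2 (p 0 t))"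
    by (rule MVT2[OF h]) (auto intro!: DERIV_diff dt f inU)
  then obtain t' where t': "0 < t'" "t' < h" "A = h * (f2 (p h t') - f2 (p 0 t'))" by (auto simp: A_def)
  have "\<exists>s. 0 < s \<and> s < h \<and> f2 (p h t') - f2 (p 0 t') = (h - 0) * f21 (p s t')"
    by (rule MVT2[OF h]) (use t' in \<open>auto intro!: ds f2 inU\<close>)
  then obtain s' where s': "0 < s'" "s' < h" "A = h * (h * f21 (p s' t'))" using t' by auto
  have "f12 (p s t) = f21 (p s' t')" using t s' h by simp
  moreover have "dist (f12 (p s t)) (f12 x) < \<delta>" "dist (f21 (p s' t')) (f21 x) < \<delta>"
    using near[of s t] near[of s' t'] s t s' t' by (auto intro!: r1 r2 simp: \<rho>_def)
  ultimately show False unfolding \<delta>_def dist_real_def by (simp add: abs_if split: if_splits)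
qed

section \<open>Integration over a boundary layer\<close>

definition unit_clamp :: "real \<Rightarrow> real" where "unit_clamp x = max 0 (min 1 x)"

lemma unit_clamp: "0 \<le> unit_clamp x" "unit_clamp x \<le> 1" "x \<le> 0 \<Longrightarrow> unit_clamp x = 0" "1 \<le> x \<Longrightarrow> unit_clamp x = 1"
  "0 \<le> x \<Longrightarrow> x \<le> 1 \<Longrightarrow> unit_clamp x = x"
  by (auto simp: unit_clamp_def)

lemma continuous_on_unit_clamp [continuous_intros]:
  "continuous_on S f \<Longrightarrow> continuous_on S (\<lambda>x. unit_clamp (f x))"
  unfolding unit_clamp_def by (intro continuous_intros)

text \<open>At 0 and 1 the two one-sided difference quotients are that of p and that of a constant;
  both tend to 0 because p' vanishes there. Elsewhere the function agrees locally with p or with a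
  constant.\<close>

lemma has_real_derivative_unit_clamp:
  assumes p: "\<And>x. (p has_real_derivative p' x) (at x)" and z: "p' 0 = 0" "p' 1 = 0"
  shows "((\<lambda>x. p (unit_clamp x)) has_real_derivative p' (unit_clamp x)) (at x)"
proof -
  have zero: "((\<lambda>x. p (unit_clamp x)) has_real_derivative 0) (at x)"
    if "open S" "x \<in> S" "\<And>y. y \<in> S \<Longrightarrow> unit_clamp y = c" for S x c
    by (rule has_field_derivative_transform_within_open[OF DERIV_const[of "p c"] that(1,2)]) (use that(3) in auto)
  have half: "((\<lambda>y. (p (unit_clamp y) - p c) / (y - c)) \<longlongrightarrow> 0) (at c within S)"
    if "p' c = 0" "c \<in> {0,1}" "(\<forall>\<^sub>F y in at c within S. unit_clamp y = y) \<or> (\<forall>\<^sub>F y in at c within S. unit_clamp y = c)" for c S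
    using that(3)
  proof
    assume "\<forall>\<^sub>F y in at c within S. unit_clamp y = y"
    moreover have "((\<lambda>y. (p y - p c) / (y - c)) \<longlongrightarrow> 0) (at c within S)"
      using has_field_derivative_at_within[OF p[of c], of S] that(1) by (simp add: has_field_derivative_iff)
    ultimately show ?thesis
      by (elim Lim_transform_eventually) (auto elim: eventually_mono)
  next
    assume "\<forall>\<^sub>F y in at c within S. unit_clamp y = c"
    then show ?thesis
      by (intro tendsto_eventually) (auto elim: eventually_mono)
  qed
  have at01: "((\<lambda>x. p (unit_clamp x)) has_real_derivative 0) (at c)" if c: "c \<in> {0,1}" for c
  proof -
    have c0: "p' c = 0" "unit_clamp c = c" using c z by (auto simp: unit_clamp_def)
    have "\<forall>\<^sub>F y in at_left (0::real). unit_clamp y = 0" "\<forall>\<^sub>F y in at_right (0::real). unit_clamp y = y"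
      "\<forall>\<^sub>F y in at_left (1::real). unit_clamp y = y" "\<forall>\<^sub>F y in at_right (1::real). unit_clamp y = 1"
      unfolding unit_clamp_def eventually_at by (rule exI[of _ 1], simp add: dist_real_def)+
    then have "(\<forall>\<^sub>F y in at_left c. unit_clamp y = y) \<or> (\<forall>\<^sub>F y in at_left c. unit_clamp y = c)"
      and "(\<forall>\<^sub>F y in at_right c. unit_clamp y = y) \<or> (\<forall>\<^sub>F y in at_right c. unit_clamp y = c)"
      using c by auto
    then show ?thesis
      unfolding has_field_derivative_iff filterlim_at_split using half[OF c0(1) c] c0(2) by simp
  qed
  consider "x < 0" | "x \<in> {0,1}" | "0 < x" "x < 1" | "x > 1" by fastforce
  then show ?thesis
  proof cases
    case 1 then show ?thesis using zero[of "{..<0}" x 0] z by (auto simp: unit_clamp_def)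
  next
    case 2 then show ?thesis using at01[OF 2] z by (auto simp: unit_clamp_def)
  next
    case 3
    have "((\<lambda>x. p (unit_clamp x)) has_real_derivative p' x) (at x)"
      by (rule has_field_derivative_transform_within_open[OF p, of "{0<..<1}"]) (use 3 in \<open>auto simp: unit_clamp_def\<close>)
    then show ?thesis using 3 by (simp add: unit_clamp)
  next
    case 4 then show ?thesis using zero[of "{1<..}" x 1] z by (auto simp: unit_clamp_def)
  qed
qed

text \<open>A transition of class \<open>C\<^sup>2\<close> from 0 to 1: the quintic has vanishing first and second derivatives at both ends.\<close>

definition step :: "real \<Rightarrow> real" where
  "step x = 6 * unit_clamp x ^ 5 - 15 * unit_clamp x ^ 4 + 10 * unit_clamp x ^ 3"
definition step' :: "real \<Rightarrow> real" where
  "step' x = 30 * (unit_clamp x * (1 - unit_clamp x))\<^sup>2"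
definition step'' :: "real \<Rightarrow> real" where
  "step'' x = 60 * unit_clamp x * (1 - unit_clamp x) * (1 - 2 * unit_clamp x)"

lemma step_deriv: "(step has_real_derivative step' x) (at x)"
proof -
  have "((\<lambda>x::real. 6 * x ^ 5 - 15 * x ^ 4 + 10 * x ^ 3) has_real_derivative 30 * (x * (1 - x))\<^sup>2) (at x)" for x
    by (auto intro!: derivative_eq_intros simp: power2_eq_square algebra_simps eval_nat_numeral)
  from has_real_derivative_unit_clamp[OF this] show ?thesis
    unfolding step_def[abs_def] step'_def[abs_def] by simp
qed

lemma step'_deriv: "(step' has_real_derivative step'' x) (at x)"
proof -
  have "((\<lambda>x::real. 30 * (x * (1 - x))\<^sup>2) has_real_derivative 60 * x * (1 - x) * (1 - 2 * x)) (at x)" for x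
    by (auto intro!: derivative_eq_intros simp: power2_eq_square algebra_simps eval_nat_numeral)
  from has_real_derivative_unit_clamp[OF this] show ?thesis
    unfolding step'_def[abs_def] step''_def[abs_def] by simp
qed

lemma step_cont [continuous_intros]:
  "continuous_on S f \<Longrightarrow> continuous_on S (\<lambda>x. step (f x))"
  "continuous_on S f \<Longrightarrow> continuous_on S (\<lambda>x. step' (f x))"
  "continuous_on S f \<Longrightarrow> continuous_on S (\<lambda>x. step'' (f x))"
  unfolding step_def step'_def step''_def by (intro continuous_intros; assumption)+

lemma step_simps: "x \<le> 0 \<Longrightarrow> step x = 0" "1 \<le> x \<Longrightarrow> step x = 1"
  "x \<le> 0 \<or> 1 \<le> x \<Longrightarrow> step' x = 0" "x \<le> 0 \<or> 1 \<le> x \<Longrightarrow> step'' x = 0"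
  unfolding step_def step'_def step''_def using unit_clamp(3,4)[of x] by (auto simp del: mult_eq_0_iff)

lemma step'_bounds: "0 \<le> step' x" "step' x \<le> 2"
proof -
  \<comment> \<open>The product y is at most 1/4, so the derivative of the quintic is at most 30/16,
    which is below 2.\<close>
  define y where "y = unit_clamp x * (1 - unit_clamp x)"
  have y: "0 \<le> y" "y \<le> 1/4"
    using mult_nonneg_nonneg[of "unit_clamp x" "1 - unit_clamp x"] unit_clamp(1,2)[of x]
      zero_le_power2[of "unit_clamp x - 1/2"] by (simp_all add: y_def power2_eq_square algebra_simps)
  have "y^2 \<le> (1/4)^2" by (rule power_mono) (use y in auto)
  then show "step' x \<le> 2" unfolding step'_def y_def[symmetric] by (simp add: power2_eq_square)
qed (simp add: step'_def)

lemma step_bounds: "0 \<le> step x" "step x \<le> 1"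
proof -
  have mono: "a \<le> b \<Longrightarrow> step a \<le> step b" for a b
    by (rule DERIV_nonneg_imp_nondecreasing) (use step_deriv step'_bounds in auto)
  show "0 \<le> step x" using mono[of "min 0 x" x] step_simps(1)[of "min 0 x"] by simp
  show "step x \<le> 1" using mono[of x "max 1 x"] step_simps(2)[of "max 1 x"] by simp
qed

text \<open>Here \<open>d\<close> is the distance to the boundary, \<open>n\<close> the outer normal at the nearest boundary point, written as a complex
  number, and \<open>k\<close> the curvature of the level line of \<open>d\<close>.\<close>

locale layer =
  fixes \<Omega> :: "(real^2) set" and r :: real and d :: "real^2 \<Rightarrow> real" and n :: "real^2 \<Rightarrow> complex"
    and k :: "real^2 \<Rightarrow> real"
  assumes r: "0 < r" and bounded_\<Omega>: "bounded \<Omega>"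
    and d_cont: "continuous_on UNIV d" and d_nonneg: "0 \<le> d x" and d_pos: "0 < d x \<longleftrightarrow> x \<in> \<Omega>"
    and d_deriv: "x \<in> \<Omega> \<Longrightarrow> d x < r \<Longrightarrow> has_partials d (- Re (n x)) (- Im (n x)) x"
    and n_norm: "x \<in> \<Omega> \<Longrightarrow> d x < r \<Longrightarrow> cmod (n x) = 1"
    and n_deriv: "x \<in> \<Omega> \<Longrightarrow> d x < r \<Longrightarrow>
      has_partials n (of_real (- k x * Im (n x)) * (\<i> * n x)) (of_real (k x * Re (n x)) * (\<i> * n x)) x"
    and k_bound: "x \<in> \<Omega> \<Longrightarrow> d x < r \<Longrightarrow> \<bar>k x\<bar> \<le> 1 / r"
    and k_cont: "continuous_on {x \<in> \<Omega>. d x < r} k"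
begin

definition L where "L = {x \<in> \<Omega>. d x < r}"

lemma d_cont' [continuous_intros]: "continuous_on S d" using d_cont continuous_on_subset by blast

lemma open_\<Omega>: "open \<Omega>"
proof -
  have "\<Omega> = {x. 0 < d x}" using d_pos by auto
  then show ?thesis using open_Collect_less[OF continuous_on_const[of _ 0] d_cont] by simp
qed

lemma open_L: "open L"
proof -
  have "L = \<Omega> \<inter> {x. d x < r}" by (auto simp: L_def)
  then show ?thesis using open_\<Omega> open_Collect_less[OF d_cont continuous_on_const[of _ r]] by auto
qed

lemma closed_level: "closed {x. c \<le> d x}"
  using closed_Collect_le[OF continuous_on_const[of _ c] d_cont] .

lemma compact_level: "0 < c \<Longrightarrow> compact {x. c \<le> d x}"
proof -
  assume c: "0 < c"
  have "{x. c \<le> d x} \<subseteq> \<Omega>" using c d_pos by (auto intro: less_le_trans)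
  then show ?thesis using closed_level bounded_\<Omega> bounded_subset compact_eq_bounded_closed by blast
qed

lemma compact_shell: "0 < c \<Longrightarrow> compact {x. c \<le> d x \<and> d x \<le> c'}"
proof -
  assume "0 < c"
  then have "compact ({x. c \<le> d x} \<inter> {x. d x \<le> c'})"
    using compact_level closed_Collect_le[OF d_cont continuous_on_const[of _ c']] by (intro compact_Int_closed)
  then show ?thesis by (simp add: Collect_conj_eq)
qed

lemma k_cont' [continuous_intros]: "continuous_on L k" using k_cont by (simp add: L_def)
lemma n_cont [continuous_intros]: "continuous_on L n"
  using n_deriv by (intro has_partials_continuous_on) (auto simp: L_def)

lemma n_sq: "x \<in> L \<Longrightarrow> (Re (n x))\<^sup>2 + (Im (n x))\<^sup>2 = 1" "x \<in> L \<Longrightarrow> n x * cnj (n x) = 1"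
  using n_norm by (auto simp: L_def cmod_def complex_mult_cnj simp flip: of_real_add of_real_power)

text \<open>The gradient of \<open>cut \<epsilon>\<close> is \<open>- b \<epsilon> *\<^sub>R n\<close>, so that integrals against the weight \<open>b \<epsilon>\<close> play the role of boundary integrals.\<close>

definition cut where "cut \<epsilon> x = step (d x / \<epsilon> - 1)"
definition b where "b \<epsilon> x = step' (d x / \<epsilon> - 1) / \<epsilon>"
definition b' where "b' \<epsilon> x = step'' (d x / \<epsilon> - 1) / \<epsilon>\<^sup>2"

lemma cut_cont [continuous_intros]: "continuous_on S (cut \<epsilon>)"
  unfolding cut_def divide_inverse by (intro continuous_intros)
lemma b_cont [continuous_intros]: "continuous_on S (b \<epsilon>)"
  unfolding b_def divide_inverse by (intro continuous_intros)
lemma b'_cont [continuous_intros]: "continuous_on S (b' \<epsilon>)"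
  unfolding b'_def divide_inverse by (intro continuous_intros)

lemma cut_bounds: "0 \<le> cut \<epsilon> x" "cut \<epsilon> x \<le> 1" using step_bounds by (auto simp: cut_def)

lemma b_bounds: "0 < \<epsilon> \<Longrightarrow> 0 \<le> b \<epsilon> x" "0 < \<epsilon> \<Longrightarrow> b \<epsilon> x \<le> 2 / \<epsilon>"
  using step'_bounds by (auto simp: b_def divide_right_mono)

lemma cut_zero: "0 < \<epsilon> \<Longrightarrow> d x \<le> \<epsilon> \<Longrightarrow> cut \<epsilon> x = 0"
  by (simp add: cut_def step_simps field_simps)
lemma cut_one: "0 < \<epsilon> \<Longrightarrow> 2 * \<epsilon> \<le> d x \<Longrightarrow> cut \<epsilon> x = 1"
  by (simp add: cut_def step_simps field_simps)
lemma b_zero: "0 < \<epsilon> \<Longrightarrow> d x \<le> \<epsilon> \<or> 2 * \<epsilon> \<le> d x \<Longrightarrow> b \<epsilon> x = 0"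
  by (auto simp: b_def step_simps field_simps)
lemma b'_zero: "0 < \<epsilon> \<Longrightarrow> d x \<le> \<epsilon> \<or> 2 * \<epsilon> \<le> d x \<Longrightarrow> b' \<epsilon> x = 0"
  by (auto simp: b'_def step_simps field_simps)

lemma b_nz: "0 < \<epsilon> \<Longrightarrow> 2 * \<epsilon> < r \<Longrightarrow> b \<epsilon> x \<noteq> 0 \<Longrightarrow> x \<in> L \<and> \<epsilon> < d x \<and> d x < 2 * \<epsilon>"
  using b_zero[of \<epsilon> x] d_pos[of x] by (fastforce simp: L_def)

lemma integrable_cut:
  fixes f :: "real^2 \<Rightarrow> 'b::{banach, second_countable_topology}"
  assumes "continuous_on \<Omega> f" "0 < \<epsilon>"
  shows "integrable lborel (\<lambda>x. cut \<epsilon> x *\<^sub>R f x)"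
  by (rule integrable_cutoff[OF cut_cont open_\<Omega> assms(1) compact_level[of \<epsilon>]])
    (use assms(2) cut_zero d_pos in \<open>auto intro: less_le_trans\<close>)

lemma integrable_b:
  fixes f :: "real^2 \<Rightarrow> 'b::{banach, second_countable_topology}"
  assumes "continuous_on L f" "0 < \<epsilon>" "2 * \<epsilon> < r"
  shows "integrable lborel (\<lambda>x. b \<epsilon> x *\<^sub>R f x)"
proof (rule integrable_cutoff[OF b_cont open_L assms(1) compact_shell[of \<epsilon> "2 * \<epsilon>"]])
  show "{x. \<epsilon> \<le> d x \<and> d x \<le> 2 * \<epsilon>} \<subseteq> L" using assms d_pos by (fastforce simp: L_def)
qed (use assms b_zero in force)+

lemma cut_partials:
  assumes "0 < \<epsilon>" "2 * \<epsilon> < r" "x \<in> \<Omega>"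
  shows "has_partials (cut \<epsilon>) (- b \<epsilon> x * Re (n x)) (- b \<epsilon> x * Im (n x)) x"
proof (cases "d x < r")
  case True
  have "((\<lambda>t. step (t / \<epsilon> - 1)) has_real_derivative step' (d x / \<epsilon> - 1) * (1 / \<epsilon>)) (at (d x))"
    by (rule DERIV_chain2[OF step_deriv]) (use assms in \<open>auto intro!: derivative_eq_intros\<close>)
  from has_partials_compose_real[OF this d_deriv[OF assms(3) True]] show ?thesis
    by (simp add: cut_def[abs_def] b_def)
next
  case False
  have "has_partials (\<lambda>x. 1::real) 0 0 x" by (rule has_partials_const)
  then have "has_partials (cut \<epsilon>) 0 0 x"
    by (rule has_partials_cong_open[where U="{x. 2 * \<epsilon> < d x}"])
      (use assms False cut_one in \<open>auto intro!: open_Collect_less continuous_intros\<close>)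
  moreover have "b \<epsilon> x = 0" using False assms by (intro b_zero) auto
  ultimately show ?thesis by simp
qed

lemma b_partials:
  assumes "0 < \<epsilon>" "x \<in> L"
  shows "has_partials (b \<epsilon>) (- b' \<epsilon> x * Re (n x)) (- b' \<epsilon> x * Im (n x)) x"
proof -
  have x: "x \<in> \<Omega>" "d x < r" using assms by (auto simp: L_def)
  have "((\<lambda>t. step' (t / \<epsilon> - 1) / \<epsilon>) has_real_derivative step'' (d x / \<epsilon> - 1) * (1 / \<epsilon>) / \<epsilon>) (at (d x))"
    by (rule DERIV_cdivide, rule DERIV_chain2[OF step'_deriv]) (use assms in \<open>auto intro!: derivative_eq_intros\<close>)
  from has_partials_compose_real[OF this d_deriv[OF x]] show ?thesis
    by (simp add: b_def[abs_def] b'_def power2_eq_square)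
qed

text \<open>The product of the cutoff with F has compact support, so both its partials integrate to
  0, and the gradient of the cutoff is -b n. Adding \<i> times the second identity to the first
  gives one complex identity for the operator \<partial>_x + \<i> \<partial>_y, in which holomorphic
  factors pass through undifferentiated.\<close>

lemma stokes:
  fixes F :: "real^2 \<Rightarrow> complex"
  assumes e: "0 < \<epsilon>" "2 * \<epsilon> < r"
    and F: "\<And>x. x \<in> \<Omega> \<Longrightarrow> has_partials F (F1 x) (F2 x) x" and c: "continuous_on \<Omega> F1" "continuous_on \<Omega> F2"
  shows "(LINT x|lborel. cut \<epsilon> x *\<^sub>R (F1 x + \<i> * F2 x)) = (LINT x|lborel. b \<epsilon> x *\<^sub>R (n x * F x))"
proof -
  define A where "A = {x. \<epsilon> \<le> d x}"
  have A: "compact A" "A \<subseteq> \<Omega>" using e compact_level d_pos by (auto simp: A_def intro: less_le_trans)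
  have Fc: "continuous_on \<Omega> F" using F by (rule has_partials_continuous_on)
  have Lsub: "L \<subseteq> \<Omega>" by (auto simp: L_def)
  have FcL: "continuous_on L F" using Fc Lsub continuous_on_subset by blast
  define P where "P = (\<lambda>x. cut \<epsilon> x *\<^sub>R F1 x + b \<epsilon> x *\<^sub>R (- of_real (Re (n x)) * F x))"
  define Q where "Q = (\<lambda>x. cut \<epsilon> x *\<^sub>R F2 x + b \<epsilon> x *\<^sub>R (- of_real (Im (n x)) * F x))"
  have bs: "compact {x. \<epsilon> \<le> d x \<and> d x \<le> 2 * \<epsilon>}" "{x. \<epsilon> \<le> d x \<and> d x \<le> 2 * \<epsilon>} \<subseteq> L"
    using compact_shell e d_pos by (auto simp: L_def intro: less_le_trans)
  have cb: "continuous_on UNIV (\<lambda>x. b \<epsilon> x *\<^sub>R f x)" if "continuous_on L f" for f :: "real^2 \<Rightarrow> complex"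
    by (rule continuous_cutoff[OF b_cont open_L that compact_imp_closed[OF bs(1)] bs(2)]) (use e b_zero in force)
  have cP: "continuous_on A P" "continuous_on A Q"
    unfolding P_def Q_def
    by (intro continuous_intros continuous_on_subset[OF c(1) A(2)] continuous_on_subset[OF c(2) A(2)]
        continuous_on_subset[OF cb] FcL; simp)+
  have z: "cut \<epsilon> x = 0" "b \<epsilon> x = 0" if "x \<notin> A" for x using that e cut_zero b_zero by (auto simp: A_def)
  have part: "has_partials (\<lambda>x. cut \<epsilon> x *\<^sub>R F x) (P x) (Q x) x" if "x \<in> A" for x
    using has_partials_scaleR[OF cut_partials[OF e, of x] F[of x]] that A
    by (auto simp: P_def Q_def scaleR_conv_of_real algebra_simps)
  have bd: "bounded (P ` A)" "bounded (Q ` A)"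
    using cP A(1) compact_continuous_image compact_imp_bounded by blast+
  have *: "integral\<^sup>L lborel P = 0" "integral\<^sup>L lborel Q = 0"
    using integral_partials_zero[OF A(1) part _ bd] z by (auto simp: P_def Q_def)
  have i: "integrable lborel (\<lambda>x. cut \<epsilon> x *\<^sub>R F1 x)" "integrable lborel (\<lambda>x. cut \<epsilon> x *\<^sub>R F2 x)"
    "integrable lborel (\<lambda>x. b \<epsilon> x *\<^sub>R (- of_real (Re (n x)) * F x))"
    "integrable lborel (\<lambda>x. b \<epsilon> x *\<^sub>R (- of_real (Im (n x)) * F x))"
    by (intro integrable_cut integrable_b c e continuous_intros FcL)+
  have iPQ: "integrable lborel P" "integrable lborel Q" unfolding P_def Q_def using i by (auto intro: Bochner_Integration.integrable_add)
  have ib: "integrable lborel (\<lambda>x. b \<epsilon> x *\<^sub>R (n x * F x))"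
    by (intro integrable_b e continuous_intros FcL)
  have "(LINT x|lborel. cut \<epsilon> x *\<^sub>R (F1 x + \<i> * F2 x)) = (LINT x|lborel. (P x + \<i> * Q x) + b \<epsilon> x *\<^sub>R (n x * F x))"
  proof (rule Bochner_Integration.integral_cong[OF refl])
    fix x
    have "n x * F x = (of_real (Re (n x)) + \<i> * of_real (Im (n x))) * F x" by (simp flip: complex_eq)
    then show "cut \<epsilon> x *\<^sub>R (F1 x + \<i> * F2 x) = (P x + \<i> * Q x) + b \<epsilon> x *\<^sub>R (n x * F x)"
      by (simp only:) (simp add: P_def Q_def scaleR_conv_of_real algebra_simps)
  qed
  also have "\<dots> = (LINT x|lborel. P x + \<i> * Q x) + (LINT x|lborel. b \<epsilon> x *\<^sub>R (n x * F x))"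
    using iPQ ib by (intro Bochner_Integration.integral_add) auto
  also have "(LINT x|lborel. P x + \<i> * Q x) = 0" using iPQ * by simp
  finally show ?thesis by simp
qed

text \<open>The tangent \<i> n is a rotated gradient of d up to sign, hence divergence free
  (\<open>l1 = m2\<close> in the proof), and b is constant along the level lines of d. So b times
  the tangent is divergence free and there is no curvature term.\<close>

lemma tangential_parts:
  fixes f :: "real^2 \<Rightarrow> real"
  assumes e: "0 < \<epsilon>" "2 * \<epsilon> < r"
    and f: "\<And>x. x \<in> L \<Longrightarrow> has_partials f (f1 x) (f2 x) x" and c: "continuous_on L f1" "continuous_on L f2"
  shows "(LINT x|lborel. b \<epsilon> x * (- Im (n x) * f1 x + Re (n x) * f2 x)) = 0"
proof -
  define A where "A = {x. \<epsilon> \<le> d x \<and> d x \<le> 2 * \<epsilon>}"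
  have A: "compact A" "A \<subseteq> L" using e compact_shell d_pos by (auto simp: A_def L_def intro: less_le_trans)
  have fc: "continuous_on L f" using f by (rule has_partials_continuous_on)
  have z: "b' \<epsilon> x = 0" "b \<epsilon> x = 0" if "x \<notin> A" for x using that e b'_zero b_zero by (auto simp: A_def)
  define m1 where "m1 x = Re (of_real (- k x * Im (n x)) * (\<i> * n x))" for x
  define m2 where "m2 x = Re (of_real (k x * Re (n x)) * (\<i> * n x))" for x
  define l1 where "l1 x = Im (of_real (- k x * Im (n x)) * (\<i> * n x))" for x
  define l2 where "l2 x = Im (of_real (k x * Re (n x)) * (\<i> * n x))" for x
  have nr: "has_partials (\<lambda>x. Re (n x)) (m1 x) (m2 x) x" "has_partials (\<lambda>x. Im (n x)) (l1 x) (l2 x) x" if "x \<in> L" for x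
    unfolding m1_def m2_def l1_def l2_def
    using has_partials_Re[OF n_deriv, of x] has_partials_Im[OF n_deriv, of x] that by (auto simp: L_def)
  define P1 P2 where "P1 = (\<lambda>x. (- b' \<epsilon> x * Re (n x)) * (Im (n x) * f x) + b \<epsilon> x * (l1 x * f x + Im (n x) * f1 x))"
    and "P2 = (\<lambda>x. (- b' \<epsilon> x * Im (n x)) * (Im (n x) * f x) + b \<epsilon> x * (l2 x * f x + Im (n x) * f2 x))"
  define Q1 Q2 where "Q1 = (\<lambda>x. (- b' \<epsilon> x * Re (n x)) * (Re (n x) * f x) + b \<epsilon> x * (m1 x * f x + Re (n x) * f1 x))"
    and "Q2 = (\<lambda>x. (- b' \<epsilon> x * Im (n x)) * (Re (n x) * f x) + b \<epsilon> x * (m2 x * f x + Re (n x) * f2 x))"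
  have P: "has_partials (\<lambda>x. b \<epsilon> x * (Im (n x) * f x)) (P1 x) (P2 x) x"
    and Q: "has_partials (\<lambda>x. b \<epsilon> x * (Re (n x) * f x)) (Q1 x) (Q2 x) x" if "x \<in> A" for x
    unfolding P1_def P2_def Q1_def Q2_def
    by (intro has_partials_mult b_partials e nr f; use that A in auto)+
  have lm: "continuous_on L l1" "continuous_on L l2" "continuous_on L m1" "continuous_on L m2"
    unfolding l1_def l2_def m1_def m2_def by (intro continuous_intros)+
  have "continuous_on L P1" "continuous_on L P2" "continuous_on L Q1" "continuous_on L Q2"
    unfolding P1_def P2_def Q1_def Q2_def by (intro continuous_intros lm fc c)+
  then have cc: "continuous_on A P1" "continuous_on A P2" "continuous_on A Q1" "continuous_on A Q2"
    using A(2) continuous_on_subset by blast+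
  then have bd: "bounded (P1 ` A)" "bounded (P2 ` A)" "bounded (Q1 ` A)" "bounded (Q2 ` A)"
    using A(1) compact_continuous_image compact_imp_bounded by blast+
  have ii: "integrable lborel f" if "continuous_on A f" "\<And>x. x \<notin> A \<Longrightarrow> f x = 0" for f :: "real^2 \<Rightarrow> real"
  proof -
    have "integrable lborel (\<lambda>x. indicator A x *\<^sub>R f x)"
      using borel_integrable_compact[OF A(1) that(1)] by auto
    moreover have "(\<lambda>x. indicator A x *\<^sub>R f x) = f"
    proof
      show "indicator A x *\<^sub>R f x = f x" for x using that(2)[of x] by (cases "x \<in> A") auto
    qed
    ultimately show ?thesis by simp
  qed
  have i: "integrable lborel P1" "integrable lborel Q2"
    by (rule ii; use cc z in \<open>simp add: P1_def Q2_def\<close>)+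
  have *: "integral\<^sup>L lborel P1 = 0"
    using integral_partials_zero(1)[OF A(1) P _ bd(1,2)] z by (auto simp: P1_def P2_def)
  have **: "integral\<^sup>L lborel Q2 = 0"
    using integral_partials_zero(2)[OF A(1) Q _ bd(3,4)] z by (auto simp: Q1_def Q2_def)
  have "(LINT x|lborel. b \<epsilon> x * (- Im (n x) * f1 x + Re (n x) * f2 x)) = (LINT x|lborel. Q2 x - P1 x)"
    by (rule Bochner_Integration.integral_cong) (auto simp: P1_def Q2_def l1_def m2_def algebra_simps)
  also have "\<dots> = 0" using i * ** by simp
  finally show ?thesis .
qed

text \<open>The cutoff is logarithmic because \<open>t * log_cut' t\<close> has to be uniformly small; this makes the constant in
  \<open>fR_bar\<close> smaller than 1.\<close>

definition log_cut where "log_cut t = step (ln (r / (4 * t)) / 8)"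
definition log_cut' where "log_cut' t = - step' (ln (r / (4 * t)) / 8) / (8 * t)"

lemma log_cut_deriv: "0 < t \<Longrightarrow> (log_cut has_real_derivative log_cut' t) (at t)"
proof -
  assume t: "0 < t"
  have "((\<lambda>t. ln (r / (4 * t)) / 8) has_real_derivative - 1 / (8 * t)) (at t)"
    using t r by (auto intro!: derivative_eq_intros simp: field_simps)
  from DERIV_chain2[OF step_deriv this] show ?thesis
    by (simp add: log_cut_def[abs_def] log_cut'_def)
qed

lemma log_cut_zero: "r / 4 \<le> t \<Longrightarrow> log_cut t = 0 \<and> log_cut' t = 0"
proof -
  assume t: "r / 4 \<le> t"
  then have "ln (r / (4 * t)) / 8 \<le> 0" using r by (simp add: field_simps)
  then show ?thesis unfolding log_cut_def log_cut'_def by (simp add: step_simps del: divide_le_0_iff)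
qed

lemma log_cut_one: "0 < t \<Longrightarrow> t \<le> r / (4 * exp 8) \<Longrightarrow> log_cut t = 1 \<and> log_cut' t = 0"
proof -
  assume t: "0 < t" "t \<le> r / (4 * exp 8)"
  then have "exp 8 \<le> r / (4 * t)" by (simp add: field_simps)
  then have "ln (exp 8) \<le> ln (r / (4 * t))" using t r by (subst ln_le_cancel_iff) auto
  then have "1 \<le> ln (r / (4 * t)) / 8" by simp
  then show ?thesis unfolding log_cut_def log_cut'_def by (simp add: step_simps del: le_divide_eq_1_pos)
qed

lemma log_cut_bounds: "0 \<le> log_cut t" "log_cut t \<le> 1" using step_bounds by (auto simp: log_cut_def)

lemma log_cut'_small: "0 < t \<Longrightarrow> \<bar>t * log_cut' t\<bar> \<le> 1 / 4"
  using step'_bounds[of "ln (r / (4 * t)) / 8"] by (simp add: log_cut'_def abs_mult)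

text \<open>The bound 1/(4t) blows up at 0, but the derivative vanishes for t below r / (4 * exp 8).
  This is where exp 8 enters all later constants.\<close>

lemma log_cut'_bound: "0 < t \<Longrightarrow> \<bar>log_cut' t\<bar> \<le> exp 8 / r"
proof -
  assume t: "0 < t"
  show ?thesis
  proof (cases "t \<le> r / (4 * exp 8)")
    case True then show ?thesis using log_cut_one[OF t] r by simp
  next
    case False
    have "\<bar>log_cut' t\<bar> \<le> 1 / (4 * t)" using log_cut'_small[OF t] t by (simp add: abs_mult field_simps)
    also have "\<dots> \<le> exp 8 / r" using False t r by (simp add: field_simps)
    finally show ?thesis .
  qed
qed

lemma log_cut_cont [continuous_intros]: "S \<subseteq> \<Omega> \<Longrightarrow> continuous_on S (\<lambda>x. log_cut (d x))" "S \<subseteq> \<Omega> \<Longrightarrow> continuous_on S (\<lambda>x. log_cut' (d x))"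
proof -
  assume S: "S \<subseteq> \<Omega>"
  have pos: "\<forall>x\<in>S. d x \<noteq> 0 \<and> r / (4 * d x) \<noteq> 0"
  proof
    fix x assume "x \<in> S"
    then have "0 < d x" using S d_pos by blast
    then show "d x \<noteq> 0 \<and> r / (4 * d x) \<noteq> 0" using r by simp
  qed
  show "continuous_on S (\<lambda>x. log_cut (d x))" "continuous_on S (\<lambda>x. log_cut' (d x))"
    unfolding log_cut_def log_cut'_def using pos by (auto intro!: continuous_intros)
qed

lemma L_sub: "L \<subseteq> \<Omega>" by (auto simp: L_def)

text \<open>The factor h is controlled only on \<open>L\<close>, but the product vanishes from depth
  r/4 on, so it extends by 0 to the whole domain; \<open>layer_partials\<close> does the same for
  derivatives.\<close>

lemma layer_cont:
  assumes g: "continuous_on \<Omega> (\<lambda>x. g (d x))" "\<And>t. r / 4 \<le> t \<Longrightarrow> g t = 0" and h: "continuous_on L h"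
  shows "continuous_on \<Omega> (\<lambda>x. (g (d x) :: real) *\<^sub>R (h x :: complex))"
proof -
  define U where "U = {x. r / 4 < d x}"
  have U: "open U" unfolding U_def by (intro open_Collect_less continuous_intros)
  have "continuous_on (L \<union> U) (\<lambda>x. g (d x) *\<^sub>R h x)"
  proof (rule continuous_on_open_Un[OF open_L U])
    show "continuous_on L (\<lambda>x. g (d x) *\<^sub>R h x)"
      by (intro continuous_intros continuous_on_subset[OF g(1) L_sub] h)
    show "continuous_on U (\<lambda>x. g (d x) *\<^sub>R h x)"
      by (rule continuous_on_eq[OF continuous_on_const[of _ 0]]) (use g(2) in \<open>auto simp: U_def\<close>)
  qed
  moreover have "\<Omega> \<subseteq> L \<union> U" using r by (auto simp: L_def U_def)
  ultimately show ?thesis using continuous_on_subset by blast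
qed

lemma layer_partials:
  assumes x: "x \<in> \<Omega>" and g: "(g has_real_derivative g' (d x)) (at (d x))"
    and z: "\<And>t. r / 4 \<le> t \<Longrightarrow> g t = 0 \<and> g' t = 0"
    and h: "x \<in> L \<Longrightarrow> has_partials h (ha x) (hb x) x"
  shows "has_partials (\<lambda>x. g (d x) *\<^sub>R (h x :: complex))
    (g' (d x) *\<^sub>R (- of_real (Re (n x)) * h x) + g (d x) *\<^sub>R ha x)
    (g' (d x) *\<^sub>R (- of_real (Im (n x)) * h x) + g (d x) *\<^sub>R hb x) x"
proof (cases "d x < r")
  case True
  then have xL: "x \<in> L" using x by (simp add: L_def)
  show ?thesis
    using has_partials_scaleR[OF has_partials_compose_real[OF g d_deriv[OF x True]] h[OF xL]]
    by (simp add: scaleR_conv_of_real algebra_simps)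
next
  case False
  have "has_partials (\<lambda>x. 0) 0 0 x" by (rule has_partials_const)
  then have "has_partials (\<lambda>x. g (d x) *\<^sub>R h x) 0 0 x"
    by (rule has_partials_cong_open[where U="{x. r / 4 < d x}"])
     (use False z r in \<open>auto intro!: open_Collect_less continuous_intros\<close>)
  then show ?thesis using z[of "d x"] False r by simp
qed

definition n1 where "n1 x = of_real (- k x * Im (n x)) * (\<i> * n x)"
definition n2 where "n2 x = of_real (k x * Re (n x)) * (\<i> * n x)"

lemma n_partials: "x \<in> L \<Longrightarrow> has_partials n (n1 x) (n2 x) x"
  using n_deriv by (simp add: L_def n1_def n2_def)

lemma n12_cont [continuous_intros]: "continuous_on L n1" "continuous_on L n2"
  unfolding n1_def n2_def by (intro continuous_intros)+

lemma n12: "n1 x + \<i> * n2 x = - of_real (k x) * (n x)\<^sup>2"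
  by (rule complex_eqI) (simp_all add: n1_def n2_def power2_eq_square algebra_simps)

text \<open>The real part is the divergence of n, the imaginary part its curl up to sign. The curl
  vanishes because n is minus the gradient of d, and the divergence is the curvature of the level
  line.\<close>

lemma n12_cnj: "x \<in> L \<Longrightarrow> cnj (n1 x) + \<i> * cnj (n2 x) = of_real (k x)"
proof -
  assume x: "x \<in> L"
  have "cnj (n1 x) + \<i> * cnj (n2 x) = of_real (k x * ((Re (n x))\<^sup>2 + (Im (n x))\<^sup>2))"
    by (rule complex_eqI) (simp_all add: n1_def n2_def power2_eq_square algebra_simps)
  then show ?thesis using n_sq(1)[OF x] by simp
qed

text \<open>Near the boundary \<open>fM = n\<^sup>2\<close>, \<open>fV = cnj n\<close> and \<open>fR = d *\<^sub>R n\<close>. The field \<open>fV\<close> gives the trace inequality, and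
  \<open>(\<partial>\<^sub>x + \<i>\<partial>\<^sub>y) fR\<close> almost cancels \<open>fM\<close>. The suffixes 1 and 2 mark partial derivatives.\<close>

definition fM where "fM x = log_cut (d x) *\<^sub>R (n x)\<^sup>2"
definition fM1 where "fM1 x = log_cut' (d x) *\<^sub>R (- of_real (Re (n x)) * (n x)\<^sup>2) + log_cut (d x) *\<^sub>R (n1 x * n x + n x * n1 x)"
definition fM2 where "fM2 x = log_cut' (d x) *\<^sub>R (- of_real (Im (n x)) * (n x)\<^sup>2) + log_cut (d x) *\<^sub>R (n2 x * n x + n x * n2 x)"
definition fR where "fR x = (d x * log_cut (d x)) *\<^sub>R n x"
definition fR1 where "fR1 x = (log_cut (d x) + d x * log_cut' (d x)) *\<^sub>R (- of_real (Re (n x)) * n x) + (d x * log_cut (d x)) *\<^sub>R n1 x"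
definition fR2 where "fR2 x = (log_cut (d x) + d x * log_cut' (d x)) *\<^sub>R (- of_real (Im (n x)) * n x) + (d x * log_cut (d x)) *\<^sub>R n2 x"
definition fV where "fV x = log_cut (d x) *\<^sub>R cnj (n x)"
definition fV1 where "fV1 x = log_cut' (d x) *\<^sub>R (- of_real (Re (n x)) * cnj (n x)) + log_cut (d x) *\<^sub>R cnj (n1 x)"
definition fV2 where "fV2 x = log_cut' (d x) *\<^sub>R (- of_real (Im (n x)) * cnj (n x)) + log_cut (d x) *\<^sub>R cnj (n2 x)"

lemma n_square_partials: "x \<in> L \<Longrightarrow> has_partials (\<lambda>x. (n x)\<^sup>2) (n1 x * n x + n x * n1 x) (n2 x * n x + n x * n2 x) x"
  unfolding power2_eq_square by (intro has_partials_mult n_partials)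

lemma fM_partials: "x \<in> \<Omega> \<Longrightarrow> has_partials fM (fM1 x) (fM2 x) x"
  unfolding fM_def[abs_def] fM1_def fM2_def
  by (rule layer_partials[where g=log_cut and g'=log_cut', OF _ log_cut_deriv log_cut_zero n_square_partials]) (use d_pos in auto)

lemma fV_partials: "x \<in> \<Omega> \<Longrightarrow> has_partials fV (fV1 x) (fV2 x) x"
  unfolding fV_def[abs_def] fV1_def fV2_def
  by (rule layer_partials[where g=log_cut and g'=log_cut', OF _ log_cut_deriv log_cut_zero has_partials_cnj[OF n_partials]]) (use d_pos in auto)

lemma fR_partials: "x \<in> \<Omega> \<Longrightarrow> has_partials fR (fR1 x) (fR2 x) x"
  unfolding fR_def[abs_def] fR1_def fR2_def
  by (rule layer_partials[where h=n and ha=n1 and hb=n2 and g="\<lambda>t. t * log_cut t" and g'="\<lambda>t. log_cut t + t * log_cut' t"])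
    (use log_cut_deriv d_pos log_cut_zero in \<open>auto intro!: derivative_eq_intros n_partials\<close>)

lemma fields_cont [continuous_intros]:
  "continuous_on \<Omega> fM1" "continuous_on \<Omega> fM2" "continuous_on \<Omega> fR1" "continuous_on \<Omega> fR2"
  "continuous_on \<Omega> fV1" "continuous_on \<Omega> fV2"
  unfolding fM1_def fM2_def fR1_def fR2_def fV1_def fV2_def
  by (intro continuous_on_add layer_cont[where g=log_cut] layer_cont[where g=log_cut'] layer_cont[where g="\<lambda>t. log_cut t + t * log_cut' t"]
      layer_cont[where g="\<lambda>t. t * log_cut t"] continuous_intros subset_refl; simp add: log_cut_zero)+

lemma fields_cont' [continuous_intros]: "continuous_on \<Omega> fM" "continuous_on \<Omega> fR" "continuous_on \<Omega> fV"
  using fM_partials fR_partials fV_partials by (blast intro: has_partials_continuous_on)+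

text \<open>In the layer the quantity is \<open>- (log_cut' + 2 * log_cut * k) * n^3\<close>, hence
  of order 1/r. A term in which the derivative falls on \<open>fM\<close> is therefore only linear
  in W, at the cost of a factor 1/r.\<close>

lemma fM_bar:
  assumes x: "x \<in> \<Omega>" shows "cmod (fM1 x + \<i> * fM2 x) \<le> (exp 8 + 2) / r"
proof (cases "d x < r")
  case True
  then have xL: "x \<in> L" using x by (simp add: L_def)
  have c: "cmod (n x) = 1" using n_norm[OF x True] .
  have "fM1 x + \<i> * fM2 x = - of_real (log_cut' (d x)) * (of_real (Re (n x)) + \<i> * of_real (Im (n x))) * (n x)\<^sup>2
     + of_real (log_cut (d x)) * (2 * n x * (n1 x + \<i> * n2 x))"
    by (simp add: fM1_def fM2_def scaleR_conv_of_real algebra_simps)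
  also have "\<dots> = - of_real (log_cut' (d x) + 2 * (log_cut (d x) * k x)) * (n x)^3"
    by (simp add: n12 flip: complex_eq) (simp add: algebra_simps power2_eq_square power3_eq_cube)
  finally have "cmod (fM1 x + \<i> * fM2 x) = cmod (of_real (log_cut' (d x) + 2 * (log_cut (d x) * k x)) :: complex)"
    by (simp only: norm_mult norm_power c norm_minus_cancel) simp
  also have "\<dots> \<le> \<bar>log_cut' (d x)\<bar> + 2 * (log_cut (d x) * \<bar>k x\<bar>)"
    using log_cut_bounds by (simp only: norm_of_real) (auto intro: order_trans[OF abs_triangle_ineq] simp: abs_mult)
  also have "\<dots> \<le> exp 8 / r + 2 * (1 * (1 / r))"
    by (intro add_mono mult_left_mono mult_mono log_cut'_bound k_bound log_cut_bounds) (use x True d_pos r in auto)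
  finally show ?thesis by (simp add: add_divide_distrib)
next
  case False
  then show ?thesis using log_cut_zero[of "d x"] r by (simp add: fM1_def fM2_def)
qed

lemma fV_bar:
  assumes x: "x \<in> \<Omega>" shows "cmod (fV1 x + \<i> * fV2 x) \<le> (exp 8 + 2) / r"
proof (cases "d x < r")
  case True
  then have xL: "x \<in> L" using x by (simp add: L_def)
  have c: "cmod (n x) = 1" using n_norm[OF x True] .
  have "fV1 x + \<i> * fV2 x = - of_real (log_cut' (d x)) * (of_real (Re (n x)) + \<i> * of_real (Im (n x))) * cnj (n x)
     + of_real (log_cut (d x)) * (cnj (n1 x) + \<i> * cnj (n2 x))"
    by (simp add: fV1_def fV2_def scaleR_conv_of_real algebra_simps)
  also have "\<dots> = of_real (log_cut (d x) * k x - log_cut' (d x))"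
    by (simp add: n12_cnj[OF xL] mult.assoc n_sq(2)[OF xL] flip: complex_eq)
  finally have "cmod (fV1 x + \<i> * fV2 x) = \<bar>log_cut (d x) * k x - log_cut' (d x)\<bar>" by (simp only: norm_of_real)
  also have "\<dots> \<le> \<bar>log_cut' (d x)\<bar> + log_cut (d x) * \<bar>k x\<bar>"
    using log_cut_bounds[of "d x"] abs_triangle_ineq4[of "log_cut (d x) * k x" "log_cut' (d x)"] by (simp add: abs_mult)
  also have "\<dots> \<le> exp 8 / r + 1 * (1 / r)"
    by (intro add_mono mult_left_mono mult_mono log_cut'_bound k_bound log_cut_bounds) (use x True d_pos r in auto)
  also have "\<dots> \<le> (exp 8 + 2) / r" using r by (simp add: field_simps)
  finally show ?thesis .
next
  case False
  then show ?thesis using log_cut_zero[of "d x"] r by (simp add: fV1_def fV2_def)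
qed

text \<open>Where the cutoff is active, differentiating d reproduces \<open>- fM\<close>. Of the two
  remainders, \<open>d * log_cut'\<close> is at most 1/4 by the slow logarithmic decay, and
  \<open>d * log_cut * k\<close> is at most 1/4 because d < r/4 and |k| \<le> 1/r.\<close>

lemma fR_bar:
  assumes x: "x \<in> \<Omega>" shows "cmod (fR1 x + \<i> * fR2 x + fM x) \<le> 1 / 2"
proof (cases "d x < r / 4")
  case True
  then have xL: "x \<in> L" and xr: "d x < r" using x r by (auto simp: L_def)
  have c: "cmod (n x) = 1" using n_norm[OF x xr] .
  have dp: "0 < d x" using x d_pos by simp
  have "fR1 x + \<i> * fR2 x + fM x = - of_real (log_cut (d x) + d x * log_cut' (d x)) * (of_real (Re (n x)) + \<i> * of_real (Im (n x))) * n x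
     + of_real (d x * log_cut (d x)) * (n1 x + \<i> * n2 x) + of_real (log_cut (d x)) * (n x)\<^sup>2"
    by (simp add: fR1_def fR2_def fM_def scaleR_conv_of_real algebra_simps)
  also have "\<dots> = - of_real (d x * log_cut' (d x) + d x * log_cut (d x) * k x) * (n x)\<^sup>2"
    by (simp add: n12 flip: complex_eq) (simp add: algebra_simps power2_eq_square)
  finally have "cmod (fR1 x + \<i> * fR2 x + fM x) = \<bar>d x * log_cut' (d x) + d x * log_cut (d x) * k x\<bar>"
    by (simp add: norm_mult norm_power c del: of_real_add of_real_mult)
  also have "\<dots> \<le> \<bar>d x * log_cut' (d x)\<bar> + d x * (log_cut (d x) * \<bar>k x\<bar>)"
    using log_cut_bounds[of "d x"] abs_triangle_ineq[of "d x * log_cut' (d x)" "d x * log_cut (d x) * k x"] d_nonneg[of x] by (simp add: abs_mult mult.assoc)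
  also have "\<dots> \<le> 1 / 4 + (r / 4) * (1 * (1 / r))"
    by (intro add_mono mult_mono log_cut'_small k_bound log_cut_bounds)
      (use x True xr dp r log_cut_bounds d_nonneg in auto)
  finally show ?thesis using r by simp
next
  case False
  then show ?thesis using log_cut_zero[of "d x"] r by (simp add: fR1_def fR2_def fM_def)
qed

lemma fV_norm: "x \<in> \<Omega> \<Longrightarrow> cmod (fV x) \<le> 1"
proof (cases "d x < r")
  case True assume "x \<in> \<Omega>"
  then show ?thesis using log_cut_bounds[of "d x"] n_norm[of x] True by (simp add: fV_def)
next
  case False then show ?thesis using log_cut_zero[of "d x"] r by (simp add: fV_def)
qed

lemma fR_norm: "x \<in> \<Omega> \<Longrightarrow> cmod (fR x) \<le> d x"
proof (cases "d x < r")
  case True assume x: "x \<in> \<Omega>"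
  then show ?thesis using log_cut_bounds[of "d x"] n_norm[of x] True d_nonneg[of x]
    by (simp add: fR_def abs_mult mult_left_le)
next
  case False then show ?thesis using log_cut_zero[of "d x"] r d_nonneg[of x] by (simp add: fR_def)
qed

lemma fields_near:
  assumes "x \<in> \<Omega>" "d x \<le> r / (4 * exp 8)"
  shows "fM x = (n x)\<^sup>2" "fV x = cnj (n x)"
  using log_cut_one[of "d x"] assms d_pos by (auto simp: fM_def fV_def)

end

section \<open>Interior and boundary averages for a fixed layer width \<epsilon>\<close>

locale layer_eps = layer +
  fixes \<epsilon> :: real
  assumes eps: "0 < \<epsilon>" "2 * \<epsilon> < r" "2 * \<epsilon> \<le> r / (4 * exp 8)"
begin

definition IC :: "(real^2 \<Rightarrow> 'b::{banach, second_countable_topology}) \<Rightarrow> 'b" where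
  "IC f = (LINT x|lborel. cut \<epsilon> x *\<^sub>R f x)"
definition IB :: "(real^2 \<Rightarrow> 'b::{banach, second_countable_topology}) \<Rightarrow> 'b" where
  "IB f = (LINT x|lborel. b \<epsilon> x *\<^sub>R f x)"

lemma IC_add: "continuous_on \<Omega> f \<Longrightarrow> continuous_on \<Omega> g \<Longrightarrow> IC (\<lambda>x. f x + g x) = IC f + IC g"
  unfolding IC_def scaleR_add_right by (intro Bochner_Integration.integral_add integrable_cut eps)
lemma IC_diff: "continuous_on \<Omega> f \<Longrightarrow> continuous_on \<Omega> g \<Longrightarrow> IC (\<lambda>x. f x - g x) = IC f - IC g"
  unfolding IC_def scaleR_diff_right by (intro Bochner_Integration.integral_diff integrable_cut eps)
lemma IB_add: "continuous_on L f \<Longrightarrow> continuous_on L g \<Longrightarrow> IB (\<lambda>x. f x + g x) = IB f + IB g"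
  unfolding IB_def scaleR_add_right by (intro Bochner_Integration.integral_add integrable_b eps)
lemma IB_diff: "continuous_on L f \<Longrightarrow> continuous_on L g \<Longrightarrow> IB (\<lambda>x. f x - g x) = IB f - IB g"
  unfolding IB_def scaleR_diff_right by (intro Bochner_Integration.integral_diff integrable_b eps)
lemma IC_cmult: "IC (\<lambda>x. c * f x) = c * (IC f :: real)"
proof -
  have "(\<lambda>x. cut \<epsilon> x *\<^sub>R (c * f x)) = (\<lambda>x. c * (cut \<epsilon> x * f x))" by (auto simp: mult_ac)
  then show ?thesis unfolding IC_def by simp
qed
lemma IB_cmult: "IB (\<lambda>x. c * f x) = c * (IB f :: real)"
proof -
  have "(\<lambda>x. b \<epsilon> x *\<^sub>R (c * f x)) = (\<lambda>x. c * (b \<epsilon> x * f x))" by (auto simp: mult_ac)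
  then show ?thesis unfolding IB_def by simp
qed

lemma IC_linear: "bounded_linear T \<Longrightarrow> continuous_on \<Omega> f \<Longrightarrow> IC (\<lambda>x. T (f x)) = T (IC f)"
  for f :: "real^2 \<Rightarrow> 'b::{banach, second_countable_topology}" and T :: "'b \<Rightarrow> 'c::{banach, second_countable_topology}"
  unfolding IC_def using integral_bounded_linear[of T lborel "\<lambda>x. cut \<epsilon> x *\<^sub>R f x"]
  by (simp add: integrable_cut eps linear_simps)
lemma IB_linear: "bounded_linear T \<Longrightarrow> continuous_on L f \<Longrightarrow> IB (\<lambda>x. T (f x)) = T (IB f)"
  for f :: "real^2 \<Rightarrow> 'b::{banach, second_countable_topology}" and T :: "'b \<Rightarrow> 'c::{banach, second_countable_topology}"
  unfolding IB_def using integral_bounded_linear[of T lborel "\<lambda>x. b \<epsilon> x *\<^sub>R f x"]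
  by (simp add: integrable_b eps linear_simps)
lemmas IC_Re = IC_linear[OF bounded_linear_Re] and IC_Im = IC_linear[OF bounded_linear_Im]
lemmas IB_Re = IB_linear[OF bounded_linear_Re] and IB_Im = IB_linear[OF bounded_linear_Im]

lemma IC_cong:
  assumes "\<And>x. x \<in> \<Omega> \<Longrightarrow> f x = g x" shows "IC f = IC g"
  unfolding IC_def
proof (rule Bochner_Integration.integral_cong[OF refl])
  fix x show "cut \<epsilon> x *\<^sub>R f x = cut \<epsilon> x *\<^sub>R g x"
    using assms[of x] d_pos[of x] cut_zero[OF eps(1), of x] eps by (cases "x \<in> \<Omega>") auto
qed

lemma IB_cong: "(\<And>x. x \<in> L \<Longrightarrow> \<epsilon> < d x \<Longrightarrow> d x < 2 * \<epsilon> \<Longrightarrow> f x = g x) \<Longrightarrow> IB f = IB g"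
  unfolding IB_def by (rule Bochner_Integration.integral_cong) (use b_nz[OF eps(1,2)] in auto)

lemma IC_mono:
  fixes f g :: "real^2 \<Rightarrow> real"
  assumes "continuous_on \<Omega> f" "continuous_on \<Omega> g" "\<And>x. x \<in> \<Omega> \<Longrightarrow> f x \<le> g x"
  shows "IC f \<le> IC g"
  unfolding IC_def
proof (rule integral_mono[OF integrable_cut[OF assms(1) eps(1)] integrable_cut[OF assms(2) eps(1)]])
  fix x
  show "cut \<epsilon> x *\<^sub>R f x \<le> cut \<epsilon> x *\<^sub>R g x"
  proof (cases "x \<in> \<Omega>")
    case True then show ?thesis using assms(3) cut_bounds by (simp add: mult_left_mono)
  next
    case False then show ?thesis using d_pos[of x] d_nonneg[of x] cut_zero[OF eps(1), of x] eps by simp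
  qed
qed

lemma IB_mono:
  fixes f g :: "real^2 \<Rightarrow> real"
  assumes "continuous_on L f" "continuous_on L g" "\<And>x. x \<in> L \<Longrightarrow> \<epsilon> < d x \<Longrightarrow> d x < 2 * \<epsilon> \<Longrightarrow> f x \<le> g x"
  shows "IB f \<le> IB g"
  unfolding IB_def
proof (rule integral_mono[OF integrable_b[OF assms(1) eps(1,2)] integrable_b[OF assms(2) eps(1,2)]])
  fix x
  show "b \<epsilon> x *\<^sub>R f x \<le> b \<epsilon> x *\<^sub>R g x"
  proof (cases "b \<epsilon> x = 0")
    case False then show ?thesis using assms(3) b_nz[OF eps(1,2) False] b_bounds[OF eps(1)] by (simp add: mult_left_mono)
  qed simp
qed

lemma stokes':
  assumes "\<And>x. x \<in> \<Omega> \<Longrightarrow> has_partials F (F1 x) (F2 x) x" "continuous_on \<Omega> F1" "continuous_on \<Omega> F2"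
  shows "IC (\<lambda>x. F1 x + \<i> * F2 x) = IB (\<lambda>x. n x * F x)"
  unfolding IC_def IB_def by (rule stokes[OF eps(1,2) assms])

definition mass where "mass = IB (\<lambda>x. 1 :: real)"

lemma IB_bound:
  fixes f :: "real^2 \<Rightarrow> real"
  assumes "continuous_on L f" "\<And>x. x \<in> L \<Longrightarrow> \<epsilon> < d x \<Longrightarrow> d x < 2 * \<epsilon> \<Longrightarrow> f x \<le> c"
  shows "IB f \<le> c * mass"
proof -
  have "IB f \<le> IB (\<lambda>x. c * 1)" by (rule IB_mono) (use assms in auto)
  then show ?thesis unfolding mass_def by (simp only: IB_cmult)
qed

text \<open>The third assumption on \<open>eps\<close> places the support of
  \<open>b \<epsilon>\<close> inside the plateau of the logarithmic cutoff, so that the extended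
  fields take their boundary form exactly, not just approximately.\<close>

lemma near: "x \<in> L \<Longrightarrow> d x < 2 * \<epsilon> \<Longrightarrow> fM x = (n x)\<^sup>2" "x \<in> L \<Longrightarrow> d x < 2 * \<epsilon> \<Longrightarrow> fV x = cnj (n x)"
  using fields_near[of x] eps(3) L_sub by force+

text \<open>The bound for r times the derivatives of \<open>fM\<close> and \<open>fV\<close>, named
  so that exp 8 stays out of the arithmetic.\<close>

definition Z where "Z = exp 8 + (2::real)"
lemma Z_pos: "0 < Z" by (simp add: Z_def add_pos_pos)

text \<open>Near the boundary \<open>n * fV\<close> is 1, so f^2 is the flux of
  \<open>f^2 * fV\<close>, whose divergence is bounded by 2 |f| |grad f| + f^2 Z / r. Young's
  inequality with the weight \<delta> r leaves a gradient term that a small \<delta> makes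
  absorbable.\<close>

lemma trace_bound:
  fixes f :: "real^2 \<Rightarrow> real"
  assumes f: "\<And>x. x \<in> \<Omega> \<Longrightarrow> has_partials f (f1 x) (f2 x) x" and c: "continuous_on \<Omega> f1" "continuous_on \<Omega> f2"
    and \<delta>: "0 < \<delta>"
  shows "IB (\<lambda>x. (f x)\<^sup>2) \<le> IC (\<lambda>x. \<delta> * r * ((f1 x)\<^sup>2 + (f2 x)\<^sup>2) + ((1 / \<delta> + Z) / r) * (f x)\<^sup>2)"
proof -
  have fc: "continuous_on \<Omega> f" using f by (rule has_partials_continuous_on)
  note cL = continuous_on_subset[OF _ L_sub]
  define F where "F x = of_real (f x * f x) * fV x" for x
  define F1 where "F1 x = of_real (f1 x * f x + f x * f1 x) * fV x + of_real (f x * f x) * fV1 x" for x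
  define F2 where "F2 x = of_real (f2 x * f x + f x * f2 x) * fV x + of_real (f x * f x) * fV2 x" for x
  have F: "has_partials F (F1 x) (F2 x) x" if "x \<in> \<Omega>" for x
    unfolding F_def[abs_def] F1_def F2_def
    by (intro has_partials_mult has_partials_of_real fV_partials f that)
  have Fc: "continuous_on \<Omega> F1" "continuous_on \<Omega> F2"
    unfolding F1_def[abs_def] F2_def[abs_def] by (intro continuous_intros fc c)+
  have "IB (\<lambda>x. (f x)\<^sup>2) = IB (\<lambda>x. Re (n x * F x))"
  proof (rule IB_cong)
    fix x assume x: "x \<in> L" "d x < 2 * \<epsilon>"
    have "n x * F x = of_real (f x * f x) * (n x * cnj (n x))" by (simp add: F_def near(2)[OF x])
    then show "(f x)\<^sup>2 = Re (n x * F x)" using n_sq(2)[OF x(1)] by (simp add: power2_eq_square)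
  qed
  also have "\<dots> = Re (IB (\<lambda>x. n x * F x))"
    unfolding F_def by (intro IB_Re continuous_intros cL[OF fc] cL[OF fields_cont'(3)])
  also have "IB (\<lambda>x. n x * F x) = IC (\<lambda>x. F1 x + \<i> * F2 x)" using stokes'[OF F Fc] by simp
  also have "Re (IC (\<lambda>x. F1 x + \<i> * F2 x)) = IC (\<lambda>x. Re (F1 x + \<i> * F2 x))"
    by (rule IC_Re[symmetric]) (intro continuous_intros Fc)
  also have "\<dots> \<le> IC (\<lambda>x. \<delta> * r * ((f1 x)\<^sup>2 + (f2 x)\<^sup>2) + ((1 / \<delta> + Z) / r) * (f x)\<^sup>2)"
  proof (rule IC_mono)
    fix x assume x: "x \<in> \<Omega>"
    define g where "g = Complex (f1 x) (f2 x)"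
    have gg: "(cmod g)\<^sup>2 = (f1 x)\<^sup>2 + (f2 x)\<^sup>2" by (simp add: g_def cmod_power2)
    have "F1 x + \<i> * F2 x = of_real (2 * f x) * g * fV x + of_real ((f x)\<^sup>2) * (fV1 x + \<i> * fV2 x)"
      by (simp add: F1_def F2_def g_def Complex_eq algebra_simps power2_eq_square)
    then have "Re (F1 x + \<i> * F2 x) \<le> cmod (of_real (2 * f x) * g * fV x) + cmod (of_real ((f x)\<^sup>2) * (fV1 x + \<i> * fV2 x))"
      by (metis complex_Re_le_cmod norm_triangle_ineq order_trans)
    also have "\<dots> = 2 * \<bar>f x\<bar> * cmod g * cmod (fV x) + (f x)\<^sup>2 * cmod (fV1 x + \<i> * fV2 x)"
      by (simp only: norm_mult norm_of_real abs_mult) simp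
    also have "\<dots> \<le> 2 * \<bar>f x\<bar> * cmod g * 1 + (f x)\<^sup>2 * (Z / r)"
      by (intro add_mono mult_left_mono fV_norm x) (use fV_bar[OF x] in \<open>auto simp: Z_def\<close>)
    also have "2 * \<bar>f x\<bar> * cmod g \<le> \<delta> * r * (cmod g)\<^sup>2 + (1 / \<delta> / r) * (f x)\<^sup>2"
    proof -
      have "0 \<le> (\<delta> * r * cmod g - \<bar>f x\<bar>)\<^sup>2 / (\<delta> * r)" using \<delta> r by simp
      also have "\<dots> = \<delta> * r * (cmod g)\<^sup>2 + (1 / \<delta> / r) * (f x)\<^sup>2 - 2 * \<bar>f x\<bar> * cmod g"
        using \<delta> r by (simp add: power2_diff field_simps) (simp add: power2_eq_square)
      finally show ?thesis by simp
    qed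
    finally show "Re (F1 x + \<i> * F2 x) \<le> \<delta> * r * ((f1 x)\<^sup>2 + (f2 x)\<^sup>2) + ((1 / \<delta> + Z) / r) * (f x)\<^sup>2"
      by (simp add: gg add_divide_distrib algebra_simps)
  qed (intro continuous_intros Fc fc c)+
  finally show ?thesis .
qed

text \<open>The mass stands for the length of the boundary. Written as the flux of \<open>fV\<close>
  it is bounded independently of \<epsilon>, so errors with a factor \<eta> or \<epsilon> disappear
  in the limit.\<close>

lemma mass_bound: "mass \<le> Z / r * measure lborel \<Omega>"
proof -
  have "IB (\<lambda>x. 1::real) = IB (\<lambda>x. Re (n x * fV x))"
    by (rule IB_cong) (simp add: near n_sq)
  also have "\<dots> = Re (IB (\<lambda>x. n x * fV x))"
    by (intro IB_Re continuous_intros continuous_on_subset[OF fields_cont'(3) L_sub])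
  also have "IB (\<lambda>x. n x * fV x) = IC (\<lambda>x. fV1 x + \<i> * fV2 x)"
    using stokes'[OF fV_partials fields_cont(5,6)] by simp
  also have "Re \<dots> = IC (\<lambda>x. Re (fV1 x + \<i> * fV2 x))"
    by (rule IC_Re[symmetric]) (intro continuous_intros)
  also have "\<dots> \<le> IC (\<lambda>x. Z / r)"
    by (intro IC_mono continuous_intros) (use fV_bar complex_Re_le_cmod order_trans in \<open>unfold Z_def, blast\<close>)
  also have "\<dots> \<le> (LINT x|lborel. indicator \<Omega> x * (Z / r))"
    unfolding IC_def
  proof (rule integral_mono)
    show "integrable lborel (\<lambda>x. cut \<epsilon> x *\<^sub>R (Z / r))"
      by (intro integrable_cut continuous_intros eps)
    have "emeasure lborel \<Omega> < \<infinity>" using bounded_\<Omega> by (rule emeasure_bounded_finite)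
    then show "integrable lborel (\<lambda>x. indicator \<Omega> x * (Z / r))"
      using open_\<Omega> by (auto intro!: integrable_mult_left integrable_real_indicator)
    show "cut \<epsilon> x *\<^sub>R (Z / r) \<le> indicator \<Omega> x * (Z / r)" for x
    proof (cases "x \<in> \<Omega>")
      case True then show ?thesis using cut_bounds[of \<epsilon> x] Z_pos r by (simp add: divide_right_mono mult_left_le_one_le)
    next
      case False then show ?thesis using d_pos[of x] d_nonneg[of x] cut_zero[OF eps(1), of x] eps by simp
    qed
  qed
  also have "\<dots> = Z / r * measure lborel \<Omega>" by simp
  finally show ?thesis by (simp add: mass_def)
qed

end

section \<open>The interior estimate\<close>

text \<open>In the application \<open>P = p / \<theta>\<close>, \<open>K\<close> is the curvature at the nearest boundary point divided by \<open>\<theta>\<close>, and \<open>q\<close> is its derivative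
  in the direction \<open>\<i> n\<close>.\<close>

locale stokes_layer = layer +
  fixes e s w P K q ex ey sx sy wx wy exx exy eyy sxx sxy syy wxx wxy wyy :: "real^2 \<Rightarrow> real" and S :: real
  assumes e1: "x \<in> \<Omega> \<Longrightarrow> has_partials e (ex x) (ey x) x" and s1: "x \<in> \<Omega> \<Longrightarrow> has_partials s (sx x) (sy x) x"
    and w1: "x \<in> \<Omega> \<Longrightarrow> has_partials w (wx x) (wy x) x"
    and e2: "x \<in> \<Omega> \<Longrightarrow> has_partials ex (exx x) (exy x) x" "x \<in> \<Omega> \<Longrightarrow> has_partials ey (exy x) (eyy x) x"
    and s2: "x \<in> \<Omega> \<Longrightarrow> has_partials sx (sxx x) (sxy x) x" "x \<in> \<Omega> \<Longrightarrow> has_partials sy (sxy x) (syy x) x"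
    and w2: "x \<in> \<Omega> \<Longrightarrow> has_partials wx (wxx x) (wxy x) x" "x \<in> \<Omega> \<Longrightarrow> has_partials wy (wxy x) (wyy x) x"
    and c2: "continuous_on \<Omega> exx" "continuous_on \<Omega> exy" "continuous_on \<Omega> eyy" "continuous_on \<Omega> sxx"
      "continuous_on \<Omega> sxy" "continuous_on \<Omega> syy" "continuous_on \<Omega> wxx" "continuous_on \<Omega> wxy" "continuous_on \<Omega> wyy"
    and P1: "x \<in> \<Omega> \<Longrightarrow> has_partials P (- wy x) (wx x) x"
    and harmonic: "x \<in> \<Omega> \<Longrightarrow> wxx x + wyy x = 0"
    and stokes_eq: "x \<in> \<Omega> \<Longrightarrow> ex x + sy x = - wy x / 2" "x \<in> \<Omega> \<Longrightarrow> sx x - ey x = wx x / 2"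
    and K1: "x \<in> \<Omega> \<Longrightarrow> d x < r \<Longrightarrow> has_partials K (- q x * Im (n x)) (q x * Re (n x)) x"
    and q_cont': "continuous_on {x \<in> \<Omega>. d x < r} q"
    and bounds: "x \<in> \<Omega> \<Longrightarrow> \<bar>e x\<bar> \<le> S \<and> \<bar>s x\<bar> \<le> S \<and> \<bar>ex x\<bar> \<le> S \<and> \<bar>ey x\<bar> \<le> S \<and> \<bar>sx x\<bar> \<le> S \<and> \<bar>sy x\<bar> \<le> S
      \<and> \<bar>wx x\<bar> \<le> S \<and> \<bar>wy x\<bar> \<le> S"
begin

lemma first_cont [continuous_intros]: "continuous_on \<Omega> ex" "continuous_on \<Omega> ey" "continuous_on \<Omega> sx" "continuous_on \<Omega> sy"
   "continuous_on \<Omega> wx" "continuous_on \<Omega> wy"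
  by (rule has_partials_continuous_on, erule e2 s2 w2)+
lemma zeroth_cont [continuous_intros]: "continuous_on \<Omega> e" "continuous_on \<Omega> s" "continuous_on \<Omega> w" "continuous_on \<Omega> P"
  by (rule has_partials_continuous_on, erule e1 s1 w1 P1)+
lemmas second_cont [continuous_intros] = c2
lemmas layer_first_cont [continuous_intros] = first_cont[THEN continuous_on_subset[OF _ L_sub]] zeroth_cont[THEN continuous_on_subset[OF _ L_sub]]
  c2[THEN continuous_on_subset[OF _ L_sub]]

lemma q_cont [continuous_intros]: "continuous_on L q" using q_cont' by (simp add: L_def)
lemma K1': "x \<in> L \<Longrightarrow> has_partials K (- q x * Im (n x)) (q x * Re (n x)) x" using K1 by (simp add: L_def)
lemma K_cont [continuous_intros]: "continuous_on L K"
  using K1' by (rule has_partials_continuous_on)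

definition G where "G x = of_real (e x) - \<i> * of_real (s x)"
definition G1 where "G1 x = of_real (ex x) - \<i> * of_real (sx x)"
definition G2 where "G2 x = of_real (ey x) - \<i> * of_real (sy x)"
definition W where "W x = of_real (wx x) - \<i> * of_real (wy x)"
definition W1 where "W1 x = of_real (wxx x) - \<i> * of_real (wxy x)"
definition W2 where "W2 x = of_real (wxy x) - \<i> * of_real (wyy x)"

lemma GW_partials: "x \<in> \<Omega> \<Longrightarrow> has_partials G (G1 x) (G2 x) x" "x \<in> \<Omega> \<Longrightarrow> has_partials W (W1 x) (W2 x) x"
  unfolding G_def[abs_def] G1_def G2_def W_def[abs_def] W1_def W2_def
  by (intro has_partials_diff has_partials_of_real has_partials_bounded_linear[OF bounded_linear_mult_right] e1 s1 w2; assumption)+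

lemma GW_cont [continuous_intros]:
  "A \<subseteq> \<Omega> \<Longrightarrow> continuous_on A G" "A \<subseteq> \<Omega> \<Longrightarrow> continuous_on A G1" "A \<subseteq> \<Omega> \<Longrightarrow> continuous_on A G2"
  "A \<subseteq> \<Omega> \<Longrightarrow> continuous_on A W" "A \<subseteq> \<Omega> \<Longrightarrow> continuous_on A W1" "A \<subseteq> \<Omega> \<Longrightarrow> continuous_on A W2"
  unfolding G_def[abs_def] G1_def[abs_def] G2_def[abs_def] W_def[abs_def] W1_def[abs_def] W2_def[abs_def]
  by (erule continuous_on_subset[rotated], intro continuous_intros)+

lemma G_bar: "x \<in> \<Omega> \<Longrightarrow> G1 x + \<i> * G2 x = - (\<i> / 2) * W x"
  by (rule complex_eqI) (use stokes_eq[of x] in \<open>simp_all add: G1_def G2_def W_def\<close>)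

lemma W_bar: "x \<in> \<Omega> \<Longrightarrow> W1 x + \<i> * W2 x = 0"
  by (rule complex_eqI) (use harmonic[of x] in \<open>simp_all add: W1_def W2_def\<close>)

lemma norms: "(cmod (G x))\<^sup>2 = (e x)\<^sup>2 + (s x)\<^sup>2" "(cmod (W x))\<^sup>2 = (wx x)\<^sup>2 + (wy x)\<^sup>2"
  by (simp_all add: G_def W_def cmod_power2)

lemma S_nonneg: "\<Omega> \<noteq> {} \<Longrightarrow> 0 \<le> S" using bounds by (meson abs_ge_zero all_not_in_conv order_trans)

lemma norm_bounds:
  assumes "x \<in> \<Omega>"
  shows "cmod (G x) \<le> 2 * S" "cmod (G1 x) \<le> 2 * S" "cmod (G2 x) \<le> 2 * S" "cmod (W x) \<le> 2 * S"
proof -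
  have "cmod (of_real a - \<i> * of_real c) \<le> \<bar>a\<bar> + \<bar>c\<bar>" for a c
    by (rule order_trans[OF norm_triangle_ineq4]) (simp add: norm_mult)
  then show "cmod (G x) \<le> 2 * S" "cmod (G1 x) \<le> 2 * S" "cmod (G2 x) \<le> 2 * S" "cmod (W x) \<le> 2 * S"
    unfolding G_def G1_def G2_def W_def using bounds[OF assms] by (smt (verit))+
qed

text \<open>This is the strain in the frame of the normal: the real part is its normal-normal
  component, the imaginary part is minus its normal-tangential component, which the surface
  condition makes vanish on the boundary.\<close>

definition H where "H x = G x * (n x)\<^sup>2"
definition H1 where "H1 x = G1 x * (n x)\<^sup>2 + G x * (n1 x * n x + n x * n1 x)"
definition H2 where "H2 x = G2 x * (n x)\<^sup>2 + G x * (n2 x * n x + n x * n2 x)"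

lemma H_partials: "x \<in> L \<Longrightarrow> has_partials H (H1 x) (H2 x) x"
  unfolding H_def[abs_def] H1_def H2_def using L_sub by (intro has_partials_mult n_square_partials GW_partials) auto

lemma H_cont [continuous_intros]: "continuous_on L H" "continuous_on L H1" "continuous_on L H2"
  unfolding H_def[abs_def] H1_def[abs_def] H2_def[abs_def] by (intro continuous_intros L_sub)+

definition HT where "HT x = - of_real (Im (n x)) * H1 x + of_real (Re (n x)) * H2 x"

text \<open>\<open>HT\<close> is the derivative of \<open>H\<close> in the direction \<i> n. Along a
  level line n turns at the rate k, so the factor n^2 contributes 2 \<i> k \<open>H\<close>.\<close>

lemma HT_eq:
  assumes x: "x \<in> L"
  shows "HT x = (- of_real (Im (n x)) * G1 x + of_real (Re (n x)) * G2 x) * (n x)\<^sup>2 + 2 * \<i> * of_real (k x) * H x"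
proof -
  have "- of_real (Im (n x)) * n1 x + of_real (Re (n x)) * n2 x
      = of_real (k x * ((Re (n x))\<^sup>2 + (Im (n x))\<^sup>2)) * (\<i> * n x)"
    by (simp add: n1_def n2_def algebra_simps power2_eq_square)
  also have "\<dots> = of_real (k x) * (\<i> * n x)" using n_sq(1)[OF x] by simp
  finally have *: "- of_real (Im (n x)) * n1 x + of_real (Re (n x)) * n2 x = of_real (k x) * (\<i> * n x)" .
  have "HT x = (- of_real (Im (n x)) * G1 x + of_real (Re (n x)) * G2 x) * (n x)\<^sup>2
      + 2 * G x * n x * (- of_real (Im (n x)) * n1 x + of_real (Re (n x)) * n2 x)"
    by (simp add: HT_def H1_def H2_def algebra_simps)
  also have "2 * G x * n x * (- of_real (Im (n x)) * n1 x + of_real (Re (n x)) * n2 x) = 2 * \<i> * of_real (k x) * H x"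
    unfolding * by (simp add: H_def power2_eq_square algebra_simps)
  finally show ?thesis .
qed

lemma HT_bound: "x \<in> L \<Longrightarrow> cmod (HT x) \<le> 4 * S + 4 * S / r"
proof -
  assume x: "x \<in> L"
  have x': "x \<in> \<Omega>" "d x < r" using x by (auto simp: L_def)
  have c: "cmod (n x) = 1" using n_norm[OF x'] .
  have a: "\<bar>Im (n x)\<bar> \<le> 1" "\<bar>Re (n x)\<bar> \<le> 1" using abs_Im_le_cmod[of "n x"] abs_Re_le_cmod[of "n x"] c by auto
  have "cmod (HT x) \<le> cmod (- of_real (Im (n x)) * G1 x) + cmod (of_real (Re (n x)) * G2 x) + cmod (2 * \<i> * of_real (k x) * H x)"
  proof -
    define y where "y = - of_real (Im (n x)) * G1 x + of_real (Re (n x)) * G2 x"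
    have "cmod (HT x) \<le> cmod (y * (n x)\<^sup>2) + cmod (2 * \<i> * of_real (k x) * H x)"
      unfolding HT_eq[OF x] y_def[symmetric] by (rule norm_triangle_ineq)
    also have "cmod (y * (n x)\<^sup>2) = cmod y" by (simp add: norm_mult norm_power c)
    also have "cmod y \<le> cmod (- of_real (Im (n x)) * G1 x) + cmod (of_real (Re (n x)) * G2 x)"
      unfolding y_def by (rule norm_triangle_ineq)
    finally show ?thesis by simp
  qed
  also have "\<dots> = \<bar>Im (n x)\<bar> * cmod (G1 x) + \<bar>Re (n x)\<bar> * cmod (G2 x) + 2 * \<bar>k x\<bar> * cmod (G x)"
    by (simp add: norm_mult norm_power H_def c)
  also have "\<dots> \<le> 1 * (2 * S) + 1 * (2 * S) + 2 * (1 / r) * (2 * S)"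
    using S_nonneg x'(1) r by (intro add_mono mult_mono a norm_bounds k_bound x' order_refl) auto
  finally show ?thesis by simp
qed

text \<open>As G = e - \<i> s, the left side is minus the angular part Im (cnj G * \<partial>_\<tau>
  G). The argument of \<open>H\<close> is that of G plus twice that of n, whence the correction 2 k
  |G|^2.\<close>

lemma H_pointwise:
  assumes x: "x \<in> L"
  shows "e x * (- Im (n x) * sx x + Re (n x) * sy x) - s x * (- Im (n x) * ex x + Re (n x) * ey x)
    = 2 * k x * ((e x)\<^sup>2 + (s x)\<^sup>2) - Im (cnj (H x) * HT x)"
proof -
  define g where "g = - of_real (Im (n x)) * G1 x + of_real (Re (n x)) * G2 x"
  have cn: "n x * cnj (n x) = 1" using n_sq(2)[OF x] .
  have "cnj (H x) * HT x = cnj (G x) * g * (n x * cnj (n x))\<^sup>2 + 2 * \<i> * of_real (k x) * (G x * cnj (G x)) * (n x * cnj (n x))\<^sup>2"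
    unfolding HT_eq[OF x] g_def[symmetric] by (simp add: H_def power2_eq_square algebra_simps)
  also have "\<dots> = cnj (G x) * g + 2 * \<i> * of_real (k x * ((e x)\<^sup>2 + (s x)\<^sup>2))"
    unfolding cn by (simp add: complex_norm_square[symmetric] norms)
  finally have "Im (cnj (H x) * HT x) = Im (cnj (G x) * g) + 2 * (k x * ((e x)\<^sup>2 + (s x)\<^sup>2))"
    by simp
  then show ?thesis by (simp add: g_def G_def G1_def G2_def algebra_simps)
qed

end

section \<open>The estimate with layer width \<epsilon> and boundary error \<eta>\<close>

locale stokes_layer_eps = stokes_layer + layer_eps +
  fixes \<eta> :: real
  assumes bc: "x \<in> L \<Longrightarrow> \<epsilon> < d x \<Longrightarrow> d x < 2 * \<epsilon> \<Longrightarrow> \<bar>P x - K x - 2 * Re (H x)\<bar> \<le> \<eta> \<and> \<bar>Im (H x)\<bar> \<le> \<eta>"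
    and ne: "\<Omega> \<noteq> {}" and \<eta>: "0 \<le> \<eta>"
begin

definition D where "D = IC (\<lambda>x. (wx x)\<^sup>2 + (wy x)\<^sup>2)"
definition tau where "tau x = Im (n x * W x)"

lemma tau_cont [continuous_intros]: "continuous_on L tau"
  unfolding tau_def[abs_def] by (intro continuous_intros L_sub)

text \<open>Conjugacy of P and w means (\<partial>_x + \<i> \<partial>_y) P = \<i> cnj W. Since W is
  holomorphic, the operator applied to -\<i> P W gives exactly |W|^2.\<close>

lemma D_boundary: "D = IB (\<lambda>x. P x * tau x)"
proof -
  define F where "F x = - \<i> * (of_real (P x) * W x)" for x
  define F1 where "F1 x = - \<i> * (of_real (- wy x) * W x + of_real (P x) * W1 x)" for x
  define F2 where "F2 x = - \<i> * (of_real (wx x) * W x + of_real (P x) * W2 x)" for x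
  have F: "has_partials F (F1 x) (F2 x) x" if "x \<in> \<Omega>" for x
    unfolding F_def[abs_def] F1_def F2_def
    by (intro has_partials_bounded_linear[OF bounded_linear_mult_right] has_partials_mult has_partials_of_real P1 GW_partials that)
  have Fc: "continuous_on \<Omega> F1" "continuous_on \<Omega> F2" "continuous_on L F"
    unfolding F1_def[abs_def] F2_def[abs_def] F_def[abs_def] by (intro continuous_intros subset_refl L_sub)+
  have "D = IC (\<lambda>x. Re (F1 x + \<i> * F2 x))"
    unfolding D_def
  proof (rule IC_cong)
    fix x assume x: "x \<in> \<Omega>"
    have "F1 x + \<i> * F2 x = - \<i> * (of_real (- wy x) + \<i> * of_real (wx x)) * W x - \<i> * of_real (P x) * (W1 x + \<i> * W2 x)"
      by (simp add: F1_def F2_def algebra_simps)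
    then show "(wx x)\<^sup>2 + (wy x)\<^sup>2 = Re (F1 x + \<i> * F2 x)"
      unfolding W_bar[OF x] by (simp add: W_def power2_eq_square)
  qed
  also have "\<dots> = Re (IC (\<lambda>x. F1 x + \<i> * F2 x))" by (intro IC_Re continuous_intros Fc)
  also have "IC (\<lambda>x. F1 x + \<i> * F2 x) = IB (\<lambda>x. n x * F x)" by (rule stokes'[OF F Fc(1,2)])
  also have "Re \<dots> = IB (\<lambda>x. Re (n x * F x))" by (intro IB_Re[symmetric] continuous_intros Fc)
  also have "\<dots> = IB (\<lambda>x. P x * tau x)"
    by (rule IB_cong) (simp add: F_def tau_def algebra_simps)
  finally show ?thesis .
qed

lemma curvature_term: "IB (\<lambda>x. K x * tau x) = IB (\<lambda>x. q x * w x)"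
proof -
  define f1 where "f1 x = - q x * Im (n x) * w x + K x * wx x" for x
  define f2 where "f2 x = q x * Re (n x) * w x + K x * wy x" for x
  have f: "has_partials (\<lambda>x. K x * w x) (f1 x) (f2 x) x" if "x \<in> L" for x
    unfolding f1_def f2_def using that L_sub by (intro has_partials_mult K1' w1) auto
  have "IB (\<lambda>x. - Im (n x) * f1 x + Re (n x) * f2 x) = 0"
    unfolding IB_def using tangential_parts[OF eps(1,2) f] unfolding f1_def f2_def
    by (simp add: continuous_intros)
  also have "IB (\<lambda>x. - Im (n x) * f1 x + Re (n x) * f2 x) = IB (\<lambda>x. q x * w x - K x * tau x)"
  proof (rule IB_cong)
    fix x assume x: "x \<in> L"
    have "- Im (n x) * f1 x + Re (n x) * f2 x = q x * w x * ((Re (n x))\<^sup>2 + (Im (n x))\<^sup>2) - K x * tau x"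
      by (simp add: f1_def f2_def tau_def W_def algebra_simps power2_eq_square)
    then show "- Im (n x) * f1 x + Re (n x) * f2 x = q x * w x - K x * tau x" using n_sq(1)[OF x] by simp
  qed
  also have "\<dots> = IB (\<lambda>x. q x * w x) - IB (\<lambda>x. K x * tau x)" by (intro IB_diff continuous_intros)
  finally show ?thesis by simp
qed

text \<open>The imaginary part of the product of \<open>H\<close> and n W consists of the wanted
  term and one with the factor \<open>Im (H x)\<close>, which is small. On the support of b the
  field \<open>fM\<close> equals n^2, so the product is n times a field defined on the whole
  domain.\<close>

lemma H_term: "2 * IB (\<lambda>x. Re (H x) * tau x) = 2 * Im (IB (\<lambda>x. n x * (G x * W x * fM x))) - 2 * IB (\<lambda>x. Im (H x) * Re (n x * W x))"
proof -
  have "Im (IB (\<lambda>x. n x * (G x * W x * fM x))) = IB (\<lambda>x. Im (n x * (G x * W x * fM x)))"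
    by (intro IB_Im[symmetric] continuous_intros L_sub continuous_on_subset[OF fields_cont'(1) L_sub])
  also have "\<dots> = IB (\<lambda>x. Re (H x) * tau x + Im (H x) * Re (n x * W x))"
  proof (rule IB_cong)
    fix x assume x: "x \<in> L" "d x < 2 * \<epsilon>"
    have "n x * (G x * W x * fM x) = H x * (n x * W x)" by (simp add: H_def near(1)[OF x])
    then show "Im (n x * (G x * W x * fM x)) = Re (H x) * tau x + Im (H x) * Re (n x * W x)"
      by (simp only: times_complex.simps tau_def)
  qed
  also have "\<dots> = IB (\<lambda>x. Re (H x) * tau x) + IB (\<lambda>x. Im (H x) * Re (n x * W x))"
    by (intro IB_add continuous_intros L_sub)
  finally show ?thesis by simp
qed

text \<open>Apply \<open>stokes\<close> to \<open>G W M\<close>; since \<open>W\<close> is holomorphic, only \<open>G\<close> and \<open>M\<close> are differentiated.\<close>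

lemma GWM_term: "IB (\<lambda>x. n x * (G x * W x * fM x)) =
   IC (\<lambda>x. - (\<i> / 2) * ((W x)\<^sup>2 * fM x) + G x * W x * (fM1 x + \<i> * fM2 x))"
proof -
  define F1 where "F1 x = (G1 x * W x + G x * W1 x) * fM x + G x * W x * fM1 x" for x
  define F2 where "F2 x = (G2 x * W x + G x * W2 x) * fM x + G x * W x * fM2 x" for x
  have F: "has_partials (\<lambda>x. G x * W x * fM x) (F1 x) (F2 x) x" if "x \<in> \<Omega>" for x
    unfolding F1_def F2_def by (intro has_partials_mult GW_partials fM_partials that)
  have Fc: "continuous_on \<Omega> F1" "continuous_on \<Omega> F2"
    unfolding F1_def[abs_def] F2_def[abs_def] by (intro continuous_intros subset_refl)+
  have "IB (\<lambda>x. n x * (G x * W x * fM x)) = IC (\<lambda>x. F1 x + \<i> * F2 x)" by (rule stokes'[OF F Fc, symmetric])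
  also have "\<dots> = IC (\<lambda>x. - (\<i> / 2) * ((W x)\<^sup>2 * fM x) + G x * W x * (fM1 x + \<i> * fM2 x))"
  proof (rule IC_cong)
    fix x assume x: "x \<in> \<Omega>"
    have "F1 x + \<i> * F2 x = (G1 x + \<i> * G2 x) * W x * fM x + G x * (W1 x + \<i> * W2 x) * fM x + G x * W x * (fM1 x + \<i> * fM2 x)"
      by (simp add: F1_def F2_def algebra_simps)
    then show "F1 x + \<i> * F2 x = - (\<i> / 2) * ((W x)\<^sup>2 * fM x) + G x * W x * (fM1 x + \<i> * fM2 x)"
      unfolding G_bar[OF x] W_bar[OF x] by (simp add: power2_eq_square)
  qed
  finally show ?thesis .
qed

text \<open>The derivative falls only on \<open>fR\<close>, because W^2 is holomorphic. As
  \<open>fR\<close> is of size \<epsilon> on the support of b, the right side can be added to any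
  identity at the price of an error that vanishes with \<epsilon>.\<close>

lemma WWR_term: "IB (\<lambda>x. n x * ((W x)\<^sup>2 * fR x)) = IC (\<lambda>x. (W x)\<^sup>2 * (fR1 x + \<i> * fR2 x))"
proof -
  define F1 where "F1 x = (W1 x * W x + W x * W1 x) * fR x + (W x * W x) * fR1 x" for x
  define F2 where "F2 x = (W2 x * W x + W x * W2 x) * fR x + (W x * W x) * fR2 x" for x
  have F: "has_partials (\<lambda>x. (W x)\<^sup>2 * fR x) (F1 x) (F2 x) x" if "x \<in> \<Omega>" for x
    unfolding F1_def F2_def power2_eq_square by (intro has_partials_mult GW_partials fR_partials that)
  have Fc: "continuous_on \<Omega> F1" "continuous_on \<Omega> F2"
    unfolding F1_def[abs_def] F2_def[abs_def] by (intro continuous_intros subset_refl)+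
  have "IB (\<lambda>x. n x * ((W x)\<^sup>2 * fR x)) = IC (\<lambda>x. F1 x + \<i> * F2 x)" by (rule stokes'[OF F Fc, symmetric])
  also have "\<dots> = IC (\<lambda>x. (W x)\<^sup>2 * (fR1 x + \<i> * fR2 x))"
  proof (rule IC_cong)
    fix x assume x: "x \<in> \<Omega>"
    have "F1 x + \<i> * F2 x = 2 * W x * (W1 x + \<i> * W2 x) * fR x + (W x)\<^sup>2 * (fR1 x + \<i> * fR2 x)"
      by (simp add: F1_def F2_def algebra_simps power2_eq_square)
    then show "F1 x + \<i> * F2 x = (W x)\<^sup>2 * (fR1 x + \<i> * fR2 x)"
      unfolding W_bar[OF x] by simp
  qed
  finally show ?thesis .
qed

lemma fields_cont_L [continuous_intros]: "continuous_on L fM" "continuous_on L fR" "continuous_on L fV"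
  by (rule continuous_on_subset[OF _ L_sub], rule fields_cont')+

text \<open>The term \<open>Re (W^2 * fM)\<close> could cost all of D. After the correction by
  \<open>fR\<close> it costs 1/2 of D, and the Young inequality for G W costs another 1/4, so that
  1/4 of D remains on the left.\<close>

lemma D_estimate:
  assumes \<beta>: "0 < \<beta>" and Q: "IB (\<lambda>x. (q x)\<^sup>2) \<le> Q"
  shows "D / 4 \<le> \<beta> * r * Q + IB (\<lambda>x. (w x)\<^sup>2) / (4 * \<beta> * r) + 4 * Z\<^sup>2 / r\<^sup>2 * IC (\<lambda>x. (e x)\<^sup>2 + (s x)\<^sup>2)
     + (6 * \<eta> * S + 8 * \<epsilon> * S\<^sup>2) * mass"
proof -
  have S: "0 \<le> S" using S_nonneg ne by blast
  have cn: "cmod (n x) = 1" and xO: "x \<in> \<Omega>" if "x \<in> L" for x using n_norm that by (auto simp: L_def)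
  have tb: "cmod (n x * W x) \<le> 2 * S" if "x \<in> L" for x
    using norm_bounds(4)[OF xO[OF that]] cn[OF that] by (simp add: norm_mult)
  have "D = IB (\<lambda>x. (K x * tau x + (P x - K x - 2 * Re (H x)) * tau x) + 2 * (Re (H x) * tau x))"
    unfolding D_boundary by (rule IB_cong) (simp add: algebra_simps)
  also have "\<dots> = IB (\<lambda>x. K x * tau x) + IB (\<lambda>x. (P x - K x - 2 * Re (H x)) * tau x) + 2 * IB (\<lambda>x. Re (H x) * tau x)"
    by (subst IB_add IB_add, (intro continuous_intros)+)+ (simp add: IB_cmult)
  finally have 1: "D = IB (\<lambda>x. q x * w x) + IB (\<lambda>x. (P x - K x - 2 * Re (H x)) * tau x)
      + 2 * Im (IB (\<lambda>x. n x * (G x * W x * fM x))) - 2 * IB (\<lambda>x. Im (H x) * Re (n x * W x))"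
    unfolding curvature_term H_term by simp
  have "2 * Im (IB (\<lambda>x. n x * (G x * W x * fM x))) =
      2 * IC (\<lambda>x. Im (- (\<i> / 2) * ((W x)\<^sup>2 * fM x) + G x * W x * (fM1 x + \<i> * fM2 x)))"
    unfolding GWM_term by (subst IC_Im) (intro continuous_intros subset_refl refl)+
  also have "\<dots> = IC (\<lambda>x. 2 * Im (- (\<i> / 2) * ((W x)\<^sup>2 * fM x) + G x * W x * (fM1 x + \<i> * fM2 x)))"
    by (rule IC_cmult[symmetric])
  \<comment> \<open>Twice the imaginary part of -(\<i>/2) W^2 M is -Re (W^2 M). The derivative of
    \<open>fR\<close> is added and subtracted here: alone it turns into a small boundary term,
    together with \<open>fM\<close> it is bounded by 1/2.\<close>
  also have "\<dots> = IC (\<lambda>x. Re ((W x)\<^sup>2 * (fR1 x + \<i> * fR2 x)) +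
       (2 * Im (G x * W x * (fM1 x + \<i> * fM2 x)) - Re ((W x)\<^sup>2 * (fR1 x + \<i> * fR2 x + fM x))))"
    by (rule IC_cong) (simp add: field_simps)
  also have "\<dots> = IC (\<lambda>x. Re ((W x)\<^sup>2 * (fR1 x + \<i> * fR2 x))) +
       IC (\<lambda>x. 2 * Im (G x * W x * (fM1 x + \<i> * fM2 x)) - Re ((W x)\<^sup>2 * (fR1 x + \<i> * fR2 x + fM x)))"
    by (intro IC_add continuous_intros subset_refl)
  also have "IC (\<lambda>x. Re ((W x)\<^sup>2 * (fR1 x + \<i> * fR2 x))) = Re (IB (\<lambda>x. n x * ((W x)\<^sup>2 * fR x)))"
    unfolding WWR_term by (intro IC_Re continuous_intros subset_refl)
  also have "\<dots> = IB (\<lambda>x. Re (n x * ((W x)\<^sup>2 * fR x)))"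
    by (intro IB_Re[symmetric] continuous_intros L_sub)
  also have "\<dots> \<le> (8 * \<epsilon> * S\<^sup>2) * mass"
  proof (rule IB_bound)
    fix x assume x: "x \<in> L" "d x < 2 * \<epsilon>"
    have "Re (n x * ((W x)\<^sup>2 * fR x)) \<le> cmod (n x * ((W x)\<^sup>2 * fR x))" by (rule complex_Re_le_cmod)
    also have "\<dots> = (cmod (W x))\<^sup>2 * cmod (fR x)" using cn[OF x(1)] by (simp add: norm_mult norm_power)
    also have "\<dots> \<le> (2 * S)\<^sup>2 * (2 * \<epsilon>)"
      using fR_norm[OF xO[OF x(1)]] x(2) by (intro mult_mono power_mono norm_bounds xO x) auto
    finally show "Re (n x * ((W x)\<^sup>2 * fR x)) \<le> 8 * \<epsilon> * S\<^sup>2" by (simp add: power2_eq_square algebra_simps)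
  qed (intro continuous_intros L_sub)
  also have "IC (\<lambda>x. 2 * Im (G x * W x * (fM1 x + \<i> * fM2 x)) - Re ((W x)\<^sup>2 * (fR1 x + \<i> * fR2 x + fM x)))
    \<le> IC (\<lambda>x. 3 / 4 * ((wx x)\<^sup>2 + (wy x)\<^sup>2) + 4 * Z\<^sup>2 / r\<^sup>2 * ((e x)\<^sup>2 + (s x)\<^sup>2))"
  proof (rule IC_mono)
    fix x assume x: "x \<in> \<Omega>"
    have a: "Im (G x * W x * (fM1 x + \<i> * fM2 x)) \<le> cmod (G x) * cmod (W x) * (Z / r)"
    proof -
      have "Im (G x * W x * (fM1 x + \<i> * fM2 x)) \<le> cmod (G x * W x * (fM1 x + \<i> * fM2 x))"
        using abs_Im_le_cmod abs_ge_self order_trans by blast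
      also have "\<dots> = cmod (G x) * cmod (W x) * cmod (fM1 x + \<i> * fM2 x)" by (simp only: norm_mult)
      also have "\<dots> \<le> cmod (G x) * cmod (W x) * (Z / r)"
        unfolding Z_def by (intro mult_left_mono fM_bar x) simp
      finally show ?thesis .
    qed
    have b: "- Re ((W x)\<^sup>2 * (fR1 x + \<i> * fR2 x + fM x)) \<le> (cmod (W x))\<^sup>2 * (1 / 2)"
    proof -
      have "- Re ((W x)\<^sup>2 * (fR1 x + \<i> * fR2 x + fM x)) \<le> cmod ((W x)\<^sup>2 * (fR1 x + \<i> * fR2 x + fM x))"
        using abs_Re_le_cmod abs_ge_minus_self order_trans by blast
      also have "\<dots> = (cmod (W x))\<^sup>2 * cmod (fR1 x + \<i> * fR2 x + fM x)" by (simp only: norm_mult norm_power)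
      also have "\<dots> \<le> (cmod (W x))\<^sup>2 * (1 / 2)" by (intro mult_left_mono fR_bar x) simp
      finally show ?thesis .
    qed
    \<comment> \<open>The weight 1/4 is chosen to stay below the half of |W|^2 that is still
      free.\<close>
    have y: "2 * (cmod (G x) * cmod (W x) * (Z / r)) \<le> 1 / 4 * (cmod (W x))\<^sup>2 + 4 * Z\<^sup>2 / r\<^sup>2 * (cmod (G x))\<^sup>2"
      using zero_le_power2[of "1 / 2 * cmod (W x) - 2 * (Z / r) * cmod (G x)"]
      by (simp add: power2_diff power_mult_distrib power_divide algebra_simps)
    show "2 * Im (G x * W x * (fM1 x + \<i> * fM2 x)) - Re ((W x)\<^sup>2 * (fR1 x + \<i> * fR2 x + fM x))
      \<le> 3 / 4 * ((wx x)\<^sup>2 + (wy x)\<^sup>2) + 4 * Z\<^sup>2 / r\<^sup>2 * ((e x)\<^sup>2 + (s x)\<^sup>2)"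
      using a b y unfolding norms[symmetric] by linarith
  qed (intro continuous_intros subset_refl)+
  also have "\<dots> = 3 / 4 * D + 4 * Z\<^sup>2 / r\<^sup>2 * IC (\<lambda>x. (e x)\<^sup>2 + (s x)\<^sup>2)"
    unfolding D_def by (subst IC_add) (intro continuous_intros | simp only: IC_cmult)+
  finally have 2: "2 * Im (IB (\<lambda>x. n x * (G x * W x * fM x)))
     \<le> (8 * \<epsilon> * S\<^sup>2) * mass + (3 / 4 * D + 4 * Z\<^sup>2 / r\<^sup>2 * IC (\<lambda>x. (e x)\<^sup>2 + (s x)\<^sup>2))" by simp
  have 3: "IB (\<lambda>x. (P x - K x - 2 * Re (H x)) * tau x) \<le> (\<eta> * (2 * S)) * mass"
  proof (rule IB_bound)
    fix x assume x: "x \<in> L" "\<epsilon> < d x" "d x < 2 * \<epsilon>"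
    have "\<bar>tau x\<bar> \<le> 2 * S" using tb[OF x(1)] abs_Im_le_cmod[of "n x * W x"] unfolding tau_def by linarith
    then have "\<bar>(P x - K x - 2 * Re (H x)) * tau x\<bar> \<le> \<eta> * (2 * S)"
      unfolding abs_mult using bc[OF x] \<eta> by (intro mult_mono) auto
    then show "(P x - K x - 2 * Re (H x)) * tau x \<le> \<eta> * (2 * S)" by linarith
  qed (intro continuous_intros)
  have 4: "- 2 * IB (\<lambda>x. Im (H x) * Re (n x * W x)) \<le> (2 * (\<eta> * (2 * S))) * mass"
    unfolding IB_cmult[symmetric]
  proof (rule IB_bound)
    fix x assume x: "x \<in> L" "\<epsilon> < d x" "d x < 2 * \<epsilon>"
    have "\<bar>Re (n x * W x)\<bar> \<le> 2 * S" using tb[OF x(1)] abs_Re_le_cmod[of "n x * W x"] by linarith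
    then have "\<bar>Im (H x) * Re (n x * W x)\<bar> \<le> \<eta> * (2 * S)"
      unfolding abs_mult using bc[OF x] \<eta> by (intro mult_mono) auto
    then show "- 2 * (Im (H x) * Re (n x * W x)) \<le> 2 * (\<eta> * (2 * S))" by linarith
  qed (intro continuous_intros L_sub)
  \<comment> \<open>Young's inequality with the weight \<beta> r. The free parameter \<beta> is what
    later normalises the coefficient of the curvature term.\<close>
  have "IB (\<lambda>x. q x * w x) \<le> IB (\<lambda>x. \<beta> * r * (q x)\<^sup>2 + 1 / (4 * \<beta> * r) * (w x)\<^sup>2)"
  proof (rule IB_mono)
    fix x
    have "0 \<le> (2 * \<beta> * r * q x - w x)\<^sup>2 / (4 * \<beta> * r)" using \<beta> r by simp
    also have "\<dots> = \<beta> * r * (q x)\<^sup>2 + 1 / (4 * \<beta> * r) * (w x)\<^sup>2 - q x * w x"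
      using \<beta> r by (simp add: power2_diff field_simps) (simp add: power2_eq_square)
    finally show "q x * w x \<le> \<beta> * r * (q x)\<^sup>2 + 1 / (4 * \<beta> * r) * (w x)\<^sup>2" by simp
  qed (intro continuous_intros)+
  also have "\<dots> = \<beta> * r * IB (\<lambda>x. (q x)\<^sup>2) + 1 / (4 * \<beta> * r) * IB (\<lambda>x. (w x)\<^sup>2)"
    by (subst IB_add) (intro continuous_intros | simp only: IB_cmult)+
  also have "\<dots> \<le> \<beta> * r * Q + 1 / (4 * \<beta> * r) * IB (\<lambda>x. (w x)\<^sup>2)"
    using Q \<beta> r by simp
  finally have 5: "IB (\<lambda>x. q x * w x) \<le> \<beta> * r * Q + IB (\<lambda>x. (w x)\<^sup>2) / (4 * \<beta> * r)" by simp
  have "(6 * \<eta> * S + 8 * \<epsilon> * S\<^sup>2) * mass = (\<eta> * (2 * S)) * mass + (2 * (\<eta> * (2 * S))) * mass + (8 * \<epsilon> * S\<^sup>2) * mass"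
    by (simp add: algebra_simps)
  then show ?thesis using 1 2 3 4 5 by linarith
qed

text \<open>The integrand is a null Lagrangian. Its boundary term is \<open>k |G|\<^sup>2\<close> up to a multiple of \<open>Im (G n\<^sup>2)\<close>, which
  is small.\<close>

lemma J_term: "- 2 * IC (\<lambda>x. ex x * sy x - ey x * sx x) \<le> (2 / r) * IB (\<lambda>x. (e x)\<^sup>2 + (s x)\<^sup>2) + 2 * \<eta> * (4 * S + 4 * S / r) * mass"
proof -
  \<comment> \<open>The real part of \<open>n * F\<close> is half of e \<partial>_\<tau> s - s
    \<partial>_\<tau> e; on applying the operator to F, the second derivatives enter the real part
    with opposite signs and cancel.\<close>
  define F where "F x = (\<i> / 2) * (of_real (e x) * (of_real (sx x) - \<i> * of_real (sy x)) - of_real (s x) * (of_real (ex x) - \<i> * of_real (ey x)))" for x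
  define F1 where "F1 x = (\<i> / 2) * ((of_real (ex x) * (of_real (sx x) - \<i> * of_real (sy x)) + of_real (e x) * (of_real (sxx x) - \<i> * of_real (sxy x)))
     - (of_real (sx x) * (of_real (ex x) - \<i> * of_real (ey x)) + of_real (s x) * (of_real (exx x) - \<i> * of_real (exy x))))" for x
  define F2 where "F2 x = (\<i> / 2) * ((of_real (ey x) * (of_real (sx x) - \<i> * of_real (sy x)) + of_real (e x) * (of_real (sxy x) - \<i> * of_real (syy x)))
     - (of_real (sy x) * (of_real (ex x) - \<i> * of_real (ey x)) + of_real (s x) * (of_real (exy x) - \<i> * of_real (eyy x))))" for x
  have F: "has_partials F (F1 x) (F2 x) x" if "x \<in> \<Omega>" for x
    unfolding F_def[abs_def] F1_def F2_def
    by (intro has_partials_bounded_linear[OF bounded_linear_mult_right] has_partials_mult has_partials_diff has_partials_of_real e1 e2 s1 s2 that)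
  have Fc: "continuous_on \<Omega> F1" "continuous_on \<Omega> F2" "continuous_on L F"
    unfolding F1_def[abs_def] F2_def[abs_def] F_def[abs_def] by (intro continuous_intros)+
  have "IC (\<lambda>x. ex x * sy x - ey x * sx x) = IC (\<lambda>x. Re (F1 x + \<i> * F2 x))"
    by (rule IC_cong) (simp add: F1_def F2_def algebra_simps)
  also have "\<dots> = Re (IC (\<lambda>x. F1 x + \<i> * F2 x))" by (intro IC_Re continuous_intros Fc)
  also have "IC (\<lambda>x. F1 x + \<i> * F2 x) = IB (\<lambda>x. n x * F x)" by (rule stokes'[OF F Fc(1,2)])
  also have "Re \<dots> = IB (\<lambda>x. Re (n x * F x))" by (intro IB_Re[symmetric] continuous_intros Fc)
  \<comment> \<open>Half the tangential derivative of Re H * Im H is split off. It integrates to 0,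
    and what is left of Im (cnj H * HT) carries the small factor Im H, so no bound on
    \<open>Im (HT x)\<close> is required.\<close>
  also have "\<dots> = IB (\<lambda>x. (k x * ((e x)\<^sup>2 + (s x)\<^sup>2) - Im (H x) * - Re (HT x)) - 1 / 2 * (Re (H x) * Im (HT x) + Im (H x) * Re (HT x)))"
  proof (rule IB_cong)
    fix x assume x: "x \<in> L"
    have "Re (n x * F x) = 1 / 2 * (e x * (- Im (n x) * sx x + Re (n x) * sy x) - s x * (- Im (n x) * ex x + Re (n x) * ey x))"
      by (simp add: F_def algebra_simps)
    also have "\<dots> = k x * ((e x)\<^sup>2 + (s x)\<^sup>2) - 1 / 2 * Im (cnj (H x) * HT x)"
      unfolding H_pointwise[OF x] by (simp add: algebra_simps)
    finally show "Re (n x * F x) = (k x * ((e x)\<^sup>2 + (s x)\<^sup>2) - Im (H x) * - Re (HT x)) - 1 / 2 * (Re (H x) * Im (HT x) + Im (H x) * Re (HT x))"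
      by (simp add: algebra_simps)
  qed
  also have "\<dots> = IB (\<lambda>x. k x * ((e x)\<^sup>2 + (s x)\<^sup>2) - Im (H x) * - Re (HT x)) - 1 / 2 * IB (\<lambda>x. Re (H x) * Im (HT x) + Im (H x) * Re (HT x))"
    unfolding HT_def by (subst IB_diff) (intro continuous_intros | simp only: IB_cmult)+
  also have "IB (\<lambda>x. Re (H x) * Im (HT x) + Im (H x) * Re (HT x)) = 0"
  proof -
    define f1 where "f1 x = Re (H1 x) * Im (H x) + Re (H x) * Im (H1 x)" for x
    define f2 where "f2 x = Re (H2 x) * Im (H x) + Re (H x) * Im (H2 x)" for x
    have f: "has_partials (\<lambda>x. Re (H x) * Im (H x)) (f1 x) (f2 x) x" if "x \<in> L" for x
      unfolding f1_def f2_def using that by (intro has_partials_mult has_partials_Re has_partials_Im H_partials)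
    have "IB (\<lambda>x. - Im (n x) * f1 x + Re (n x) * f2 x) = 0"
      unfolding IB_def using tangential_parts[OF eps(1,2) f] unfolding f1_def f2_def
      by (simp add: continuous_intros)
    moreover have "(\<lambda>x. - Im (n x) * f1 x + Re (n x) * f2 x) = (\<lambda>x. Re (H x) * Im (HT x) + Im (H x) * Re (HT x))"
      by (simp add: f1_def f2_def HT_def algebra_simps)
    ultimately show ?thesis by simp
  qed
  finally have "- 2 * IC (\<lambda>x. ex x * sy x - ey x * sx x) = - 2 * IB (\<lambda>x. k x * ((e x)\<^sup>2 + (s x)\<^sup>2) - Im (H x) * - Re (HT x))" by simp
  also have "\<dots> = IB (\<lambda>x. - 2 * (k x * ((e x)\<^sup>2 + (s x)\<^sup>2) - Im (H x) * - Re (HT x)))" by (rule IB_cmult[symmetric])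
  also have "\<dots> \<le> IB (\<lambda>x. (2 / r) * ((e x)\<^sup>2 + (s x)\<^sup>2) + (2 * \<eta> * (4 * S + 4 * S / r)) * 1)"
  proof (rule IB_mono)
    fix x assume x: "x \<in> L" "\<epsilon> < d x" "d x < 2 * \<epsilon>"
    have "\<bar>Re (HT x)\<bar> \<le> 4 * S + 4 * S / r" using HT_bound[OF x(1)] abs_Re_le_cmod[of "HT x"] by linarith
    then have "\<bar>Im (H x) * Re (HT x)\<bar> \<le> \<eta> * (4 * S + 4 * S / r)"
      unfolding abs_mult using bc[OF x] \<eta> by (intro mult_mono) auto
    moreover have "\<bar>k x * ((e x)\<^sup>2 + (s x)\<^sup>2)\<bar> \<le> 1 / r * ((e x)\<^sup>2 + (s x)\<^sup>2)"
      unfolding abs_mult using k_bound[of x] x(1) mult_right_mono[of "\<bar>k x\<bar>" "1 / r" "(e x)\<^sup>2 + (s x)\<^sup>2"] by (auto simp: L_def)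
    moreover have "- 2 * (k x * ((e x)\<^sup>2 + (s x)\<^sup>2) - Im (H x) * - Re (HT x)) \<le> 2 * \<bar>k x * ((e x)\<^sup>2 + (s x)\<^sup>2)\<bar> + 2 * \<bar>Im (H x) * Re (HT x)\<bar>"
    proof -
      have "- 2 * (X + Y) \<le> 2 * \<bar>X\<bar> + 2 * \<bar>Y\<bar>" for X Y :: real by (simp add: abs_if)
      from this[of "k x * ((e x)\<^sup>2 + (s x)\<^sup>2)" "Im (H x) * Re (HT x)"] show ?thesis by (simp only: mult_minus_right diff_minus_eq_add)
    qed
    moreover have "2 * (1 / r * ((e x)\<^sup>2 + (s x)\<^sup>2)) = (2 / r) * ((e x)\<^sup>2 + (s x)\<^sup>2)" by simp
    ultimately show "- 2 * (k x * ((e x)\<^sup>2 + (s x)\<^sup>2) - Im (H x) * - Re (HT x))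
       \<le> (2 / r) * ((e x)\<^sup>2 + (s x)\<^sup>2) + (2 * \<eta> * (4 * S + 4 * S / r)) * 1"
      by linarith
  qed (unfold HT_def, (intro continuous_intros)+)
  also have "\<dots> = (2 / r) * IB (\<lambda>x. (e x)\<^sup>2 + (s x)\<^sup>2) + 2 * \<eta> * (4 * S + 4 * S / r) * mass"
  proof -
    have "IB (\<lambda>x. (2 / r) * ((e x)\<^sup>2 + (s x)\<^sup>2) + (2 * \<eta> * (4 * S + 4 * S / r)) * 1)
      = IB (\<lambda>x. (2 / r) * ((e x)\<^sup>2 + (s x)\<^sup>2)) + IB (\<lambda>x. (2 * \<eta> * (4 * S + 4 * S / r)) * 1)"
      by (intro IB_add continuous_intros)
    then show ?thesis unfolding mass_def by (simp only: IB_cmult)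
  qed
  finally show ?thesis .
qed

text \<open>A closed system of three inequalities for D, the strain part \<open>HE\<close> and the
  boundary integral B: D is bounded by B/r, \<open>HE\<close> by D/4 and B/r, and B/r by a small
  multiple of \<open>HE + D\<close>. The number c collects the coefficients of B/r in the first
  two.\<close>

lemma eps_estimate:
  assumes \<beta>: "0 < \<beta>" and Q: "IB (\<lambda>x. (q x)\<^sup>2) \<le> Q" and c: "c = 1 / \<beta> + 4"
  shows "IC (\<lambda>x. 2 * ((ex x)\<^sup>2 + (ey x)\<^sup>2 + (sx x)\<^sup>2 + (sy x)\<^sup>2) + 1 / 2 * ((wx x)\<^sup>2 + (wy x)\<^sup>2))
    \<le> 8 * \<beta> * r * Q + (2 * c * (4 * c + Z) + 32 * Z\<^sup>2) / r\<^sup>2 * IC (\<lambda>x. (e x)\<^sup>2 + (s x)\<^sup>2 + (w x)\<^sup>2)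
     + (8 * (6 * \<eta> * S + 8 * \<epsilon> * S\<^sup>2) + 8 * \<eta> * (4 * S + 4 * S / r)) * mass"
proof -
  define HE where "HE = IC (\<lambda>x. (ex x)\<^sup>2 + (ey x)\<^sup>2 + ((sx x)\<^sup>2 + (sy x)\<^sup>2))"
  define A where "A = IC (\<lambda>x. (e x)\<^sup>2 + (s x)\<^sup>2 + (w x)\<^sup>2)"
  define B where "B = IB (\<lambda>x. (e x)\<^sup>2 + (s x)\<^sup>2 + (w x)\<^sup>2)"
  define err1 where "err1 = (6 * \<eta> * S + 8 * \<epsilon> * S\<^sup>2) * mass"
  define err2 where "err2 = 2 * \<eta> * (4 * S + 4 * S / r) * mass"
  have cpos: "c > 0" using \<beta> c by (simp add: add_pos_pos)
  \<comment> \<open>With this choice c * \<delta> = 1/4, small enough for the trace terms to be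
    absorbed on the left.\<close>
  define \<delta> where "\<delta> = 1 / (4 * c)"
  have \<delta>: "\<delta> > 0" using cpos by (simp add: \<delta>_def)
  have hess: "IC (\<lambda>x. 2 * ((ex x)\<^sup>2 + (ey x)\<^sup>2 + (sx x)\<^sup>2 + (sy x)\<^sup>2) + 1 / 2 * ((wx x)\<^sup>2 + (wy x)\<^sup>2)) = 2 * HE + 1 / 2 * D"
    unfolding HE_def D_def by (subst IC_add) (intro continuous_intros | simp only: IC_cmult add.assoc)+
  \<comment> \<open>By the Stokes system, |(\<partial>_x + \<i> \<partial>_y) G|^2 = |W|^2 / 4. It
    differs from the full squared gradient of G only by twice the null Lagrangian.\<close>
  have HE: "HE = D / 4 - 2 * IC (\<lambda>x. ex x * sy x - ey x * sx x)"
  proof -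
    have "HE = IC (\<lambda>x. 1 / 4 * ((wx x)\<^sup>2 + (wy x)\<^sup>2) - 2 * (ex x * sy x - ey x * sx x))"
      unfolding HE_def
    proof (rule IC_cong)
      fix x assume x: "x \<in> \<Omega>"
      have wxy: "wy x = - 2 * (ex x + sy x)" "wx x = 2 * (sx x - ey x)" using stokes_eq[OF x] by auto
      have "(wx x)\<^sup>2 + (wy x)\<^sup>2 = 4 * (sx x - ey x)\<^sup>2 + 4 * (ex x + sy x)\<^sup>2"
        unfolding wxy by (simp only: power_mult_distrib) simp
      then show "(ex x)\<^sup>2 + (ey x)\<^sup>2 + ((sx x)\<^sup>2 + (sy x)\<^sup>2) = 1 / 4 * ((wx x)\<^sup>2 + (wy x)\<^sup>2) - 2 * (ex x * sy x - ey x * sx x)"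
        by (simp add: power2_eq_square algebra_simps)
    qed
    also have "\<dots> = 1 / 4 * D - 2 * IC (\<lambda>x. ex x * sy x - ey x * sx x)"
      unfolding D_def by (subst IC_diff) (intro continuous_intros | simp only: IC_cmult)+
    finally show ?thesis by simp
  qed
  have A_es: "IC (\<lambda>x. (e x)\<^sup>2 + (s x)\<^sup>2) \<le> A" unfolding A_def by (rule IC_mono) (intro continuous_intros | simp)+
  have B_es: "IB (\<lambda>x. (e x)\<^sup>2 + (s x)\<^sup>2) \<le> B" unfolding B_def by (rule IB_mono) (intro continuous_intros | simp)+
  have B_w: "IB (\<lambda>x. (w x)\<^sup>2) \<le> B" unfolding B_def by (rule IB_mono) (intro continuous_intros | simp)+
  have nn: "0 \<le> IC f" if "continuous_on \<Omega> f" "\<And>x. 0 \<le> f x" for f :: "real^2 \<Rightarrow> real"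
    using IC_mono[of "\<lambda>x. 0" f] that by (simp add: IC_def)
  have HE0: "0 \<le> HE" and D0: "0 \<le> D" unfolding HE_def D_def
    by (rule nn; (intro continuous_intros)?; simp)+
  have BB: "B \<le> \<delta> * r * (HE + D) + (1 / \<delta> + Z) / r * A"
  proof -
    have "B = IB (\<lambda>x. (e x)\<^sup>2) + IB (\<lambda>x. (s x)\<^sup>2) + IB (\<lambda>x. (w x)\<^sup>2)"
      unfolding B_def by (subst IB_add IB_add, (intro continuous_intros)+)+ simp
    also have "\<dots> \<le> IC (\<lambda>x. \<delta> * r * ((ex x)\<^sup>2 + (ey x)\<^sup>2) + ((1 / \<delta> + Z) / r) * (e x)\<^sup>2)
      + IC (\<lambda>x. \<delta> * r * ((sx x)\<^sup>2 + (sy x)\<^sup>2) + ((1 / \<delta> + Z) / r) * (s x)\<^sup>2)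
      + IC (\<lambda>x. \<delta> * r * ((wx x)\<^sup>2 + (wy x)\<^sup>2) + ((1 / \<delta> + Z) / r) * (w x)\<^sup>2)"
      by (intro add_mono trace_bound[OF e1 first_cont(1,2) \<delta>] trace_bound[OF s1 first_cont(3,4) \<delta>] trace_bound[OF w1 first_cont(5,6) \<delta>])
    also have "\<dots> = IC (\<lambda>x. (\<delta> * r * ((ex x)\<^sup>2 + (ey x)\<^sup>2) + ((1 / \<delta> + Z) / r) * (e x)\<^sup>2)
      + (\<delta> * r * ((sx x)\<^sup>2 + (sy x)\<^sup>2) + ((1 / \<delta> + Z) / r) * (s x)\<^sup>2)
      + (\<delta> * r * ((wx x)\<^sup>2 + (wy x)\<^sup>2) + ((1 / \<delta> + Z) / r) * (w x)\<^sup>2))"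
      by (subst IC_add, (intro continuous_intros)+)+ simp
    also have "\<dots> = IC (\<lambda>x. \<delta> * r * (((ex x)\<^sup>2 + (ey x)\<^sup>2 + ((sx x)\<^sup>2 + (sy x)\<^sup>2)) + ((wx x)\<^sup>2 + (wy x)\<^sup>2))
       + ((1 / \<delta> + Z) / r) * ((e x)\<^sup>2 + (s x)\<^sup>2 + (w x)\<^sup>2))"
      by (rule IC_cong) (simp only: distrib_left add_ac)
    also have "\<dots> = \<delta> * r * (HE + D) + (1 / \<delta> + Z) / r * A"
      unfolding HE_def D_def A_def
      by (subst IC_add[symmetric], (intro continuous_intros)+, simp only: IC_cmult[symmetric],
          rule IC_add, (intro continuous_intros)+)
    finally show ?thesis .
  qed
  have D1: "D \<le> 4 * \<beta> * r * Q + (1 / \<beta>) * (B / r) + 16 * Z\<^sup>2 / r\<^sup>2 * A + 4 * err1"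
  proof -
    have "IB (\<lambda>x. (w x)\<^sup>2) / (4 * \<beta> * r) \<le> B / (4 * \<beta> * r)" using B_w \<beta> r by (simp add: divide_right_mono)
    moreover have "4 * Z\<^sup>2 / r\<^sup>2 * IC (\<lambda>x. (e x)\<^sup>2 + (s x)\<^sup>2) \<le> 4 * Z\<^sup>2 / r\<^sup>2 * A" using A_es by (intro mult_left_mono) auto
    ultimately have "D / 4 \<le> \<beta> * r * Q + B / (4 * \<beta> * r) + 4 * Z\<^sup>2 / r\<^sup>2 * A + err1"
      using D_estimate[OF \<beta> Q] unfolding err1_def by linarith
    moreover have "B / (4 * \<beta> * r) = (1 / \<beta>) * (B / r) / 4" by simp
    ultimately show ?thesis by (simp add: algebra_simps)
  qed
  have "(2 / r) * IB (\<lambda>x. (e x)\<^sup>2 + (s x)\<^sup>2) \<le> 2 * (B / r)" using B_es r by (simp add: divide_right_mono)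
  then have H1: "HE \<le> D / 4 + 2 * (B / r) + err2" using HE J_term unfolding err2_def by linarith
  have "B / r \<le> (\<delta> * r * (HE + D) + (1 / \<delta> + Z) / r * A) / r" using BB r by (simp add: divide_right_mono)
  also have "\<dots> = \<delta> * (HE + D) + (1 / \<delta> + Z) * (A / r\<^sup>2)" using r by (simp add: field_simps power2_eq_square)
  finally have "c * (B / r) \<le> c * (\<delta> * (HE + D) + (1 / \<delta> + Z) * (A / r\<^sup>2))" using cpos by (intro mult_left_mono) auto
  also have "\<dots> = (c * \<delta>) * (HE + D) + c * (1 / \<delta> + Z) * (A / r\<^sup>2)" by (simp add: algebra_simps)
  also have "\<dots> = (HE + D) / 4 + c * (4 * c + Z) * (A / r\<^sup>2)" using cpos by (simp add: \<delta>_def)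
  finally have B1: "c * (B / r) \<le> (HE + D) / 4 + c * (4 * c + Z) * (A / r\<^sup>2)" .
  have cB: "c * (B / r) = (1 / \<beta>) * (B / r) + 4 * (B / r)" by (simp add: c algebra_simps)
  have "16 * Z\<^sup>2 / r\<^sup>2 * A = 16 * (Z\<^sup>2 * (A / r\<^sup>2))" by simp
  then have "2 * HE + 1 / 2 * D \<le> 8 * (\<beta> * r * Q) + 2 * (c * (4 * c + Z) * (A / r\<^sup>2)) + 32 * (Z\<^sup>2 * (A / r\<^sup>2)) + 8 * err1 + 4 * err2"
  proof -
    \<comment> \<open>The combination is twice the first, four times the second and twice the third
      inequality; the surplus of h is dropped because h is nonnegative.\<close>
    have "2 * h + 1 / 2 * D \<le> 8 * X + 2 * V + 32 * Y + 8 * e1 + 4 * e2"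
      if "D \<le> 4 * X + b1 + 16 * Y + 4 * e1" "h \<le> D / 4 + 2 * b + e2" "b1 + 4 * b \<le> (h + D) / 4 + V" "0 \<le> h" "0 \<le> D"
      for h D X V Y e1 e2 b b1 :: real using that unfolding add_divide_distrib by linarith
    from this[OF _ H1 _ HE0 D0, of "\<beta> * r * Q" "1 / \<beta> * (B / r)" "Z\<^sup>2 * (A / r\<^sup>2)" err1 "c * (4 * c + Z) * (A / r\<^sup>2)"]
    show ?thesis using D1 B1 cB by (simp add: mult.assoc)
  qed
  also have "\<dots> = 8 * \<beta> * r * Q + (2 * c * (4 * c + Z) + 32 * Z\<^sup>2) / r\<^sup>2 * A + (8 * (6 * \<eta> * S + 8 * \<epsilon> * S\<^sup>2) + 8 * \<eta> * (4 * S + 4 * S / r)) * mass"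
    by (simp add: err1_def err2_def algebra_simps add_divide_distrib)
  finally show ?thesis unfolding hess A_def .
qed

end

section \<open>Passage to the limit in the layer width and the boundary error\<close>

context stokes_layer begin

text \<open>The surface condition holds up to \<eta> in some layer whose width depends on \<eta>. So
  \<epsilon> tends to 0 first, with \<eta> fixed, and \<eta> afterwards. Every error is multiplied
  by \<open>m0\<close>, which depends on neither.\<close>

lemma main_estimate:
  assumes \<beta>: "0 < \<beta>" and c: "c = 1 / \<beta> + 4" and Z: "Z = exp 8 + 2"
    and bc: "\<And>\<eta>. 0 < \<eta> \<Longrightarrow> \<exists>\<delta>>0. \<forall>x\<in>L. d x < \<delta> \<longrightarrow> \<bar>P x - K x - 2 * Re (H x)\<bar> \<le> \<eta> \<and> \<bar>Im (H x)\<bar> \<le> \<eta>"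
    and Q: "\<exists>\<delta>>0. \<forall>\<epsilon>. 0 < \<epsilon> \<longrightarrow> \<epsilon> < \<delta> \<longrightarrow> (LINT x|lborel. b \<epsilon> x * (q x)\<^sup>2) \<le> Q"
    and ne: "\<Omega> \<noteq> {}"
    and w_bound: "bounded (w ` \<Omega>)"
  shows "(LINT x:\<Omega>|lborel. 2 * ((ex x)\<^sup>2 + (ey x)\<^sup>2 + (sx x)\<^sup>2 + (sy x)\<^sup>2) + 1 / 2 * ((wx x)\<^sup>2 + (wy x)\<^sup>2))
    \<le> 8 * \<beta> * r * Q + (2 * c * (4 * c + Z) + 32 * Z\<^sup>2) / r\<^sup>2 * (LINT x:\<Omega>|lborel. (e x)\<^sup>2 + (s x)\<^sup>2 + (w x)\<^sup>2)"
proof -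
  define f where "f x = 2 * ((ex x)\<^sup>2 + (ey x)\<^sup>2 + (sx x)\<^sup>2 + (sy x)\<^sup>2) + 1 / 2 * ((wx x)\<^sup>2 + (wy x)\<^sup>2)" for x
  define g where "g x = (e x)\<^sup>2 + (s x)\<^sup>2 + (w x)\<^sup>2" for x
  have S0: "0 \<le> S" by (rule S_nonneg[OF ne])
  have fc: "continuous_on \<Omega> f" "continuous_on \<Omega> g" unfolding f_def[abs_def] g_def[abs_def] by (intro continuous_intros)+
  have em: "emeasure lborel \<Omega> < \<infinity>" using bounded_\<Omega> by (rule emeasure_bounded_finite)
  have mO: "\<Omega> \<in> sets lborel" using open_\<Omega> by simp
  have si: "integrable lborel (\<lambda>x. indicator \<Omega> x *\<^sub>R h x)" if h: "continuous_on \<Omega> h" "\<And>x. x \<in> \<Omega> \<Longrightarrow> \<bar>h x\<bar> \<le> N" for h :: "real^2 \<Rightarrow> real" and N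
  proof (rule Bochner_Integration.integrable_bound[where f="\<lambda>x. indicator \<Omega> x * N"])
    show "integrable lborel (\<lambda>x. indicator \<Omega> x * N)" using em mO by (auto intro!: integrable_mult_left integrable_real_indicator)
    show "(\<lambda>x. indicator \<Omega> x *\<^sub>R h x) \<in> borel_measurable lborel"
      using borel_measurable_continuous_on_indicator[OF _ h(1)] open_\<Omega> by simp
  qed (use h(2) in \<open>fastforce simp: indicator_def intro!: AE_I2\<close>)
  have fb: "\<bar>f x\<bar> \<le> 9 * S\<^sup>2" if x: "x \<in> \<Omega>" for x
  proof -
    have "a\<^sup>2 \<le> S\<^sup>2" if "\<bar>a\<bar> \<le> S" for a using that S0 by (metis abs_ge_zero power2_abs power_mono)
    then have "(ex x)\<^sup>2 \<le> S\<^sup>2" "(ey x)\<^sup>2 \<le> S\<^sup>2" "(sx x)\<^sup>2 \<le> S\<^sup>2" "(sy x)\<^sup>2 \<le> S\<^sup>2" "(wx x)\<^sup>2 \<le> S\<^sup>2" "(wy x)\<^sup>2 \<le> S\<^sup>2"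
      using bounds[OF x] by blast+
    moreover have "2 * (a1 + a2 + a3 + a4) + 1 / 2 * (a5 + a6) \<le> 9 * t"
      if "a1 \<le> t" "a2 \<le> t" "a3 \<le> t" "a4 \<le> t" "a5 \<le> t" "a6 \<le> t" for a1 a2 a3 a4 a5 a6 t :: real
      using that by (simp add: distrib_left)
    ultimately have "f x \<le> 9 * S\<^sup>2" unfolding f_def by blast
    moreover have "0 \<le> f x" by (simp add: f_def)
    ultimately show ?thesis by simp
  qed
  obtain N where N: "\<And>x. x \<in> \<Omega> \<Longrightarrow> \<bar>w x\<bar> \<le> N" using w_bound unfolding bounded_iff by auto
  have gb: "\<bar>g x\<bar> \<le> 2 * S\<^sup>2 + N\<^sup>2" if x: "x \<in> \<Omega>" for x
  proof -
    have "(e x)\<^sup>2 \<le> S\<^sup>2" "(s x)\<^sup>2 \<le> S\<^sup>2" using bounds[OF x] S0 by (auto simp: abs_le_square_iff[symmetric])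
    moreover have "(w x)\<^sup>2 \<le> N\<^sup>2" using N[OF x] abs_ge_zero[of "w x"] by (simp add: abs_le_square_iff[symmetric])
    moreover have "0 \<le> g x" by (simp add: g_def)
    ultimately show ?thesis unfolding g_def by simp
  qed
  note fi = si[OF fc(1) fb] and gi = si[OF fc(2) gb]
  define I where "I = (LINT x|lborel. indicator \<Omega> x *\<^sub>R f x)"
  define A where "A = (LINT x|lborel. indicator \<Omega> x *\<^sub>R g x)"
  define C where "C = (2 * c * (4 * c + Z) + 32 * Z\<^sup>2) / r\<^sup>2"
  have C0: "0 \<le> C" using \<beta> c Z r by (auto simp: C_def intro!: divide_nonneg_nonneg add_nonneg_nonneg mult_nonneg_nonneg)
  define m0 where "m0 = Z / r * measure lborel \<Omega>"
  have m0: "0 \<le> m0" using Z r by (simp add: m0_def add_nonneg_nonneg)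
  define E where "E \<eta> \<epsilon> = (8 * (6 * \<eta> * S + 8 * \<epsilon> * S\<^sup>2) + 8 * \<eta> * (4 * S + 4 * S / r)) * m0" for \<eta> \<epsilon>
  have key: "\<exists>\<delta>>0. \<forall>\<epsilon>. 0 < \<epsilon> \<longrightarrow> \<epsilon> < \<delta> \<longrightarrow> (LINT x|lborel. cut \<epsilon> x *\<^sub>R f x) \<le> 8 * \<beta> * r * Q + C * A + E \<eta> \<epsilon>" if \<eta>: "0 < \<eta>" for \<eta>
  proof -
    obtain \<delta>1 where d1: "\<delta>1 > 0" "\<And>x. x \<in> L \<Longrightarrow> d x < \<delta>1 \<Longrightarrow> \<bar>P x - K x - 2 * Re (H x)\<bar> \<le> \<eta> \<and> \<bar>Im (H x)\<bar> \<le> \<eta>"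
      using bc[OF \<eta>] by blast
    obtain \<delta>2 where d2: "\<delta>2 > 0" "\<And>\<epsilon>. 0 < \<epsilon> \<Longrightarrow> \<epsilon> < \<delta>2 \<Longrightarrow> (LINT x|lborel. b \<epsilon> x * (q x)\<^sup>2) \<le> Q" using Q by blast
    \<comment> \<open>These bounds secure, in turn, the surface condition for d < 2 \<epsilon>, the
      bound Q, the inclusion of the averaging layer in \<open>L\<close>, and the plateau of the
      logarithmic cutoff.\<close>
    define \<delta> where "\<delta> = min (\<delta>1 / 2) (min \<delta>2 (min (r / 2) (r / (8 * exp 8))))"
    show ?thesis
    proof (intro exI[of _ \<delta>] conjI allI impI)
      show "0 < \<delta>" using d1 d2 r by (simp add: \<delta>_def)
      fix \<epsilon> :: real assume e: "0 < \<epsilon>" "\<epsilon> < \<delta>"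
      interpret se: stokes_layer_eps \<Omega> r d n k e s w P K q ex ey sx sy wx wy exx exy eyy sxx sxy syy wxx wxy wyy S \<epsilon> \<eta>
        by unfold_locales (use e d1(2) ne \<eta> in \<open>auto simp: \<delta>_def field_simps\<close>)
      have ZZ: "se.Z = Z" using Z by (simp add: se.Z_def)
      have mb: "se.mass \<le> m0" using se.mass_bound by (simp add: m0_def ZZ)
      have "se.IB (\<lambda>x. (q x)\<^sup>2) \<le> Q" unfolding se.IB_def using d2(2)[of \<epsilon>] e by (simp add: \<delta>_def)
      from se.eps_estimate[OF \<beta> this c]
      have "(LINT x|lborel. cut \<epsilon> x *\<^sub>R f x) \<le> 8 * \<beta> * r * Q + C * (LINT x|lborel. cut \<epsilon> x *\<^sub>R g x)
         + (8 * (6 * \<eta> * S + 8 * \<epsilon> * S\<^sup>2) + 8 * \<eta> * (4 * S + 4 * S / r)) * se.mass"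
        unfolding se.IC_def f_def g_def C_def ZZ .
      also have "(8 * (6 * \<eta> * S + 8 * \<epsilon> * S\<^sup>2) + 8 * \<eta> * (4 * S + 4 * S / r)) * se.mass \<le> E \<eta> \<epsilon>"
        unfolding E_def using mb S0 \<eta> e r by (intro mult_left_mono) auto
      also have "C * (LINT x|lborel. cut \<epsilon> x *\<^sub>R g x) \<le> C * A"
        unfolding A_def
      proof (intro mult_left_mono integral_mono integrable_cut fc gi C0)
        show "cut \<epsilon> x *\<^sub>R g x \<le> indicator \<Omega> x *\<^sub>R g x" for x
        proof (cases "x \<in> \<Omega>")
          case True then show ?thesis using cut_bounds[of \<epsilon> x] by (simp add: mult_left_le_one_le g_def)
        next
          case False then show ?thesis using d_pos[of x] d_nonneg[of x] cut_zero[OF e(1), of x] e by simp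
        qed
      qed (use e in auto)
      finally show "(LINT x|lborel. cut \<epsilon> x *\<^sub>R f x) \<le> 8 * \<beta> * r * Q + C * A + E \<eta> \<epsilon>" by simp
    qed
  qed
  define h where "h i = inverse (real (Suc i))" for i
  have h: "0 < h i" for i by (simp add: h_def)
  have h0: "h \<longlonglongrightarrow> 0" using LIMSEQ_inverse_real_of_nat by (simp add: h_def[abs_def])
  have lim: "(\<lambda>i. LINT x|lborel. cut (h i) x *\<^sub>R f x) \<longlonglongrightarrow> I"
    unfolding I_def
  proof (rule integral_dominated_convergence[where w="\<lambda>x. indicator \<Omega> x *\<^sub>R f x"])
    show "(\<lambda>x. indicator \<Omega> x *\<^sub>R f x) \<in> borel_measurable lborel" using fi by (rule borel_measurable_integrable)
    show "(\<lambda>x. cut (h i) x *\<^sub>R f x) \<in> borel_measurable lborel" for i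
      using integrable_cut[OF fc(1) h] by (rule borel_measurable_integrable)
    show "AE x in lborel. norm (cut (h i) x *\<^sub>R f x) \<le> indicator \<Omega> x *\<^sub>R f x" for i
    proof (rule AE_I2)
      fix x show "norm (cut (h i) x *\<^sub>R f x) \<le> indicator \<Omega> x *\<^sub>R f x"
      proof (cases "x \<in> \<Omega>")
        case True
        have "0 \<le> f x" by (simp add: f_def)
        then show ?thesis using cut_bounds[of "h i" x] True by (simp add: mult_left_le_one_le)
      next
        case False then show ?thesis using d_pos[of x] d_nonneg[of x] cut_zero[OF h, of x i] less_imp_le[OF h[of i]] by simp
      qed
    qed
    show "AE x in lborel. (\<lambda>i. cut (h i) x *\<^sub>R f x) \<longlonglongrightarrow> indicator \<Omega> x *\<^sub>R f x"
    proof (rule AE_I2)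
      fix x show "(\<lambda>i. cut (h i) x *\<^sub>R f x) \<longlonglongrightarrow> indicator \<Omega> x *\<^sub>R f x"
      proof (cases "x \<in> \<Omega>")
        case True
        then have "0 < d x / 2" using d_pos by simp
        then have "\<forall>\<^sub>F i in sequentially. h i < d x / 2" using order_tendstoD(2)[OF h0] by blast
        then have "\<forall>\<^sub>F i in sequentially. cut (h i) x *\<^sub>R f x = indicator \<Omega> x *\<^sub>R f x"
          by eventually_elim (use True cut_one[OF h] in auto)
        then show ?thesis by (rule tendsto_eventually)
      next
        case False then show ?thesis using d_pos[of x] d_nonneg[of x] cut_zero[OF h, of x] less_imp_le[OF h] by simp
      qed
    qed
  qed (use fi in auto)
  have "I \<le> 8 * \<beta> * r * Q + C * A + (8 * (6 * \<eta> * S) + 8 * \<eta> * (4 * S + 4 * S / r)) * m0" if \<eta>: "0 < \<eta>" for \<eta>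
  proof -
    obtain \<delta> where \<delta>: "\<delta> > 0" "\<And>\<epsilon>. 0 < \<epsilon> \<Longrightarrow> \<epsilon> < \<delta> \<Longrightarrow> (LINT x|lborel. cut \<epsilon> x *\<^sub>R f x) \<le> 8 * \<beta> * r * Q + C * A + E \<eta> \<epsilon>"
      using key[OF \<eta>] by blast
    have "(\<lambda>i. 8 * \<beta> * r * Q + C * A + E \<eta> (h i)) \<longlonglongrightarrow> 8 * \<beta> * r * Q + C * A + (8 * (6 * \<eta> * S + 8 * 0 * S\<^sup>2) + 8 * \<eta> * (4 * S + 4 * S / r)) * m0"
      unfolding E_def by (intro tendsto_intros h0)
    moreover have "\<forall>\<^sub>F i in sequentially. (LINT x|lborel. cut (h i) x *\<^sub>R f x) \<le> 8 * \<beta> * r * Q + C * A + E \<eta> (h i)"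
      using order_tendstoD(2)[OF h0 \<delta>(1)] by eventually_elim (use \<delta>(2) h in auto)
    ultimately have "I \<le> 8 * \<beta> * r * Q + C * A + (8 * (6 * \<eta> * S + 8 * 0 * S\<^sup>2) + 8 * \<eta> * (4 * S + 4 * S / r)) * m0"
      by (intro tendsto_le[OF _ _ lim]) auto
    then show ?thesis by simp
  qed note * = this
  \<comment> \<open>The second limit: \<eta> runs through the same null sequence h, and the
    remaining errors are linear in \<eta>.\<close>
  have "I \<le> 8 * \<beta> * r * Q + C * A + (8 * (6 * 0 * S) + 8 * 0 * (4 * S + 4 * S / r)) * m0"
  proof (rule tendsto_le[OF sequentially_bot _ tendsto_const])
    show "(\<lambda>i. 8 * \<beta> * r * Q + C * A + (8 * (6 * h i * S) + 8 * h i * (4 * S + 4 * S / r)) * m0) \<longlonglongrightarrow>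
       8 * \<beta> * r * Q + C * A + (8 * (6 * 0 * S) + 8 * 0 * (4 * S + 4 * S / r)) * m0"
      by (intro tendsto_intros h0)
  qed (use * h in auto)
  then show ?thesis unfolding I_def A_def C_def f_def g_def set_lebesgue_integral_def by simp
qed

end

section \<open>Charts and curvature\<close>

declare transpose_matrix_vector [simp del]

lemma rotation_matrix_2:
  fixes Q :: "real^2^2"
  assumes "rotation_matrix Q"
  shows "Q$2$2 = Q$1$1" "Q$2$1 = - Q$1$2" "(Q$1$1)\<^sup>2 + (Q$1$2)\<^sup>2 = 1"
proof -
  have o: "transpose Q ** Q = mat 1" and d: "det Q = 1"
    using assms by (auto simp: rotation_matrix_def orthogonal_matrix)
  have "(transpose Q ** Q)$1$1 = 1" "(transpose Q ** Q)$2$2 = 1"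
    unfolding o by (simp_all add: mat_def)
  then have 1: "(Q$1$1)\<^sup>2 + (Q$2$1)\<^sup>2 = 1" "(Q$1$2)\<^sup>2 + (Q$2$2)\<^sup>2 = 1"
    by (simp_all add: matrix_matrix_mult_def transpose_def sum_2 power2_eq_square)
  have 2: "Q$1$1 * Q$2$2 - Q$1$2 * Q$2$1 = 1" using d by (simp add: det_2)
  \<comment> \<open>Expanded, the left side is the sum of the squares of all entries minus twice the
    determinant, that is 2 - 2.\<close>
  have "(Q$1$1 - Q$2$2)\<^sup>2 + (Q$1$2 + Q$2$1)\<^sup>2 = 0"
    using 1 2 by (simp add: power2_eq_square algebra_simps)
  then have "Q$1$1 - Q$2$2 = 0" "Q$1$2 + Q$2$1 = 0" by (simp_all add: sum_power2_eq_zero_iff)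
  then show "Q$2$2 = Q$1$1" "Q$2$1 = - Q$1$2" by simp_all
  then show "(Q$1$1)\<^sup>2 + (Q$1$2)\<^sup>2 = 1" using 1 by simp
qed

lemma matvec_2: "(Q *v x)$1 = Q$1$1 * x$1 + Q$1$2 * x$2" "(Q *v x)$2 = Q$2$1 * x$1 + Q$2$2 * x$2"
  "(transpose Q *v x)$1 = Q$1$1 * x$1 + Q$2$1 * x$2" "(transpose Q *v x)$2 = Q$1$2 * x$1 + Q$2$2 * x$2"
  for Q :: "real^2^2"
  by (simp_all add: matrix_vector_mult_def transpose_def sum_2)

lemma vec2_eq: "x = y \<longleftrightarrow> x$1 = y$1 \<and> x$2 = y$2" for x y :: "'a^2"
  by (simp add: vec_eq_iff forall_2)

lemma inner_2: "x \<bullet> y = x$1 * y$1 + x$2 * y$2" for x y :: "real^2"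
  by (simp add: inner_vec_def sum_2)

lemma rotation_inverse:
  fixes Q :: "real^2^2" assumes "rotation_matrix Q"
  shows "transpose Q *v (Q *v x) = x" "Q *v (transpose Q *v x) = x"
  using assms by (simp_all add: rotation_matrix_def orthogonal_matrix_def matrix_vector_mul_assoc)

lemma iter_deriv_snoc: "iter_deriv (bs @ [c]) f = iter_deriv bs (dir_deriv c f)"
  by (simp add: iter_deriv_def)

lemma Ck_on_mono: "Ck_on k S f \<Longrightarrow> l \<le> k \<Longrightarrow> Ck_on l S f"
  unfolding Ck_on_def by (meson le_trans less_le_trans)

lemma dir_deriv_real: "dir_deriv 1 f = (deriv f :: real \<Rightarrow> real)" if "\<And>x. f differentiable (at x)"
proof
  fix x
  have "(f has_real_derivative deriv f x) (at x)" using that real_differentiable_def DERIV_imp_deriv by metis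
  then have "frechet_derivative f (at x) = (*) (deriv f x)"
    unfolding has_field_derivative_def by (rule frechet_derivative_at[symmetric])
  then show "dir_deriv 1 f x = deriv f x" by (simp add: dir_deriv_def)
qed

lemma Ck_on_0_real: "Ck_on 0 UNIV f \<Longrightarrow> continuous_on UNIV (f :: real \<Rightarrow> real)"
  unfolding Ck_on_def by (auto simp: iter_deriv_def dest!: spec[of _ "[]"])

lemma Ck_on_Suc_real:
  fixes f :: "real \<Rightarrow> real"
  assumes "Ck_on (Suc k) UNIV f"
  shows "(f has_real_derivative deriv f x) (at x)" "Ck_on k UNIV (deriv f)"
proof -
  have d: "f differentiable (at x)" for x
    using assms unfolding Ck_on_def by (auto simp: iter_deriv_def dest!: spec[of _ "[]"])
  then show "(f has_real_derivative deriv f x) (at x)" using real_differentiable_def DERIV_imp_deriv by metis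
  show "Ck_on k UNIV (deriv f)"
    unfolding Ck_on_def
  proof (intro conjI allI impI open_UNIV)
    fix bs :: "real list" assume bs: "set bs \<subseteq> Basis"
    have eq: "iter_deriv bs (deriv f) = iter_deriv (bs @ [1]) f"
      by (simp add: iter_deriv_snoc dir_deriv_real[OF d])
    have s: "set (bs @ [1]) \<subseteq> Basis" using bs by simp
    { assume "length bs < k" then show "\<forall>x\<in>UNIV. iter_deriv bs (deriv f) differentiable (at x)"
        unfolding eq using assms s unfolding Ck_on_def by (metis Suc_less_eq length_append_singleton) }
    { assume "length bs \<le> k" then show "continuous_on UNIV (iter_deriv bs (deriv f))"
        unfolding eq using assms s unfolding Ck_on_def by (metis Suc_le_mono length_append_singleton) }
  qed
qed

lemma Ck_on_1I:
  assumes "open U" and "\<And>x. x \<in> U \<Longrightarrow> (F has_derivative F' x) (at x)" "\<And>v. v \<in> Basis \<Longrightarrow> continuous_on U (\<lambda>x. F' x v)"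
  shows "Ck_on 1 U F"
  unfolding Ck_on_def
proof (intro conjI allI impI assms(1))
  fix bs :: "'a list" assume bs: "set bs \<subseteq> Basis"
  { assume "length bs < 1" then show "\<forall>x\<in>U. iter_deriv bs F differentiable (at x)"
      using assms(2) by (auto simp: iter_deriv_def differentiable_def) }
  { assume "length bs \<le> 1"
    then consider "bs = []" | b where "bs = [b]" by (cases bs) auto
    then show "continuous_on U (iter_deriv bs F)"
    proof cases
      case 1 then show ?thesis using assms(2)
        by (auto simp: iter_deriv_def intro!: continuous_at_imp_continuous_on has_derivative_continuous)
    next
      case 2
      have "continuous_on U (\<lambda>x. F' x b)" using assms(3) bs 2 by simp
      then show ?thesis
        by (rule continuous_on_eq) (use 2 frechet_derivative_at[OF assms(2)] in \<open>simp add: iter_deriv_def dir_deriv_def\<close>)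
    qed }
qed

lemma Ck_on_1D:
  assumes "Ck_on 1 U F" "x \<in> U" shows "(F has_derivative frechet_derivative F (at x)) (at x)"
proof -
  have "F differentiable (at x)" using assms unfolding Ck_on_def by (auto simp: iter_deriv_def dest!: spec[of _ "[]"])
  then show ?thesis by (simp add: frechet_derivative_works)
qed

section \<open>Graph charts: normal, tangential derivative and curvature\<close>

definition graph_normal :: "real^2^2 \<Rightarrow> (real \<Rightarrow> real) \<Rightarrow> real \<Rightarrow> real^2" where
  "graph_normal Q g' t = (1 / sqrt (1 + (g' t)\<^sup>2)) *\<^sub>R (transpose Q *v vector [- g' t, 1])"

definition graph_curve :: "real^2^2 \<Rightarrow> (real \<Rightarrow> real) \<Rightarrow> real \<Rightarrow> real^2" where
  "graph_curve Q g t = transpose Q *v vector [t, g t]"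

definition rot90 :: "real^2 \<Rightarrow> real^2" where "rot90 v = vector [- v$2, v$1]"

lemma rot90_simps [simp]: "rot90 v $ 1 = - v$2" "rot90 v $ 2 = v$1" by (simp_all add: rot90_def)

lemma norm_sq_2: "(norm x)\<^sup>2 = (x$1)\<^sup>2 + (x$2)\<^sup>2" for x :: "real^2"
  unfolding power2_norm_eq_inner inner_2 by (simp add: power2_eq_square)

locale chart =
  fixes \<Omega> U :: "(real^2) set" and Q g g1
  assumes Q: "rotation_matrix Q" and open_\<Omega>: "open \<Omega>" and open_U: "open U"
    and g: "\<And>t. (g has_real_derivative g1 t) (at t)" and g1_cont: "continuous_on UNIV g1"
    and sub: "\<And>y. y \<in> U \<Longrightarrow> y \<in> \<Omega> \<longleftrightarrow> (Q *v y) $ 2 < g ((Q *v y) $ 1)"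
begin

lemmas Q2 = rotation_matrix_2[OF Q]

abbreviation coord where "coord y \<equiv> (Q *v y) $ 1"
abbreviation \<gamma> where "\<gamma> \<equiv> graph_curve Q g"
abbreviation \<nu> where "\<nu> \<equiv> graph_normal Q g1"

lemma root_pos: "0 < sqrt (1 + (g1 t)\<^sup>2)" "sqrt (1 + (g1 t)\<^sup>2) \<noteq> 0"  "(sqrt (1 + (g1 t)\<^sup>2))\<^sup>2 = 1 + (g1 t)\<^sup>2"
  using add_pos_nonneg[OF zero_less_one zero_le_power2[of "g1 t"]] by auto

lemma norm_\<nu>: "norm (\<nu> t) = 1"
proof -
  define y where "y = transpose Q *v vector [- g1 t, 1]"
  have "(norm y)\<^sup>2 = ((Q$1$1)\<^sup>2 + (Q$1$2)\<^sup>2) * (1 + (g1 t)\<^sup>2)"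
    unfolding norm_sq_2 y_def matvec_2(3,4) vector_2 Q2(1,2) by (simp add: power2_eq_square algebra_simps)
  then have "sqrt ((norm y)\<^sup>2) = sqrt (1 + (g1 t)\<^sup>2)" unfolding Q2(3) by simp
  then have "norm y = sqrt (1 + (g1 t)\<^sup>2)" by simp
  then show ?thesis using root_pos(1)[of t] by (simp add: graph_normal_def y_def[symmetric])
qed

lemma graph_eq: "\<gamma> (coord y) = y" if "(Q *v y) $ 2 = g (coord y)"
proof -
  have "vector [coord y, g (coord y)] = Q *v y" using that by (simp add: vec2_eq)
  then show ?thesis by (simp add: graph_curve_def rotation_inverse[OF Q])
qed

lemma coord_\<gamma>: "coord (\<gamma> t) = t" "(Q *v \<gamma> t) $ 2 = g t"
  by (simp_all add: graph_curve_def rotation_inverse[OF Q])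

text \<open>The height over the graph is negative exactly on the side of the domain. Its derivative
  along h is a positive multiple of the normal component of h, whose sign thus decides whether short
  segments from a boundary point enter or leave the domain.\<close>

lemma height_deriv:
  "((\<lambda>t. (Q *v (x + t *\<^sub>R h)) $ 2 - g (coord (x + t *\<^sub>R h))) has_real_derivative
     sqrt (1 + (g1 (coord x))\<^sup>2) * (h \<bullet> \<nu> (coord x))) (at 0)"
proof -
  have e: "(Q *v (x + t *\<^sub>R h)) = Q *v x + t *\<^sub>R (Q *v h)" for t by (simp add: matrix_vector_right_distrib matrix_vector_mult_scaleR)
  have gd: "((\<lambda>t. g ((Q *v x) $ 1 + t * (Q *v h) $ 1)) has_real_derivative g1 ((Q *v x) $ 1) * (Q *v h) $ 1) (at 0)"
    by (rule DERIV_chain2[where g="\<lambda>t. (Q *v x) $ 1 + t * (Q *v h) $ 1"]) (use g in \<open>auto intro!: derivative_eq_intros\<close>)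
  have "((\<lambda>t. (Q *v x) $ 2 + t * (Q *v h) $ 2 - g ((Q *v x) $ 1 + t * (Q *v h) $ 1)) has_real_derivative
     (Q *v h) $ 2 - g1 ((Q *v x) $ 1) * (Q *v h) $ 1) (at 0)"
    using gd by (auto intro!: derivative_eq_intros)
  moreover have "sqrt (1 + (g1 (coord x))\<^sup>2) * (h \<bullet> \<nu> (coord x)) = (Q *v h) $ 2 - g1 ((Q *v x) $ 1) * (Q *v h) $ 1"
  proof -
    have "sqrt (1 + (g1 (coord x))\<^sup>2) * (h \<bullet> \<nu> (coord x)) = h \<bullet> (transpose Q *v vector [- g1 (coord x), 1])"
      using root_pos(2)[of "coord x"] by (simp add: graph_normal_def)
    also have "\<dots> = (Q *v h) $ 2 - g1 ((Q *v x) $ 1) * (Q *v h) $ 1"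
      unfolding inner_2 matvec_2(3,4) matvec_2(1,2)[of Q h] vector_2 by (simp add: algebra_simps)
    finally show ?thesis .
  qed
  ultimately show ?thesis by (simp add: e)
qed

lemma frontier_graph:
  assumes "x \<in> frontier \<Omega>" "x \<in> U" shows "(Q *v x) $ 2 = g (coord x)"
proof (rule ccontr)
  assume ne: "(Q *v x) $ 2 \<noteq> g (coord x)"
  have "x \<notin> \<Omega>" "x \<in> closure \<Omega>" using assms(1) open_\<Omega> by (auto simp: frontier_def interior_open)
  then have gt: "g (coord x) < (Q *v x) $ 2" using sub[OF assms(2)] ne by auto
  have gc: "continuous_on UNIV g" using g by (meson DERIV_continuous continuous_at_imp_continuous_on)
  define V where "V = U \<inter> {y. g (coord y) < (Q *v y) $ 2}"
  have "open {y. g (coord y) < (Q *v y) $ 2}"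
    by (intro open_Collect_less continuous_on_compose2[OF gc] continuous_intros) auto
  then have "open V" "x \<in> V" using open_U assms(2) gt by (auto simp: V_def)
  moreover have "V \<inter> \<Omega> = {}" using sub by (fastforce simp: V_def)
  ultimately show False using \<open>x \<in> closure \<Omega>\<close> open_Int_closure_eq_empty by blast
qed

lemma inward:
  assumes x: "x \<in> frontier \<Omega>" "x \<in> U" and h: "h \<bullet> \<nu> (coord x) < 0"
  shows "\<forall>\<^sub>F t in at_right 0. x + t *\<^sub>R h \<in> \<Omega>"
proof -
  have "sqrt (1 + (g1 (coord x))\<^sup>2) * (h \<bullet> \<nu> (coord x)) < 0" using h root_pos(1) by (simp add: mult_pos_neg)
  from has_real_derivative_neg_dec_right[OF has_field_derivative_at_within[OF height_deriv] this, of UNIV]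
  obtain \<delta> where \<delta>: "\<delta> > 0" "\<And>t. 0 < t \<Longrightarrow> t < \<delta> \<Longrightarrow> (Q *v (x + t *\<^sub>R h)) $ 2 - g (coord (x + t *\<^sub>R h)) < 0"
    using frontier_graph[OF x] by (auto simp del: matrix_vector_right_distrib)
  have "((\<lambda>t. x + t *\<^sub>R h) \<longlongrightarrow> x + 0 *\<^sub>R h) (at_right 0)" by (intro tendsto_intros)
  then have "\<forall>\<^sub>F t in at_right 0. x + t *\<^sub>R h \<in> U" using topological_tendstoD[OF _ open_U] x(2) by fastforce
  moreover have "\<forall>\<^sub>F t in at_right 0. 0 < t \<and> t < \<delta>" using \<delta>(1) eventually_at_right_less by (auto simp: eventually_at_right)
  ultimately show ?thesis by eventually_elim (use sub \<delta>(2) in fastforce)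
qed

lemma outward:
  assumes x: "x \<in> frontier \<Omega>" "x \<in> U" and h: "0 < h \<bullet> \<nu> (coord x)"
  shows "\<forall>\<^sub>F t in at_right 0. x + t *\<^sub>R h \<notin> \<Omega>"
proof -
  have "0 < sqrt (1 + (g1 (coord x))\<^sup>2) * (h \<bullet> \<nu> (coord x))" using h root_pos(1) by simp
  from has_real_derivative_pos_inc_right[OF has_field_derivative_at_within[OF height_deriv] this, of UNIV]
  obtain \<delta> where \<delta>: "\<delta> > 0" "\<And>t. 0 < t \<Longrightarrow> t < \<delta> \<Longrightarrow> 0 < (Q *v (x + t *\<^sub>R h)) $ 2 - g (coord (x + t *\<^sub>R h))"
    using frontier_graph[OF x] by (auto simp del: matrix_vector_right_distrib)
  have "((\<lambda>t. x + t *\<^sub>R h) \<longlongrightarrow> x + 0 *\<^sub>R h) (at_right 0)" by (intro tendsto_intros)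
  then have "\<forall>\<^sub>F t in at_right 0. x + t *\<^sub>R h \<in> U" using topological_tendstoD[OF _ open_U] x(2) by fastforce
  moreover have "\<forall>\<^sub>F t in at_right 0. 0 < t \<and> t < \<delta>" using \<delta>(1) eventually_at_right_less by (auto simp: eventually_at_right)
  ultimately show ?thesis by eventually_elim (use sub \<delta>(2) in fastforce)
qed

lemma \<gamma>_frontier: assumes "\<gamma> t \<in> U" shows "\<gamma> t \<in> frontier \<Omega>"
proof -
  have "\<gamma> t \<notin> \<Omega>" using sub[OF assms] by (simp add: coord_\<gamma>)
  moreover have "\<gamma> t \<in> closure \<Omega>"
  proof (rule ccontr)
    assume "\<gamma> t \<notin> closure \<Omega>"
    then have V: "open (U - closure \<Omega>)" "\<gamma> t \<in> U - closure \<Omega>" using open_U assms by auto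
    define h where "h = transpose Q *v vector [0, - 1 :: real]"
    have "((\<lambda>s. \<gamma> t + s *\<^sub>R h) \<longlongrightarrow> \<gamma> t + 0 *\<^sub>R h) (at_right 0)" by (intro tendsto_intros)
    then have "\<forall>\<^sub>F s in at_right 0. \<gamma> t + s *\<^sub>R h \<in> U - closure \<Omega>" using topological_tendstoD[OF _ V(1)] V(2) by fastforce
    then have "\<forall>\<^sub>F s in at_right 0. \<gamma> t + s *\<^sub>R h \<in> U - closure \<Omega> \<and> 0 < s"
      using eventually_at_right_less[of "0::real"] by eventually_elim simp
    from eventually_happens'[OF trivial_limit_at_right_real this]
    obtain s where s: "s > 0" "\<gamma> t + s *\<^sub>R h \<in> U - closure \<Omega>" by blast
    have "Q *v (\<gamma> t + s *\<^sub>R h) = Q *v \<gamma> t + s *\<^sub>R vector [0, - 1]"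
      by (simp add: h_def matrix_vector_right_distrib matrix_vector_mult_scaleR rotation_inverse[OF Q])
    then have "\<gamma> t + s *\<^sub>R h \<in> \<Omega>" using sub[of "\<gamma> t + s *\<^sub>R h"] s by (simp add: coord_\<gamma>)
    then show False using s(2) closure_subset by blast
  qed
  ultimately show ?thesis using open_\<Omega> by (simp add: frontier_def interior_open)
qed

lemma \<gamma>_deriv: "(\<gamma> has_vector_derivative (- sqrt (1 + (g1 t)\<^sup>2)) *\<^sub>R rot90 (\<nu> t)) (at t)"
proof -
  have *: "\<gamma> = (\<lambda>t. t *\<^sub>R (transpose Q *v axis 1 1) + g t *\<^sub>R (transpose Q *v axis 2 1))"
    by (auto simp: graph_curve_def vec2_eq matvec_2(3,4) axis_def algebra_simps)
  have "(- sqrt (1 + (g1 t)\<^sup>2)) *\<^sub>R rot90 (\<nu> t) = (transpose Q *v axis 1 1) + g1 t *\<^sub>R (transpose Q *v axis 2 1)"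
    using root_pos(2)[of t] by (simp add: graph_normal_def vec2_eq matvec_2(3,4) axis_def Q2 field_simps)
  moreover have "((\<lambda>t. t *\<^sub>R (transpose Q *v axis 1 1) + g t *\<^sub>R (transpose Q *v axis 2 1)) has_vector_derivative
     (transpose Q *v axis 1 1) + g1 t *\<^sub>R (transpose Q *v axis 2 1)) (at t)"
    using g[of t] by (auto intro!: derivative_eq_intros)
  ultimately show ?thesis unfolding * by simp
qed

lemma \<gamma>_cont: "continuous_on UNIV \<gamma>"
  using \<gamma>_deriv by (meson continuous_at_imp_continuous_on has_vector_derivative_continuous)

lemma coord_rot90: "coord (rot90 (\<nu> t)) = - 1 / sqrt (1 + (g1 t)\<^sup>2)"
proof -
  have "coord (rot90 (\<nu> t)) = - ((Q$1$1)\<^sup>2 + (Q$1$2)\<^sup>2) / sqrt (1 + (g1 t)\<^sup>2)"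
    using root_pos(2)[of t] by (simp add: matvec_2 transpose_def graph_normal_def Q2(1,2) field_simps power2_eq_square)
  then show ?thesis by (simp add: Q2)
qed

end

text \<open>If a and c differ, the test vector c - a has negative product with a and positive
  product with c. This is the uniqueness argument behind both the outer normal and the position of
  the touching balls.\<close>

lemma unit_vectors_equal:
  fixes a c :: "'a::real_inner"
  assumes "norm a = 1" "norm c = 1" "\<And>h. h \<bullet> a < 0 \<Longrightarrow> h \<bullet> c \<le> 0"
  shows "a = c"
proof (rule ccontr)
  assume ne: "a \<noteq> c"
  have sq: "a \<bullet> a = 1" "c \<bullet> c = 1" using assms by (simp_all add: dot_square_norm)
  have "0 < (a - c) \<bullet> (a - c)" using ne by simp
  also have "(a - c) \<bullet> (a - c) = 2 - 2 * (a \<bullet> c)" using sq by (simp add: inner_diff inner_commute)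
  finally have l: "a \<bullet> c < 1" by simp
  have "(c - a) \<bullet> a < 0" using l sq by (simp add: inner_diff inner_commute)
  from assms(3)[OF this] show False using l sq by (simp add: inner_diff inner_commute)
qed

lemma chart_from_subgraph:
  assumes "subgraph_chart 1 \<Omega> U Q g" "open \<Omega>"
  shows "chart \<Omega> U Q g (deriv g)"
proof -
  have C: "Ck_on (Suc 0) UNIV g" using assms by (simp add: subgraph_chart_def)
  show ?thesis
  proof
    show "(g has_real_derivative deriv g t) (at t)" for t by (rule Ck_on_Suc_real(1)[OF C])
    show "continuous_on UNIV (deriv g)" by (rule Ck_on_0_real[OF Ck_on_Suc_real(2)[OF C]])
    show "y \<in> \<Omega> \<longleftrightarrow> (Q *v y) $ 2 < g ((Q *v y) $ 1)" if "y \<in> U" for y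
      using assms(1) that unfolding subgraph_chart_def by blast
  qed (use assms in \<open>auto simp: subgraph_chart_def\<close>)
qed

text \<open>Which short segments enter the domain is a property of the set and not of the chart: a
  direction inward for one chart cannot be outward for another. Hence all charts give the same
  vector and the definite description in \<open>outer_normal\<close> is meaningful.\<close>

lemma outer_normal_chart:
  assumes c: "subgraph_chart 1 \<Omega> U Q g" and o: "open \<Omega>" and x: "x \<in> frontier \<Omega>" "x \<in> U"
  shows "outer_normal \<Omega> x = graph_normal Q (deriv g) ((Q *v x) $ 1)"
proof -
  have eq: "(1 / sqrt (1 + (deriv g ((Q *v x) $ 1))\<^sup>2)) *\<^sub>R (transpose Q *v vector [- deriv g ((Q *v x) $ 1), 1])
     = graph_normal Q (deriv g) ((Q *v x) $ 1)" for Q g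
    by (simp add: graph_normal_def)
  show ?thesis
    unfolding outer_normal_def eq
  proof (rule the_equality)
    show "\<exists>U Q' g'. x \<in> U \<and> subgraph_chart 1 \<Omega> U Q' g' \<and>
       graph_normal Q (deriv g) ((Q *v x) $ 1) = graph_normal Q' (deriv g') ((Q' *v x) $ 1)"
      using c x by blast
    fix n assume "\<exists>U Q' g'. x \<in> U \<and> subgraph_chart 1 \<Omega> U Q' g' \<and> n = graph_normal Q' (deriv g') ((Q' *v x) $ 1)"
    then obtain U' Q' g' where c': "x \<in> U'" "subgraph_chart 1 \<Omega> U' Q' g'" "n = graph_normal Q' (deriv g') ((Q' *v x) $ 1)"
      by blast
    interpret a: chart \<Omega> U Q g "deriv g" by (rule chart_from_subgraph[OF c o])
    interpret b: chart \<Omega> U' Q' g' "deriv g'" by (rule chart_from_subgraph[OF c'(2) o])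
    show "n = graph_normal Q (deriv g) ((Q *v x) $ 1)"
      unfolding c'(3)
    proof (rule unit_vectors_equal)
      fix h assume h: "h \<bullet> graph_normal Q' (deriv g') ((Q' *v x) $ 1) < 0"
      show "h \<bullet> graph_normal Q (deriv g) ((Q *v x) $ 1) \<le> 0"
      proof (rule ccontr)
        assume "\<not> ?thesis"
        then have "\<forall>\<^sub>F t in at_right 0. x + t *\<^sub>R h \<notin> \<Omega>" using a.outward[OF x] by simp
        moreover have "\<forall>\<^sub>F t in at_right 0. x + t *\<^sub>R h \<in> \<Omega>" using b.inward[OF x(1) c'(1) h] .
        ultimately have "\<forall>\<^sub>F t in at_right (0::real). False" by eventually_elim simp
        then show False by (simp add: trivial_limit_def[symmetric])
      qed
    qed (simp_all add: a.norm_\<nu> b.norm_\<nu>)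
  qed
qed

text \<open>Existence comes from extending f constantly in the vertical direction of the chart.
  Uniqueness holds because any C^1 extension, composed with the boundary curve, agrees with \<phi>
  near the point, and the velocity of the curve is a nonzero multiple of the tangent.\<close>

lemma tangential_deriv_chart:
  fixes f :: "real^2 \<Rightarrow> 'b::real_normed_vector"
  assumes c: "subgraph_chart 1 \<Omega> U Q g" and o: "open \<Omega>" and x: "x \<in> frontier \<Omega>" "x \<in> U"
    and f: "\<And>y. y \<in> frontier \<Omega> \<Longrightarrow> y \<in> U \<Longrightarrow> f y = \<phi> ((Q *v y) $ 1)"
    and \<phi>: "\<And>t. (\<phi> has_vector_derivative \<phi>' t) (at t)" "continuous_on UNIV \<phi>'"
  shows "tangential_deriv \<Omega> f x = (- 1 / sqrt (1 + (deriv g ((Q *v x) $ 1))\<^sup>2)) *\<^sub>R \<phi>' ((Q *v x) $ 1)"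
    "(- 1 / sqrt (1 + (deriv g ((Q *v x) $ 1))\<^sup>2)) = (Q *v unit_tangent \<Omega> x) $ 1"
proof -
  interpret a: chart \<Omega> U Q g "deriv g" by (rule chart_from_subgraph[OF c o])
  define t0 where "t0 = (Q *v x) $ 1"
  have ut: "unit_tangent \<Omega> x = rot90 (a.\<nu> t0)"
    by (simp add: unit_tangent_def outer_normal_chart[OF c o x] rot90_def t0_def)
  show R: "(- 1 / sqrt (1 + (deriv g ((Q *v x) $ 1))\<^sup>2)) = (Q *v unit_tangent \<Omega> x) $ 1"
    unfolding ut a.coord_rot90 t0_def ..
  define F where "F y = \<phi> ((Q *v y) $ 1)" for y
  have Fd: "(F has_derivative (\<lambda>h. ((Q *v h) $ 1) *\<^sub>R \<phi>' ((Q *v y) $ 1))) (at y)" for y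
  proof -
    have "bounded_linear (\<lambda>y. (Q *v y) $ 1)"
      by (intro bounded_linear_compose[OF bounded_linear_vec_nth] matrix_vector_mul_bounded_linear)
    then have "((\<lambda>y. (Q *v y) $ 1) has_derivative (\<lambda>h. (Q *v h) $ 1)) (at y)" by (rule bounded_linear_imp_has_derivative)
    from has_derivative_compose[OF this \<phi>(1)[unfolded has_vector_derivative_def]]
    show ?thesis by (simp add: F_def[abs_def])
  qed
  have FC: "Ck_on 1 U F"
    by (rule Ck_on_1I[OF a.open_U Fd]) (intro continuous_intros continuous_on_compose2[OF \<phi>(2)]; simp)
  show "tangential_deriv \<Omega> f x = (- 1 / sqrt (1 + (deriv g ((Q *v x) $ 1))\<^sup>2)) *\<^sub>R \<phi>' ((Q *v x) $ 1)"
    unfolding tangential_deriv_def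
  proof (rule the_equality)
    show "\<exists>U F. x \<in> U \<and> Ck_on 1 U F \<and> (\<forall>y\<in>frontier \<Omega> \<inter> U. F y = f y) \<and>
        (- 1 / sqrt (1 + (deriv g ((Q *v x) $ 1))\<^sup>2)) *\<^sub>R \<phi>' ((Q *v x) $ 1) = frechet_derivative F (at x) (unit_tangent \<Omega> x)"
      using x FC f R by (intro exI[of _ U] exI[of _ F]) (auto simp: F_def frechet_derivative_at[OF Fd, symmetric])
    fix v assume "\<exists>U F. x \<in> U \<and> Ck_on 1 U F \<and> (\<forall>y\<in>frontier \<Omega> \<inter> U. F y = f y) \<and> v = frechet_derivative F (at x) (unit_tangent \<Omega> x)"
    then obtain U' F' where F': "x \<in> U'" "Ck_on 1 U' F'" "\<And>y. y \<in> frontier \<Omega> \<Longrightarrow> y \<in> U' \<Longrightarrow> F' y = f y"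
      "v = frechet_derivative F' (at x) (unit_tangent \<Omega> x)" by auto
    have gx: "a.\<gamma> t0 = x" unfolding t0_def by (rule a.graph_eq[OF a.frontier_graph[OF x]])
    have oU': "open U'" using F'(2) by (simp add: Ck_on_def)
    have D': "(F' has_derivative frechet_derivative F' (at x)) (at (a.\<gamma> t0))" using Ck_on_1D[OF F'(2,1)] gx by simp
    have lin: "linear (frechet_derivative F' (at x))" using D' has_derivative_linear by blast
    have "((\<lambda>t. F' (a.\<gamma> t)) has_vector_derivative frechet_derivative F' (at x) ((- sqrt (1 + (deriv g t0)\<^sup>2)) *\<^sub>R rot90 (a.\<nu> t0))) (at t0)"
    proof -
      define v where "v = (- sqrt (1 + (deriv g t0)\<^sup>2)) *\<^sub>R rot90 (a.\<nu> t0)"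
      have "(a.\<gamma> has_derivative (\<lambda>s. s *\<^sub>R v)) (at t0)"
        using a.\<gamma>_deriv[of t0] by (simp only: has_vector_derivative_def v_def)
      from has_derivative_compose[OF this D'] show ?thesis
        using lin by (simp only: has_vector_derivative_def v_def[symmetric] linear_scale)
    qed
    \<comment> \<open>Near \<open>t0\<close> the curve stays in both neighbourhoods and on the
      boundary, where the extension must equal f and hence \<phi>.\<close>
    moreover have "((\<lambda>t. F' (a.\<gamma> t)) has_vector_derivative \<phi>' t0) (at t0)"
    proof (rule has_vector_derivative_transform_within_open[OF \<phi>(1)])
      show "open (a.\<gamma> -` (U \<inter> U'))" using a.\<gamma>_cont a.open_U oU' by (intro open_vimage) auto
      show "t0 \<in> a.\<gamma> -` (U \<inter> U')" using gx x F'(1) by simp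
      fix t assume "t \<in> a.\<gamma> -` (U \<inter> U')"
      then have t: "a.\<gamma> t \<in> U" "a.\<gamma> t \<in> U'" by auto
      then show "\<phi> t = F' (a.\<gamma> t)" using F'(3)[OF a.\<gamma>_frontier] f[OF a.\<gamma>_frontier] by (simp add: a.coord_\<gamma>)
    qed
    ultimately have "frechet_derivative F' (at x) ((- sqrt (1 + (deriv g t0)\<^sup>2)) *\<^sub>R rot90 (a.\<nu> t0)) = \<phi>' t0"
      by (rule vector_derivative_unique_at)
    then have "(- sqrt (1 + (deriv g t0)\<^sup>2)) *\<^sub>R v = \<phi>' t0" by (simp only: linear_scale[OF lin] ut F'(4))
    then have "(- 1 / sqrt (1 + (deriv g t0)\<^sup>2)) *\<^sub>R \<phi>' t0 = (- 1 / sqrt (1 + (deriv g t0)\<^sup>2)) *\<^sub>R (- sqrt (1 + (deriv g t0)\<^sup>2)) *\<^sub>R v" by simp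
    also have "\<dots> = v" using a.root_pos(2)[of t0] by simp
    finally have "v = (- 1 / sqrt (1 + (deriv g t0)\<^sup>2)) *\<^sub>R \<phi>' t0" ..
    then show "v = (- 1 / sqrt (1 + (deriv g ((Q *v x) $ 1))\<^sup>2)) *\<^sub>R \<phi>' ((Q *v x) $ 1)" by (simp add: t0_def)
  qed
qed

lemma rot90_cont [continuous_intros]: "continuous_on S f \<Longrightarrow> continuous_on S (\<lambda>x. rot90 (f x))"
proof -
  assume f: "continuous_on S f"
  have "rot90 v = (- v $ 2) *\<^sub>R axis 1 1 + (v $ 1) *\<^sub>R axis 2 1" for v by (simp add: vec2_eq axis_def)
  then show ?thesis by (simp only:) (intro continuous_intros f)
qed

text \<open>With \<open>\<phi>2\<close> the classical curvature of a graph appears, with the sign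
  that is nonnegative for concave g, that is for a convex region below the graph. The minus sign in
  the tangential derivative reflects that the parameter runs against the unit tangent.\<close>

lemma chart_curvature:
  fixes g :: "real \<Rightarrow> real"
  assumes c: "subgraph_chart 3 \<Omega> U Q g" and o: "open \<Omega>"
  defines "g1 \<equiv> deriv g" and "g2 \<equiv> deriv (deriv g)" and "g3 \<equiv> deriv (deriv (deriv g))"
  defines "\<rho> \<equiv> \<lambda>t. sqrt (1 + (g1 t)\<^sup>2)"
  defines "\<phi>2 \<equiv> \<lambda>t. - g2 t / \<rho> t ^ 3"
  defines "\<phi>2' \<equiv> \<lambda>t. - g3 t / \<rho> t ^ 3 + 3 * g1 t * (g2 t)\<^sup>2 / \<rho> t ^ 5"
  shows "\<And>t. (graph_normal Q g1 has_vector_derivative (- \<rho> t * \<phi>2 t) *\<^sub>R rot90 (graph_normal Q g1 t)) (at t)"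
    "\<And>t. (\<phi>2 has_real_derivative \<phi>2' t) (at t)" "continuous_on UNIV \<phi>2" "continuous_on UNIV \<phi>2'" "continuous_on UNIV \<rho>"
    "\<And>x. x \<in> frontier \<Omega> \<Longrightarrow> x \<in> U \<Longrightarrow> curvature \<Omega> x = \<phi>2 ((Q *v x) $ 1)"
    "\<And>x. x \<in> frontier \<Omega> \<Longrightarrow> x \<in> U \<Longrightarrow> tangential_deriv \<Omega> (curvature \<Omega>) x = - \<phi>2' ((Q *v x) $ 1) / \<rho> ((Q *v x) $ 1)"
proof -
  have C3: "Ck_on (Suc 2) UNIV g" using c by (simp add: subgraph_chart_def eval_nat_numeral)
  have C1: "subgraph_chart 1 \<Omega> U Q g" using c Ck_on_mono[of 3 UNIV g 1] by (simp add: subgraph_chart_def)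
  have C2: "Ck_on (Suc 1) UNIV g1" using Ck_on_Suc_real(2)[OF C3] by (simp add: g1_def eval_nat_numeral)
  have Cg2: "Ck_on (Suc 0) UNIV g2" using Ck_on_Suc_real(2)[OF C2] by (simp add: g1_def g2_def)
  have d1: "(g1 has_real_derivative g2 t) (at t)" for t using Ck_on_Suc_real(1)[OF C2] by (simp add: g1_def g2_def)
  have d2: "(g2 has_real_derivative g3 t) (at t)" for t using Ck_on_Suc_real(1)[OF Cg2] by (simp add: g2_def g3_def)
  have c3: "continuous_on UNIV g3" using Ck_on_0_real[OF Ck_on_Suc_real(2)[OF Cg2]] by (simp add: g2_def g3_def)
  have c1: "continuous_on UNIV g1" using d1 by (meson DERIV_continuous continuous_at_imp_continuous_on)
  have c2: "continuous_on UNIV g2" using d2 by (meson DERIV_continuous continuous_at_imp_continuous_on)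
  interpret a: chart \<Omega> U Q g g1 using chart_from_subgraph[OF C1 o] by (simp add: g1_def)
  have rp: "0 < \<rho> t" "\<rho> t \<noteq> 0" "\<rho> t * \<rho> t = 1 + (g1 t)\<^sup>2" for t
    using a.root_pos[of t] by (simp_all add: \<rho>_def power2_eq_square)
  have rd: "(\<rho> has_real_derivative g1 t * g2 t / \<rho> t) (at t)" for t
  proof -
    have "((\<lambda>t. 1 + (g1 t)\<^sup>2) has_real_derivative 2 * g1 t * g2 t) (at t)"
      by (auto intro!: derivative_eq_intros d1)
    from DERIV_chain2[OF DERIV_real_sqrt this] show ?thesis
      using rp[of t] by (simp add: \<rho>_def[symmetric] \<rho>_def[abs_def, symmetric] field_simps) (simp add: \<rho>_def)
  qed
  show rc: "continuous_on UNIV \<rho>" unfolding \<rho>_def by (intro continuous_intros c1)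
  show f2c: "continuous_on UNIV \<phi>2" unfolding \<phi>2_def by (intro continuous_intros c2 rc) (simp add: rp)
  show f2c': "continuous_on UNIV \<phi>2'" unfolding \<phi>2'_def by (intro continuous_intros c1 c2 c3 rc) (simp_all add: rp)
  show f2: "(\<phi>2 has_real_derivative \<phi>2' t) (at t)" for t
  proof -
    have "((\<lambda>t. - g2 t / \<rho> t ^ 3) has_real_derivative ((- g3 t) * \<rho> t ^ 3 - (- g2 t) * (3 * \<rho> t ^ 2 * (g1 t * g2 t / \<rho> t))) / (\<rho> t ^ 3 * \<rho> t ^ 3)) (at t)"
      by (rule derivative_eq_intros d2 rd | use rp[of t] in simp)+
    also have "((- g3 t) * \<rho> t ^ 3 - (- g2 t) * (3 * \<rho> t ^ 2 * (g1 t * g2 t / \<rho> t))) / (\<rho> t ^ 3 * \<rho> t ^ 3) = \<phi>2' t"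
      using rp(2)[of t] by (simp add: \<phi>2'_def field_simps eval_nat_numeral)
    finally show ?thesis by (simp add: \<phi>2_def)
  qed
  \<comment> \<open>In a fixed frame the derivative of the normal reduces to that of two scalar
    quotients.\<close>
  have f1': "graph_normal Q g1 = (\<lambda>t. (- g1 t / \<rho> t) *\<^sub>R (transpose Q *v axis 1 1) + (1 / \<rho> t) *\<^sub>R (transpose Q *v axis 2 1))"
    by (auto simp: graph_normal_def \<rho>_def vec2_eq matvec_2(3,4) axis_def algebra_simps add_divide_distrib diff_divide_distrib)
  show f1: "(graph_normal Q g1 has_vector_derivative (- \<rho> t * \<phi>2 t) *\<^sub>R rot90 (graph_normal Q g1 t)) (at t)" for t
  proof -
    have A: "((\<lambda>t. - g1 t / \<rho> t) has_real_derivative - g2 t / \<rho> t ^ 3) (at t)"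
    proof -
      have "((\<lambda>t. - g1 t / \<rho> t) has_real_derivative ((- g2 t) * \<rho> t - (- g1 t) * (g1 t * g2 t / \<rho> t)) / (\<rho> t * \<rho> t)) (at t)"
        by (rule derivative_eq_intros d1 rd | use rp[of t] in simp)+
      also have "((- g2 t) * \<rho> t - (- g1 t) * (g1 t * g2 t / \<rho> t)) / (\<rho> t * \<rho> t) = (- g2 t) * (\<rho> t * \<rho> t - (g1 t)\<^sup>2) / \<rho> t ^ 3"
        using rp(2)[of t] by (simp add: field_simps eval_nat_numeral)
      also have "\<dots> = - g2 t / \<rho> t ^ 3" unfolding rp(3) by simp
      finally show ?thesis .
    qed
    have B: "((\<lambda>t. 1 / \<rho> t) has_real_derivative - (g1 t * g2 t) / \<rho> t ^ 3) (at t)"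
    proof -
      have "((\<lambda>t. 1 / \<rho> t) has_real_derivative (0 * \<rho> t - 1 * (g1 t * g2 t / \<rho> t)) / (\<rho> t * \<rho> t)) (at t)"
        by (rule derivative_eq_intros d1 rd | use rp[of t] in simp)+
      then show ?thesis by (simp add: eval_nat_numeral)
    qed
    have "(graph_normal Q g1 has_vector_derivative (- g2 t / \<rho> t ^ 3) *\<^sub>R (transpose Q *v axis 1 1) + (- (g1 t * g2 t) / \<rho> t ^ 3) *\<^sub>R (transpose Q *v axis 2 1)) (at t)"
      unfolding f1' using has_vector_derivative_add[OF has_vector_derivative_scaleR[OF A has_vector_derivative_const]
        has_vector_derivative_scaleR[OF B has_vector_derivative_const]] by simp
    also have "(- g2 t / \<rho> t ^ 3) *\<^sub>R (transpose Q *v axis 1 1) + (- (g1 t * g2 t) / \<rho> t ^ 3) *\<^sub>R (transpose Q *v axis 2 1)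
      = (- \<rho> t * \<phi>2 t) *\<^sub>R rot90 (graph_normal Q g1 t)"
      unfolding f1' using rp(2)[of t] by (simp add: vec2_eq matvec_2(3,4) axis_def a.Q2 \<phi>2_def field_simps)
    finally show ?thesis .
  qed
  show kap: "curvature \<Omega> x = \<phi>2 ((Q *v x) $ 1)" if x: "x \<in> frontier \<Omega>" "x \<in> U" for x
  proof -
    define t where "t = (Q *v x) $ 1"
    have cc: "continuous_on UNIV (\<lambda>t. (- \<rho> t * \<phi>2 t) *\<^sub>R rot90 (graph_normal Q g1 t))"
    proof -
      have "continuous_on UNIV (graph_normal Q g1)" using f1 by (meson continuous_at_imp_continuous_on has_vector_derivative_continuous)
      then show ?thesis by (intro continuous_intros rc f2c)
    qed
    have "tangential_deriv \<Omega> (outer_normal \<Omega>) x = (- 1 / \<rho> t) *\<^sub>R ((- \<rho> t * \<phi>2 t) *\<^sub>R rot90 (graph_normal Q g1 t))"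
      using tangential_deriv_chart(1)[OF C1 o x, of "outer_normal \<Omega>", OF _ f1 cc] outer_normal_chart[OF C1 o]
      by (simp add: t_def g1_def \<rho>_def)
    also have "\<dots> = \<phi>2 t *\<^sub>R rot90 (graph_normal Q g1 t)" using rp(2)[of t] by simp
    also have "rot90 (graph_normal Q g1 t) = unit_tangent \<Omega> x"
      by (simp add: unit_tangent_def outer_normal_chart[OF C1 o x] rot90_def t_def g1_def)
    finally have "curvature \<Omega> x = \<phi>2 t * (unit_tangent \<Omega> x \<bullet> unit_tangent \<Omega> x)"
      by (simp add: curvature_def tangential_div_def)
    moreover have "unit_tangent \<Omega> x \<bullet> unit_tangent \<Omega> x = 1"
    proof -
      have "unit_tangent \<Omega> x \<bullet> unit_tangent \<Omega> x = (norm (graph_normal Q g1 t))\<^sup>2"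
        unfolding inner_2 norm_sq_2 by (simp add: unit_tangent_def outer_normal_chart[OF C1 o x] t_def g1_def power2_eq_square)
      then show ?thesis by (simp add: a.norm_\<nu>)
    qed
    ultimately show ?thesis by (simp add: t_def)
  qed
  show "tangential_deriv \<Omega> (curvature \<Omega>) x = - \<phi>2' ((Q *v x) $ 1) / \<rho> ((Q *v x) $ 1)" if x: "x \<in> frontier \<Omega>" "x \<in> U" for x
    using tangential_deriv_chart(1)[OF C1 o x, of "curvature \<Omega>" \<phi>2 \<phi>2'] kap f2 f2c'
    by (simp add: has_real_derivative_iff_has_vector_derivative g1_def \<rho>_def)
qed

text \<open>The curve \<open>\<gamma>\<close> is a graph traversed from left to right below which the domain lies, that is, against the direction of the
  unit tangent, with speed \<open>\<rho>\<close> at \<open>y\<close>; \<open>co\<close> is its inverse.\<close>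

definition boundary_param :: "(real^2) set \<Rightarrow> real^2 \<Rightarrow> (real^2) set \<Rightarrow> (real^2 \<Rightarrow> real) \<Rightarrow> (real \<Rightarrow> real^2) \<Rightarrow>
    (real \<Rightarrow> real^2) \<Rightarrow> (real \<Rightarrow> real) \<Rightarrow> (real \<Rightarrow> real) \<Rightarrow> real \<Rightarrow> (real \<Rightarrow> real^2) \<Rightarrow> bool" where
  "boundary_param \<Omega> y U co \<gamma> \<phi>1 \<phi>2 \<phi>3 \<rho> \<gamma>' \<longleftrightarrow>
    (open U) \<and>
    (y \<in> U) \<and>
    (continuous_on UNIV co) \<and>
    (\<forall>z. z \<in> frontier \<Omega> \<longrightarrow> z \<in> U \<longrightarrow> \<gamma> (co z) = z \<and> outer_normal \<Omega> z = \<phi>1 (co z) \<and> curvature \<Omega> z = \<phi>2 (co z)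
      \<and> tangential_deriv \<Omega> (curvature \<Omega>) z = \<phi>3 (co z)) \<and>
    (continuous_on UNIV \<phi>2) \<and>
    (continuous_on UNIV \<phi>3) \<and>
    (0 < \<rho>) \<and>
    ((\<gamma> has_vector_derivative (- \<rho>) *\<^sub>R unit_tangent \<Omega> y) (at (co y))) \<and>
    ((\<phi>1 has_vector_derivative (- \<rho> * curvature \<Omega> y) *\<^sub>R unit_tangent \<Omega> y) (at (co y))) \<and>
    ((\<phi>2 has_real_derivative (- \<rho> * tangential_deriv \<Omega> (curvature \<Omega>) y)) (at (co y))) \<and>
    (\<forall>\<^sub>F t in at (co y). \<gamma> t \<in> frontier \<Omega> \<and> \<gamma> t \<in> U \<and> co (\<gamma> t) = t) \<and>
    (\<forall>t. (\<gamma> has_vector_derivative \<gamma>' t) (at t)) \<and>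
    (continuous_on UNIV \<gamma>') \<and>
    (norm (outer_normal \<Omega> y) = 1) \<and>
    (\<forall>h. h \<bullet> outer_normal \<Omega> y < 0 \<longrightarrow> (\<forall>\<^sub>F t in at_right 0. y + t *\<^sub>R h \<in> \<Omega>))"

lemma boundary_parametrization:
  assumes reg: "regular_domain 3 \<Omega>" and y: "y \<in> frontier \<Omega>"
  obtains U co \<gamma> \<phi>1 \<phi>2 \<phi>3 \<rho> \<gamma>' where "boundary_param \<Omega> y U co \<gamma> \<phi>1 \<phi>2 \<phi>3 \<rho> \<gamma>'"
proof -
  have o: "open \<Omega>" using reg by (simp add: regular_domain_def planar_domain_def)
  obtain U Q g where U: "y \<in> U" "subgraph_chart 3 \<Omega> U Q g" using reg y unfolding regular_domain_def by blast
  have C1: "subgraph_chart 1 \<Omega> U Q g" using U(2) Ck_on_mono[of 3 UNIV g 1] by (simp add: subgraph_chart_def)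
  interpret a: chart \<Omega> U Q g "deriv g" by (rule chart_from_subgraph[OF C1 o])
  note cc = chart_curvature[OF U(2) o]
  define \<rho> where "\<rho> t = sqrt (1 + (deriv g t)\<^sup>2)" for t
  define \<phi>2 where "\<phi>2 t = - deriv (deriv g) t / \<rho> t ^ 3" for t
  define \<phi>2' where "\<phi>2' t = - deriv (deriv (deriv g)) t / \<rho> t ^ 3 + 3 * deriv g t * (deriv (deriv g) t)\<^sup>2 / \<rho> t ^ 5" for t
  define \<gamma>' where "\<gamma>' t = (- sqrt (1 + (deriv g t)\<^sup>2)) *\<^sub>R rot90 (a.\<nu> t)" for t
  define t0 where "t0 = (Q *v y) $ 1"
  have rp: "0 < \<rho> t" for t using a.root_pos(1)[of t] by (simp add: \<rho>_def)
  have rnz: "\<rho> t \<noteq> 0" for t using rp[of t] by simp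
  have gy: "a.\<gamma> t0 = y" unfolding t0_def by (rule a.graph_eq[OF a.frontier_graph[OF y U(1)]])
  have ut: "rot90 (a.\<nu> t0) = unit_tangent \<Omega> y"
    by (simp add: unit_tangent_def outer_normal_chart[OF C1 o y U(1)] rot90_def t0_def)
  have kap: "curvature \<Omega> x = \<phi>2 ((Q *v x) $ 1)" if "x \<in> frontier \<Omega>" "x \<in> U" for x
    using cc(6)[OF that] by (simp add: \<phi>2_def \<rho>_def)
  have tk: "tangential_deriv \<Omega> (curvature \<Omega>) x = - \<phi>2' ((Q *v x) $ 1) / \<rho> ((Q *v x) $ 1)" if "x \<in> frontier \<Omega>" "x \<in> U" for x
    using cc(7)[OF that] by (simp add: \<phi>2'_def \<rho>_def)
  have rc: "continuous_on UNIV \<rho>" using cc(5) by (simp add: \<rho>_def[abs_def])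
  have ncont: "continuous_on UNIV (graph_normal Q (deriv g))" using cc(1) by (meson continuous_at_imp_continuous_on has_vector_derivative_continuous)
  show ?thesis
  proof (rule that[of U "\<lambda>z. (Q *v z) $ 1" a.\<gamma> "graph_normal Q (deriv g)" \<phi>2 "\<lambda>t. - \<phi>2' t / \<rho> t" "\<rho> t0" \<gamma>'], unfold boundary_param_def, intro conjI allI impI)
    show "open U" by (rule a.open_U)
    show "y \<in> U" by fact
    show "continuous_on UNIV (\<lambda>z. (Q *v z) $ 1)" by (intro continuous_intros)
    show "continuous_on UNIV \<phi>2" using cc(3) by (simp add: \<phi>2_def[abs_def] \<rho>_def)
    have "continuous_on UNIV \<phi>2'" using cc(4) by (simp add: \<phi>2'_def[abs_def] \<rho>_def)
    then show "continuous_on UNIV (\<lambda>t. - \<phi>2' t / \<rho> t)" by (intro continuous_intros rc) (auto simp: rnz)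
    fix z assume z: "z \<in> frontier \<Omega>" "z \<in> U"
    show "a.\<gamma> ((Q *v z) $ 1) = z" by (rule a.graph_eq[OF a.frontier_graph[OF z]])
    show "outer_normal \<Omega> z = graph_normal Q (deriv g) ((Q *v z) $ 1)" by (rule outer_normal_chart[OF C1 o z])
    show "curvature \<Omega> z = \<phi>2 ((Q *v z) $ 1)" by (rule kap[OF z])
    show "tangential_deriv \<Omega> (curvature \<Omega>) z = - \<phi>2' ((Q *v z) $ 1) / \<rho> ((Q *v z) $ 1)" by (rule tk[OF z])
  next
    show "0 < \<rho> t0" by (rule rp)
    show "(a.\<gamma> has_vector_derivative - \<rho> t0 *\<^sub>R unit_tangent \<Omega> y) (at ((Q *v y) $ 1))"
      using a.\<gamma>_deriv[of t0] unfolding ut by (simp only: \<rho>_def t0_def)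
    show "(graph_normal Q (deriv g) has_vector_derivative (- \<rho> t0 * curvature \<Omega> y) *\<^sub>R unit_tangent \<Omega> y) (at ((Q *v y) $ 1))"
      using cc(1)[of t0] unfolding ut kap[OF y U(1)] by (simp only: t0_def \<rho>_def \<phi>2_def)
    show "(\<phi>2 has_real_derivative - \<rho> t0 * tangential_deriv \<Omega> (curvature \<Omega>) y) (at ((Q *v y) $ 1))"
    proof -
      have "- \<rho> t0 * tangential_deriv \<Omega> (curvature \<Omega>) y = \<phi>2' t0"
        using tk[OF y U(1)] rnz[of t0] by (simp add: t0_def[symmetric])
      then show ?thesis using cc(2)[of t0] by (simp only: t0_def[symmetric]) (simp only: \<phi>2_def[abs_def] \<phi>2'_def \<rho>_def)
    qed
    have "(a.\<gamma> \<longlongrightarrow> y) (at t0)" using a.\<gamma>_cont gy by (auto simp: continuous_on_eq_continuous_at isCont_def)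
    then have "\<forall>\<^sub>F t in at t0. a.\<gamma> t \<in> U" using topological_tendstoD a.open_U U(1) by fastforce
    then show "\<forall>\<^sub>F t in at ((Q *v y) $ 1). a.\<gamma> t \<in> frontier \<Omega> \<and> a.\<gamma> t \<in> U \<and> (Q *v a.\<gamma> t) $ 1 = t"
      unfolding t0_def by eventually_elim (use a.\<gamma>_frontier a.coord_\<gamma> in auto)
    show "(a.\<gamma> has_vector_derivative \<gamma>' t) (at t)" for t unfolding \<gamma>'_def by (rule a.\<gamma>_deriv)
    show "continuous_on UNIV \<gamma>'" unfolding \<gamma>'_def[abs_def] \<rho>_def[symmetric] by (intro continuous_intros rc ncont)
    show "norm (outer_normal \<Omega> y) = 1" by (simp add: outer_normal_chart[OF C1 o y U(1)] a.norm_\<nu>)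
    show "\<forall>\<^sub>F t in at_right 0. y + t *\<^sub>R h \<in> \<Omega>" if "h \<bullet> outer_normal \<Omega> y < 0" for h
      using a.inward[OF y U(1)] that by (simp add: outer_normal_chart[OF C1 o y U(1)])
  qed
qed

lemma has_vector_derivative_quotient:
  assumes "(f has_vector_derivative v) (at t0)"
  shows "((\<lambda>t. (1 / (t - t0)) *\<^sub>R (f t - f t0)) \<longlongrightarrow> v) (at t0)"
proof -
  have "((\<lambda>t. norm (f t - f t0 - (t - t0) *\<^sub>R v) / norm (t - t0)) \<longlongrightarrow> 0) (at t0)"
    using assms unfolding has_vector_derivative_def has_derivative_iff_norm by blast
  moreover have "\<forall>\<^sub>F t in at t0. norm (f t - f t0 - (t - t0) *\<^sub>R v) / norm (t - t0) = norm ((1 / (t - t0)) *\<^sub>R (f t - f t0) - v)"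
  proof (rule eventually_at_filter[THEN iffD2, OF always_eventually], intro allI impI)
    fix t assume t: "t \<noteq> t0"
    have "(1 / (t - t0)) *\<^sub>R (f t - f t0) - v = (1 / (t - t0)) *\<^sub>R (f t - f t0 - (t - t0) *\<^sub>R v)"
      using t by (simp add: scaleR_diff_right)
    also have "norm \<dots> = norm (f t - f t0 - (t - t0) *\<^sub>R v) / norm (t - t0)"
      by (simp only: norm_scaleR real_norm_def abs_divide) simp
    finally show "norm (f t - f t0 - (t - t0) *\<^sub>R v) / norm (t - t0) = norm ((1 / (t - t0)) *\<^sub>R (f t - f t0) - v)" ..
  qed
  ultimately have "((\<lambda>t. norm ((1 / (t - t0)) *\<^sub>R (f t - f t0) - v)) \<longlongrightarrow> 0) (at t0)"
    using tendsto_cong by force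
  then show ?thesis using LIM_zero_iff tendsto_norm_zero_iff by blast
qed

text \<open>An inequality between increments passes to difference quotients in the common parameter
  and so to the derivatives. It turns the Lipschitz bound of the normal in space into a curvature
  bound, with no need of arc length.\<close>

lemma vector_derivative_norm_le:
  assumes f: "(f has_vector_derivative v) (at t0)" and g: "(g has_vector_derivative w) (at t0)"
    and le: "\<forall>\<^sub>F t in at t0. norm (f t - f t0) \<le> C * norm (g t - g t0)"
  shows "norm v \<le> C * norm w"
proof (rule tendsto_le[OF _ tendsto_mult_left[OF tendsto_norm] tendsto_norm])
  show "((\<lambda>t. (1 / (t - t0)) *\<^sub>R (g t - g t0)) \<longlongrightarrow> w) (at t0)" "((\<lambda>t. (1 / (t - t0)) *\<^sub>R (f t - f t0)) \<longlongrightarrow> v) (at t0)"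
    by (rule has_vector_derivative_quotient; fact)+
  show "\<forall>\<^sub>F t in at t0. norm ((1 / (t - t0)) *\<^sub>R (f t - f t0)) \<le> C * norm ((1 / (t - t0)) *\<^sub>R (g t - g t0))"
    using le
  proof eventually_elim
    case (elim t)
    then have "\<bar>1 / (t - t0)\<bar> * norm (f t - f t0) \<le> \<bar>1 / (t - t0)\<bar> * (C * norm (g t - g t0))" by (rule mult_left_mono) simp
    then show ?case by (simp only: norm_scaleR real_norm_def mult.left_commute)
  qed
qed simp

lemma disjoint_balls_dist:
  fixes a c :: "'a::real_normed_vector"
  assumes "ball a r1 \<inter> ball c r2 = {}" "0 < r1" "0 < r2"
  shows "r1 + r2 \<le> dist a c"
proof (rule ccontr)
  assume "\<not> ?thesis" then have l: "dist a c < r1 + r2" by simp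
  \<comment> \<open>The point that divides the segment in the ratio of the radii would lie in both
    balls.\<close>
  define z where "z = a + (r1 / (r1 + r2)) *\<^sub>R (c - a)"
  have 1: "dist a z = r1 / (r1 + r2) * dist a c" using assms by (simp add: z_def dist_norm norm_minus_commute)
  have "c - z = (r2 / (r1 + r2)) *\<^sub>R (c - a)"
  proof -
    have "c - z = (1 - r1 / (r1 + r2)) *\<^sub>R (c - a)" by (simp add: z_def algebra_simps)
    also have "1 - r1 / (r1 + r2) = r2 / (r1 + r2)" using assms by (simp add: field_simps)
    finally show ?thesis .
  qed
  then have 2: "dist c z = r2 / (r1 + r2) * dist a c" using assms by (simp add: dist_norm norm_minus_commute)
  have "r1 / (r1 + r2) * dist a c < r1 / (r1 + r2) * (r1 + r2)" "r2 / (r1 + r2) * dist a c < r2 / (r1 + r2) * (r1 + r2)"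
    using l assms by (intro mult_strict_left_mono; simp)+
  moreover have "r1 / (r1 + r2) * (r1 + r2) = r1" "r2 / (r1 + r2) * (r1 + r2) = r2" using assms by auto
  ultimately have "z \<in> ball a r1 \<inter> ball c r2" unfolding Int_iff mem_ball 1 2 by simp
  then show False using assms by blast
qed

section \<open>The distance function under the uniform ball condition\<close>

locale ubc_domain =
  fixes \<Omega> :: "(real^2) set" and r :: real
  assumes reg: "regular_domain 3 \<Omega>" and ubc: "uniform_ball_condition \<Omega> r"
begin

abbreviation \<nu> where "\<nu> \<equiv> outer_normal \<Omega>"
abbreviation \<tau> where "\<tau> \<equiv> unit_tangent \<Omega>"
abbreviation \<kappa> where "\<kappa> \<equiv> curvature \<Omega>"
abbreviation d\<kappa> where "d\<kappa> \<equiv> tangential_deriv \<Omega> (curvature \<Omega>)"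

lemma open_dom: "open \<Omega>" and bounded_dom: "bounded \<Omega>" and ne_dom: "\<Omega> \<noteq> {}"
  using reg by (auto simp: regular_domain_def planar_domain_def)

lemma r_pos: "0 < r" using ubc by (simp add: uniform_ball_condition_def)

lemma norm_nu: "y \<in> frontier \<Omega> \<Longrightarrow> norm (\<nu> y) = 1"
  by (rule boundary_parametrization[OF reg]) (auto simp: boundary_param_def)

lemma inward_nu: "y \<in> frontier \<Omega> \<Longrightarrow> h \<bullet> \<nu> y < 0 \<Longrightarrow> \<forall>\<^sub>F t in at_right 0. y + t *\<^sub>R h \<in> \<Omega>"
  by (rule boundary_parametrization[OF reg, of y]) (auto simp: boundary_param_def)

text \<open>The two balls are disjoint, so their centers are at least 2r apart, while both are at
  distance r from y. The parallelogram law forces y to be their midpoint. The common direction is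
  the normal, since a segment entering the domain cannot enter the outer ball.\<close>

lemma centers:
  assumes y: "y \<in> frontier \<Omega>"
  shows "ball (y - r *\<^sub>R \<nu> y) r \<subseteq> \<Omega>" "ball (y + r *\<^sub>R \<nu> y) r \<subseteq> - \<Omega>"
proof -
  obtain xm xp where x: "ball xm r \<subseteq> \<Omega>" "ball xp r \<subseteq> - \<Omega>" "sphere xm r \<inter> sphere xp r = {y}"
    using ubc y unfolding uniform_ball_condition_def by blast
  have n: "norm (y - xm) = r" "norm (xp - y) = r" using x(3) by (auto simp: dist_norm norm_minus_commute)
  have "2 * r \<le> dist xm xp" using disjoint_balls_dist[of xm r xp r] x r_pos by fastforce
  then have "(2 * r)\<^sup>2 \<le> (norm ((y - xm) + (xp - y)))\<^sup>2"
    using r_pos by (intro power_mono) (auto simp: dist_norm norm_minus_commute)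
  moreover have "(norm ((y - xm) + (xp - y)))\<^sup>2 + (norm ((y - xm) - (xp - y)))\<^sup>2 = 2 * (norm (y - xm))\<^sup>2 + 2 * (norm (xp - y))\<^sup>2"
    unfolding power2_norm_eq_inner by (simp only: inner_diff inner_add) (simp add: inner_commute)
  moreover have "(2 * r)\<^sup>2 = 2 * r\<^sup>2 + 2 * r\<^sup>2" by (simp add: power_mult_distrib)
  ultimately have "(norm ((y - xm) - (xp - y)))\<^sup>2 \<le> 0" unfolding n by linarith
  then have "norm ((y - xm) - (xp - y)) = 0" by (simp only: power2_less_eq_zero_iff)
  then have mid: "y - xm = xp - y" by (simp only: norm_eq_zero right_minus_eq)
  define m where "m = (1 / r) *\<^sub>R (xp - y)"
  have "norm m = 1" unfolding m_def norm_scaleR n(2) using r_pos by simp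
  moreover have rm: "r *\<^sub>R m = xp - y" using r_pos by (simp add: m_def del: scaleR_diff_right)
  moreover have "xm = y - r *\<^sub>R m" unfolding rm mid[symmetric] by simp
  ultimately have m: "norm m = 1" "xp = y + r *\<^sub>R m" "xm = y - r *\<^sub>R m" by simp_all
  have "\<nu> y = m"
  proof (rule unit_vectors_equal[OF norm_nu[OF y] m(1)])
    fix h assume h: "h \<bullet> \<nu> y < 0"
    show "h \<bullet> m \<le> 0"
    proof (rule ccontr)
      assume "\<not> ?thesis"
      then have hm: "0 < h \<bullet> m" by simp
      have "((\<lambda>t. t * (h \<bullet> h)) \<longlongrightarrow> 0 * (h \<bullet> h)) (at_right 0)" by (intro tendsto_intros)
      \<comment> \<open>For t > 0 this says that y + t h lies in the outer ball: the squared
        distance from its center is r^2 + t (t |h|^2 - 2 r (h . m)).\<close>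
      then have "\<forall>\<^sub>F t in at_right 0. t * (h \<bullet> h) < 2 * r * (h \<bullet> m)"
        by (rule order_tendstoD) (use hm r_pos in simp)
      moreover have "\<forall>\<^sub>F t in at_right 0. (0::real) < t" by (rule eventually_at_right_less)
      ultimately have "\<forall>\<^sub>F t in at_right 0. y + t *\<^sub>R h \<in> ball xp r"
      proof eventually_elim
        case (elim t)
        have "(dist xp (y + t *\<^sub>R h))\<^sup>2 = (r *\<^sub>R m - t *\<^sub>R h) \<bullet> (r *\<^sub>R m - t *\<^sub>R h)"
          by (simp add: m(2) dist_norm power2_norm_eq_inner)
        also have "\<dots> = r\<^sup>2 * (m \<bullet> m) + t * (t * (h \<bullet> h) - 2 * r * (h \<bullet> m))"
          by (simp only: inner_diff) (simp add: inner_commute power2_eq_square algebra_simps)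
        also have "\<dots> < r\<^sup>2" using m(1) elim by (simp add: dot_square_norm mult_pos_neg)
        finally show ?case using r_pos by (simp add: power2_less_imp_less less_imp_le)
      qed
      moreover have "\<forall>\<^sub>F t in at_right 0. y + t *\<^sub>R h \<in> \<Omega>" by (rule inward_nu[OF y h])
      ultimately have "\<forall>\<^sub>F t in at_right (0::real). False" by eventually_elim (use x(2) in blast)
      then show False by (simp add: trivial_limit_def[symmetric])
    qed
  qed
  then show "ball (y - r *\<^sub>R \<nu> y) r \<subseteq> \<Omega>" "ball (y + r *\<^sub>R \<nu> y) r \<subseteq> - \<Omega>" using x m by auto
qed

text \<open>The inner ball at y misses the outer ball at z and conversely, so two distances of
  centers are at least 2r. Adding their squares by the parallelogram law leaves r^2 |\<nu> y - \<nu>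
  z|^2 \<le> |y - z|^2.\<close>

lemma nu_lipschitz:
  assumes y: "y \<in> frontier \<Omega>" and z: "z \<in> frontier \<Omega>"
  shows "norm (\<nu> y - \<nu> z) \<le> norm (y - z) / r"
proof -
  define u v where "u = y - z" and "v = r *\<^sub>R (\<nu> y + \<nu> z)"
  have "r + r \<le> dist (y - r *\<^sub>R \<nu> y) (z + r *\<^sub>R \<nu> z)"
    by (rule disjoint_balls_dist[OF _ r_pos r_pos]) (use centers[OF y] centers[OF z] in blast)
  then have 1: "2 * r \<le> norm (u - v)" by (simp add: dist_norm u_def v_def algebra_simps)
  have "r + r \<le> dist (z - r *\<^sub>R \<nu> z) (y + r *\<^sub>R \<nu> y)"
    by (rule disjoint_balls_dist[OF _ r_pos r_pos]) (use centers[OF y] centers[OF z] in blast)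
  also have "dist (z - r *\<^sub>R \<nu> z) (y + r *\<^sub>R \<nu> y) = norm (u + v)"
    unfolding dist_norm u_def v_def by (subst norm_minus_commute) (simp add: algebra_simps)
  finally have 2: "2 * r \<le> norm (u + v)" by simp
  have "(2 * r)\<^sup>2 + (2 * r)\<^sup>2 \<le> (norm (u - v))\<^sup>2 + (norm (u + v))\<^sup>2" using 1 2 r_pos by (intro add_mono power_mono) auto
  also have "\<dots> = 2 * (norm u)\<^sup>2 + 2 * (norm v)\<^sup>2"
    unfolding power2_norm_eq_inner by (simp add: inner_diff inner_add inner_commute)
  also have "(norm v)\<^sup>2 = r\<^sup>2 * (norm (\<nu> y + \<nu> z))\<^sup>2" using r_pos by (simp add: v_def power_mult_distrib)
  also have "(norm (\<nu> y + \<nu> z))\<^sup>2 = 4 - (norm (\<nu> y - \<nu> z))\<^sup>2"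
  proof -
    have "\<nu> y \<bullet> \<nu> y = 1" "\<nu> z \<bullet> \<nu> z = 1" using norm_nu[OF y] norm_nu[OF z] by (simp_all add: dot_square_norm)
    then show ?thesis unfolding power2_norm_eq_inner by (simp add: inner_diff inner_add inner_commute)
  qed
  finally have "r\<^sup>2 * (norm (\<nu> y - \<nu> z))\<^sup>2 \<le> (norm u)\<^sup>2" by (simp add: power_mult_distrib algebra_simps)
  then have "(r * norm (\<nu> y - \<nu> z))\<^sup>2 \<le> (norm u)\<^sup>2" by (simp add: power_mult_distrib)
  then have "r * norm (\<nu> y - \<nu> z) \<le> norm u" by (rule power2_le_imp_le) simp
  then show ?thesis using r_pos by (simp add: u_def field_simps)
qed

lemma norm_tau: "y \<in> frontier \<Omega> \<Longrightarrow> norm (\<tau> y) = 1"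
proof -
  assume y: "y \<in> frontier \<Omega>"
  have "(norm (\<tau> y))\<^sup>2 = (norm (\<nu> y))\<^sup>2" unfolding norm_sq_2 by (simp add: unit_tangent_def)
  then show ?thesis using norm_nu[OF y] by (metis norm_ge_zero one_power2 power2_eq_iff_nonneg zero_le_one)
qed

lemma tau_nu: "\<tau> y \<bullet> \<nu> y = 0" "\<nu> y \<bullet> \<tau> y = 0"
  by (simp_all add: inner_2 unit_tangent_def)

lemma curvature_bound:
  assumes y: "y \<in> frontier \<Omega>" shows "\<bar>\<kappa> y\<bar> \<le> 1 / r"
proof -
  obtain U co \<gamma> \<phi>1 \<phi>2 \<phi>3 \<rho> \<gamma>' where p: "boundary_param \<Omega> y U co \<gamma> \<phi>1 \<phi>2 \<phi>3 \<rho> \<gamma>'"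
    by (rule boundary_parametrization[OF reg y])
  then have P: "y \<in> U"
    "\<And>z. z \<in> frontier \<Omega> \<Longrightarrow> z \<in> U \<Longrightarrow> \<gamma> (co z) = z \<and> \<nu> z = \<phi>1 (co z) \<and> \<kappa> z = \<phi>2 (co z) \<and> d\<kappa> z = \<phi>3 (co z)" "0 < (\<rho>::real)"
    "(\<gamma> has_vector_derivative (- \<rho>) *\<^sub>R \<tau> y) (at (co y))"
    "(\<phi>1 has_vector_derivative (- \<rho> * \<kappa> y) *\<^sub>R \<tau> y) (at (co y))"
    "\<forall>\<^sub>F t in at (co y). \<gamma> t \<in> frontier \<Omega> \<and> \<gamma> t \<in> U \<and> co (\<gamma> t) = t"
    unfolding boundary_param_def by blast+
  have cy: "\<gamma> (co y) = y" "\<nu> y = \<phi>1 (co y)" using P(2)[OF y P(1)] by auto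
  have "norm ((- \<rho> * \<kappa> y) *\<^sub>R \<tau> y) \<le> 1 / r * norm ((- \<rho>) *\<^sub>R \<tau> y)"
  proof (rule vector_derivative_norm_le[OF P(5,4)])
    show "\<forall>\<^sub>F t in at (co y). norm (\<phi>1 t - \<phi>1 (co y)) \<le> 1 / r * norm (\<gamma> t - \<gamma> (co y))"
      using P(6)
    proof eventually_elim
      case (elim t)
      then have "\<nu> (\<gamma> t) = \<phi>1 t" using P(2)[of "\<gamma> t"] by simp
      then show ?case using nu_lipschitz[of "\<gamma> t" y] elim y cy by simp
    qed
  qed
  then have "\<rho> * \<bar>\<kappa> y\<bar> \<le> \<rho> * (1 / r)" using P(3) norm_tau[OF y] by (simp add: abs_mult)
  then show ?thesis using P(3) by (simp only: mult_le_cancel_left_pos)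
qed

section \<open>The nearest boundary point and its derivative\<close>

definition dst where "dst x = infdist x (- \<Omega>)"
definition proj where "proj x = (SOME y. y \<in> frontier \<Omega> \<and> dist x y = dst x)"

lemma compl_dom: "closed (- \<Omega>)" "- \<Omega> \<noteq> {}"
proof -
  show "closed (- \<Omega>)" using open_dom by (simp add: closed_def)
  have "\<Omega> \<noteq> UNIV" using bounded_dom not_bounded_UNIV by metis
  then show "- \<Omega> \<noteq> {}" by blast
qed

lemma dst_nonneg: "0 \<le> dst x" by (simp add: dst_def infdist_nonneg)

lemma dst_pos: "0 < dst x \<longleftrightarrow> x \<in> \<Omega>"
  using in_closed_iff_infdist_zero[OF compl_dom] infdist_nonneg[of x "- \<Omega>"] by (auto simp: dst_def less_le)

lemma dst_cont: "continuous_on S dst"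
  unfolding dst_def by (intro continuous_intros)

lemma dst_lipschitz: "\<bar>dst x - dst y\<bar> \<le> norm (x - y)"
  unfolding dst_def using infdist_triangle_abs[of x "- \<Omega>" y] by (simp add: dist_norm)

lemma dst_ball: "ball x (dst x) \<subseteq> \<Omega>"
proof
  fix z assume z: "z \<in> ball x (dst x)"
  show "z \<in> \<Omega>"
  proof (rule ccontr)
    assume "z \<notin> \<Omega>"
    then have "dst x \<le> dist x z" unfolding dst_def by (intro infdist_le) simp
    then show False using z by simp
  qed
qed

lemma proj: assumes x: "x \<in> \<Omega>" shows "proj x \<in> frontier \<Omega>" "dist x (proj x) = dst x"
proof -
  obtain y where y: "y \<in> - \<Omega>" "dst x = dist x y"
    using infdist_attains_inf[OF compl_dom] unfolding dst_def by blast
  have "y \<in> closure (ball x (dst x))" using y(2) dst_pos[of x] x by (simp add: closure_ball)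
  then have "y \<in> closure \<Omega>" using closure_mono[OF dst_ball] by blast
  then have "y \<in> frontier \<Omega>" using y(1) open_dom by (simp add: frontier_def interior_open)
  then have "\<exists>y. y \<in> frontier \<Omega> \<and> dist x y = dst x" using y(2) by auto
  from someI_ex[OF this] show "proj x \<in> frontier \<Omega>" "dist x (proj x) = dst x" by (auto simp: proj_def)
qed

text \<open>The ball about x that reaches the boundary and the outer ball at the nearest point are
  disjoint, so their centers are at least dst x + r apart. This is equality in the triangle
  inequality, so the two radius vectors are parallel.\<close>

lemma proj_eq: assumes x: "x \<in> \<Omega>" shows "x = proj x - dst x *\<^sub>R \<nu> (proj x)"
proof -
  define y where "y = proj x"
  have y: "y \<in> frontier \<Omega>" "norm (y - x) = dst x" using proj[OF x] by (simp_all add: y_def dist_norm norm_minus_commute)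
  have d: "0 < dst x" using dst_pos x by simp
  have "dst x + r \<le> dist x (y + r *\<^sub>R \<nu> y)"
    by (rule disjoint_balls_dist[OF _ d r_pos]) (use dst_ball[of x] centers(2)[OF y(1)] in blast)
  also have "dist x (y + r *\<^sub>R \<nu> y) = norm ((y - x) + r *\<^sub>R \<nu> y)"
    unfolding dist_norm by (subst norm_minus_commute) (simp add: algebra_simps)
  finally have 1: "norm (y - x) + norm (r *\<^sub>R \<nu> y) \<le> norm ((y - x) + r *\<^sub>R \<nu> y)"
    using y(2) norm_nu[OF y(1)] r_pos by simp
  then have "norm ((y - x) + r *\<^sub>R \<nu> y) = norm (y - x) + norm (r *\<^sub>R \<nu> y)"
    using norm_triangle_ineq[of "y - x" "r *\<^sub>R \<nu> y"] by linarith
  then have "dst x *\<^sub>R (r *\<^sub>R \<nu> y) = r *\<^sub>R (y - x)"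
    unfolding norm_triangle_eq using y(2) norm_nu[OF y(1)] r_pos by simp
  then have "r *\<^sub>R (dst x *\<^sub>R \<nu> y) = r *\<^sub>R (y - x)" by (simp add: mult.commute)
  then have "dst x *\<^sub>R \<nu> y = y - x" using r_pos by (simp only: scaleR_cancel_left) auto
  then show ?thesis by (simp add: y_def)
qed

text \<open>Subtracting the representations of x and z by \<open>proj_eq\<close> leaves a term with
  the difference of the normals. At depth at most r/2 it is at most half of the left side and is
  absorbed, which doubles the remaining 2 to 4.\<close>

lemma proj_lipschitz:
  assumes x: "x \<in> \<Omega>" "dst x \<le> r / 2" and z: "z \<in> \<Omega>"
  shows "norm (proj x - proj z) \<le> 4 * norm (x - z)"
proof -
  have "proj x - proj z = (x - z) + dst x *\<^sub>R (\<nu> (proj x) - \<nu> (proj z)) + (dst x - dst z) *\<^sub>R \<nu> (proj z)"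
  proof -
    have a: "x = proj x - dst x *\<^sub>R \<nu> (proj x)" "z = proj z - dst z *\<^sub>R \<nu> (proj z)"
      using proj_eq x(1) z by auto
    then have "x - z = (proj x - dst x *\<^sub>R \<nu> (proj x)) - (proj z - dst z *\<^sub>R \<nu> (proj z))" by simp
    then show ?thesis by (simp only:) (simp add: algebra_simps)
  qed
  then have "norm (proj x - proj z) \<le> norm (x - z) + norm (dst x *\<^sub>R (\<nu> (proj x) - \<nu> (proj z))) + norm ((dst x - dst z) *\<^sub>R \<nu> (proj z))"
    by (simp only:) (rule order_trans[OF norm_triangle_ineq add_right_mono[OF norm_triangle_ineq]])
  also have "norm (dst x *\<^sub>R (\<nu> (proj x) - \<nu> (proj z))) \<le> (r / 2) * (norm (proj x - proj z) / r)"
    using x dst_nonneg[of x] by (simp only: norm_scaleR real_norm_def) (intro mult_mono nu_lipschitz proj z, auto)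
  also have "norm ((dst x - dst z) *\<^sub>R \<nu> (proj z)) \<le> norm (x - z)"
    using dst_lipschitz[of x z] norm_nu[OF proj(1)[OF z]] by simp
  finally show ?thesis using r_pos by simp
qed

definition Lr where "Lr = {x \<in> \<Omega>. dst x < r / 2}"

lemma open_Lr: "open Lr"
proof -
  have "Lr = \<Omega> \<inter> {x. dst x < r / 2}" by (auto simp: Lr_def)
  then show ?thesis using open_dom open_Collect_less[OF dst_cont continuous_on_const[of _ "r / 2"]] by auto
qed

lemma proj_cont: "continuous_on Lr proj"
  unfolding continuous_on_iff
proof (intro ballI allI impI)
  fix x e assume x: "x \<in> Lr" and e: "0 < (e::real)"
  show "\<exists>\<delta>>0. \<forall>x'\<in>Lr. dist x' x < \<delta> \<longrightarrow> dist (proj x') (proj x) < e"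
  proof (intro exI[of _ "e / 4"] conjI ballI impI)
    fix x' assume "x' \<in> Lr" "dist x' x < e / 4"
    then show "dist (proj x') (proj x) < e"
      using proj_lipschitz[of x' x] x by (simp add: Lr_def dist_norm)
  qed (use e in simp)
qed

lemma frontier_cont: "continuous_on (frontier \<Omega>) \<kappa>" "continuous_on (frontier \<Omega>) d\<kappa>" "continuous_on (frontier \<Omega>) \<nu>"
proof -
  have "continuous (at y within frontier \<Omega>) \<kappa> \<and> continuous (at y within frontier \<Omega>) d\<kappa>" if y: "y \<in> frontier \<Omega>" for y
  proof -
    obtain U co \<gamma> \<phi>1 \<phi>2 \<phi>3 \<rho> \<gamma>' where p: "boundary_param \<Omega> y U co \<gamma> \<phi>1 \<phi>2 \<phi>3 \<rho> \<gamma>'"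
      by (rule boundary_parametrization[OF reg y])
    then have P: "open U" "y \<in> U" "continuous_on UNIV co"
      "\<And>z. z \<in> frontier \<Omega> \<Longrightarrow> z \<in> U \<Longrightarrow> \<kappa> z = \<phi>2 (co z) \<and> d\<kappa> z = \<phi>3 (co z)"
      "continuous_on UNIV \<phi>2" "continuous_on UNIV \<phi>3"
      unfolding boundary_param_def by blast+
    have c: "continuous_on UNIV (\<lambda>z. \<phi>2 (co z))" "continuous_on UNIV (\<lambda>z. \<phi>3 (co z))"
      by (intro continuous_on_compose2[OF P(5) P(3)] continuous_on_compose2[OF P(6) P(3)]; simp)+
    have ev: "\<forall>\<^sub>F z in at y within frontier \<Omega>. z \<in> frontier \<Omega> \<and> z \<in> U"
      using P(1,2) by (auto simp: eventually_at_topological)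
    have "((\<lambda>z. \<phi>2 (co z)) \<longlongrightarrow> \<kappa> y) (at y within frontier \<Omega>)" "((\<lambda>z. \<phi>3 (co z)) \<longlongrightarrow> d\<kappa> y) (at y within frontier \<Omega>)"
      using c P(4)[OF y P(2)] unfolding continuous_on_def by (metis UNIV_I tendsto_within_subset top_greatest)+
    moreover have "\<forall>\<^sub>F z in at y within frontier \<Omega>. \<phi>2 (co z) = \<kappa> z" "\<forall>\<^sub>F z in at y within frontier \<Omega>. \<phi>3 (co z) = d\<kappa> z"
      using ev by (auto elim!: eventually_mono simp: P(4))
    ultimately show ?thesis unfolding continuous_within using Lim_transform_eventually by blast
  qed
  then show "continuous_on (frontier \<Omega>) \<kappa>" "continuous_on (frontier \<Omega>) d\<kappa>"
    by (auto simp: continuous_on_eq_continuous_within)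
  show "continuous_on (frontier \<Omega>) \<nu>"
    unfolding continuous_on_iff
  proof (intro ballI allI impI)
    fix x e assume x: "x \<in> frontier \<Omega>" and e: "0 < (e::real)"
    show "\<exists>\<delta>>0. \<forall>x'\<in>frontier \<Omega>. dist x' x < \<delta> \<longrightarrow> dist (\<nu> x') (\<nu> x) < e"
    proof (intro exI[of _ "e * r"] conjI ballI impI)
      fix x' assume x': "x' \<in> frontier \<Omega>" "dist x' x < e * r"
      then have "norm (x' - x) / r < e" using r_pos by (simp add: dist_norm field_simps)
      then show "dist (\<nu> x') (\<nu> x) < e" using nu_lipschitz[OF x'(1) x] by (simp add: dist_norm)
    qed (use e r_pos in simp)
  qed
qed

text \<open>The inverse function theorem applied to \<open>(t, a) \<mapsto> \<gamma> t - a *\<^sub>R \<phi>1 t\<close> differentiates \<open>proj\<close>; its continuity is already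
  known.\<close>

lemma layer_derivatives:
  assumes x0: "x0 \<in> Lr"
  defines "y \<equiv> proj x0"
  shows "(dst has_derivative (\<lambda>h. - (h \<bullet> \<nu> y))) (at x0)"
    "((\<lambda>x. \<nu> (proj x)) has_derivative (\<lambda>h. (\<kappa> y / (1 - dst x0 * \<kappa> y) * (h \<bullet> \<tau> y)) *\<^sub>R \<tau> y)) (at x0)"
    "((\<lambda>x. \<kappa> (proj x)) has_derivative (\<lambda>h. d\<kappa> y / (1 - dst x0 * \<kappa> y) * (h \<bullet> \<tau> y))) (at x0)"
    "1 / 2 \<le> 1 - dst x0 * \<kappa> y"
proof -
  have xO: "x0 \<in> \<Omega>" and xd: "dst x0 < r / 2" using x0 by (auto simp: Lr_def)
  have y: "y \<in> frontier \<Omega>" using proj(1)[OF xO] by (simp add: y_def)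
  obtain U co \<gamma> \<phi>1 \<phi>2 \<phi>3 \<rho> \<gamma>' where p: "boundary_param \<Omega> y U co \<gamma> \<phi>1 \<phi>2 \<phi>3 \<rho> \<gamma>'"
    by (rule boundary_parametrization[OF reg y])
  then have P: "open U" "y \<in> U" "continuous_on UNIV co"
    "\<And>z. z \<in> frontier \<Omega> \<Longrightarrow> z \<in> U \<Longrightarrow> \<gamma> (co z) = z \<and> \<nu> z = \<phi>1 (co z) \<and> \<kappa> z = \<phi>2 (co z) \<and> d\<kappa> z = \<phi>3 (co z)" "0 < (\<rho>::real)"
    "(\<gamma> has_vector_derivative (- \<rho>) *\<^sub>R \<tau> y) (at (co y))"
    "(\<phi>1 has_vector_derivative (- \<rho> * \<kappa> y) *\<^sub>R \<tau> y) (at (co y))"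
    "(\<phi>2 has_real_derivative (- \<rho> * d\<kappa> y)) (at (co y))"
    unfolding boundary_param_def by blast+
  define d0 where "d0 = dst x0"
  \<comment> \<open>Depth below r/2 together with |\<kappa>| \<le> 1/r keeps the Jacobian factor 1 -
    d0 \<kappa> away from 0.\<close>
  have "\<bar>d0 * \<kappa> y\<bar> \<le> (r / 2) * (1 / r)"
    unfolding abs_mult using xd dst_nonneg[of x0] curvature_bound[OF y] by (intro mult_mono) (auto simp: d0_def)
  then have half: "1 / 2 \<le> 1 - d0 * \<kappa> y" using r_pos by simp
  then show "1 / 2 \<le> 1 - dst x0 * \<kappa> y" by (simp add: d0_def)
  have one: "\<tau> y \<bullet> \<tau> y = 1" "\<nu> y \<bullet> \<nu> y = 1" using norm_tau[OF y] norm_nu[OF y] by (simp_all add: dot_square_norm)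
  define T where "T = Lr \<inter> proj -` U"
  have T: "open T" "x0 \<in> T"
    unfolding T_def using continuous_open_preimage[OF proj_cont open_Lr P(1)] x0 P(2) by (auto simp: y_def)
  define G where "G x = (co (proj x), dst x)" for x
  define f where "f = (\<lambda>p. \<gamma> (fst p) - snd p *\<^sub>R \<phi>1 (fst p))"
  \<comment> \<open>In the frame of tangent and normal the derivative of f is diagonal with entries
    - \<rho> (1 - d0 \<kappa>) and -1; this is its inverse.\<close>
  define G' where "G' h = (- (h \<bullet> \<tau> y) / (\<rho> * (1 - d0 * \<kappa> y)), - (h \<bullet> \<nu> y))" for h
  define f' where "f' = (\<lambda>p :: real \<times> real. fst p *\<^sub>R ((- \<rho>) *\<^sub>R \<tau> y) - (d0 *\<^sub>R (fst p *\<^sub>R ((- \<rho> * \<kappa> y) *\<^sub>R \<tau> y)) + snd p *\<^sub>R \<nu> y))"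
  have gy: "\<phi>1 (co y) = \<nu> y" using P(4)[OF y P(2)] by simp
  have G0: "G x0 = (co y, d0)" by (simp add: G_def y_def d0_def)
  have fstd: "(fst has_derivative fst) (at p)" for p :: "real \<times> real" by (rule bounded_linear_imp_has_derivative[OF bounded_linear_fst])
  have sndd: "(snd has_derivative snd) (at p)" for p :: "real \<times> real" by (rule bounded_linear_imp_has_derivative[OF bounded_linear_snd])
  have dg: "((\<lambda>p. \<gamma> (fst p)) has_derivative (\<lambda>p. fst p *\<^sub>R ((- \<rho>) *\<^sub>R \<tau> y))) (at (co y, d0))"
    using has_derivative_compose[OF fstd, of \<gamma> "\<lambda>s. s *\<^sub>R ((- \<rho>) *\<^sub>R \<tau> y)" "(co y, d0)"] P(6) by (simp only: has_vector_derivative_def fst_conv)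
  have dp: "((\<lambda>p. \<phi>1 (fst p)) has_derivative (\<lambda>p. fst p *\<^sub>R ((- \<rho> * \<kappa> y) *\<^sub>R \<tau> y))) (at (co y, d0))"
    using has_derivative_compose[OF fstd, of \<phi>1 "\<lambda>s. s *\<^sub>R ((- \<rho> * \<kappa> y) *\<^sub>R \<tau> y)" "(co y, d0)"] P(7) by (simp only: has_vector_derivative_def fst_conv)
  have df: "(f has_derivative f') (at (G x0))"
    unfolding f_def f'_def G0 using has_derivative_diff[OF dg has_derivative_scaleR[OF sndd dp]] by (simp add: gy)
  have bl: "bounded_linear G'"
  proof -
    have e: "G' = (\<lambda>h. (h \<bullet> \<tau> y * (- 1 / (\<rho> * (1 - d0 * \<kappa> y))), h \<bullet> (- \<nu> y)))" by (auto simp: G'_def)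
    show ?thesis unfolding e
      by (intro bounded_linear_Pair bounded_linear_mult_const bounded_linear_inner_left)
  qed
  have id: "G' \<circ> f' = id"
  proof
    fix p :: "real \<times> real"
    have 1: "f' p \<bullet> \<tau> y = - \<rho> * (1 - d0 * \<kappa> y) * fst p"
      unfolding f'_def by (simp add: inner_diff inner_add one tau_nu) (simp add: algebra_simps)
    have 2: "f' p \<bullet> \<nu> y = - snd p" unfolding f'_def by (simp add: inner_diff inner_add one tau_nu)
    have nz: "\<rho> * (1 - d0 * \<kappa> y) \<noteq> 0" using P(5) half by auto
    have "- (f' p \<bullet> \<tau> y) / (\<rho> * (1 - d0 * \<kappa> y)) = fst p" unfolding 1 using nz by (simp add: divide_eq_eq)
    then show "(G' \<circ> f') p = id p" using 2 by (simp add: G'_def)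
  qed
  have cG: "continuous (at x0) G"
  proof -
    have "continuous_on Lr G" unfolding G_def[abs_def]
      by (intro continuous_on_Pair continuous_on_compose2[OF P(3) proj_cont] dst_cont) simp
    then show ?thesis using open_Lr x0 by (simp add: continuous_on_eq_continuous_at)
  qed
  have fG: "f (G z) = z" if "z \<in> T" for z
  proof -
    have z: "z \<in> \<Omega>" "proj z \<in> U" using that by (auto simp: T_def Lr_def)
    show ?thesis using P(4)[OF proj(1)[OF z(1)] z(2)] proj_eq[OF z(1)] by (simp add: f_def G_def)
  qed
  have dG: "(G has_derivative G') (at x0)"
    by (rule has_derivative_inverse_basic[OF df bl id cG T fG])
  from has_derivative_snd[OF this] show "(dst has_derivative (\<lambda>h. - (h \<bullet> \<nu> y))) (at x0)" by (simp add: G_def[abs_def] G'_def)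
  have dco: "((\<lambda>x. co (proj x)) has_derivative (\<lambda>h. - (h \<bullet> \<tau> y) / (\<rho> * (1 - d0 * \<kappa> y)))) (at x0)"
    using has_derivative_fst[OF dG] by (simp add: G_def[abs_def] G'_def)
  have nz: "\<rho> \<noteq> 0" "1 - d0 * \<kappa> y \<noteq> 0" using P(5) half by auto
  have zz: "proj z \<in> frontier \<Omega>" "proj z \<in> U" if "z \<in> T" for z using that proj(1) by (auto simp: T_def Lr_def)
  have "((\<lambda>x. \<phi>1 (co (proj x))) has_derivative (\<lambda>h. (- (h \<bullet> \<tau> y) / (\<rho> * (1 - d0 * \<kappa> y))) *\<^sub>R ((- \<rho> * \<kappa> y) *\<^sub>R \<tau> y))) (at x0)"
    using has_derivative_compose[OF dco, of \<phi>1] P(7) unfolding has_vector_derivative_def y_def by blast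
  then have "((\<lambda>x. \<nu> (proj x)) has_derivative (\<lambda>h. (- (h \<bullet> \<tau> y) / (\<rho> * (1 - d0 * \<kappa> y))) *\<^sub>R ((- \<rho> * \<kappa> y) *\<^sub>R \<tau> y))) (at x0)"
    by (rule has_derivative_transform_within_open[OF _ T]) (use P(4) zz in auto)
  moreover have "(\<lambda>h. (- (h \<bullet> \<tau> y) / (\<rho> * (1 - d0 * \<kappa> y))) *\<^sub>R ((- \<rho> * \<kappa> y) *\<^sub>R \<tau> y)) = (\<lambda>h. (\<kappa> y / (1 - d0 * \<kappa> y) * (h \<bullet> \<tau> y)) *\<^sub>R \<tau> y)"
    using nz by (simp add: fun_eq_iff)
  ultimately show "((\<lambda>x. \<nu> (proj x)) has_derivative (\<lambda>h. (\<kappa> y / (1 - dst x0 * \<kappa> y) * (h \<bullet> \<tau> y)) *\<^sub>R \<tau> y)) (at x0)"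
    by (simp add: d0_def)
  have "((\<lambda>x. \<phi>2 (co (proj x))) has_derivative (\<lambda>h. (- \<rho> * d\<kappa> y) * (- (h \<bullet> \<tau> y) / (\<rho> * (1 - d0 * \<kappa> y))))) (at x0)"
    using has_derivative_compose[OF dco, of \<phi>2] P(8) unfolding has_field_derivative_def y_def by blast
  then have "((\<lambda>x. \<kappa> (proj x)) has_derivative (\<lambda>h. (- \<rho> * d\<kappa> y) * (- (h \<bullet> \<tau> y) / (\<rho> * (1 - d0 * \<kappa> y))))) (at x0)"
    by (rule has_derivative_transform_within_open[OF _ T]) (use P(4) zz in auto)
  moreover have "(\<lambda>h. (- \<rho> * d\<kappa> y) * (- (h \<bullet> \<tau> y) / (\<rho> * (1 - d0 * \<kappa> y)))) = (\<lambda>h. d\<kappa> y / (1 - d0 * \<kappa> y) * (h \<bullet> \<tau> y))"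
    using nz by (simp add: fun_eq_iff)
  ultimately show "((\<lambda>x. \<kappa> (proj x)) has_derivative (\<lambda>h. d\<kappa> y / (1 - dst x0 * \<kappa> y) * (h \<bullet> \<tau> y))) (at x0)"
    by (simp add: d0_def)
qed

definition nrm where "nrm x = Complex (\<nu> (proj x) $ 1) (\<nu> (proj x) $ 2)"
text \<open>The curvature of the inner parallel curve: a circle of radius 1/\<kappa> shrinks to
  radius 1/\<kappa> - d. The same stretching factor appears in \<open>qq\<close>, the derivative of
  \<kappa> at the nearest boundary point in the direction \<i> n.\<close>

definition kk where "kk x = \<kappa> (proj x) / (1 - dst x * \<kappa> (proj x))"
definition qq where "qq x = d\<kappa> (proj x) / (1 - dst x * \<kappa> (proj x))"

lemma proj_frontier: "x \<in> Lr \<Longrightarrow> proj x \<in> frontier \<Omega>" using proj(1) by (auto simp: Lr_def)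

lemma kk_cont: "continuous_on Lr kk" "continuous_on Lr qq"
proof -
  have 1: "continuous_on Lr (\<lambda>x. \<kappa> (proj x))" "continuous_on Lr (\<lambda>x. d\<kappa> (proj x))"
    by (rule continuous_on_compose2[OF frontier_cont(1) proj_cont] continuous_on_compose2[OF frontier_cont(2) proj_cont], use proj_frontier in auto)+
  have "\<forall>x\<in>Lr. 1 - dst x * \<kappa> (proj x) \<noteq> 0" using layer_derivatives(4) by force
  then show "continuous_on Lr kk" "continuous_on Lr qq"
    unfolding kk_def[abs_def] qq_def[abs_def] by (intro continuous_intros 1 dst_cont; blast)+
qed

text \<open>Halving the radius fits on both counts: below depth r/2 the factor 1 - d \<kappa> is at
  least 1/2, so \<open>kk\<close> is at most 2/r, which is precisely the curvature bound demanded of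
  a layer of width r/2.\<close>

lemma layer: "layer \<Omega> (r / 2) dst nrm kk"
proof
  show "0 < r / 2" using r_pos by simp
  show "bounded \<Omega>" by (rule bounded_dom)
  show "continuous_on UNIV dst" by (rule dst_cont)
  show "0 \<le> dst x" "(0 < dst x) = (x \<in> \<Omega>)" for x by (simp_all add: dst_nonneg dst_pos)
  show "continuous_on {x \<in> \<Omega>. dst x < r / 2} kk" using kk_cont(1) by (simp add: Lr_def)
  fix x assume "x \<in> \<Omega>" "dst x < r / 2"
  then have x: "x \<in> Lr" by (simp add: Lr_def)
  note D = layer_derivatives[OF x]
  show "has_partials dst (- Re (nrm x)) (- Im (nrm x)) x"
    unfolding has_partials_def using D(1) by (simp add: nrm_def inner_2 algebra_simps)
  have "(cmod (nrm x))\<^sup>2 = (norm (\<nu> (proj x)))\<^sup>2" unfolding norm_sq_2 by (simp add: cmod_power2 nrm_def)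
  then show "cmod (nrm x) = 1" using norm_nu[OF proj_frontier[OF x]]
    by (metis norm_ge_zero one_power2 power2_eq_iff_nonneg zero_le_one)
  have bl: "bounded_linear (\<lambda>v::real^2. Complex (v $ 1) (v $ 2))"
    unfolding Complex_eq
    by (intro bounded_linear_add bounded_linear_compose[OF bounded_linear_of_real bounded_linear_vec_nth]
        bounded_linear_compose[OF bounded_linear_mult_right bounded_linear_compose[OF bounded_linear_of_real bounded_linear_vec_nth]])
  have "(nrm has_derivative (\<lambda>h. Complex (((kk x * (h \<bullet> \<tau> (proj x))) *\<^sub>R \<tau> (proj x)) $ 1) (((kk x * (h \<bullet> \<tau> (proj x))) *\<^sub>R \<tau> (proj x)) $ 2))) (at x)"
    unfolding nrm_def[abs_def] kk_def by (rule bounded_linear.has_derivative[OF bl D(2)])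
  moreover have "Complex (((kk x * (h \<bullet> \<tau> (proj x))) *\<^sub>R \<tau> (proj x)) $ 1) (((kk x * (h \<bullet> \<tau> (proj x))) *\<^sub>R \<tau> (proj x)) $ 2)
    = h $ 1 *\<^sub>R (of_real (- kk x * Im (nrm x)) * (\<i> * nrm x)) + h $ 2 *\<^sub>R (of_real (kk x * Re (nrm x)) * (\<i> * nrm x))" for h
    by (rule complex_eqI) (simp_all add: nrm_def inner_2 unit_tangent_def algebra_simps)
  ultimately show "has_partials nrm (of_real (- kk x * Im (nrm x)) * (\<i> * nrm x)) (of_real (kk x * Re (nrm x)) * (\<i> * nrm x)) x"
    unfolding has_partials_def by simp
  have "\<bar>kk x\<bar> = \<bar>\<kappa> (proj x)\<bar> / (1 - dst x * \<kappa> (proj x))" unfolding kk_def abs_divide using D(4) by simp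
  also have "\<dots> \<le> (1 / r) / (1 / 2)"
    by (intro frac_le curvature_bound proj_frontier x D(4)) (use r_pos in auto)
  finally show "\<bar>kk x\<bar> \<le> 1 / (r / 2)" by simp
qed

lemma K_partials:
  assumes x: "x \<in> Lr"
  shows "has_partials (\<lambda>x. \<kappa> (proj x)) (- qq x * Im (nrm x)) (qq x * Re (nrm x)) x" "\<bar>qq x\<bar> \<le> 2 * \<bar>d\<kappa> (proj x)\<bar>"
proof -
  note D = layer_derivatives[OF x]
  show "has_partials (\<lambda>x. \<kappa> (proj x)) (- qq x * Im (nrm x)) (qq x * Re (nrm x)) x"
    unfolding has_partials_def using D(3) by (simp add: nrm_def inner_2 qq_def unit_tangent_def algebra_simps)
  have "\<bar>qq x\<bar> = \<bar>d\<kappa> (proj x)\<bar> / (1 - dst x * \<kappa> (proj x))" unfolding qq_def abs_divide using D(4) by simp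
  also have "\<dots> \<le> \<bar>d\<kappa> (proj x)\<bar> / (1 / 2)"
    by (intro frac_le D(4)) auto
  finally show "\<bar>qq x\<bar> \<le> 2 * \<bar>d\<kappa> (proj x)\<bar>" by simp
qed

end

section \<open>The one-dimensional Hausdorff measure is a measure\<close>

definition delta_cover :: "real \<Rightarrow> 'a::metric_space set \<Rightarrow> (nat \<Rightarrow> 'a set) \<Rightarrow> bool" where
  "delta_cover \<delta> A C \<longleftrightarrow> A \<subseteq> (\<Union>i. C i) \<and> (\<forall>i. bounded (C i) \<and> diameter (C i) \<le> \<delta>)"

lemma hausdorff1_pre_eq: "hausdorff1_pre \<delta> A = (INF C \<in> Collect (delta_cover \<delta> A). \<Sum>i. ennreal (diameter (C i)))"
  unfolding hausdorff1_pre_def delta_cover_def ..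

lemma hausdorff1_pre_le: "delta_cover \<delta> A C \<Longrightarrow> hausdorff1_pre \<delta> A \<le> (\<Sum>i. ennreal (diameter (C i)))"
  unfolding hausdorff1_pre_eq by (rule INF_lower) simp

lemma hausdorff1_pre_greatest: "(\<And>C. delta_cover \<delta> A C \<Longrightarrow> x \<le> (\<Sum>i. ennreal (diameter (C i)))) \<Longrightarrow> x \<le> hausdorff1_pre \<delta> A"
  unfolding hausdorff1_pre_eq by (rule INF_greatest) simp

lemma hausdorff1_pre_mono: "A \<subseteq> B \<Longrightarrow> \<delta>' \<le> \<delta> \<Longrightarrow> hausdorff1_pre \<delta> A \<le> hausdorff1_pre \<delta>' B"
  by (rule hausdorff1_pre_greatest, rule hausdorff1_pre_le) (auto simp: delta_cover_def intro: order_trans)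

lemma hausdorff1_pre_empty: "0 \<le> \<delta> \<Longrightarrow> hausdorff1_pre \<delta> {} = 0"
proof -
  assume "0 \<le> \<delta>"
  then have "delta_cover \<delta> {} (\<lambda>i. {})" by (simp add: delta_cover_def diameter_def)
  from hausdorff1_pre_le[OF this] show ?thesis by (simp add: diameter_def)
qed

lemma hausdorff1_pre_close:
  assumes "hausdorff1_pre \<delta> A < x" obtains C where "delta_cover \<delta> A C" "(\<Sum>i. ennreal (diameter (C i))) < x"
  using assms unfolding hausdorff1_pre_eq INF_less_iff by auto

lemma hausdorff1_pre_subadditive: "hausdorff1_pre \<delta> (\<Union>i. A i) \<le> (\<Sum>n. hausdorff1_pre \<delta> (A (n::nat)))"
proof (rule ennreal_le_epsilon)
  fix e :: real assume e: "0 < e" and fin: "(\<Sum>n. hausdorff1_pre \<delta> (A n)) < top"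
  have "hausdorff1_pre \<delta> (A n) < hausdorff1_pre \<delta> (A n) + ennreal (e * (1/2) ^ Suc n)" for n
    using e fin by (auto simp: less_top dest!: ennreal_suminf_lessD)
  then have "\<exists>C. delta_cover \<delta> (A n) C \<and> (\<Sum>i. ennreal (diameter (C i))) \<le> hausdorff1_pre \<delta> (A n) + ennreal (e * (1/2) ^ Suc n)" for n
    by (rule hausdorff1_pre_close) (blast intro: less_imp_le)
  then obtain B where B: "\<And>n. delta_cover \<delta> (A n) (B n)"
    "\<And>n. (\<Sum>i. ennreal (diameter (B n i))) \<le> hausdorff1_pre \<delta> (A n) + ennreal (e * (1/2) ^ Suc n)" by metis
  \<comment> \<open>One sequence enumerates the double family of covers chosen with the errors e /
    2^(n+1), which sum to e.\<close>
  define C where "C i = case_prod B (prod_decode i)" for i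
  have "delta_cover \<delta> (\<Union>i. A i) C"
    unfolding delta_cover_def
  proof (intro conjI allI subsetI)
    fix x assume "x \<in> (\<Union>i. A i)"
    then obtain n where "x \<in> A n" by blast
    then obtain i where "x \<in> B n i" using B(1)[of n] unfolding delta_cover_def by blast
    then have "x \<in> C (prod_encode (n, i))" by (simp add: C_def)
    then show "x \<in> (\<Union>i. C i)" by blast
  qed (use B(1) in \<open>auto simp: delta_cover_def C_def split: prod.split\<close>)
  then have "hausdorff1_pre \<delta> (\<Union>i. A i) \<le> (\<Sum>i. ennreal (diameter (C i)))" by (rule hausdorff1_pre_le)
  also have "\<dots> = (\<Sum>i. case_prod (\<lambda>n i. ennreal (diameter (B n i))) (prod_decode i))"
    by (simp add: C_def split_def)
  also have "\<dots> = (\<Sum>n. \<Sum>i. ennreal (diameter (B n i)))"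
    using suminf_ennreal_2dimen[of "\<lambda>n. \<Sum>i. ennreal (diameter (B n i))" "case_prod (\<lambda>n i. ennreal (diameter (B n i)))"]
    by (simp add: comp_def)
  also have "\<dots> \<le> (\<Sum>n. hausdorff1_pre \<delta> (A n) + ennreal (e * (1/2) ^ Suc n))"
    by (intro suminf_le B) auto
  also have "\<dots> = (\<Sum>n. hausdorff1_pre \<delta> (A n)) + (\<Sum>n. ennreal e * ennreal ((1/2) ^ Suc n))"
    using e by (subst suminf_add[symmetric]) (auto simp del: ennreal_suminf_cmult simp add: ennreal_mult[symmetric])
  also have "\<dots> = (\<Sum>n. hausdorff1_pre \<delta> (A n)) + e"
    unfolding ennreal_suminf_cmult by (subst suminf_ennreal_eq[OF zero_le_power power_half_series]) auto
  finally show "hausdorff1_pre \<delta> (\<Union>i. A i) \<le> (\<Sum>n. hausdorff1_pre \<delta> (A n)) + ennreal e" .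
qed

lemma hausdorff1_pre_le_outer: "0 < \<delta> \<Longrightarrow> hausdorff1_pre \<delta> A \<le> hausdorff1_outer A"
  unfolding hausdorff1_outer_def by (rule SUP_upper) simp

lemma hausdorff1_outer_least: "(\<And>\<delta>. 0 < \<delta> \<Longrightarrow> hausdorff1_pre \<delta> A \<le> x) \<Longrightarrow> hausdorff1_outer A \<le> x"
  unfolding hausdorff1_outer_def by (rule SUP_least) simp

lemma hausdorff1_outer_mono: "A \<subseteq> B \<Longrightarrow> hausdorff1_outer A \<le> hausdorff1_outer B"
  by (rule hausdorff1_outer_least) (meson order_refl order_trans hausdorff1_pre_le_outer hausdorff1_pre_mono)

lemma hausdorff1_outer_empty: "hausdorff1_outer {} = 0"
proof -
  have "hausdorff1_outer {} \<le> (0 :: ennreal)" by (rule hausdorff1_outer_least) (simp add: hausdorff1_pre_empty)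
  then show ?thesis by simp
qed

lemma hausdorff1_outer_subadditive: "hausdorff1_outer (\<Union>i. A i) \<le> (\<Sum>n. hausdorff1_outer (A (n::nat)))"
proof (rule hausdorff1_outer_least)
  fix \<delta> :: real assume "0 < \<delta>"
  then have "(\<Sum>n. hausdorff1_pre \<delta> (A n)) \<le> (\<Sum>n. hausdorff1_outer (A n))" by (intro suminf_le hausdorff1_pre_le_outer) auto
  then show "hausdorff1_pre \<delta> (\<Union>i. A i) \<le> (\<Sum>n. hausdorff1_outer (A n))" using hausdorff1_pre_subadditive order_trans by blast
qed

lemma hausdorff1_outer_Un: "hausdorff1_outer (A \<union> B) \<le> hausdorff1_outer A + hausdorff1_outer B"
proof -
  define C where "C n = (if n = 0 then A else if n = (1::nat) then B else {})" for n
  have "A \<union> B = (\<Union>n. C n)" by (auto simp: C_def split: if_splits)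
  then have "hausdorff1_outer (A \<union> B) \<le> (\<Sum>n. hausdorff1_outer (C n))" using hausdorff1_outer_subadditive by metis
  also have "\<dots> = (\<Sum>n\<in>{0,1}. hausdorff1_outer (C n))" by (rule suminf_finite) (auto simp: C_def hausdorff1_outer_empty)
  finally show ?thesis by (simp add: C_def)
qed

text \<open>A set of diameter at most \<delta> < \<eta> cannot meet both A and B. So a fine cover of
  the union splits into a cover of A and one of B that share no nonempty set.\<close>

lemma hausdorff1_outer_metric:
  fixes A B :: "'a::metric_space set"
  assumes \<eta>: "0 < \<eta>" and sep: "\<And>a b. a \<in> A \<Longrightarrow> b \<in> B \<Longrightarrow> \<eta> \<le> dist a b"
  shows "hausdorff1_outer A + hausdorff1_outer B \<le> hausdorff1_outer (A \<union> B)"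
proof -
  have pre: "hausdorff1_pre \<delta> A + hausdorff1_pre \<delta> B \<le> hausdorff1_outer (A \<union> B)" if \<delta>: "0 < \<delta>" "\<delta> < \<eta>" for \<delta>
  proof -
    have "hausdorff1_pre \<delta> A + hausdorff1_pre \<delta> B \<le> hausdorff1_pre \<delta> (A \<union> B)"
    proof (rule hausdorff1_pre_greatest)
      fix C assume C: "delta_cover \<delta> (A \<union> B) C"
      define CA where "CA i = (if C i \<inter> A \<noteq> {} then C i else {})" for i
      define CB where "CB i = (if C i \<inter> B \<noteq> {} then C i else {})" for i
      have d0: "diameter ({} :: 'a set) = 0" by (simp add: diameter_def)
      have cov: "delta_cover \<delta> X (\<lambda>i. if C i \<inter> X \<noteq> {} then C i else {})" if X: "X \<subseteq> A \<union> B" for X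
        unfolding delta_cover_def
      proof (intro conjI allI subsetI)
        fix x assume x: "x \<in> X"
        then obtain i where "x \<in> C i" using C X unfolding delta_cover_def by blast
        then show "x \<in> (\<Union>i. if C i \<inter> X \<noteq> {} then C i else {})" using x by (intro UN_I[of i]) auto
      qed (use C \<delta> d0 in \<open>auto simp: delta_cover_def\<close>)
      have "delta_cover \<delta> A CA" "delta_cover \<delta> B CB"
        using cov[of A] cov[of B] unfolding CA_def CB_def by auto
      then have "hausdorff1_pre \<delta> A + hausdorff1_pre \<delta> B \<le> (\<Sum>i. ennreal (diameter (CA i))) + (\<Sum>i. ennreal (diameter (CB i)))"
        by (intro add_mono hausdorff1_pre_le)
      also have "\<dots> = (\<Sum>i. ennreal (diameter (CA i)) + ennreal (diameter (CB i)))" by (rule suminf_add) auto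
      also have "\<dots> \<le> (\<Sum>i. ennreal (diameter (C i)))"
      proof (intro suminf_le summableI)
        fix i
        have "C i \<inter> A = {} \<or> C i \<inter> B = {}"
        proof (rule ccontr)
          assume "\<not> ?thesis"
          then obtain a b where ab: "a \<in> C i" "a \<in> A" "b \<in> C i" "b \<in> B" by blast
          have "dist a b \<le> diameter (C i)" using C ab unfolding delta_cover_def by (intro diameter_bounded_bound) auto
          also have "\<dots> \<le> \<delta>" using C unfolding delta_cover_def by blast
          finally show False using sep[OF ab(2,4)] \<delta> by simp
        qed
        then show "ennreal (diameter (CA i)) + ennreal (diameter (CB i)) \<le> ennreal (diameter (C i))"
          by (auto simp: CA_def CB_def diameter_def)
      qed
      finally show "hausdorff1_pre \<delta> A + hausdorff1_pre \<delta> B \<le> (\<Sum>i. ennreal (diameter (C i)))" .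
    qed
    then show ?thesis using hausdorff1_pre_le_outer[OF \<delta>(1)] order_trans by blast
  qed
  \<comment> \<open>The two suprema are taken separately, so the inequality is needed for two
    independent sizes; passing to a common smaller one only increases the left side.\<close>
  have 1: "hausdorff1_pre \<delta>1 A + hausdorff1_pre \<delta>2 B \<le> hausdorff1_outer (A \<union> B)" if "0 < \<delta>1" "0 < \<delta>2" for \<delta>1 \<delta>2
  proof -
    define \<delta> where "\<delta> = min \<delta>1 (min \<delta>2 (\<eta> / 2))"
    have "hausdorff1_pre \<delta>1 A + hausdorff1_pre \<delta>2 B \<le> hausdorff1_pre \<delta> A + hausdorff1_pre \<delta> B"
      by (intro add_mono hausdorff1_pre_mono) (auto simp: \<delta>_def)
    also have "\<dots> \<le> hausdorff1_outer (A \<union> B)" by (rule pre) (use that \<eta> in \<open>auto simp: \<delta>_def min_def\<close>)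
    finally show ?thesis .
  qed
  have 2: "hausdorff1_outer A + hausdorff1_pre \<delta>2 B \<le> hausdorff1_outer (A \<union> B)" if "0 < \<delta>2" for \<delta>2
    unfolding hausdorff1_outer_def[of A]
    by (subst ennreal_SUP_add_left[symmetric]) (auto intro!: SUP_least 1 that)
  show ?thesis
    unfolding hausdorff1_outer_def[of B] add.commute[of "hausdorff1_outer A"]
    by (subst ennreal_SUP_add_left[symmetric]) (auto intro!: SUP_least 2 simp: add.commute[of _ "hausdorff1_outer A"])
qed

lemma hausdorff1_outer_metric_sum:
  fixes R :: "nat \<Rightarrow> 'a::metric_space set"
  assumes sep: "\<And>m n. m < n \<Longrightarrow> n < N \<Longrightarrow> \<exists>\<eta>>0. \<forall>a\<in>R m. \<forall>b\<in>R n. \<eta> \<le> dist a b"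
  shows "(\<Sum>m<N. hausdorff1_outer (R m)) \<le> hausdorff1_outer (\<Union>m<N. R m)"
  using sep
proof (induction N)
  case 0 then show ?case by simp
next
  case (Suc N)
  have "\<exists>\<eta>. m < N \<longrightarrow> 0 < \<eta> \<and> (\<forall>a\<in>R m. \<forall>b\<in>R N. \<eta> \<le> dist a b)" for m
    using Suc.prems[of m N] by (cases "m < N") auto
  then obtain \<eta> where \<eta>: "\<And>m. m < N \<Longrightarrow> 0 < \<eta> m" "\<And>m a b. m < N \<Longrightarrow> a \<in> R m \<Longrightarrow> b \<in> R N \<Longrightarrow> \<eta> m \<le> dist a b" by metis
  \<comment> \<open>The inserted 1 keeps the minimum meaningful for N = 0.\<close>
  define \<zeta> where "\<zeta> = Min (insert 1 (\<eta> ` {..<N}))"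
  have "(\<Sum>m<N. hausdorff1_outer (R m)) + hausdorff1_outer (R N) \<le> hausdorff1_outer (\<Union>m<N. R m) + hausdorff1_outer (R N)"
    using Suc by (intro add_right_mono) (metis less_SucI)
  also have "\<dots> \<le> hausdorff1_outer ((\<Union>m<N. R m) \<union> R N)"
  proof (rule hausdorff1_outer_metric[of \<zeta>])
    show "0 < \<zeta>" using \<eta>(1) by (auto simp: \<zeta>_def)
    fix a b assume "a \<in> (\<Union>m<N. R m)" "b \<in> R N"
    then obtain m where m: "m < N" "a \<in> R m" by blast
    then have "\<zeta> \<le> \<eta> m" by (auto simp: \<zeta>_def)
    then show "\<zeta> \<le> dist a b" using \<eta>(2)[OF m \<open>b \<in> R N\<close>] by simp
  qed
  also have "(\<Union>m<N. R m) \<union> R N = (\<Union>m<Suc N. R m)" by (auto simp: less_Suc_eq)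
  finally show ?case by simp
qed

lemma ennreal_suminf_tail:
  fixes f :: "nat \<Rightarrow> ennreal"
  assumes "(\<Sum>n. f n) < top" "0 < e"
  obtains n where "(\<Sum>m. f (m + n)) \<le> ennreal e"
proof -
  obtain n where n: "(\<Sum>n. f n) \<le> (\<Sum>i<n. f i) + ennreal e"
  proof (cases "(\<Sum>n. f n) = 0")
    case True then show ?thesis using that by simp
  next
    case False
    define S where "S = (\<Sum>n. f n)"
    have "S - ennreal e < S" using assms False by (intro ennreal_between) (auto simp: S_def zero_less_iff_neq_zero)
    then have "\<exists>n. S - ennreal e < (\<Sum>i<n. f i)" unfolding S_def suminf_eq_SUP less_SUP_iff by auto
    then obtain n where "S - ennreal e < (\<Sum>i<n. f i)" by blast
    then have "S - ennreal e \<le> (\<Sum>i<n. f i)" by simp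
    then have "S \<le> (\<Sum>i<n. f i) + ennreal e" using ennreal_minus_le_iff[of S "ennreal e"] by (auto simp: add.commute)
    then show ?thesis using that by (simp add: S_def)
  qed
  have "(\<Sum>n. f n) = (\<Sum>m. f (m + n)) + (\<Sum>i<n. f i)" by (rule suminf_offset) simp
  with n have "(\<Sum>i<n. f i) + (\<Sum>m. f (m + n)) \<le> (\<Sum>i<n. f i) + ennreal e" by (simp add: add.commute)
  \<comment> \<open>Finiteness of the partial sum permits its cancellation; in
    \<open>ennreal\<close> this would fail at \<open>top\<close>.\<close>
  moreover have "(\<Sum>i<n. f i) \<noteq> top"
  proof -
    have "(\<Sum>i<n. f i) \<le> (\<Sum>n. f n)" by (rule sum_le_suminf) auto
    from le_less_trans[OF this assms(1)] show ?thesis by (rule less_imp_neq)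
  qed
  ultimately have "(\<Sum>m. f (m + n)) \<le> ennreal e" by (metis ennreal_add_left_cancel_le infinity_ennreal_def)
  then show ?thesis by (rule that)
qed

text \<open>Caratheodory's argument: \<open>A - F\<close> is exhausted by the sets at distance at least \<open>1/(n+1)\<close> from \<open>F\<close>,
  and the outer measures of the successive differences are summable because every other one of them
  is separated from the previous ones.\<close>

lemma hausdorff1_outer_caratheodory_closed:
  fixes A F :: "'a::metric_space set"
  assumes F: "closed F"
  shows "hausdorff1_outer (A \<inter> F) + hausdorff1_outer (A - F) \<le> hausdorff1_outer A"
proof (cases "F = {} \<or> hausdorff1_outer A = top")
  case True then show ?thesis by (auto simp: hausdorff1_outer_empty)
next
  case False
  then have ne: "F \<noteq> {}" and fin: "hausdorff1_outer A < top" by (auto simp: less_top)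
  define \<delta> where "\<delta> n = 1 / (real n + 1)" for n
  define An where "An n = {x \<in> A. \<delta> n \<le> infdist x F}" for n
  define R where "R n = {x \<in> A. \<delta> (Suc n) \<le> infdist x F \<and> infdist x F < \<delta> n}" for n
  have \<delta>: "0 < \<delta> n" "m < n \<Longrightarrow> \<delta> n < \<delta> m" for m n by (auto simp: \<delta>_def field_simps)
  have sep: "\<exists>\<eta>>0. \<forall>a\<in>R m. \<forall>b\<in>R n. \<eta> \<le> dist a b" if "Suc m < n" for m n
  proof (intro exI[of _ "\<delta> (Suc m) - \<delta> n"] conjI ballI)
    show "0 < \<delta> (Suc m) - \<delta> n" using \<delta>(2)[OF that] by simp
    fix a b assume "a \<in> R m" "b \<in> R n"
    then have "\<delta> (Suc m) \<le> infdist a F" "infdist b F < \<delta> n" by (auto simp: R_def)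
    then show "\<delta> (Suc m) - \<delta> n \<le> dist a b" using infdist_triangle_abs[of a F b] by linarith
  qed
  have par: "(\<Sum>m. hausdorff1_outer (R (2 * m + c))) \<le> hausdorff1_outer A" for c
  proof (rule suminf_le_const)
    fix N
    have "(\<Sum>m<N. hausdorff1_outer (R (2 * m + c))) \<le> hausdorff1_outer (\<Union>m<N. R (2 * m + c))"
      by (rule hausdorff1_outer_metric_sum, rule sep) simp
    also have "\<dots> \<le> hausdorff1_outer A" by (rule hausdorff1_outer_mono) (auto simp: R_def)
    finally show "(\<Sum>m<N. hausdorff1_outer (R (2 * m + c))) \<le> hausdorff1_outer A" .
  qed simp
  have "(\<Sum>m. hausdorff1_outer (R m)) \<le> hausdorff1_outer A + hausdorff1_outer A"
  proof (rule suminf_le_const)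
    fix N
    have "(\<Sum>m<N. hausdorff1_outer (R m)) \<le> (\<Sum>m<2 * N. hausdorff1_outer (R m))" by (rule sum_mono2) auto
    also have "\<dots> = (\<Sum>m<N. hausdorff1_outer (R (2 * m + 0)) + hausdorff1_outer (R (2 * m + 1)))"
      by (induction N) (simp_all add: add.assoc)
    also have "\<dots> = (\<Sum>m<N. hausdorff1_outer (R (2 * m + 0))) + (\<Sum>m<N. hausdorff1_outer (R (2 * m + 1)))" by (rule sum.distrib)
    also have "\<dots> \<le> hausdorff1_outer A + hausdorff1_outer A"
      by (intro add_mono order_trans[OF sum_le_suminf par]) auto
    finally show "(\<Sum>m<N. hausdorff1_outer (R m)) \<le> hausdorff1_outer A + hausdorff1_outer A" .
  qed simp
  then have fs: "(\<Sum>m. hausdorff1_outer (R m)) < top" using fin by (simp add: le_less_trans)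
  show ?thesis
  proof (rule ennreal_le_epsilon)
    fix e :: real assume e: "0 < e"
    obtain n where n: "(\<Sum>m. hausdorff1_outer (R (m + n))) \<le> ennreal e" using ennreal_suminf_tail[OF fs e] .
    have "A - F \<subseteq> An n \<union> (\<Union>m. R (m + n))"
    proof
      fix x assume x: "x \<in> A - F"
      then have "0 < infdist x F" using in_closed_iff_infdist_zero[OF F ne] infdist_nonneg[of x F] by (simp add: less_le)
      then obtain k where k: "\<delta> k < infdist x F" using reals_Archimedean[of "infdist x F"] by (auto simp: \<delta>_def inverse_eq_divide add.commute)
      show "x \<in> An n \<union> (\<Union>m. R (m + n))"
      proof (cases "\<delta> n \<le> infdist x F")
        case True then show ?thesis using x by (simp add: An_def)
      next
        case False
        define j where "j = (LEAST j. \<delta> j \<le> infdist x F)"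
        have j: "\<delta> j \<le> infdist x F" unfolding j_def by (rule LeastI[of _ k]) (use k in simp)
        have "n < j" using False j \<delta>(2) by (metis linorder_neqE_nat order_less_imp_le order_trans)
        then obtain i where i: "j = Suc i" "n \<le> i" by (cases j) auto
        have "\<not> \<delta> i \<le> infdist x F" using not_less_Least[of i "\<lambda>j. \<delta> j \<le> infdist x F"] i(1) by (simp add: j_def)
        then have "x \<in> R i" using j i(1) x by (simp add: R_def)
        moreover have "i = (i - n) + n" using i(2) by simp
        ultimately show ?thesis by (metis UN_iff UNIV_I UnI2)
      qed
    qed
    then have "hausdorff1_outer (A - F) \<le> hausdorff1_outer (An n) + hausdorff1_outer (\<Union>m. R (m + n))"
      by (rule order_trans[OF hausdorff1_outer_mono hausdorff1_outer_Un])
    also have "hausdorff1_outer (\<Union>m. R (m + n)) \<le> ennreal e" by (rule order_trans[OF hausdorff1_outer_subadditive n])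
    finally have 1: "hausdorff1_outer (A - F) \<le> hausdorff1_outer (An n) + ennreal e" by (simp add: add_left_mono)
    have "hausdorff1_outer (A \<inter> F) + hausdorff1_outer (An n) \<le> hausdorff1_outer ((A \<inter> F) \<union> An n)"
    proof (rule hausdorff1_outer_metric[OF \<delta>(1)[of n]])
      fix a b assume ab: "a \<in> A \<inter> F" "b \<in> An n"
      then have "infdist b F \<le> dist b a" by (intro infdist_le) simp
      then show "\<delta> n \<le> dist a b" using ab by (simp add: An_def dist_commute)
    qed
    also have "\<dots> \<le> hausdorff1_outer A" by (rule hausdorff1_outer_mono) (auto simp: An_def)
    finally have "hausdorff1_outer (A \<inter> F) + hausdorff1_outer (An n) + ennreal e \<le> hausdorff1_outer A + ennreal e" by (rule add_right_mono)
    then show "hausdorff1_outer (A \<inter> F) + hausdorff1_outer (A - F) \<le> hausdorff1_outer A + ennreal e"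
      using order_trans[OF add_left_mono[OF 1, of "hausdorff1_outer (A \<inter> F)"]] by (simp only: add.assoc)
  qed
qed

text \<open>The value of \<open>measure_of\<close> is the outer measure only once countable
  additivity on the Borel sets is known. Closed sets satisfy Caratheodory's criterion, and the sets
  satisfying it form a sigma algebra on which the outer measure is additive.\<close>

lemma emeasure_hausdorff1:
  fixes A :: "'a::metric_space set"
  assumes A: "A \<in> sets borel" shows "emeasure hausdorff1 A = hausdorff1_outer A"
proof -
  interpret P: sigma_algebra UNIV "Pow UNIV :: 'a set set" by (rule sigma_algebra_Pow)
  define L where "L = lambda_system UNIV (Pow UNIV) (hausdorff1_outer :: 'a set \<Rightarrow> ennreal)"
  have "outer_measure_space (Pow UNIV) (hausdorff1_outer :: 'a set \<Rightarrow> ennreal)"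
    unfolding outer_measure_space_def positive_def increasing_def countably_subadditive_def
    using hausdorff1_outer_empty hausdorff1_outer_mono hausdorff1_outer_subadditive by auto
  from P.caratheodory_lemma[OF this] have L: "measure_space UNIV L (hausdorff1_outer :: 'a set \<Rightarrow> ennreal)" by (simp add: L_def)
  have "F \<in> L" if F: "closed F" for F :: "'a set"
  proof -
    have "hausdorff1_outer (X \<inter> F) + hausdorff1_outer (X - F) = hausdorff1_outer X" for X
    proof (rule antisym[OF hausdorff1_outer_caratheodory_closed[OF F]])
      have "X = (X \<inter> F) \<union> (X - F)" by blast
      then show "hausdorff1_outer X \<le> hausdorff1_outer (X \<inter> F) + hausdorff1_outer (X - F)" using hausdorff1_outer_Un by metis
    qed
    then show ?thesis unfolding L_def P.lambda_system_eq by blast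
  qed
  then have "sigma_sets UNIV (Collect closed) \<subseteq> L"
    using L by (intro sigma_algebra.sigma_sets_subset) (auto simp: measure_space_def)
  then have bL: "sets (borel :: 'a measure) \<subseteq> L" by (simp add: borel_eq_closed)
  have "countably_additive (sets (borel :: 'a measure)) hausdorff1_outer"
    unfolding countably_additive_def
  proof (intro allI impI)
    fix A :: "nat \<Rightarrow> 'a set" assume A: "range A \<subseteq> sets borel" "disjoint_family A" "(\<Union>i. A i) \<in> sets borel"
    have "range A \<subseteq> L" using A(1) bL by (rule subset_trans)
    moreover have "(\<Union>i. A i) \<in> L" using A(3) bL by (rule subsetD[rotated])
    moreover have "\<forall>A. range A \<subseteq> L \<longrightarrow> disjoint_family A \<longrightarrow> (\<Union>i. A i) \<in> L \<longrightarrow> (\<Sum>i. hausdorff1_outer (A i)) = hausdorff1_outer (\<Union>i. A i)"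
      using L unfolding measure_space_def countably_additive_def by simp
    ultimately show "(\<Sum>i. hausdorff1_outer (A i)) = hausdorff1_outer (\<Union>i. A i)"
      using A(2) by simp
  qed
  moreover have "positive (sets (borel :: 'a measure)) hausdorff1_outer" by (simp add: positive_def hausdorff1_outer_empty)
  moreover have "sigma_algebra UNIV (sets (borel :: 'a measure))" using sets.sigma_algebra_axioms[of "borel :: 'a measure"] by simp
  ultimately show ?thesis unfolding hausdorff1_def using A by (intro emeasure_measure_of_sigma) auto
qed

lemma sets_hausdorff1 [simp, measurable_cong]: "sets hausdorff1 = sets borel"
  using sets.sigma_sets_eq[of borel] by (simp add: hausdorff1_def)

lemma space_hausdorff1 [simp]: "space hausdorff1 = UNIV"
  by (simp add: hausdorff1_def space_measure_of_conv)

text \<open>Cutting the parameter interval into n pieces of length h with B h \<le> \<delta> gives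
  an admissible cover whose diameters sum to at most B (c - a), uniformly in \<delta>.\<close>

lemma hausdorff1_outer_lipschitz_curve:
  fixes \<gamma> :: "real \<Rightarrow> 'a::metric_space"
  assumes ab: "a \<le> c" and B: "0 < B" and lip: "\<And>s t. s \<in> {a..c} \<Longrightarrow> t \<in> {a..c} \<Longrightarrow> dist (\<gamma> s) (\<gamma> t) \<le> B * \<bar>s - t\<bar>"
  shows "hausdorff1_outer (\<gamma> ` {a..c}) \<le> ennreal (B * (c - a))"
proof (rule hausdorff1_outer_least)
  fix \<delta> :: real assume \<delta>: "0 < \<delta>"
  obtain n :: nat where n: "B * (c - a) / \<delta> < real n" using reals_Archimedean2 by blast
  have n0: "0 < real n" by (rule le_less_trans[OF _ n]) (use B \<delta> ab in simp)
  define h where "h = (c - a) / real n"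
  have h: "0 \<le> h" "B * h \<le> \<delta>" "real n * h = c - a" using ab n n0 \<delta> B by (auto simp: h_def field_simps)
  define J where "J i = {a + real i * h .. a + real (Suc i) * h}" for i :: nat
  define C where "C i = (if i < n then \<gamma> ` J i else {})" for i
  have J: "J i \<subseteq> {a..c}" if "i < n" for i
  proof -
    have "real (Suc i) * h \<le> real n * h" using that h(1) by (intro mult_right_mono) auto
    then show ?thesis using h by (auto simp: J_def)
  qed
  have dd: "dist x y \<le> B * h" if "x \<in> C i" "y \<in> C i" for x y i
  proof -
    have i: "i < n" using that by (auto simp: C_def split: if_splits)
    then have "x \<in> \<gamma> ` J i" "y \<in> \<gamma> ` J i" using that by (simp_all add: C_def)
    with i obtain s t where st: "i < n" "s \<in> J i" "t \<in> J i" "x = \<gamma> s" "y = \<gamma> t" by blast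
    have "dist x y \<le> B * \<bar>s - t\<bar>" using lip[OF subsetD[OF J[OF st(1)] st(2)] subsetD[OF J[OF st(1)] st(3)]] st by simp
    also have "\<dots> \<le> B * h" using st B by (intro mult_left_mono) (auto simp: J_def algebra_simps)
    finally show ?thesis .
  qed
  have bdd: "bounded (C i)" for i
  proof (cases "C i = {}")
    case False then obtain x where "x \<in> C i" by blast
    then show ?thesis using dd unfolding bounded_def by blast
  qed simp
  have diam: "diameter (C i) \<le> B * h" for i
  proof (cases "C i = {}")
    case False then show ?thesis using dd by (auto simp: diameter_def intro!: cSUP_least)
  next
    case True then show ?thesis using B h(1) by (simp add: diameter_def)
  qed
  have "delta_cover \<delta> (\<gamma> ` {a..c}) C"
    unfolding delta_cover_def
  proof (intro conjI allI subsetI bdd)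
    show "diameter (C i) \<le> \<delta>" for i using diam[of i] h(2) by simp
    fix x assume "x \<in> \<gamma> ` {a..c}"
    then obtain t where t: "t \<in> {a..c}" "x = \<gamma> t" by blast
    show "x \<in> (\<Union>i. C i)"
    proof (cases "h = 0")
      case True
      then have "t = a" using h(3) t by simp
      then have "t \<in> J 0" using True by (simp add: J_def)
      then show ?thesis using n0 t by (auto simp: C_def intro!: exI[of _ 0])
    next
      case False
      then have hp: "0 < h" using h(1) by simp
      \<comment> \<open>The minimum assigns the right end point c, for which the quotient equals n,
        to the last piece.\<close>
      define i where "i = min (n - 1) (nat \<lfloor>(t - a) / h\<rfloor>)"
      have q: "0 \<le> (t - a) / h" using t hp by simp
      have "i < n" using n0 by (auto simp: i_def)
      moreover have "t \<in> J i"
      proof (cases "nat \<lfloor>(t - a) / h\<rfloor> \<le> n - 1")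
        case True
        then have "real i = of_int \<lfloor>(t - a) / h\<rfloor>" using q by (simp add: i_def)
        then have "real i \<le> (t - a) / h" "(t - a) / h \<le> real i + 1" by linarith+
        then show ?thesis using hp by (simp add: J_def field_simps)
      next
        case F: False
        then have i: "i = n - 1" by (simp add: i_def)
        have "real (n - 1) + 1 \<le> (t - a) / h" using F q n0 by linarith
        then have "real n * h \<le> t - a" using n0 hp by (simp add: field_simps of_nat_diff)
        then have "t = a + real n * h" using t h(3) by simp
        then show ?thesis using i n0 hp by (simp add: J_def of_nat_diff algebra_simps)
      qed
      ultimately show ?thesis using t by (auto simp: C_def intro!: exI[of _ i])
    qed
  qed
  then have "hausdorff1_pre \<delta> (\<gamma> ` {a..c}) \<le> (\<Sum>i. ennreal (diameter (C i)))" by (rule hausdorff1_pre_le)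
  also have "\<dots> = (\<Sum>i<n. ennreal (diameter (C i)))" by (rule suminf_finite) (auto simp: C_def diameter_def)
  also have "\<dots> \<le> (\<Sum>i<n. ennreal (B * h))" by (intro sum_mono ennreal_leI diam)
  also have "\<dots> = ennreal (real n * (B * h))" using B h(1) by (simp add: ennreal_mult ennreal_of_nat_eq_real_of_nat)
  also have "real n * (B * h) = B * (c - a)" using h(3) by (simp add: mult.left_commute)
  finally show "hausdorff1_pre \<delta> (\<gamma> ` {a..c}) \<le> ennreal (B * (c - a))" .
qed

section \<open>Layer averages and the Hausdorff measure\<close>

context ubc_domain begin

lemma compact_frontier_dom: "compact (frontier \<Omega>)"
  using bounded_dom compact_frontier_bounded by blast

text \<open>Locally the boundary is a Lipschitz curve, and finitely many such pieces cover it.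
  Finite length makes the boundary integral of the squared curvature derivative a genuine one and
  not the default value 0 of a nonintegrable function.\<close>

lemma frontier_outer_finite: "hausdorff1_outer (frontier \<Omega>) < top"
proof -
  have "\<exists>V. open V \<and> y \<in> V \<and> hausdorff1_outer (frontier \<Omega> \<inter> V) < top" if y: "y \<in> frontier \<Omega>" for y
  proof -
    obtain U co \<gamma> \<phi>1 \<phi>2 \<phi>3 \<rho> \<gamma>' where p: "boundary_param \<Omega> y U co \<gamma> \<phi>1 \<phi>2 \<phi>3 \<rho> \<gamma>'"
      by (rule boundary_parametrization[OF reg y])
    then have P: "open U" "y \<in> U" "continuous_on UNIV co"
      "\<And>z. z \<in> frontier \<Omega> \<Longrightarrow> z \<in> U \<Longrightarrow> \<gamma> (co z) = z"
      "\<And>t. (\<gamma> has_vector_derivative \<gamma>' t) (at t)" "continuous_on UNIV \<gamma>'"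
      unfolding boundary_param_def by blast+
    define V where "V = U \<inter> {z. co y - 1 < co z} \<inter> {z. co z < co y + 1}"
    have V: "open V" "y \<in> V" unfolding V_def using P(1,2,3)
      by (auto intro!: open_Int open_Collect_less continuous_intros)
    define J where "J = {co y - 1 .. co y + 1}"
    have "compact (\<gamma>' ` J)" unfolding J_def by (intro compact_continuous_image continuous_on_subset[OF P(6)]) auto
    then obtain B where B: "0 < B" "\<And>t. t \<in> J \<Longrightarrow> norm (\<gamma>' t) \<le> B"
      using compact_imp_bounded bounded_pos by (metis image_eqI)
    have "dist (\<gamma> s) (\<gamma> t) \<le> B * \<bar>s - t\<bar>" if "s \<in> J" "t \<in> J" for s t
    proof -
      have "norm (\<gamma> s - \<gamma> t) \<le> B * norm (s - t)"
      proof (rule differentiable_bound[of J \<gamma> "\<lambda>t h. h *\<^sub>R \<gamma>' t"])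
        show "convex J" by (simp add: J_def)
        show "(\<gamma> has_derivative (\<lambda>h. h *\<^sub>R \<gamma>' t)) (at t within J)" for t
          using P(5)[of t] by (simp add: has_vector_derivative_def has_derivative_at_withinI)
        show "onorm (\<lambda>h. h *\<^sub>R \<gamma>' t) \<le> B" if "t \<in> J" for t
          by (rule onorm_bound) (use B that in \<open>auto simp: mult.commute[of B] intro!: mult_left_mono\<close>)
      qed (use that in auto)
      then show ?thesis by (simp add: dist_norm)
    qed
    then have "hausdorff1_outer (\<gamma> ` J) \<le> ennreal (B * (co y + 1 - (co y - 1)))"
      unfolding J_def by (intro hausdorff1_outer_lipschitz_curve B) auto
    moreover have "frontier \<Omega> \<inter> V \<subseteq> \<gamma> ` J"
    proof
      fix z assume z: "z \<in> frontier \<Omega> \<inter> V"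
      then have "\<gamma> (co z) = z" using P(4) by (simp add: V_def)
      moreover have "co z \<in> J" using z by (auto simp: V_def J_def)
      ultimately show "z \<in> \<gamma> ` J" by force
    qed
    ultimately have "hausdorff1_outer (frontier \<Omega> \<inter> V) < top" by (meson hausdorff1_outer_mono order_trans ennreal_less_top le_less_trans)
    then show ?thesis using V by blast
  qed
  then obtain V where V: "\<And>y. y \<in> frontier \<Omega> \<Longrightarrow> open (V y) \<and> y \<in> V y \<and> hausdorff1_outer (frontier \<Omega> \<inter> V y) < top" by metis
  have "frontier \<Omega> \<subseteq> (\<Union>y\<in>frontier \<Omega>. V y)" using V by blast
  then obtain D where D: "D \<subseteq> frontier \<Omega>" "finite D" "frontier \<Omega> \<subseteq> (\<Union>y\<in>D. V y)"
    using compactE_image[OF compact_frontier_dom, of "frontier \<Omega>" V] V by metis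
  have "hausdorff1_outer (\<Union>y\<in>D. frontier \<Omega> \<inter> V y) < top"
    using D(2,1)
  proof (induction D)
    case empty then show ?case by (simp add: hausdorff1_outer_empty)
  next
    case (insert y D)
    have "hausdorff1_outer (\<Union>z\<in>insert y D. frontier \<Omega> \<inter> V z) \<le> hausdorff1_outer (frontier \<Omega> \<inter> V y) + hausdorff1_outer (\<Union>z\<in>D. frontier \<Omega> \<inter> V z)"
      using hausdorff1_outer_Un by simp
    also have "\<dots> < top" using insert V[of y] by simp
    finally show ?case .
  qed
  moreover have "frontier \<Omega> = (\<Union>y\<in>D. frontier \<Omega> \<inter> V y)" using D(3) by blast
  ultimately show ?thesis by simp
qed

text \<open>Tangent and normal form an orthonormal frame, so T is a linear isometry and the set is a
  translated, rotated box with sides 2a and 2a + c.\<close>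

lemma tube_measure:
  assumes y: "y \<in> frontier \<Omega>" and e: "0 \<le> a" "0 \<le> c"
  shows "emeasure lborel {z. \<bar>(z - y) \<bullet> \<tau> y\<bar> \<le> a \<and> - c - a \<le> (z - y) \<bullet> \<nu> y \<and> (z - y) \<bullet> \<nu> y \<le> a} = ennreal (2 * a * (2 * a + c))"
    (is "emeasure lborel ?S = _")
proof -
  define T where "T v = v$1 *\<^sub>R \<tau> y + v$2 *\<^sub>R \<nu> y" for v :: "real^2"
  have one: "\<tau> y \<bullet> \<tau> y = 1" "\<nu> y \<bullet> \<nu> y = 1" using norm_tau[OF y] norm_nu[OF y] by (simp_all add: dot_square_norm)
  have "linear T" unfolding T_def by (intro linearI) (simp_all add: algebra_simps)
  moreover have "T v \<bullet> T w = v \<bullet> w" for v w unfolding T_def by (simp add: inner_add one tau_nu) (simp add: inner_2)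
  ultimately have oT: "orthogonal_transformation T" by (simp add: orthogonal_transformation_def)
  define C :: "(real^2) set" where "C = cbox (vector [- a, - c - a]) (vector [a, a])"
  have Tz: "z = T (vector [z \<bullet> \<tau> y, z \<bullet> \<nu> y])" for z
  proof -
    have "(\<nu> y $ 1)\<^sup>2 + (\<nu> y $ 2)\<^sup>2 = 1" using one(2) by (simp add: inner_2 power2_eq_square)
    then have q: "(\<nu> y $ 1) * (\<nu> y $ 1) + (\<nu> y $ 2) * (\<nu> y $ 2) = 1" by (simp add: power2_eq_square)
    have "T (vector [z \<bullet> \<tau> y, z \<bullet> \<nu> y]) $ 1 = z$1 * ((\<nu> y $ 1) * (\<nu> y $ 1) + (\<nu> y $ 2) * (\<nu> y $ 2))"
      "T (vector [z \<bullet> \<tau> y, z \<bullet> \<nu> y]) $ 2 = z$2 * ((\<nu> y $ 1) * (\<nu> y $ 1) + (\<nu> y $ 2) * (\<nu> y $ 2))"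
      by (simp_all add: T_def inner_2 unit_tangent_def algebra_simps)
    then show ?thesis unfolding q by (simp add: vec2_eq)
  qed
  have Td: "T v \<bullet> \<tau> y = v$1" "T v \<bullet> \<nu> y = v$2" for v unfolding T_def by (simp_all add: inner_add one tau_nu)
  have inC: "v \<in> C \<longleftrightarrow> - a \<le> v$1 \<and> v$1 \<le> a \<and> - c - a \<le> v$2 \<and> v$2 \<le> a" for v
    by (auto simp: C_def mem_box_cart forall_2)
  have S: "?S = (+) y ` (T ` C)"
  proof (intro set_eqI iffI)
    fix z assume z: "z \<in> ?S"
    define v :: "real^2" where "v = vector [(z - y) \<bullet> \<tau> y, (z - y) \<bullet> \<nu> y]"
    have "v \<in> C" using z by (auto simp: inC v_def)
    moreover have "z = y + T v" using Tz[of "z - y"] by (simp add: v_def)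
    ultimately show "z \<in> (+) y ` (T ` C)" by blast
  qed (auto simp: Td inC)
  have lC: "C \<in> lmeasurable" by (simp add: C_def)
  have "measure lebesgue ?S = measure lebesgue (T ` C)" unfolding S by (rule measure_translation)
  also have "\<dots> = measure lebesgue C" by (rule measure_orthogonal_image[OF oT lC])
  also have "\<dots> = 2 * a * (2 * a + c)"
  proof -
    have "0 \<in> C" using e by (simp add: inC)
    then have "C \<noteq> {}" by blast
    then have "measure lebesgue C = (\<Prod>i\<in>UNIV. (vector [a, a] :: real^2) $ i - vector [- a, - c - a] $ i)"
      unfolding C_def by (simp add: content_cbox_cart)
    then show ?thesis by (simp add: UNIV_2 algebra_simps)
  qed
  finally have m: "measure lebesgue ?S = 2 * a * (2 * a + c)" .
  have "compact (T ` C)"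
    by (rule compact_continuous_image) (use \<open>linear T\<close> in \<open>auto simp: C_def linear_continuous_on linear_conv_bounded_linear\<close>)
  then have "compact ?S" unfolding S by (rule compact_translation)
  then have b: "?S \<in> sets borel" and l: "?S \<in> lmeasurable" by (auto simp: lmeasurable_compact borel_compact)
  have "emeasure lborel ?S = emeasure lebesgue ?S" using b by simp
  also have "\<dots> = ennreal (measure lebesgue ?S)" using l by (intro emeasure_eq_ennreal_measure fmeasurableD2)
  finally show ?thesis unfolding m .
qed

text \<open>Take a cover of the boundary part by sets of diameter \<delta>_i \<le> \<epsilon>. The
  points of the layer above one such set fit into a rectangle with sides 4 \<delta>_i and 4
  \<delta>_i + 2 \<epsilon>, whose area is at most 24 \<epsilon> \<delta>_i. Summation gives
  \<epsilon> times the premeasure of the cover.\<close>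

lemma tube_cover:
  assumes e: "0 < \<epsilon>" "2 * \<epsilon> \<le> r / 2"
  shows "emeasure lborel {x \<in> \<Omega>. dst x < 2 * \<epsilon> \<and> proj x \<in> A} \<le> ennreal (24 * \<epsilon>) * hausdorff1_outer (A \<inter> frontier \<Omega>)"
    (is "emeasure lborel ?X \<le> _")
proof -
  have key: "emeasure lborel ?X \<le> ennreal (24 * \<epsilon>) * (\<Sum>i. ennreal (diameter (C i)))" if C: "delta_cover \<epsilon> (A \<inter> frontier \<Omega>) C" for C
  proof -
    define y where "y i = (SOME y. y \<in> C i \<inter> frontier \<Omega>)" for i
    have y: "y i \<in> C i \<inter> frontier \<Omega>" if "C i \<inter> frontier \<Omega> \<noteq> {}" for i
      unfolding y_def by (rule someI_ex) (use that in blast)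
    have dn: "0 \<le> diameter (C i)" "diameter (C i) \<le> \<epsilon>" for i using C by (auto simp: delta_cover_def diameter_ge_0)
    define Y where "Y i = (if C i \<inter> frontier \<Omega> = {} then {} else
       {z. \<bar>(z - y i) \<bullet> \<tau> (y i)\<bar> \<le> 2 * diameter (C i) \<and> - (2 * \<epsilon>) - 2 * diameter (C i) \<le> (z - y i) \<bullet> \<nu> (y i) \<and> (z - y i) \<bullet> \<nu> (y i) \<le> 2 * diameter (C i)})" for i
    have Yb: "Y i \<in> sets borel" for i
    proof -
      have "closed {z. \<bar>(z - y i) \<bullet> \<tau> (y i)\<bar> \<le> 2 * diameter (C i) \<and> - (2 * \<epsilon>) - 2 * diameter (C i) \<le> (z - y i) \<bullet> \<nu> (y i) \<and> (z - y i) \<bullet> \<nu> (y i) \<le> 2 * diameter (C i)}"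
        by (intro closed_Collect_conj closed_Collect_le continuous_intros)
      then show ?thesis by (simp add: Y_def borel_closed)
    qed
    have Ym: "emeasure lborel (Y i) \<le> ennreal (24 * \<epsilon>) * ennreal (diameter (C i))" for i
    proof (cases "C i \<inter> frontier \<Omega> = {}")
      case False
      have "emeasure lborel (Y i) = ennreal (2 * (2 * diameter (C i)) * (2 * (2 * diameter (C i)) + 2 * \<epsilon>))"
        using tube_measure[of "y i" "2 * diameter (C i)" "2 * \<epsilon>"] y[OF False] dn e False by (simp add: Y_def)
      also have "\<dots> \<le> ennreal (24 * \<epsilon> * diameter (C i))"
      proof (rule ennreal_leI)
        have "diameter (C i) * diameter (C i) \<le> \<epsilon> * diameter (C i)" using dn[of i] by (intro mult_right_mono) auto
        then show "2 * (2 * diameter (C i)) * (2 * (2 * diameter (C i)) + 2 * \<epsilon>) \<le> 24 * \<epsilon> * diameter (C i)" by (simp add: algebra_simps)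
      qed
      finally show ?thesis using e dn by (simp add: ennreal_mult)
    qed (simp add: Y_def)
    have "?X \<subseteq> (\<Union>i. Y i)"
    proof
      fix x assume x: "x \<in> ?X"
      then have xO: "x \<in> \<Omega>" and xd: "dst x < 2 * \<epsilon>" and xA: "proj x \<in> A" by auto
      have z: "proj x \<in> frontier \<Omega>" using proj(1)[OF xO] .
      then obtain i where i: "proj x \<in> C i" using C xA unfolding delta_cover_def by blast
      then have ne: "C i \<inter> frontier \<Omega> \<noteq> {}" using z by blast
      note yi = y[OF ne]
      define \<delta> where "\<delta> = diameter (C i)"
      have zy: "norm (proj x - y i) \<le> \<delta>" using C i yi unfolding delta_cover_def \<delta>_def by (simp add: dist_norm[symmetric] diameter_bounded_bound)
      \<comment> \<open>The point is compared with the normal at \<open>y i\<close> instead of its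
        own; the Lipschitz bound of the normal at depth below r costs one more \<delta>, hence the
        half-width 2 \<delta>.\<close>
      define w where "w = (proj x - y i) - dst x *\<^sub>R (\<nu> (proj x) - \<nu> (y i))"
      have xy: "x - y i = w - dst x *\<^sub>R \<nu> (y i)" using proj_eq[OF xO] by (simp add: w_def algebra_simps)
      have "norm w \<le> norm (proj x - y i) + norm (dst x *\<^sub>R (\<nu> (proj x) - \<nu> (y i)))" unfolding w_def by (rule norm_triangle_ineq4)
      also have "norm (dst x *\<^sub>R (\<nu> (proj x) - \<nu> (y i))) \<le> r * (norm (proj x - y i) / r)"
        using xd e dst_nonneg[of x] yi r_pos by (simp only: norm_scaleR real_norm_def) (intro mult_mono nu_lipschitz z, auto)
      finally have w: "norm w \<le> 2 * \<delta>" using zy r_pos by simp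
      have one: "norm (\<tau> (y i)) = 1" "norm (\<nu> (y i)) = 1" using norm_tau norm_nu yi by auto
      have "\<bar>w \<bullet> \<tau> (y i)\<bar> \<le> 2 * \<delta>" "\<bar>w \<bullet> \<nu> (y i)\<bar> \<le> 2 * \<delta>"
        using Cauchy_Schwarz_ineq2[of w "\<tau> (y i)"] Cauchy_Schwarz_ineq2[of w "\<nu> (y i)"] w one by auto
      moreover have "(x - y i) \<bullet> \<tau> (y i) = w \<bullet> \<tau> (y i)" "(x - y i) \<bullet> \<nu> (y i) = w \<bullet> \<nu> (y i) - dst x"
        unfolding xy using one dot_square_norm[of "\<nu> (y i)"] by (simp_all add: inner_diff tau_nu)
      ultimately have "x \<in> Y i" using ne xd dst_nonneg[of x] unfolding Y_def \<delta>_def[symmetric] by auto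
      then show "x \<in> (\<Union>i. Y i)" by blast
    qed
    then have "emeasure lborel ?X \<le> emeasure lborel (\<Union>i. Y i)" using Yb by (intro emeasure_mono) auto
    also have "\<dots> \<le> (\<Sum>i. emeasure lborel (Y i))" using Yb by (intro emeasure_subadditive_countably) auto
    also have "\<dots> \<le> (\<Sum>i. ennreal (24 * \<epsilon>) * ennreal (diameter (C i)))" by (intro suminf_le Ym summableI)
    also have "\<dots> = ennreal (24 * \<epsilon>) * (\<Sum>i. ennreal (diameter (C i)))" by (rule ennreal_suminf_cmult)
    finally show ?thesis .
  qed
  have inv: "ennreal (1 / (24 * \<epsilon>)) * (ennreal (24 * \<epsilon>) * u) = u" "ennreal (24 * \<epsilon>) * (ennreal (1 / (24 * \<epsilon>)) * u) = u" for u
    using e by (simp_all add: mult.assoc[symmetric] ennreal_mult[symmetric])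
  have "ennreal (1 / (24 * \<epsilon>)) * emeasure lborel ?X \<le> hausdorff1_pre \<epsilon> (A \<inter> frontier \<Omega>)"
  proof (rule hausdorff1_pre_greatest)
    fix C assume "delta_cover \<epsilon> (A \<inter> frontier \<Omega>) C"
    from mult_left_mono[OF key[OF this], of "ennreal (1 / (24 * \<epsilon>))"]
    show "ennreal (1 / (24 * \<epsilon>)) * emeasure lborel ?X \<le> (\<Sum>i. ennreal (diameter (C i)))" unfolding inv(1) by simp
  qed
  also have "\<dots> \<le> hausdorff1_outer (A \<inter> frontier \<Omega>)" by (rule hausdorff1_pre_le_outer[OF e(1)])
  finally have "ennreal (24 * \<epsilon>) * (ennreal (1 / (24 * \<epsilon>)) * emeasure lborel ?X) \<le> ennreal (24 * \<epsilon>) * hausdorff1_outer (A \<inter> frontier \<Omega>)"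
    by (rule mult_left_mono) simp
  then show ?thesis unfolding inv(2) .
qed

text \<open>By \<open>tube_cover\<close>, the image of Lebesgue measure on the layer under
  \<open>proj\<close> is, as a measure, at most 24 \<epsilon> times the Hausdorff measure on the
  boundary. Monotonicity of the integral in the measure then treats all h at once.\<close>

lemma layer_nn_integral:
  assumes e: "0 < \<epsilon>" "2 * \<epsilon> \<le> r / 2" and h: "h \<in> borel_measurable borel"
  defines "S \<equiv> {x \<in> \<Omega>. dst x < 2 * \<epsilon>}"
  shows "(\<integral>\<^sup>+ x. indicator S x * h (proj x) \<partial>lborel) \<le> ennreal (24 * \<epsilon>) * (\<integral>\<^sup>+ y. indicator (frontier \<Omega>) y * h y \<partial>hausdorff1)"
proof -
  have "open {x. dst x < 2 * \<epsilon>}" by (intro open_Collect_less dst_cont continuous_intros)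
  moreover have "S = \<Omega> \<inter> {x. dst x < 2 * \<epsilon>}" by (auto simp: S_def)
  ultimately have oS: "open S" using open_dom by auto
  then have bS [measurable]: "S \<in> sets borel" by simp
  have SL: "S \<subseteq> Lr" using e by (auto simp: S_def Lr_def)
  \<comment> \<open>Continuity of \<open>proj\<close> is known only near the boundary; setting it to
    0 elsewhere makes it Borel on the whole plane.\<close>
  define pj where "pj x = indicator S x *\<^sub>R proj x" for x
  have mpj [measurable]: "pj \<in> borel_measurable borel"
    unfolding pj_def by (rule borel_measurable_continuous_on_indicator[OF bS continuous_on_subset[OF proj_cont SL]])
  have bF [measurable]: "frontier \<Omega> \<in> sets borel" by simp
  note [measurable] = h
  define M1 where "M1 = distr (density lborel (indicator S)) borel pj"
  define M2 where "M2 = density hausdorff1 (\<lambda>y. ennreal (24 * \<epsilon>) * indicator (frontier \<Omega>) y)"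
  have "M1 \<le> M2"
  proof (rule le_measure[THEN iffD2], simp add: M1_def M2_def, intro ballI)
    fix A assume "A \<in> sets M1"
    then have A [measurable]: "A \<in> sets borel" by (simp add: M1_def)
    have "emeasure M1 A = emeasure (density lborel (indicator S)) (pj -` A)"
      unfolding M1_def by (subst emeasure_distr) auto
    also have "\<dots> = emeasure lborel (S \<inter> pj -` A)"
      using measurable_sets_borel[OF mpj A] by (subst emeasure_density) (auto simp: nn_integral_indicator[symmetric] indicator_inter_arith[symmetric] simp del: nn_integral_indicator)
    also have "S \<inter> pj -` A = {x \<in> \<Omega>. dst x < 2 * \<epsilon> \<and> proj x \<in> A}" by (auto simp: S_def pj_def)
    also have "emeasure lborel \<dots> \<le> ennreal (24 * \<epsilon>) * hausdorff1_outer (A \<inter> frontier \<Omega>)" by (rule tube_cover[OF e])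
    also have "hausdorff1_outer (A \<inter> frontier \<Omega>) = emeasure hausdorff1 (A \<inter> frontier \<Omega>)" by (rule emeasure_hausdorff1[symmetric]) simp
    also have "ennreal (24 * \<epsilon>) * emeasure hausdorff1 (A \<inter> frontier \<Omega>) = emeasure M2 A"
    proof -
      have "emeasure M2 A = (\<integral>\<^sup>+ y. ennreal (24 * \<epsilon>) * indicator (frontier \<Omega>) y * indicator A y \<partial>hausdorff1)"
        unfolding M2_def by (rule emeasure_density) auto
      also have "\<dots> = (\<integral>\<^sup>+ y. ennreal (24 * \<epsilon>) * indicator (A \<inter> frontier \<Omega>) y \<partial>hausdorff1)"
        by (rule nn_integral_cong) (auto simp: indicator_def)
      also have "\<dots> = ennreal (24 * \<epsilon>) * emeasure hausdorff1 (A \<inter> frontier \<Omega>)" by (rule nn_integral_cmult_indicator) auto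
      finally show ?thesis ..
    qed
    finally show "emeasure M1 A \<le> emeasure M2 A" .
  qed
  then have "nn_integral M1 h \<le> nn_integral M2 h" by (intro nn_integral_mono_measure) (simp_all add: M1_def M2_def)
  moreover have "nn_integral M1 h = (\<integral>\<^sup>+ x. indicator S x * h (proj x) \<partial>lborel)"
  proof -
    have hp: "(\<lambda>x. h (pj x)) \<in> borel_measurable lborel" using measurable_compose[OF mpj h] by simp
    have "nn_integral M1 h = (\<integral>\<^sup>+ x. h (pj x) \<partial>density lborel (indicator S))"
      unfolding M1_def by (rule nn_integral_distr) (use mpj h in auto)
    also have "\<dots> = (\<integral>\<^sup>+ x. indicator S x * h (pj x) \<partial>lborel)"
      by (rule nn_integral_density[OF _ hp]) simp
    also have "\<dots> = (\<integral>\<^sup>+ x. indicator S x * h (proj x) \<partial>lborel)"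
    proof (rule nn_integral_cong)
      show "indicator S x * h (pj x) = indicator S x * h (proj x)" for x by (cases "x \<in> S") (simp_all add: pj_def)
    qed
    finally show ?thesis .
  qed
  moreover have "nn_integral M2 h = ennreal (24 * \<epsilon>) * (\<integral>\<^sup>+ y. indicator (frontier \<Omega>) y * h y \<partial>hausdorff1)"
  proof -
    have "nn_integral M2 h = (\<integral>\<^sup>+ y. (ennreal (24 * \<epsilon>) * indicator (frontier \<Omega>) y) * h y \<partial>hausdorff1)"
      unfolding M2_def by (rule nn_integral_density) auto
    also have "\<dots> = (\<integral>\<^sup>+ y. ennreal (24 * \<epsilon>) * (indicator (frontier \<Omega>) y * h y) \<partial>hausdorff1)" by (simp only: mult.assoc)
    also have "\<dots> = ennreal (24 * \<epsilon>) * (\<integral>\<^sup>+ y. indicator (frontier \<Omega>) y * h y \<partial>hausdorff1)"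
      by (rule nn_integral_cmult) auto
    finally show ?thesis .
  qed
  ultimately show ?thesis by simp
qed

lemma curvature_deriv_integrable:
  "integrable hausdorff1 (\<lambda>y. indicator (frontier \<Omega>) y *\<^sub>R (d\<kappa> y)\<^sup>2)"
proof -
  have "compact (d\<kappa> ` frontier \<Omega>)" by (rule compact_continuous_image[OF frontier_cont(2) compact_frontier_dom])
  then have "bounded (d\<kappa> ` frontier \<Omega>)" by (rule compact_imp_bounded)
  then obtain B where "\<forall>z\<in>d\<kappa> ` frontier \<Omega>. norm z \<le> B" by (auto simp: bounded_iff)
  then have B: "\<And>y. y \<in> frontier \<Omega> \<Longrightarrow> \<bar>d\<kappa> y\<bar> \<le> B" by simp
  have bF: "frontier \<Omega> \<in> sets borel" by simp
  show ?thesis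
  proof (rule Bochner_Integration.integrable_bound[where f="\<lambda>y. indicator (frontier \<Omega>) y * B\<^sup>2"])
    have "emeasure hausdorff1 (frontier \<Omega>) < \<infinity>" using frontier_outer_finite by (simp add: emeasure_hausdorff1)
    then show "integrable hausdorff1 (\<lambda>y. indicator (frontier \<Omega>) y * B\<^sup>2)" using bF by (auto intro!: integrable_mult_left integrable_real_indicator)
    show "(\<lambda>y. indicator (frontier \<Omega>) y *\<^sub>R (d\<kappa> y)\<^sup>2) \<in> borel_measurable hausdorff1"
      using borel_measurable_continuous_on_indicator[OF bF continuous_on_power[OF frontier_cont(2)], of 2]
      by (simp cong: measurable_cong_sets)
    show "AE y in hausdorff1. norm (indicator (frontier \<Omega>) y *\<^sub>R (d\<kappa> y)\<^sup>2) \<le> norm (indicator (frontier \<Omega>) y * B\<^sup>2)"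
    proof (rule AE_I2)
      fix y show "norm (indicator (frontier \<Omega>) y *\<^sub>R (d\<kappa> y)\<^sup>2) \<le> norm (indicator (frontier \<Omega>) y * B\<^sup>2)"
        using B[of y] abs_ge_zero[of "d\<kappa> y"] by (cases "y \<in> frontier \<Omega>") (auto simp: abs_le_square_iff[symmetric])
    qed
  qed
qed

text \<open>The factor \<epsilon> from the covering cancels the height 1/\<epsilon> of the weight.
  Its constant is 2 (bound of \<epsilon> b) times 4 (from |qq| \<le> 2 |d\<kappa>|) times 24, which
  is 192.\<close>

lemma layer_curvature_bound:
  assumes e: "0 < \<epsilon>" "2 * \<epsilon> < r / 2"
  shows "(LINT x|lborel. layer.b dst \<epsilon> x * (qq x)\<^sup>2) \<le> 192 * (LINT y:frontier \<Omega>|hausdorff1. (d\<kappa> y)\<^sup>2)"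
proof -
  interpret l: layer \<Omega> "r / 2" dst nrm kk by (rule layer)
  define S where "S = {x \<in> \<Omega>. dst x < 2 * \<epsilon>}"
  define h where "h y = indicator (frontier \<Omega>) y *\<^sub>R (d\<kappa> y)\<^sup>2" for y
  have bF: "frontier \<Omega> \<in> sets borel" by simp
  have hm: "h \<in> borel_measurable borel"
    unfolding h_def[abs_def] using borel_measurable_continuous_on_indicator[OF bF continuous_on_power[OF frontier_cont(2)], of 2] by simp
  have h0: "0 \<le> h y" for y by (simp add: h_def)
  have LL: "l.L = Lr" by (simp add: l.L_def Lr_def)
  have i: "integrable lborel (\<lambda>x. l.b \<epsilon> x * (qq x)\<^sup>2)"
    using l.integrable_b[of "\<lambda>x. (qq x)\<^sup>2" \<epsilon>] kk_cont(2) e unfolding LL by (auto intro!: continuous_intros)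
  have "ennreal (LINT x|lborel. l.b \<epsilon> x * (qq x)\<^sup>2) = (\<integral>\<^sup>+ x. ennreal (l.b \<epsilon> x * (qq x)\<^sup>2) \<partial>lborel)"
    by (rule nn_integral_eq_integral[symmetric, OF i]) (use l.b_bounds(1)[OF e(1)] in auto)
  also have "\<dots> \<le> (\<integral>\<^sup>+ x. indicator S x * ennreal (8 / \<epsilon> * h (proj x)) \<partial>lborel)"
  proof (rule nn_integral_mono)
    fix x
    show "ennreal (l.b \<epsilon> x * (qq x)\<^sup>2) \<le> indicator S x * ennreal (8 / \<epsilon> * h (proj x))"
    proof (cases "l.b \<epsilon> x = 0")
      case False
      then have x: "x \<in> Lr" "x \<in> S" using l.b_nz[OF e False] by (auto simp: LL S_def Lr_def)
      have "\<bar>qq x\<bar>\<^sup>2 \<le> (2 * \<bar>d\<kappa> (proj x)\<bar>)\<^sup>2" by (rule power_mono[OF K_partials(2)[OF x(1)]]) simp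
      then have "(qq x)\<^sup>2 \<le> (2 * \<bar>d\<kappa> (proj x)\<bar>)\<^sup>2" by simp
      also have "\<dots> = 4 * h (proj x)" using proj_frontier[OF x(1)] by (simp add: h_def power_mult_distrib)
      finally have "l.b \<epsilon> x * (qq x)\<^sup>2 \<le> 2 / \<epsilon> * (4 * h (proj x))"
        using l.b_bounds[OF e(1), of x] e(1) by (intro mult_mono) auto
      then show ?thesis using x(2) by (simp add: ennreal_leI)
    qed simp
  qed
  also have "\<dots> \<le> ennreal (24 * \<epsilon>) * (\<integral>\<^sup>+ y. indicator (frontier \<Omega>) y * ennreal (8 / \<epsilon> * h y) \<partial>hausdorff1)"
    unfolding S_def by (rule layer_nn_integral) (use e hm in auto)
  also have "(\<integral>\<^sup>+ y. indicator (frontier \<Omega>) y * ennreal (8 / \<epsilon> * h y) \<partial>hausdorff1) = (\<integral>\<^sup>+ y. ennreal (8 / \<epsilon> * h y) \<partial>hausdorff1)"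
    by (rule nn_integral_cong) (auto simp: h_def indicator_def)
  also have "\<dots> = ennreal (8 / \<epsilon> * (LINT y|hausdorff1. h y))"
  proof -
    have hi: "integrable hausdorff1 h" unfolding h_def[abs_def] by (rule curvature_deriv_integrable)
    have "(\<integral>\<^sup>+ y. ennreal (8 / \<epsilon> * h y) \<partial>hausdorff1) = ennreal (LINT y|hausdorff1. 8 / \<epsilon> * h y)"
      by (rule nn_integral_eq_integral) (use hi h0 e in auto)
    then show ?thesis by simp
  qed
  also have "ennreal (24 * \<epsilon>) * ennreal (8 / \<epsilon> * (LINT y|hausdorff1. h y)) = ennreal (192 * (LINT y|hausdorff1. h y))"
    using e h0 by (simp add: ennreal_mult[symmetric] integral_nonneg_AE)
  finally have "(LINT x|lborel. l.b \<epsilon> x * (qq x)\<^sup>2) \<le> 192 * (LINT y|hausdorff1. h y)"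
    by (subst (asm) ennreal_le_iff) (use h0 in \<open>auto intro!: integral_nonneg_AE mult_nonneg_nonneg\<close>)
  then show ?thesis by (simp add: h_def set_lebesgue_integral_def)
qed

end

section \<open>Existence of a uniform ball radius\<close>

text \<open>Two applications of the mean value inequality, first to \<open>g1\<close> and then to g
  minus its tangent. The factor 1/2 of Taylor's formula is given away.\<close>

lemma second_order_bound:
  fixes g g1 g2 :: "real \<Rightarrow> real"
  assumes g: "\<And>t. (g has_real_derivative g1 t) (at t)" "\<And>t. (g1 has_real_derivative g2 t) (at t)"
    and M: "\<And>t. t \<in> closed_segment a b \<Longrightarrow> \<bar>g2 t\<bar> \<le> M"
  shows "\<bar>g b - g a - g1 a * (b - a)\<bar> \<le> M * (b - a)\<^sup>2"
proof -
  define S where "S = closed_segment a b"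
  have S: "convex S" "a \<in> S" "b \<in> S" by (simp_all add: S_def)
  have M0: "0 \<le> M" using M[of a] by simp
  have 1: "\<bar>g1 t - g1 a\<bar> \<le> M * \<bar>b - a\<bar>" if t: "t \<in> S" for t
  proof -
    have "norm (g1 t - g1 a) \<le> M * norm (t - a)"
      by (rule field_differentiable_bound[OF S(1), of g1 g2])
        (use g(2) M S t in \<open>auto simp: S_def intro: has_field_derivative_at_within\<close>)
    also have "\<dots> \<le> M * \<bar>b - a\<bar>"
      using t M0 by (intro mult_left_mono) (auto simp: S_def closed_segment_eq_real_ivl split: if_splits)
    finally show ?thesis by simp
  qed
  have "norm ((g b - g1 a * b) - (g a - g1 a * a)) \<le> (M * \<bar>b - a\<bar>) * norm (b - a)"
  proof (rule field_differentiable_bound[OF S(1), of "\<lambda>t. g t - g1 a * t" "\<lambda>t. g1 t - g1 a"])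
    show "((\<lambda>t. g t - g1 a * t) has_field_derivative g1 t - g1 a) (at t within S)" for t
      by (rule has_field_derivative_at_within) (auto intro!: derivative_eq_intros g)
  qed (use 1 S in auto)
  then show ?thesis by (simp add: algebra_simps power2_eq_square abs_mult_self_eq)
qed

context chart begin

lemma normal_component: "sqrt (1 + (g1 t)\<^sup>2) * (h \<bullet> \<nu> t) = (Q *v h) $ 2 - g1 t * (Q *v h) $ 1"
proof -
  have "sqrt (1 + (g1 t)\<^sup>2) * (h \<bullet> \<nu> t) = h \<bullet> (transpose Q *v vector [- g1 t, 1])"
    using root_pos(2)[of t] by (simp add: graph_normal_def)
  also have "\<dots> = (Q *v h) $ 2 - g1 t * (Q *v h) $ 1"
    unfolding inner_2 matvec_2(3,4) matvec_2(1,2)[of Q h] vector_2 by (simp add: algebra_simps)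
  finally show ?thesis .
qed

lemma coord_le: "\<bar>coord h\<bar> \<le> norm h"
proof -
  have "(norm h)\<^sup>2 = ((Q$1$1)\<^sup>2 + (Q$1$2)\<^sup>2) * (norm h)\<^sup>2" unfolding Q2(3) by simp
  also have "\<dots> = (coord h)\<^sup>2 + ((Q *v h) $ 2)\<^sup>2"
    unfolding norm_sq_2 matvec_2(1,2) Q2(1,2) by (simp add: power2_eq_square algebra_simps)
  finally have "\<bar>coord h\<bar>\<^sup>2 \<le> (norm h)\<^sup>2" by simp
  then show ?thesis by (rule power2_le_imp_le) simp
qed

text \<open>The graph deviates from its tangent by at most M |w|^2 at displacement w. A point of a
  ball of radius r touching y has normal component larger than |w|^2 / (2r) in absolute value, and
  this wins as soon as 2 r M \<le> 1.\<close>

lemma local_balls: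
  assumes g2: "\<And>t. (g1 has_real_derivative g2 t) (at t)" "continuous_on UNIV g2"
    and y0: "y0 \<in> U"
  shows "\<exists>\<rho>>0. \<forall>y\<in>frontier \<Omega> \<inter> ball y0 \<rho>. \<forall>r. 0 < r \<and> r \<le> \<rho> \<longrightarrow>
    ball (y - r *\<^sub>R \<nu> (coord y)) r \<subseteq> \<Omega> \<and> ball (y + r *\<^sub>R \<nu> (coord y)) r \<subseteq> - \<Omega>"
proof -
  obtain R where R: "0 < R" "ball y0 R \<subseteq> U" using open_U y0 open_contains_ball by blast
  define J where "J = {coord y0 - R .. coord y0 + R}"
  have "compact (g2 ` J)" unfolding J_def by (intro compact_continuous_image continuous_on_subset[OF g2(2)]) auto
  then have "bounded (g2 ` J)" by (rule compact_imp_bounded)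
  then obtain M where M: "0 < M" "\<And>t. t \<in> J \<Longrightarrow> \<bar>g2 t\<bar> \<le> M" by (auto simp: bounded_pos)
  \<comment> \<open>With R/4, a ball of diameter 2r at a boundary point within \<rho> of
    \<open>y0\<close> stays in \<open>ball y0 R\<close>; with 1 / (2 * M), the ball is thinner than
    the deviation of the graph.\<close>
  define \<rho> where "\<rho> = min (R / 4) (1 / (2 * M))"
  have \<rho>: "0 < \<rho>" "\<rho> \<le> R / 4" "\<rho> \<le> 1 / (2 * M)" using R M by (auto simp: \<rho>_def)
  show ?thesis
  proof (intro exI[of _ \<rho>] conjI ballI allI impI \<rho>(1))
    fix y r assume y: "y \<in> frontier \<Omega> \<inter> ball y0 \<rho>" and r: "0 < r \<and> r \<le> \<rho>"
    have yU: "y \<in> U" using y R \<rho> by auto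
    define a where "a = coord y"
    have ga: "(Q *v y) $ 2 = g a" using frontier_graph[of y] y yU by (simp add: a_def)
    have nn: "\<nu> a \<bullet> \<nu> a = 1" using norm_\<nu>[of a] by (simp add: dot_square_norm)
    have rt: "1 \<le> sqrt (1 + (g1 a)\<^sup>2)" by simp
    have rM: "M * (2 * r) \<le> 1"
    proof -
      have "M * (2 * r) \<le> M * (2 * (1 / (2 * M)))" using r \<rho>(3) M(1) by (intro mult_left_mono) auto
      then show ?thesis using M(1) by simp
    qed
    have key: "z \<in> U \<and> \<bar>g (coord z) - g a - g1 a * coord w\<bar> \<le> M * (norm w)\<^sup>2 \<and> (Q *v z) $ 2 = g a + (Q *v w) $ 2"
      if z: "norm w < 2 * r" "w = z - y" for z w
    proof -
      have zy: "dist y0 z < R"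
      proof -
        have "dist y0 z \<le> dist y0 y + dist y z" by (rule dist_triangle)
        also have "dist y z = norm w" by (simp add: z(2) dist_norm norm_minus_commute)
        finally show ?thesis using z(1) y r \<rho>(2) R(1) by simp
      qed
      have e: "coord z = a + coord w" "(Q *v z) $ 2 = g a + (Q *v w) $ 2" using ga by (simp_all add: z(2) a_def matrix_vector_mult_diff_distrib)
      have "\<bar>coord (z - y0)\<bar> \<le> R" "\<bar>coord (y - y0)\<bar> \<le> R"
        using coord_le[of "z - y0"] coord_le[of "y - y0"] zy y \<rho>(2) R(1) by (auto simp: dist_norm norm_minus_commute)
      then have "coord z \<in> J" "a \<in> J" by (auto simp: J_def a_def matrix_vector_mult_diff_distrib)
      then have "closed_segment a (coord z) \<subseteq> J" by (auto simp: J_def closed_segment_eq_real_ivl)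
      then have "\<bar>g (coord z) - g a - g1 a * (coord z - a)\<bar> \<le> M * (coord z - a)\<^sup>2"
        by (intro second_order_bound[OF g g2(1)] M(2)) auto
      also have "\<dots> \<le> M * (norm w)\<^sup>2" using coord_le[of w] M(1) e(1) by (intro mult_left_mono) (simp_all add: abs_le_square_iff[symmetric])
      finally show ?thesis using zy R(2) e by auto
    qed
    \<comment> \<open>The values c = r and c = -r treat the inner and the outer ball
      together.\<close>
    have small: "norm w < 2 * r" if "norm (w + c *\<^sub>R \<nu> a) < r" "\<bar>c\<bar> = r" for w c
      using norm_triangle_ineq4[of "w + c *\<^sub>R \<nu> a" "c *\<^sub>R \<nu> a"] that norm_\<nu>[of a] by simp
    have sq: "(norm w)\<^sup>2 + 2 * c * (w \<bullet> \<nu> a) < 0" if "norm (w + c *\<^sub>R \<nu> a) < r" "\<bar>c\<bar> = r" for w c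
    proof -
      have "(norm (w + c *\<^sub>R \<nu> a))\<^sup>2 < r\<^sup>2" using that(1) by (intro power_strict_mono) auto
      moreover have "(norm (w + c *\<^sub>R \<nu> a))\<^sup>2 = (norm w)\<^sup>2 + 2 * c * (w \<bullet> \<nu> a) + c\<^sup>2"
        unfolding power2_norm_eq_inner by (simp add: inner_add nn inner_commute power2_eq_square)
      moreover have "c\<^sup>2 = r\<^sup>2" using that(2) by (metis power2_abs)
      ultimately show ?thesis by simp
    qed
    have Mw: "M * (norm w)\<^sup>2 * (2 * r) \<le> (norm w)\<^sup>2" for w :: "real^2"
      using mult_right_mono[OF rM, of "(norm w)\<^sup>2"] by (simp add: algebra_simps)
    show "ball (y - r *\<^sub>R \<nu> (coord y)) r \<subseteq> \<Omega>"
    proof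
      fix z assume "z \<in> ball (y - r *\<^sub>R \<nu> (coord y)) r"
      define w where "w = z - y"
      have nw: "norm (w + r *\<^sub>R \<nu> a) < r" using \<open>z \<in> _\<close> by (simp add: w_def a_def dist_norm norm_minus_commute algebra_simps)
      have K: "z \<in> U" "\<bar>g (coord z) - g a - g1 a * coord w\<bar> \<le> M * (norm w)\<^sup>2" "(Q *v z) $ 2 = g a + (Q *v w) $ 2"
        using key[OF small[OF nw] w_def] r by auto
      have "(norm w)\<^sup>2 + 2 * r * (w \<bullet> \<nu> a) < 0" using sq[OF nw] r by simp
      then have l: "w \<bullet> \<nu> a * (2 * r) < - (M * (norm w)\<^sup>2) * (2 * r)" using Mw[of w]
      proof -
        have "w \<bullet> \<nu> a * (2 * r) = 2 * r * (w \<bullet> \<nu> a)" "- (M * (norm w)\<^sup>2) * (2 * r) = - (M * (norm w)\<^sup>2 * (2 * r))" by simp_all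
        then show ?thesis using \<open>(norm w)\<^sup>2 + 2 * r * (w \<bullet> \<nu> a) < 0\<close> Mw[of w] by linarith
      qed
      then have l': "w \<bullet> \<nu> a < - (M * (norm w)\<^sup>2)" by (rule mult_right_less_imp_less) (use r in simp)
      have "w \<bullet> \<nu> a \<le> 0" using l' mult_nonneg_nonneg[OF less_imp_le[OF M(1)] zero_le_power2[of "norm w"]] by linarith
      then have "sqrt (1 + (g1 a)\<^sup>2) * (w \<bullet> \<nu> a) \<le> 1 * (w \<bullet> \<nu> a)" by (rule mult_right_mono_neg[OF rt])
      then have "(Q *v w) $ 2 - g1 a * coord w < - (M * (norm w)\<^sup>2)" using l' unfolding normal_component by simp
      then show "z \<in> \<Omega>" using sub[OF K(1)] K(2,3) by (simp add: abs_le_iff)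
    qed
    show "ball (y + r *\<^sub>R \<nu> (coord y)) r \<subseteq> - \<Omega>"
    proof
      fix z assume "z \<in> ball (y + r *\<^sub>R \<nu> (coord y)) r"
      define w where "w = z - y"
      have nw: "norm (w + (- r) *\<^sub>R \<nu> a) < r" using \<open>z \<in> _\<close> by (simp add: w_def a_def dist_norm norm_minus_commute algebra_simps)
      have K: "z \<in> U" "\<bar>g (coord z) - g a - g1 a * coord w\<bar> \<le> M * (norm w)\<^sup>2" "(Q *v z) $ 2 = g a + (Q *v w) $ 2"
        using key[OF small[OF nw] w_def] r by auto
      have "(norm w)\<^sup>2 + 2 * (- r) * (w \<bullet> \<nu> a) < 0" using sq[OF nw] r by simp
      then have l: "(M * (norm w)\<^sup>2) * (2 * r) < w \<bullet> \<nu> a * (2 * r)" using Mw[of w]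
      proof -
        have "w \<bullet> \<nu> a * (2 * r) = - (2 * (- r) * (w \<bullet> \<nu> a))" by simp
        then show ?thesis using \<open>(norm w)\<^sup>2 + 2 * (- r) * (w \<bullet> \<nu> a) < 0\<close> Mw[of w] by linarith
      qed
      then have l': "M * (norm w)\<^sup>2 < w \<bullet> \<nu> a" by (rule mult_right_less_imp_less) (use r in simp)
      have "0 \<le> w \<bullet> \<nu> a" using l' mult_nonneg_nonneg[OF less_imp_le[OF M(1)] zero_le_power2[of "norm w"]] by linarith
      then have "1 * (w \<bullet> \<nu> a) \<le> sqrt (1 + (g1 a)\<^sup>2) * (w \<bullet> \<nu> a)" by (rule mult_right_mono[OF rt])
      then have "M * (norm w)\<^sup>2 < (Q *v w) $ 2 - g1 a * coord w" using l' unfolding normal_component by simp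
      then show "z \<in> - \<Omega>" using sub[OF K(1)] K(2,3) by (simp add: abs_le_iff)
    qed
  qed
qed

end

text \<open>By compactness finitely many local radii suffice. That the two spheres meet only at y
  follows from the parallelogram law. Without this result the supremum defining
  \<open>ubc_radius\<close> could be that of an empty set.\<close>

lemma uniform_ball_condition_exists:
  assumes reg: "regular_domain 3 \<Omega>" shows "\<exists>r. uniform_ball_condition \<Omega> r"
proof -
  have o: "open \<Omega>" and b: "bounded \<Omega>" using reg by (auto simp: regular_domain_def planar_domain_def)
  have "\<exists>\<rho>>0. \<forall>y\<in>frontier \<Omega> \<inter> ball y0 \<rho>. \<forall>r. 0 < r \<and> r \<le> \<rho> \<longrightarrow>
    ball (y - r *\<^sub>R outer_normal \<Omega> y) r \<subseteq> \<Omega> \<and> ball (y + r *\<^sub>R outer_normal \<Omega> y) r \<subseteq> - \<Omega> \<and> norm (outer_normal \<Omega> y) = 1"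
    if y0: "y0 \<in> frontier \<Omega>" for y0
  proof -
    obtain U Q g where U: "y0 \<in> U" "subgraph_chart 3 \<Omega> U Q g" using reg y0 unfolding regular_domain_def by blast
    have C1: "subgraph_chart 1 \<Omega> U Q g" using U(2) Ck_on_mono[of 3 UNIV g 1] by (simp add: subgraph_chart_def)
    have C3: "Ck_on (Suc 2) UNIV g" using U(2) by (simp add: subgraph_chart_def eval_nat_numeral)
    have C2: "Ck_on (Suc 1) UNIV (deriv g)" using Ck_on_Suc_real(2)[OF C3] by (simp add: eval_nat_numeral)
    interpret a: chart \<Omega> U Q g "deriv g" by (rule chart_from_subgraph[OF C1 o])
    have d2: "(deriv g has_real_derivative deriv (deriv g) t) (at t)" for t using Ck_on_Suc_real(1)[OF C2] .
    have "Ck_on (Suc 0) UNIV (deriv (deriv g))" using Ck_on_Suc_real(2)[OF C2] by simp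
    then have c2: "continuous_on UNIV (deriv (deriv g))" by (meson Ck_on_Suc_real(1) DERIV_continuous continuous_at_imp_continuous_on)
    obtain \<rho> where \<rho>: "0 < \<rho>" "\<And>y r. y \<in> frontier \<Omega> \<Longrightarrow> y \<in> ball y0 \<rho> \<Longrightarrow> 0 < r \<Longrightarrow> r \<le> \<rho> \<Longrightarrow>
      ball (y - r *\<^sub>R a.\<nu> (a.coord y)) r \<subseteq> \<Omega> \<and> ball (y + r *\<^sub>R a.\<nu> (a.coord y)) r \<subseteq> - \<Omega>"
      using a.local_balls[OF d2 c2 U(1)] by blast
    obtain R where R: "0 < R" "ball y0 R \<subseteq> U" using a.open_U U(1) open_contains_ball by blast
    show ?thesis
    proof (intro exI[of _ "min \<rho> R"] conjI ballI allI impI)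
      show "0 < min \<rho> R" using \<rho> R by simp
      fix y r assume y: "y \<in> frontier \<Omega> \<inter> ball y0 (min \<rho> R)" and r: "0 < r \<and> r \<le> min \<rho> R"
      have eq: "outer_normal \<Omega> y = a.\<nu> (a.coord y)" using y R(2) by (intro outer_normal_chart[OF C1 o]) auto
      show "ball (y - r *\<^sub>R outer_normal \<Omega> y) r \<subseteq> \<Omega>" "ball (y + r *\<^sub>R outer_normal \<Omega> y) r \<subseteq> - \<Omega>"
        unfolding eq using \<rho>(2)[of y r] y r by auto
      show "norm (outer_normal \<Omega> y) = 1" unfolding eq by (rule a.norm_\<nu>)
    qed
  qed
  then obtain \<rho> where \<rho>: "\<And>y0. y0 \<in> frontier \<Omega> \<Longrightarrow> 0 < \<rho> y0"
    "\<And>y0 y r. y0 \<in> frontier \<Omega> \<Longrightarrow> y \<in> frontier \<Omega> \<inter> ball y0 (\<rho> y0) \<Longrightarrow> 0 < r \<and> r \<le> \<rho> y0 \<Longrightarrow>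
    ball (y - r *\<^sub>R outer_normal \<Omega> y) r \<subseteq> \<Omega> \<and> ball (y + r *\<^sub>R outer_normal \<Omega> y) r \<subseteq> - \<Omega> \<and> norm (outer_normal \<Omega> y) = 1"
    by metis
  have "compact (frontier \<Omega>)" using b compact_frontier_bounded by blast
  then obtain D where D: "D \<subseteq> frontier \<Omega>" "finite D" "frontier \<Omega> \<subseteq> (\<Union>y\<in>D. ball y (\<rho> y))"
    by (rule compactE_image[of _ "frontier \<Omega>" "\<lambda>y. ball y (\<rho> y)"]) (use \<rho>(1) in force)+
  \<comment> \<open>The inserted 1 covers an empty D, and the local statement holds for all smaller
    radii, so the minimum serves every boundary point.\<close>
  define r where "r = Min (insert 1 (\<rho> ` D))"
  have r: "0 < r" "\<And>y. y \<in> D \<Longrightarrow> r \<le> \<rho> y" using D(1,2) \<rho>(1) by (auto simp: r_def)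
  have "uniform_ball_condition \<Omega> r"
    unfolding uniform_ball_condition_def
  proof (intro conjI ballI r(1))
    fix y assume y: "y \<in> frontier \<Omega>"
    then obtain y0 where y0: "y0 \<in> D" "y \<in> ball y0 (\<rho> y0)" using D(3) by blast
    define m where "m = outer_normal \<Omega> y"
    have B: "ball (y - r *\<^sub>R m) r \<subseteq> \<Omega>" "ball (y + r *\<^sub>R m) r \<subseteq> - \<Omega>" "norm m = 1"
      using \<rho>(2)[of y0 y r] y0 D(1) y r by (auto simp: m_def)
    have "sphere (y - r *\<^sub>R m) r \<inter> sphere (y + r *\<^sub>R m) r = {y}"
    proof (intro set_eqI iffI)
      fix z assume "z \<in> sphere (y - r *\<^sub>R m) r \<inter> sphere (y + r *\<^sub>R m) r"
      then have "norm ((z - y) + r *\<^sub>R m) = r" "norm ((z - y) - r *\<^sub>R m) = r"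
        by (simp_all add: dist_norm norm_minus_commute algebra_simps)
      then have "(norm ((z - y) + r *\<^sub>R m))\<^sup>2 + (norm ((z - y) - r *\<^sub>R m))\<^sup>2 = 2 * r\<^sup>2" by simp
      moreover have "(norm ((z - y) + r *\<^sub>R m))\<^sup>2 + (norm ((z - y) - r *\<^sub>R m))\<^sup>2 = 2 * (norm (z - y))\<^sup>2 + 2 * (norm (r *\<^sub>R m))\<^sup>2"
        unfolding power2_norm_eq_inner by (simp only: inner_diff inner_add) (simp add: inner_commute)
      moreover have "(norm (r *\<^sub>R m))\<^sup>2 = r\<^sup>2" using B(3) by simp
      ultimately have "(norm (z - y))\<^sup>2 = 0" by linarith
      then show "z \<in> {y}" by simp
    qed (use r(1) B(3) in \<open>auto simp: dist_norm\<close>)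
    then show "\<exists>xm xp. ball xm r \<subseteq> \<Omega> \<and> ball xp r \<subseteq> - \<Omega> \<and> sphere xm r \<inter> sphere xp r = {y}" using B by blast
  qed
  then show ?thesis ..
qed

text \<open>Attainment of the supremum is avoided by taking an admissible radius above half of it,
  which later costs a factor 4 in the constant. The set of radii is bounded because a ball of that
  radius fits into the bounded domain.\<close>

lemma ubc_radius_approx:
  assumes reg: "regular_domain 3 \<Omega>"
  obtains r where "uniform_ball_condition \<Omega> r" "r \<le> ubc_radius \<Omega>" "ubc_radius \<Omega> / 2 < r"
proof -
  have b: "bounded \<Omega>" "\<Omega> \<noteq> {}" using reg by (auto simp: regular_domain_def planar_domain_def)
  define A where "A = {r. uniform_ball_condition \<Omega> r}"
  obtain r0 where r0: "r0 \<in> A" using uniform_ball_condition_exists[OF reg] by (auto simp: A_def)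
  have "\<Omega> \<noteq> UNIV" using b(1) not_bounded_UNIV by metis
  then obtain y where y: "y \<in> frontier \<Omega>" using b(2) frontier_eq_empty by blast
  obtain B where "\<forall>x\<in>\<Omega>. norm x \<le> B" using b(1) by (auto simp: bounded_iff)
  then have B: "\<Omega> \<subseteq> cball 0 B" by auto
  have "r \<le> B" if rA: "r \<in> A" for r
  proof -
    obtain xm where "ball xm r \<subseteq> \<Omega>" "0 < r" using rA y unfolding A_def uniform_ball_condition_def by blast
    then have "ball xm r \<subseteq> cball 0 B" "0 < r" using B by auto
    then have "dist xm 0 + r \<le> B" by (simp add: ball_subset_cball_iff)
    then show ?thesis using zero_le_dist[of xm 0] by linarith
  qed
  then have bdd: "bdd_above A" by (auto simp: bdd_above_def)
  have up: "r \<le> ubc_radius \<Omega>" if "r \<in> A" for r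
    unfolding ubc_radius_def A_def[symmetric] by (rule cSup_upper[OF that bdd])
  have "0 < r0" using r0 by (simp add: A_def uniform_ball_condition_def)
  then have "ubc_radius \<Omega> / 2 < Sup A" using up[OF r0] by (simp add: ubc_radius_def A_def)
  then obtain r where "r \<in> A" "ubc_radius \<Omega> / 2 < r" using less_cSupD[of A] r0 by blast
  then show ?thesis using that up by (auto simp: A_def)
qed

section \<open>Stokes flow at a fixed time\<close>

abbreviation B1 :: "real^2" where "B1 \<equiv> axis 1 1"
abbreviation B2 :: "real^2" where "B2 \<equiv> axis 2 1"

lemma Basis_2: "(Basis :: (real^2) set) = {B1, B2}"
  by (auto simp: Basis_vec_def UNIV_2)

lemma B_neq: "B1 \<noteq> B2" by (simp add: axis_eq_axis)

lemma Ck_partials: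
  assumes "Ck_on k S f" "set bs \<subseteq> Basis" "length bs < k" "x \<in> S"
  shows "has_partials (iter_deriv bs f) (iter_deriv (B1 # bs) f x) (iter_deriv (B2 # bs) f x) x"
proof -
  have "iter_deriv bs f differentiable (at x)" using assms unfolding Ck_on_def by blast
  then have D: "(iter_deriv bs f has_derivative frechet_derivative (iter_deriv bs f) (at x)) (at x)"
    by (simp add: frechet_derivative_works)
  then have lin: "linear (frechet_derivative (iter_deriv bs f) (at x))" by (rule has_derivative_linear)
  have "frechet_derivative (iter_deriv bs f) (at x) h = (h$1) *\<^sub>R iter_deriv (B1 # bs) f x + (h$2) *\<^sub>R iter_deriv (B2 # bs) f x" for h
  proof -
    have "h = (h$1) *\<^sub>R B1 + (h$2) *\<^sub>R B2" by (simp add: vec2_eq axis_def)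
    then have "frechet_derivative (iter_deriv bs f) (at x) h = frechet_derivative (iter_deriv bs f) (at x) ((h$1) *\<^sub>R B1 + (h$2) *\<^sub>R B2)" by simp
    also have "\<dots> = (h$1) *\<^sub>R frechet_derivative (iter_deriv bs f) (at x) B1 + (h$2) *\<^sub>R frechet_derivative (iter_deriv bs f) (at x) B2"
      using lin by (simp only: linear_add linear_scale)
    finally show ?thesis by (simp add: iter_deriv_def dir_deriv_def)
  qed
  then have "frechet_derivative (iter_deriv bs f) (at x) = (\<lambda>h. (h$1) *\<^sub>R iter_deriv (B1 # bs) f x + (h$2) *\<^sub>R iter_deriv (B2 # bs) f x)" by blast
  with D show ?thesis unfolding has_partials_def by simp
qed

lemma Ck_continuous: "Ck_on k S f \<Longrightarrow> set bs \<subseteq> Basis \<Longrightarrow> length bs \<le> k \<Longrightarrow> continuous_on S (iter_deriv bs f)"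
  unfolding Ck_on_def by blast

lemma Ck_clairaut:
  fixes f :: "real^2 \<Rightarrow> real^'n"
  assumes C: "Ck_on k S f" and bs: "set bs \<subseteq> Basis" "length bs + 2 \<le> k" and x: "x \<in> S"
  shows "iter_deriv (B1 # B2 # bs) f x = iter_deriv (B2 # B1 # bs) f x"
proof (rule vec_eq_iff[THEN iffD2], rule allI)
  fix i
  have S: "open S" using C by (simp add: Ck_on_def)
  have b: "set (B1 # bs) \<subseteq> Basis" "set (B2 # bs) \<subseteq> Basis" using bs by (auto simp: Basis_2)
  show "iter_deriv (B1 # B2 # bs) f x $ i = iter_deriv (B2 # B1 # bs) f x $ i"
  proof (rule mixed_partials_equal[OF S x, symmetric])
    show "has_partials (\<lambda>x. iter_deriv bs f x $ i) (iter_deriv (B1 # bs) f y $ i) (iter_deriv (B2 # bs) f y $ i) y" if "y \<in> S" for y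
      by (rule has_partials_vec_nth[OF Ck_partials[OF C]]) (use bs that in auto)
    show "has_partials (\<lambda>x. iter_deriv (B1 # bs) f x $ i) (iter_deriv (B1 # B1 # bs) f y $ i) (iter_deriv (B2 # B1 # bs) f y $ i) y" if "y \<in> S" for y
      by (rule has_partials_vec_nth[OF Ck_partials[OF C b(1)]]) (use bs that in auto)
    show "has_partials (\<lambda>x. iter_deriv (B2 # bs) f x $ i) (iter_deriv (B1 # B2 # bs) f y $ i) (iter_deriv (B2 # B2 # bs) f y $ i) y" if "y \<in> S" for y
      by (rule has_partials_vec_nth[OF Ck_partials[OF C b(2)]]) (use bs that in auto)
    show "continuous_on S (\<lambda>y. iter_deriv (B2 # B1 # bs) f y $ i)" "continuous_on S (\<lambda>y. iter_deriv (B1 # B2 # bs) f y $ i)"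
      by (intro continuous_on_component Ck_continuous[OF C]; use bs in \<open>auto simp: Basis_2\<close>)+
  qed
qed

lemma Ck_closure_bounded:
  assumes C: "Ck_closure k S f" and S: "bounded S" and bs: "set bs \<subseteq> Basis" "length bs \<le> k"
  shows "bounded (iter_deriv bs f ` S)"
proof -
  obtain g where g: "continuous_on (closure S) g" "\<And>x. x \<in> S \<Longrightarrow> g x = iter_deriv bs f x"
    using C bs unfolding Ck_closure_def by blast
  have "compact (g ` closure S)" by (rule compact_continuous_image[OF g(1)]) (use S in \<open>simp add: compact_closure\<close>)
  then have "bounded (g ` closure S)" by (rule compact_imp_bounded)
  moreover have "iter_deriv bs f ` S = g ` S" using g(2) by simp
  then have "iter_deriv bs f ` S \<subseteq> g ` closure S" using image_mono[OF closure_subset] by simp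
  ultimately show ?thesis by (rule bounded_subset)
qed

lemma nabla_entries: "nabla u x $ i $ j = frechet_derivative u (at x) (axis j 1) $ i"
  by (simp add: nabla_def jacobian_def matrix_def)

lemma nabla_entries': "nabla u x $ i $ 1 = iter_deriv [B1] u x $ i" "nabla u x $ i $ 2 = iter_deriv [B2] u x $ i"
  by (simp_all add: nabla_entries iter_deriv_def dir_deriv_def)

lemma trace_2: "trace (A :: real^2^2) = A$1$1 + A$2$2"
  by (simp add: trace_def sum_2)

lemma norm_matrix_2: "(norm (A :: real^2^2))\<^sup>2 = (A$1$1)\<^sup>2 + (A$1$2)\<^sup>2 + (A$2$1)\<^sup>2 + (A$2$2)\<^sup>2"
proof -
  have "(norm A)\<^sup>2 = (norm (A$1))\<^sup>2 + (norm (A$2))\<^sup>2"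
    by (simp add: norm_vec_def L2_set_def sum_2 real_sqrt_pow2)
  then show ?thesis by (simp add: norm_sq_2)
qed

section \<open>Reduction of the Stokes system to strain and vorticity\<close>

locale stokes_instant =
  fixes \<theta> :: real and \<Omega> :: "(real^2) set" and u :: "real^2 \<Rightarrow> real^2" and p :: "real^2 \<Rightarrow> real"
  assumes \<theta>: "0 < \<theta>" and reg: "regular_domain 3 \<Omega>" and Cu: "Ck_closure 3 \<Omega> u" and Cp: "Ck_closure 2 \<Omega> p"
    and stokes: "x \<in> \<Omega> \<Longrightarrow> \<theta> *\<^sub>R laplacian u x - grad p x = 0" and incompressible: "x \<in> \<Omega> \<Longrightarrow> trace (nabla u x) = 0"
    and surface: "y \<in> frontier \<Omega> \<Longrightarrow> curvature \<Omega> y *\<^sub>R outer_normal \<Omega> y =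
             (p y *\<^sub>R mat 1 - (2 * \<theta>) *\<^sub>R sym_part (ext_val \<Omega> (nabla u) y)) *v outer_normal \<Omega> y"
begin

lemma dom: "open \<Omega>" "bounded \<Omega>" "\<Omega> \<noteq> {}"
  using reg by (auto simp: regular_domain_def planar_domain_def)

lemma CuO: "Ck_on 3 \<Omega> u" and CpO: "Ck_on 2 \<Omega> p" using Cu Cp by (simp_all add: Ck_closure_def)

abbreviation U where "U bs x i \<equiv> iter_deriv bs u x $ i"

definition e where "e x = U [B1] x 1"
definition s where "s x = (U [B1] x 2 + U [B2] x 1) / 2"
definition w where "w x = U [B1] x 2 - U [B2] x 1"
definition ex where "ex x = U [B1, B1] x 1"
definition ey where "ey x = U [B2, B1] x 1"
definition sx where "sx x = (U [B1, B1] x 2 + U [B1, B2] x 1) / 2"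
definition sy where "sy x = (U [B2, B1] x 2 + U [B2, B2] x 1) / 2"
definition wx where "wx x = U [B1, B1] x 2 - U [B1, B2] x 1"
definition wy where "wy x = U [B2, B1] x 2 - U [B2, B2] x 1"
definition exx where "exx x = U [B1, B1, B1] x 1"
definition exy where "exy x = U [B2, B1, B1] x 1"
definition eyy where "eyy x = U [B2, B2, B1] x 1"
definition sxx where "sxx x = (U [B1, B1, B1] x 2 + U [B1, B1, B2] x 1) / 2"
definition sxy where "sxy x = (U [B2, B1, B1] x 2 + U [B2, B1, B2] x 1) / 2"
definition syy where "syy x = (U [B2, B2, B1] x 2 + U [B2, B2, B2] x 1) / 2"
definition wxx where "wxx x = U [B1, B1, B1] x 2 - U [B1, B1, B2] x 1"
definition wxy where "wxy x = U [B2, B1, B1] x 2 - U [B2, B1, B2] x 1"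
definition wyy where "wyy x = U [B2, B2, B1] x 2 - U [B2, B2, B2] x 1"

lemma Uc: "set bs \<subseteq> Basis \<Longrightarrow> length bs \<le> 3 \<Longrightarrow> continuous_on \<Omega> (\<lambda>x. U bs x i)"
  by (intro continuous_on_component Ck_continuous[OF CuO])

lemma Up: "set bs \<subseteq> Basis \<Longrightarrow> length bs < 3 \<Longrightarrow> x \<in> \<Omega> \<Longrightarrow> has_partials (\<lambda>x. U bs x i) (U (B1 # bs) x i) (U (B2 # bs) x i) x"
  by (intro has_partials_vec_nth Ck_partials[OF CuO])

lemma Usw: "x \<in> \<Omega> \<Longrightarrow> iter_deriv [B1, B2] u x = iter_deriv [B2, B1] u x"
  "x \<in> \<Omega> \<Longrightarrow> iter_deriv [B1, B2, B1] u x = iter_deriv [B2, B1, B1] u x"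
  "x \<in> \<Omega> \<Longrightarrow> iter_deriv [B1, B2, B2] u x = iter_deriv [B2, B1, B2] u x"
  by (rule Ck_clairaut[OF CuO]; simp add: Basis_2)+

lemma has_partials_half: "has_partials f a b x \<Longrightarrow> has_partials (\<lambda>x. f x / 2 :: real) (a / 2) (b / 2) x"
  by (rule has_partials_bounded_linear[OF bounded_linear_divide])

lemma first_partials:
  assumes x: "x \<in> \<Omega>"
  shows "has_partials e (ex x) (ey x) x" "has_partials s (sx x) (sy x) x" "has_partials w (wx x) (wy x) x"
  unfolding e_def[abs_def] s_def[abs_def] w_def[abs_def] ex_def ey_def sx_def sy_def wx_def wy_def
  by (intro has_partials_half has_partials_add has_partials_diff Up x; simp add: Basis_2)+

lemma second_partials:
  assumes x: "x \<in> \<Omega>"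
  shows "has_partials ex (exx x) (exy x) x" "has_partials ey (exy x) (eyy x) x"
    "has_partials sx (sxx x) (sxy x) x" "has_partials sy (sxy x) (syy x) x"
    "has_partials wx (wxx x) (wxy x) x" "has_partials wy (wxy x) (wyy x) x"
proof -
  note X = ex_def[abs_def] ey_def[abs_def] sx_def[abs_def] sy_def[abs_def] wx_def[abs_def] wy_def[abs_def]
    exx_def exy_def eyy_def sxx_def sxy_def syy_def wxx_def wxy_def wyy_def
  show "has_partials ex (exx x) (exy x) x" "has_partials sx (sxx x) (sxy x) x" "has_partials wx (wxx x) (wxy x) x"
    unfolding X by (intro has_partials_half has_partials_add has_partials_diff Up x; simp add: Basis_2)+
  \<comment> \<open>Differentiating in the first direction puts \<open>B1\<close> in front of an
    earlier \<open>B2\<close>; symmetry of mixed derivatives restores the order of the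
    definitions.\<close>
  show "has_partials ey (exy x) (eyy x) x" "has_partials sy (sxy x) (syy x) x" "has_partials wy (wxy x) (wyy x) x"
    unfolding X Usw(2,3)[OF x, symmetric] by (intro has_partials_half has_partials_add has_partials_diff Up x; simp add: Basis_2)+
qed

lemma third_cont: "continuous_on \<Omega> exx" "continuous_on \<Omega> exy" "continuous_on \<Omega> eyy" "continuous_on \<Omega> sxx"
  "continuous_on \<Omega> sxy" "continuous_on \<Omega> syy" "continuous_on \<Omega> wxx" "continuous_on \<Omega> wxy" "continuous_on \<Omega> wyy"
  unfolding exx_def[abs_def] exy_def[abs_def] eyy_def[abs_def] sxx_def[abs_def] sxy_def[abs_def] syy_def[abs_def] wxx_def[abs_def] wxy_def[abs_def] wyy_def[abs_def]
  divide_inverse by (intro continuous_intros Uc; simp add: Basis_2)+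

lemma div0: "x \<in> \<Omega> \<Longrightarrow> U [B2] x 2 = - e x"
  using incompressible[of x] by (simp add: trace_2 nabla_entries' e_def)

lemma div1:
  assumes x: "x \<in> \<Omega>" shows "U [B1, B2] x 2 = - ex x" "U [B2, B2] x 2 = - ey x"
proof -
  have "has_partials (\<lambda>x. U [B2] x 2) (U [B1, B2] x 2) (U [B2, B2] x 2) x" by (rule Up[OF _ _ x]) (simp_all add: Basis_2)
  moreover have "has_partials (\<lambda>x. U [B2] x 2) (- ex x) (- ey x) x"
    by (rule has_partials_cong_open[OF has_partials_minus[OF first_partials(1)[OF x]] dom(1) x]) (simp add: div0)
  ultimately have "U [B1, B2] x 2 = - ex x \<and> U [B2, B2] x 2 = - ey x" by (rule has_partials_unique)
  then show "U [B1, B2] x 2 = - ex x" "U [B2, B2] x 2 = - ey x" by auto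
qed

text \<open>For a divergence-free field the Laplacian is the rotated gradient of the vorticity, so
  the momentum equation says that p/\<theta> and w satisfy Cauchy-Riemann equations.\<close>

lemma pressure_partials:
  assumes x: "x \<in> \<Omega>" shows "has_partials (\<lambda>x. p x / \<theta>) (- wy x) (wx x) x"
proof -
  have P: "has_partials p (iter_deriv [B1] p x) (iter_deriv [B2] p x) x"
    using Ck_partials[OF CpO, of "[]" x] x by (simp add: iter_deriv_def)
  have L: "\<theta> *\<^sub>R (iter_deriv [B1, B1] u x + iter_deriv [B2, B2] u x) = iter_deriv [B1] p x *\<^sub>R B1 + iter_deriv [B2] p x *\<^sub>R B2"
    using stokes[OF x] B_neq by (simp add: laplacian_def grad_def Basis_2 iter_deriv_def)
  have "iter_deriv [B1] p x = \<theta> * (U [B1, B1] x 1 + U [B2, B2] x 1)" "iter_deriv [B2] p x = \<theta> * (U [B1, B1] x 2 + U [B2, B2] x 2)"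
    using arg_cong[OF L, of "\<lambda>v. v $ 1"] arg_cong[OF L, of "\<lambda>v. v $ 2"] by (simp_all add: axis_def)
  moreover have "U [B1, B1] x 1 + U [B2, B2] x 1 = - wy x" "U [B1, B1] x 2 + U [B2, B2] x 2 = wx x"
    using div1[OF x] Usw(1)[OF x] by (simp_all add: wy_def wx_def ex_def ey_def)
  ultimately have "iter_deriv [B1] p x = \<theta> * - wy x" "iter_deriv [B2] p x = \<theta> * wx x" by simp_all
  with P have "has_partials p (\<theta> * - wy x) (\<theta> * wx x) x" by simp
  from has_partials_bounded_linear[OF bounded_linear_divide this, of \<theta>] show ?thesis using \<theta> by simp
qed

text \<open>This is the equality of the mixed second derivatives of the pressure, whose gradient is
  \<theta> times (-wy, wx).\<close>

lemma harmonic: assumes x: "x \<in> \<Omega>" shows "wxx x + wyy x = 0"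
proof -
  have "- wyy x = wxx x"
  proof (rule mixed_partials_equal[OF dom(1) x pressure_partials])
    show "has_partials (\<lambda>x. - wy x) (- wxy y) (- wyy y) y" "has_partials wx (wxx y) (wxy y) y" if "y \<in> \<Omega>" for y
      using has_partials_minus[OF second_partials(6)[OF that]] second_partials(5)[OF that] by auto
  qed (use third_cont in \<open>auto intro!: continuous_intros\<close>)
  then show ?thesis by simp
qed

lemma stokes_eq: assumes x: "x \<in> \<Omega>" shows "ex x + sy x = - wy x / 2" "sx x - ey x = wx x / 2"
  using div1[OF x] Usw(1)[OF x] by (simp_all add: ex_def ey_def sx_def sy_def wx_def wy_def field_simps)

lemma gradient_norm:
  assumes x: "x \<in> \<Omega>" shows "(norm (nabla u x))\<^sup>2 = 2 * (e x)\<^sup>2 + 2 * (s x)\<^sup>2 + (w x)\<^sup>2 / 2"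
proof -
  have N: "U [B1] x 2 = s x + w x / 2" "U [B2] x 1 = s x - w x / 2" by (simp_all add: s_def w_def field_simps)
  show ?thesis unfolding norm_matrix_2 nabla_entries' div0[OF x] N
    by (simp add: e_def power2_eq_square field_simps)
qed

lemma hessian_norm:
  assumes x: "x \<in> \<Omega>"
  shows "hess_norm_sq u x = 2 * ((ex x)\<^sup>2 + (ey x)\<^sup>2 + (sx x)\<^sup>2 + (sy x)\<^sup>2) + 1 / 2 * ((wx x)\<^sup>2 + (wy x)\<^sup>2)"
proof -
  have h: "hess_norm_sq u x = (norm (iter_deriv [B1, B1] u x))\<^sup>2 + (norm (iter_deriv [B1, B2] u x))\<^sup>2
     + (norm (iter_deriv [B2, B1] u x))\<^sup>2 + (norm (iter_deriv [B2, B2] u x))\<^sup>2"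
    unfolding hess_norm_sq_def Basis_2 using B_neq by simp
  have c: "U [B1, B1] x 1 = ex x" "U [B2, B1] x 1 = ey x" "U [B1, B2] x 1 = ey x"
    "U [B1, B1] x 2 = sx x + wx x / 2" "U [B2, B2] x 1 = sy x - wy x / 2" "U [B2, B1] x 2 = sy x + wy x / 2"
    "U [B1, B2] x 2 = sy x + wy x / 2" "U [B2, B2] x 2 = - ey x"
    using div1[OF x] Usw(1)[OF x] by (simp_all add: ex_def ey_def sx_def sy_def wx_def wy_def field_simps)
  have E: "ex x = - (sy x + wy x / 2)" "ey x = sx x - wx x / 2" using stokes_eq[OF x] by (simp_all add: field_simps)
  show ?thesis unfolding h norm_sq_2 c unfolding E by (simp add: power2_eq_square field_simps)
qed

lemma bound: obtains S where "\<And>x. x \<in> \<Omega> \<Longrightarrow> \<bar>e x\<bar> \<le> S \<and> \<bar>s x\<bar> \<le> S \<and> \<bar>ex x\<bar> \<le> S \<and> \<bar>ey x\<bar> \<le> S \<and> \<bar>sx x\<bar> \<le> S \<and> \<bar>sy x\<bar> \<le> S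
      \<and> \<bar>wx x\<bar> \<le> S \<and> \<bar>wy x\<bar> \<le> S" "\<And>x. x \<in> \<Omega> \<Longrightarrow> \<bar>w x\<bar> \<le> S"
proof -
  have "\<exists>S. \<forall>x\<in>\<Omega>. norm (iter_deriv bs u x) \<le> S" if "set bs \<subseteq> Basis" "length bs \<le> 3" for bs
    using Ck_closure_bounded[OF Cu dom(2) that] by (auto simp: bounded_iff)
  then obtain F where F: "\<And>bs x. set bs \<subseteq> Basis \<Longrightarrow> length bs \<le> 3 \<Longrightarrow> x \<in> \<Omega> \<Longrightarrow> norm (iter_deriv bs u x) \<le> F bs" by metis
  define S where "S = Max (F ` {[B1], [B2], [B1, B1], [B1, B2], [B2, B1], [B2, B2]})"
  have FS: "F bs \<le> S" if "bs \<in> {[B1], [B2], [B1, B1], [B1, B2], [B2, B1], [B2, B2]}" for bs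
    unfolding S_def by (rule Max_ge) (use that in auto)
  have US: "\<bar>U bs x i\<bar> \<le> S" if "bs \<in> {[B1], [B2], [B1, B1], [B1, B2], [B2, B1], [B2, B2]}" "x \<in> \<Omega>" for bs x i
  proof -
    have "set bs \<subseteq> Basis" "length bs \<le> 3" using that(1) by (auto simp: Basis_2)
    then have "norm (iter_deriv bs u x) \<le> F bs" using that(2) by (rule F)
    also have "\<dots> \<le> S" by (rule FS[OF that(1)])
    finally show ?thesis using component_le_norm_cart[of "iter_deriv bs u x" i] by (rule order_trans[rotated])
  qed
  obtain x0 where "x0 \<in> \<Omega>" using dom(3) by blast
  from US[OF _ this, of "[B1]" 1] have S0: "0 \<le> S" by simp
  have "\<bar>e x\<bar> \<le> 2 * S \<and> \<bar>s x\<bar> \<le> 2 * S \<and> \<bar>ex x\<bar> \<le> 2 * S \<and> \<bar>ey x\<bar> \<le> 2 * S \<and> \<bar>sx x\<bar> \<le> 2 * S \<and> \<bar>sy x\<bar> \<le> 2 * S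
      \<and> \<bar>wx x\<bar> \<le> 2 * S \<and> \<bar>wy x\<bar> \<le> 2 * S \<and> \<bar>w x\<bar> \<le> 2 * S" if x: "x \<in> \<Omega>" for x
  proof -
    have T: "\<bar>U bs x i\<bar> \<le> S" if "bs \<in> {[B1], [B2], [B1, B1], [B1, B2], [B2, B1], [B2, B2]}" for bs i using US[OF that x] .
    have 1: "\<bar>a\<bar> \<le> 2 * S" if "\<bar>a\<bar> \<le> S" for a using that S0 by linarith
    have 2: "\<bar>(a + c) / 2\<bar> \<le> 2 * S" "\<bar>a - c\<bar> \<le> 2 * S" if "\<bar>a\<bar> \<le> S" "\<bar>c\<bar> \<le> S" for a c
      using that S0 by (simp_all add: abs_le_iff)
    show ?thesis unfolding e_def s_def w_def ex_def ey_def sx_def sy_def wx_def wy_def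
      by (intro conjI; (rule 2 | rule 1); rule T; simp)
  qed
  then show ?thesis by (intro that[of "2 * S"]) simp_all
qed

text \<open>The vector surface condition is resolved into its components along the normal and the
  tangent; with the strain (e, s; s, -e) these are the real and imaginary part of G n^2. The
  continuous extensions of e and s give it a meaning on the boundary itself.\<close>

lemma boundary_trace:
  obtains ge gs where "continuous_on (closure \<Omega>) ge" "continuous_on (closure \<Omega>) gs"
    "\<And>x. x \<in> \<Omega> \<Longrightarrow> ge x = e x" "\<And>x. x \<in> \<Omega> \<Longrightarrow> gs x = s x"
    "\<And>y n1 n2. y \<in> frontier \<Omega> \<Longrightarrow> n1 = outer_normal \<Omega> y $ 1 \<Longrightarrow> n2 = outer_normal \<Omega> y $ 2 \<Longrightarrow> n1\<^sup>2 + n2\<^sup>2 = 1 \<Longrightarrow>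
       p y / \<theta> - curvature \<Omega> y / \<theta> - 2 * (ge y * (n1\<^sup>2 - n2\<^sup>2) + 2 * gs y * n1 * n2) = 0
       \<and> 2 * ge y * n1 * n2 - gs y * (n1\<^sup>2 - n2\<^sup>2) = 0"
proof -
  have "\<exists>g. continuous_on (closure \<Omega>) g \<and> (\<forall>x\<in>\<Omega>. g x = iter_deriv bs u x)" if "set bs \<subseteq> Basis" "length bs \<le> 3" for bs
    using Cu that unfolding Ck_closure_def by blast
  from this[of "[B1]"] this[of "[B2]"] obtain g1 g2 where
    g1: "continuous_on (closure \<Omega>) g1" "\<And>x. x \<in> \<Omega> \<Longrightarrow> g1 x = iter_deriv [B1] u x" and
    g2: "continuous_on (closure \<Omega>) g2" "\<And>x. x \<in> \<Omega> \<Longrightarrow> g2 x = iter_deriv [B2] u x"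
    by (auto simp: Basis_2)
  define N where "N x = (\<chi> i j. if j = 1 then g1 x $ i else g2 x $ i :: real^2^2)" for x
  have Nc: "continuous_on (closure \<Omega>) N"
    unfolding N_def[abs_def]
    by (intro continuous_on_vec_lambda) (case_tac "j = 1"; simp; intro continuous_intros g1 g2)
  have NO: "N x = nabla u x" if "x \<in> \<Omega>" for x
    using g1(2)[OF that] g2(2)[OF that] by (simp add: vec_eq_iff forall_2 nabla_entries' N_def)
  define ge where "ge x = g1 x $ 1" for x
  define gs where "gs x = (g1 x $ 2 + g2 x $ 1) / 2" for x
  have fr: "y \<in> closure \<Omega>" "y \<notin> \<Omega>" if "y \<in> frontier \<Omega>" for y using that dom(1) by (auto simp: frontier_def interior_open)
  \<comment> \<open>Incompressibility holds on the boundary by continuity; it makes the extended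
    strain trace free.\<close>
  have tr0: "g1 y $ 1 + g2 y $ 2 = 0" if "y \<in> closure \<Omega>" for y
  proof (rule continuous_constant_on_closure[of \<Omega> "\<lambda>y. g1 y $ 1 + g2 y $ 2"])
    show "continuous_on (closure \<Omega>) (\<lambda>y. g1 y $ 1 + g2 y $ 2)" by (intro continuous_intros g1 g2)
    show "g1 x $ 1 + g2 x $ 2 = 0" if "x \<in> \<Omega>" for x using div0[OF that] g1(2)[OF that] g2(2)[OF that] by (simp add: e_def)
  qed (use that in auto)
  show ?thesis
  proof (rule that[of ge gs])
    show "continuous_on (closure \<Omega>) ge" "continuous_on (closure \<Omega>) gs"
      unfolding ge_def[abs_def] gs_def[abs_def] divide_inverse by (intro continuous_intros g1 g2)+
    show "ge x = e x" "gs x = s x" if "x \<in> \<Omega>" for x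
      using g1(2)[OF that] g2(2)[OF that] by (simp_all add: ge_def gs_def e_def s_def)
    fix y n1 n2 assume y: "y \<in> frontier \<Omega>" and n: "n1 = outer_normal \<Omega> y $ 1" "n2 = outer_normal \<Omega> y $ 2" and one: "n1\<^sup>2 + n2\<^sup>2 = 1"
    have ev: "ext_val \<Omega> (nabla u) y = N y"
      unfolding ext_val_def
    proof (rule tendsto_Lim)
      \<comment> \<open>Uniqueness of the limit, and with it the value of \<open>ext_val\<close>,
        requires y to be an accumulation point of the domain.\<close>
      have "y islimpt \<Omega>" using fr[OF y] by (auto simp: closure_def)
      then show "at y within \<Omega> \<noteq> bot" by (simp add: trivial_limit_within)
      have "(N \<longlongrightarrow> N y) (at y within closure \<Omega>)" using Nc fr(1)[OF y] by (simp add: continuous_on_def)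
      then have "(N \<longlongrightarrow> N y) (at y within \<Omega>)" by (rule tendsto_within_subset) (rule closure_subset)
      moreover have "\<forall>\<^sub>F x in at y within \<Omega>. N x = nabla u x" using NO by (auto simp: eventually_at_filter)
      ultimately show "(nabla u \<longlongrightarrow> N y) (at y within \<Omega>)" by (rule Lim_transform_eventually)
    qed
    define a where "a = ge y" define c where "c = gs y"
    have NN: "N y $ 1 $ 1 = a" "N y $ 2 $ 2 = - a" "N y $ 1 $ 2 + N y $ 2 $ 1 = 2 * c" "N y $ 2 $ 1 + N y $ 1 $ 2 = 2 * c"
      using tr0[OF fr(1)[OF y]] by (simp_all add: N_def a_def c_def ge_def gs_def)
    have sp: "sym_part (N y) $ 1 $ 1 = a" "sym_part (N y) $ 2 $ 2 = - a" "sym_part (N y) $ 1 $ 2 = c" "sym_part (N y) $ 2 $ 1 = c"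
      using NN by (simp_all add: sym_part_def transpose_def)
    note E = surface[OF y, unfolded ev]
    have "curvature \<Omega> y * n1 = p y * n1 - 2 * \<theta> * (a * n1 + c * n2)"
      using arg_cong[OF E, of "\<lambda>v. v $ 1"] by (simp add: matvec_2(1) sp n mat_def algebra_simps)
    moreover have "curvature \<Omega> y * n2 = p y * n2 - 2 * \<theta> * (c * n1 - a * n2)"
      using arg_cong[OF E, of "\<lambda>v. v $ 2"] by (simp add: matvec_2(2) sp n mat_def algebra_simps)
    ultimately have e1: "(p y - curvature \<Omega> y) * n1 = 2 * \<theta> * (a * n1 + c * n2)"
      and e2: "(p y - curvature \<Omega> y) * n2 = 2 * \<theta> * (c * n1 - a * n2)" by (simp_all add: algebra_simps)
    \<comment> \<open>Multiplying the two component equations by n1, n2 and adding gives the normal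
      component; multiplying by n2, n1 and subtracting gives the tangential one.\<close>
    have "(p y - curvature \<Omega> y) * (n1\<^sup>2 + n2\<^sup>2) = ((p y - curvature \<Omega> y) * n1) * n1 + ((p y - curvature \<Omega> y) * n2) * n2"
      by (simp add: power2_eq_square algebra_simps)
    also have "\<dots> = 2 * \<theta> * (a * (n1\<^sup>2 - n2\<^sup>2) + 2 * c * n1 * n2)" unfolding e1 e2 by (simp add: power2_eq_square algebra_simps)
    finally have A: "p y - curvature \<Omega> y = 2 * \<theta> * (a * (n1\<^sup>2 - n2\<^sup>2) + 2 * c * n1 * n2)" unfolding one by simp
    have "((p y - curvature \<Omega> y) * n1) * n2 - ((p y - curvature \<Omega> y) * n2) * n1 = 0" by simp
    then have "2 * \<theta> * (2 * a * n1 * n2 - c * (n1\<^sup>2 - n2\<^sup>2)) = 0" unfolding e1 e2 by (simp add: power2_eq_square algebra_simps)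
    then have B: "2 * a * n1 * n2 - c * (n1\<^sup>2 - n2\<^sup>2) = 0" using \<theta> by simp
    have "p y / \<theta> - curvature \<Omega> y / \<theta> = 2 * (a * (n1\<^sup>2 - n2\<^sup>2) + 2 * c * n1 * n2)"
      using A \<theta> by (simp add: diff_divide_distrib[symmetric])
    then show "p y / \<theta> - curvature \<Omega> y / \<theta> - 2 * (ge y * (n1\<^sup>2 - n2\<^sup>2) + 2 * gs y * n1 * n2) = 0
       \<and> 2 * ge y * n1 * n2 - gs y * (n1\<^sup>2 - n2\<^sup>2) = 0" using B by (simp add: a_def c_def)
  qed
qed

text \<open>The curvature and the normal are already evaluated at the nearest boundary point, so
  only p, e and s change between x and that point, by uniform continuity on the compact
  closure.\<close>

lemma boundary_limit:
  assumes ubc: "uniform_ball_condition \<Omega> r" and \<eta>: "0 < \<eta>"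
  shows "\<exists>\<delta>>0. \<forall>x\<in>ubc_domain.Lr \<Omega> r. ubc_domain.dst \<Omega> x < \<delta> \<longrightarrow>
    \<bar>p x / \<theta> - curvature \<Omega> (ubc_domain.proj \<Omega> x) / \<theta>
       - 2 * Re ((of_real (e x) - \<i> * of_real (s x)) * (ubc_domain.nrm \<Omega> x)\<^sup>2)\<bar> \<le> \<eta>
    \<and> \<bar>Im ((of_real (e x) - \<i> * of_real (s x)) * (ubc_domain.nrm \<Omega> x)\<^sup>2)\<bar> \<le> \<eta>"
proof -
  interpret d: ubc_domain \<Omega> r by unfold_locales (fact reg ubc)+
  obtain ge gs where c: "continuous_on (closure \<Omega>) ge" "continuous_on (closure \<Omega>) gs"
    and g: "\<And>x. x \<in> \<Omega> \<Longrightarrow> ge x = e x" "\<And>x. x \<in> \<Omega> \<Longrightarrow> gs x = s x"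
    and bd: "\<And>y n1 n2. y \<in> frontier \<Omega> \<Longrightarrow> n1 = outer_normal \<Omega> y $ 1 \<Longrightarrow> n2 = outer_normal \<Omega> y $ 2 \<Longrightarrow> n1\<^sup>2 + n2\<^sup>2 = 1 \<Longrightarrow>
       p y / \<theta> - curvature \<Omega> y / \<theta> - 2 * (ge y * (n1\<^sup>2 - n2\<^sup>2) + 2 * gs y * n1 * n2) = 0
       \<and> 2 * ge y * n1 * n2 - gs y * (n1\<^sup>2 - n2\<^sup>2) = 0"
    by (rule boundary_trace) blast
  have cp: "continuous_on (closure \<Omega>) (\<lambda>x. p x / \<theta>)"
    using Cp \<theta> by (auto simp: Ck_closure_def intro!: continuous_intros)
  have cpt: "compact (closure \<Omega>)" using dom(2) by (simp add: compact_closure)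
  \<comment> \<open>The error is one difference of p/\<theta> plus twice a difference of e and twice
    one of s, hence a fifth of \<eta> for each.\<close>
  have uc: "\<exists>\<delta>>0. \<forall>x\<in>closure \<Omega>. \<forall>y\<in>closure \<Omega>. dist x y < \<delta> \<longrightarrow> \<bar>h x - h y\<bar> < \<eta> / 5"
    if hc: "continuous_on (closure \<Omega>) h" for h :: "real^2 \<Rightarrow> real"
  proof -
    have "0 < \<eta> / 5" using \<eta> by simp
    obtain \<delta> where "\<delta> > 0"
      "\<And>x x'. x \<in> closure \<Omega> \<Longrightarrow> x' \<in> closure \<Omega> \<Longrightarrow> dist x' x < \<delta> \<Longrightarrow> dist (h x') (h x) < \<eta> / 5"
      by (rule uniformly_continuous_onE[OF compact_uniformly_continuous[OF hc cpt] \<open>0 < \<eta> / 5\<close>]) blast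
    then show ?thesis by (intro exI[of _ \<delta>]) (auto simp: dist_real_def)
  qed
  obtain d1 where d1: "0 < d1" "\<And>x y. x \<in> closure \<Omega> \<Longrightarrow> y \<in> closure \<Omega> \<Longrightarrow> dist x y < d1 \<Longrightarrow> \<bar>p x / \<theta> - p y / \<theta>\<bar> < \<eta> / 5"
    using uc[OF cp] by blast
  obtain d2 where d2: "0 < d2" "\<And>x y. x \<in> closure \<Omega> \<Longrightarrow> y \<in> closure \<Omega> \<Longrightarrow> dist x y < d2 \<Longrightarrow> \<bar>ge x - ge y\<bar> < \<eta> / 5"
    using uc[OF c(1)] by blast
  obtain d3 where d3: "0 < d3" "\<And>x y. x \<in> closure \<Omega> \<Longrightarrow> y \<in> closure \<Omega> \<Longrightarrow> dist x y < d3 \<Longrightarrow> \<bar>gs x - gs y\<bar> < \<eta> / 5"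
    using uc[OF c(2)] by blast
  show ?thesis
  proof (intro exI[of _ "min d1 (min d2 d3)"] conjI[of "0 < _"] ballI impI)
    show "0 < min d1 (min d2 d3)" using d1 d2 d3 by simp
    fix x assume x: "x \<in> d.Lr" "d.dst x < min d1 (min d2 d3)"
    have xO: "x \<in> \<Omega>" using x(1) by (simp add: d.Lr_def)
    define y where "y = d.proj x"
    have y: "y \<in> frontier \<Omega>" "dist x y = d.dst x" using d.proj[OF xO] by (simp_all add: y_def)
    have cl: "x \<in> closure \<Omega>" "y \<in> closure \<Omega>" using xO y(1) closure_subset by (auto simp: frontier_def)
    define n1 where "n1 = outer_normal \<Omega> y $ 1"
    define n2 where "n2 = outer_normal \<Omega> y $ 2"
    have one: "n1\<^sup>2 + n2\<^sup>2 = 1" using norm_sq_2[of "outer_normal \<Omega> y"] d.norm_nu[OF y(1)] by (simp add: n1_def n2_def)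
    have n: "d.nrm x = Complex n1 n2" by (simp add: d.nrm_def n1_def n2_def y_def)
    define A where "A = n1\<^sup>2 - n2\<^sup>2"
    define B where "B = 2 * n1 * n2"
    have "0 \<le> (n1 + n2)\<^sup>2" "0 \<le> (n1 - n2)\<^sup>2" by simp_all
    then have AB: "\<bar>A\<bar> \<le> 1" "\<bar>B\<bar> \<le> 1"
      using one zero_le_power2[of n1] zero_le_power2[of n2] unfolding A_def B_def power2_sum power2_diff by linarith+
    have Re: "Re ((of_real (e x) - \<i> * of_real (s x)) * (d.nrm x)\<^sup>2) = e x * A + s x * B"
      and Im: "Im ((of_real (e x) - \<i> * of_real (s x)) * (d.nrm x)\<^sup>2) = e x * B - s x * A"
      by (simp_all add: n A_def B_def power2_eq_square algebra_simps)
    have b: "p y / \<theta> - curvature \<Omega> y / \<theta> = 2 * (ge y * A + gs y * B)" "ge y * B = gs y * A"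
      using bd[OF y(1) n1_def n2_def one] by (simp_all add: A_def B_def algebra_simps)
    have dp: "\<bar>p x / \<theta> - p y / \<theta>\<bar> < \<eta> / 5" using d1(2)[OF cl] x(2) y(2) by simp
    have de: "\<bar>e x - ge y\<bar> < \<eta> / 5" using d2(2)[OF cl] x(2) y(2) g(1)[OF xO] by simp
    have ds: "\<bar>s x - gs y\<bar> < \<eta> / 5" using d3(2)[OF cl] x(2) y(2) g(2)[OF xO] by simp
    have m: "\<bar>a * c\<bar> \<le> \<eta> / 5" if "\<bar>a\<bar> < \<eta> / 5" "\<bar>c\<bar> \<le> 1" for a c :: real
      using mult_mono[of "\<bar>a\<bar>" "\<eta> / 5" "\<bar>c\<bar>" 1] that \<eta> by (simp add: abs_mult)
    have "p x / \<theta> - curvature \<Omega> y / \<theta> - 2 * (e x * A + s x * B)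
        = (p x / \<theta> - p y / \<theta>) - 2 * ((e x - ge y) * A) - 2 * ((s x - gs y) * B)"
      using b(1) by (simp add: algebra_simps)
    then have "\<bar>p x / \<theta> - curvature \<Omega> y / \<theta> - 2 * (e x * A + s x * B)\<bar> \<le> \<eta>"
      using dp m[OF de AB(1)] m[OF ds AB(2)] by linarith
    moreover have "e x * B - s x * A = (e x - ge y) * B - (s x - gs y) * A"
      using b(2) by (simp add: algebra_simps)
    then have "\<bar>e x * B - s x * A\<bar> \<le> \<eta>"
      using m[OF de AB(2)] m[OF ds AB(1)] \<eta> by linarith
    ultimately show "\<bar>p x / \<theta> - curvature \<Omega> (d.proj x) / \<theta> - 2 * Re ((of_real (e x) - \<i> * of_real (s x)) * (d.nrm x)\<^sup>2)\<bar> \<le> \<eta>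
      \<and> \<bar>Im ((of_real (e x) - \<i> * of_real (s x)) * (d.nrm x)\<^sup>2)\<bar> \<le> \<eta>"
      unfolding Re Im y_def by simp
  qed
qed

text \<open>All parameters are fixed here: \<beta> = 1/768 makes the coefficient of the curvature
  integral exactly r, and c = 1/\<beta> + 4 = 772.\<close>

lemma hessian_estimate:
  fixes c Z :: real
  assumes ubc: "uniform_ball_condition \<Omega> r" and c: "c = 772" and Z: "Z = exp 8 + 2"
  shows "\<theta>\<^sup>2 * (LINT x:\<Omega>|lborel. hess_norm_sq u x)
    \<le> r * (LINT y:frontier \<Omega>|hausdorff1. (tangential_deriv \<Omega> (curvature \<Omega>) y)\<^sup>2)
      + \<theta>\<^sup>2 * (8 * (2 * c * (4 * c + Z) + 32 * Z\<^sup>2) / r\<^sup>2) * (LINT x:\<Omega>|lborel. (norm (nabla u x))\<^sup>2)"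
proof -
  interpret d: ubc_domain \<Omega> r by unfold_locales (fact reg ubc)+
  obtain S where S: "\<And>x. x \<in> \<Omega> \<Longrightarrow> \<bar>e x\<bar> \<le> S \<and> \<bar>s x\<bar> \<le> S \<and> \<bar>ex x\<bar> \<le> S \<and> \<bar>ey x\<bar> \<le> S \<and> \<bar>sx x\<bar> \<le> S \<and> \<bar>sy x\<bar> \<le> S
      \<and> \<bar>wx x\<bar> \<le> S \<and> \<bar>wy x\<bar> \<le> S" "\<And>x. x \<in> \<Omega> \<Longrightarrow> \<bar>w x\<bar> \<le> S" by (rule bound) blast
  interpret l0: layer \<Omega> "r / 2" d.dst d.nrm d.kk by (rule d.layer)
  interpret l: stokes_layer \<Omega> "r / 2" d.dst d.nrm d.kk e s w "\<lambda>x. p x / \<theta>" "\<lambda>x. curvature \<Omega> (d.proj x) / \<theta>" "\<lambda>x. d.qq x / \<theta>"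
    ex ey sx sy wx wy exx exy eyy sxx sxy syy wxx wxy wyy S
  proof
    fix x assume "x \<in> \<Omega>" "d.dst x < r / 2"
    then have "x \<in> d.Lr" by (simp add: d.Lr_def)
    from has_partials_bounded_linear[OF bounded_linear_divide d.K_partials(1)[OF this], of \<theta>]
    show "has_partials (\<lambda>x. curvature \<Omega> (d.proj x) / \<theta>) (- (d.qq x / \<theta>) * Im (d.nrm x)) (d.qq x / \<theta> * Re (d.nrm x)) x" by simp
  next
    show "continuous_on {x \<in> \<Omega>. d.dst x < r / 2} (\<lambda>x. d.qq x / \<theta>)"
      using d.kk_cont(2) \<theta> unfolding d.Lr_def by (intro continuous_intros) auto
  qed (use first_partials second_partials third_cont pressure_partials harmonic stokes_eq S in auto)
  define D where "D = (LINT y:frontier \<Omega>|hausdorff1. (tangential_deriv \<Omega> (curvature \<Omega>) y)\<^sup>2)"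
  define N where "N = (LINT x:\<Omega>|lborel. (norm (nabla u x))\<^sup>2)"
  define A where "A = (LINT x:\<Omega>|lborel. (e x)\<^sup>2 + (s x)\<^sup>2 + (w x)\<^sup>2)"
  define C where "C = 2 * c * (4 * c + Z) + 32 * Z\<^sup>2"
  have C0: "0 \<le> C" unfolding C_def c Z by simp
  have hess: "(LINT x:\<Omega>|lborel. hess_norm_sq u x)
      = (LINT x:\<Omega>|lborel. 2 * ((ex x)\<^sup>2 + (ey x)\<^sup>2 + (sx x)\<^sup>2 + (sy x)\<^sup>2) + 1 / 2 * ((wx x)\<^sup>2 + (wy x)\<^sup>2))"
    by (rule set_lebesgue_integral_cong) (use dom(1) hessian_norm in auto)
  \<comment> \<open>The layer has width r/2 and the average costs 192, so the coefficient is 8 *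
    (1/768) * (r/2) * 192 = r, up to the factor 1/\<theta>^2 that comes from dividing the curvature
    by \<theta>.\<close>
  have est: "(LINT x:\<Omega>|lborel. hess_norm_sq u x) \<le> 8 * (1 / 768) * (r / 2) * (192 / \<theta>\<^sup>2 * D) + C / (r / 2)\<^sup>2 * A"
    unfolding hess C_def A_def
  proof (rule l.main_estimate[OF _ _ Z _ _ dom(3)])
    show "c = 1 / (1 / 768) + 4" using c by simp
    show "\<exists>\<delta>>0. \<forall>x\<in>l0.L. d.dst x < \<delta> \<longrightarrow> \<bar>p x / \<theta> - curvature \<Omega> (d.proj x) / \<theta> - 2 * Re (l.H x)\<bar> \<le> \<eta> \<and> \<bar>Im (l.H x)\<bar> \<le> \<eta>"
      if \<eta>: "0 < \<eta>" for \<eta>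
    proof -
      have LL: "l0.L = d.Lr" by (simp add: l0.L_def d.Lr_def)
      show ?thesis unfolding LL l.H_def l.G_def by (rule boundary_limit[OF ubc \<eta>])
    qed
    show "\<exists>\<delta>>0. \<forall>\<epsilon>. 0 < \<epsilon> \<longrightarrow> \<epsilon> < \<delta> \<longrightarrow> (LINT x|lborel. l0.b \<epsilon> x * (d.qq x / \<theta>)\<^sup>2) \<le> 192 / \<theta>\<^sup>2 * D"
    proof (intro exI[of _ "r / 4"] conjI allI impI)
      fix \<epsilon> :: real assume e: "0 < \<epsilon>" "\<epsilon> < r / 4"
      have "(LINT x|lborel. l0.b \<epsilon> x * (d.qq x / \<theta>)\<^sup>2) = (LINT x|lborel. l0.b \<epsilon> x * (d.qq x)\<^sup>2) / \<theta>\<^sup>2"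
        by (simp add: power_divide)
      also have "\<dots> \<le> 192 * D / \<theta>\<^sup>2"
        unfolding D_def by (intro divide_right_mono d.layer_curvature_bound) (use e in auto)
      finally show "(LINT x|lborel. l0.b \<epsilon> x * (d.qq x / \<theta>)\<^sup>2) \<le> 192 / \<theta>\<^sup>2 * D" by simp
    qed (use d.r_pos in simp)
    show "bounded (w ` \<Omega>)" using S(2) by (auto simp: bounded_iff)
  qed simp
  have em: "emeasure lborel \<Omega> < \<infinity>" using dom(2) by (rule emeasure_bounded_finite)
  have mO: "\<Omega> \<in> sets lborel" using dom(1) by simp
  have cO: "continuous_on \<Omega> e" "continuous_on \<Omega> s" "continuous_on \<Omega> w"
    unfolding e_def[abs_def] s_def[abs_def] w_def[abs_def] divide_inverse by (intro continuous_intros Uc; simp add: Basis_2)+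
  have sq: "set_integrable lborel \<Omega> (\<lambda>x. (f x)\<^sup>2)" if "continuous_on \<Omega> f" "\<And>x. x \<in> \<Omega> \<Longrightarrow> \<bar>f x\<bar> \<le> S" for f :: "real^2 \<Rightarrow> real"
    unfolding set_integrable_def
  proof (rule Bochner_Integration.integrable_bound[where f="\<lambda>x. indicator \<Omega> x * S\<^sup>2"])
    show "integrable lborel (\<lambda>x. indicator \<Omega> x * S\<^sup>2)" using em mO by (auto intro!: integrable_mult_left integrable_real_indicator)
    show "(\<lambda>x. indicator \<Omega> x *\<^sub>R (f x)\<^sup>2) \<in> borel_measurable lborel"
      using borel_measurable_continuous_on_indicator[OF _ continuous_on_power[OF that(1)]] dom(1) by simp
    show "AE x in lborel. norm (indicator \<Omega> x *\<^sub>R (f x)\<^sup>2) \<le> norm (indicator \<Omega> x * S\<^sup>2)"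
    proof (rule AE_I2)
      fix x show "norm (indicator \<Omega> x *\<^sub>R (f x)\<^sup>2) \<le> norm (indicator \<Omega> x * S\<^sup>2)"
        using that(2)[of x] abs_ge_zero[of "f x"] by (cases "x \<in> \<Omega>") (auto simp: abs_le_square_iff[symmetric])
    qed
  qed
  note I = sq[OF cO(1)] sq[OF cO(2)] sq[OF cO(3) S(2)]
  \<comment> \<open>Twice |\<nabla>u|^2 is 4 e^2 + 4 s^2 + w^2, which dominates the integrand of
    A.\<close>
  have "A \<le> (LINT x:\<Omega>|lborel. 4 * (e x)\<^sup>2 + 4 * (s x)\<^sup>2 + (w x)\<^sup>2)"
    unfolding A_def by (rule set_integral_mono) (use I S in \<open>auto intro!: set_integral_add\<close>)
  also have "\<dots> = (LINT x:\<Omega>|lborel. 2 * (norm (nabla u x))\<^sup>2)"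
    by (rule set_lebesgue_integral_cong) (use dom(1) gradient_norm in auto)
  also have "\<dots> = 2 * N" by (simp add: N_def)
  finally have AN: "A \<le> 2 * N" .
  have "C / (r / 2)\<^sup>2 * A \<le> C / (r / 2)\<^sup>2 * (2 * N)"
    using AN C0 by (intro mult_left_mono) auto
  then have "(LINT x:\<Omega>|lborel. hess_norm_sq u x) \<le> r * D / \<theta>\<^sup>2 + 8 * C / r\<^sup>2 * N"
    using est by (simp add: power_divide field_simps)
  from mult_left_mono[OF this, of "\<theta>\<^sup>2"] show ?thesis
    using \<theta> unfolding D_def[symmetric] N_def[symmetric] C_def[symmetric] by (simp add: algebra_simps)
qed

lemma hessian_estimate_radius:
  fixes c Z :: real
  assumes c: "c = 772" and Z: "Z = exp 8 + 2"
  shows "\<theta>\<^sup>2 * (LINT x:\<Omega>|lborel. hess_norm_sq u x)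
    \<le> ubc_radius \<Omega> * (LINT y:frontier \<Omega>|hausdorff1. (tangential_deriv \<Omega> (curvature \<Omega>) y)\<^sup>2)
      + \<theta>\<^sup>2 * (32 * (2 * c * (4 * c + Z) + 32 * Z\<^sup>2) / (ubc_radius \<Omega>)\<^sup>2) * (LINT x:\<Omega>|lborel. (norm (nabla u x))\<^sup>2)"
proof -
  define D where "D = (LINT y:frontier \<Omega>|hausdorff1. (tangential_deriv \<Omega> (curvature \<Omega>) y)\<^sup>2)"
  define N where "N = (LINT x:\<Omega>|lborel. (norm (nabla u x))\<^sup>2)"
  define C where "C = 2 * c * (4 * c + Z) + 32 * Z\<^sup>2"
  have nn: "0 \<le> C" "0 \<le> D" "0 \<le> N" unfolding C_def D_def N_def c Z set_lebesgue_integral_def by simp_all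
  obtain r where r: "uniform_ball_condition \<Omega> r" "r \<le> ubc_radius \<Omega>" "ubc_radius \<Omega> / 2 < r"
    using ubc_radius_approx[OF reg] by blast
  have r0: "0 < r" using r(1) by (simp add: uniform_ball_condition_def)
  then have R0: "0 < ubc_radius \<Omega>" using r(2) by linarith
  \<comment> \<open>Here r exceeds half the maximal radius, so 8 becomes 32; the curvature term only
    needs r \<le> \<open>ubc_radius \<Omega>\<close>, which is why its factor stays 1.\<close>
  have "8 * C / r\<^sup>2 \<le> 8 * C / (ubc_radius \<Omega> / 2)\<^sup>2"
    using nn(1) r(3) R0 by (intro divide_left_mono power_mono mult_pos_pos zero_less_power) (use r0 in auto)
  also have "\<dots> = 32 * C / (ubc_radius \<Omega>)\<^sup>2" by (simp add: power_divide)
  finally have "\<theta>\<^sup>2 * (8 * C / r\<^sup>2) * N \<le> \<theta>\<^sup>2 * (32 * C / (ubc_radius \<Omega>)\<^sup>2) * N"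
    using nn(3) by (intro mult_right_mono mult_left_mono) auto
  moreover have "r * D \<le> ubc_radius \<Omega> * D" using r(2) nn(2) by (rule mult_right_mono)
  ultimately show ?thesis
    using hessian_estimate[OF r(1) c Z] unfolding D_def[symmetric] N_def[symmetric] C_def[symmetric] by linarith
qed

end

theorem lemma4p4:
  shows "\<exists>C::real. \<forall>(\<theta>::real) (T::ereal) (\<Omega> :: real \<Rightarrow> (real^2) set)
           (u :: real \<Rightarrow> real^2 \<Rightarrow> real^2) (p :: real \<Rightarrow> real^2 \<Rightarrow> real).
         stokes_solution 3 \<theta> T \<Omega> u p \<longrightarrow>
         (\<forall>t\<in>time_interval T.
            \<theta>\<^sup>2 * (LINT x:\<Omega> t|lborel. hess_norm_sq (u t) x)
              \<le> ubc_radius (\<Omega> t)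
                  * (LINT x:frontier (\<Omega> t)|hausdorff1.
                       (tangential_deriv (\<Omega> t) (curvature (\<Omega> t)) x)\<^sup>2)
                + \<theta>\<^sup>2 * (C / (ubc_radius (\<Omega> t))\<^sup>2)
                  * (LINT x:\<Omega> t|lborel. (norm (nabla (u t) x))\<^sup>2))"
proof (intro exI allI impI ballI)
  fix \<theta> T \<Omega> u p t
  assume sol: "stokes_solution 3 \<theta> T \<Omega> u p" and t: "t \<in> time_interval T"
  interpret stokes_instant \<theta> "\<Omega> t" "u t" "p t"
    by unfold_locales (use sol t in \<open>simp_all add: stokes_solution_def\<close>)
  show "\<theta>\<^sup>2 * (LINT x:\<Omega> t|lborel. hess_norm_sq (u t) x)
      \<le> ubc_radius (\<Omega> t) * (LINT x:frontier (\<Omega> t)|hausdorff1. (tangential_deriv (\<Omega> t) (curvature (\<Omega> t)) x)\<^sup>2)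
        + \<theta>\<^sup>2 * (32 * (2 * 772 * (4 * 772 + (exp 8 + 2)) + 32 * (exp 8 + 2)\<^sup>2) / (ubc_radius (\<Omega> t))\<^sup>2)
          * (LINT x:\<Omega> t|lborel. (norm (nabla (u t) x))\<^sup>2)"
    by (rule hessian_estimate_radius[OF refl refl])
qed

end
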